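(* Let $m,\gamma,\theta,T>0$, let $V,\psi$ satisfy the assumptions listed in the context, and let $\rho^0\in\mathcal P(\mathbf R^{2d})$ with $\mathcal H(\rho^0)<\infty$. Let $I$, $\mathsf Z$, $\mathsf E,\mathsf S,\mathsf L,\mathsf M$ and the seminorm $\|\cdot\|_{\mathsf M(\mathsf z)^{-1}}$ be as defined in the context. For curves $\mathsf z=(\rho,e):[0,T]\to\mathsf Z$ define $$ J(\mathsf z)=\begin{cases} \displaystyle\int_0^T\frac1{4\theta}\bigl\|\partial_t\mathsf z_t-\mathsf L(\mathsf z_t)\operatorname{grad}\mathsf E(\mathsf z_t)-\mathsf M(\mathsf z_t)\operatorname{grad}\mathsf S(\mathsf z_t)\bigr\|_{\mathsf M(\mathsf z_t)^{-1}}^2\,dt & \text{if }\mathsf z\in AC([0,T];\mathsf Z)\text{ and }\rho|_{t=0}=\rho^0,\\ +\infty&\text{otherwise.} \end{cases} $$ Then the rate function $I$ can be written in terms of $\mathsf z$ as $J$, in the sense that $$ J\bigl((\rho,e)\bigr)=\begin{cases} I(\rho)&\text{provided }t\mapsto\mathcal H(\rho_t)+e_t\text{ is constant},\\ +\infty&\text{otherwise.} \end{cases} $$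
   Context: Coordinates on $\mathbf R^{2d}$ are $x=(q,p)$, $q,p\in\mathbf R^d$; subscripts on differential operators indicate the variables on which they act; $\nabla,\operatorname{div}$ without subscript act on $x$. $\mathcal P(\mathbf R^{2d})$ (Borel probability measures) carries the narrow topology, and $\mathcal P_2(\mathbf R^{2d})=\{\rho\in\mathcal P(\mathbf R^{2d}):\int p^2\,d\rho<\infty\}$ carries the same topology. Assumptions on $V,\psi$: $V\in C^2(\mathbf R^d)$ has globally bounded second derivatives and $V\ge0$; $\psi\in C^2(\mathbf R^d)$ has globally bounded first and second derivatives and $\psi\ge0$. Here $(\psi*\rho)(q)=\int_{\mathbf R^{2d}}\psi(q-q')\,\rho(dq'dp')$ (similarly $\nabla_q\psi*\rho$), and $$\mathcal H(\rho)=\int_{\mathbf R^{2d}}\Bigl(\frac{p^2}{2m}+V(q)+\frac12(\psi*\rho)(q)\Bigr)\rho(dq\,dp).$$ Absolute continuity: for compact $K\subset\mathbf R^{2d}$ let $\mathcal D_K=\{f\in C_c^\infty(\mathbf R^{2d}):\operatorname{supp}f\subset K\}$ with its usual test-function topology. $AC([0,T];\mathcal P(\mathbf R^{2d}))$ is the set of curves $t\mapsto\rho_t\in\mathcal P(\mathbf R^{2d})$ such that for each compact $K$ there are a neighbourhood $U_K$ of $0$ in $\mathcal D_K$ and an absolutely continuous $G_K:[0,T]\to\mathbf R$ with $|\langle\rho_{t_1},f\rangle-\langle\rho_{t_2},f\rangle|\le|G_K(t_1)-G_K(t_2)|$ for all $0\le t_1\le t_2\le T$, $f\in U_K$; then $\partial_t\rho_t$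 exists in $\mathcal D'(\mathbf R^{2d})$ for a.e. $t$. $AC([0,T];\mathcal P_2(\mathbf R^{2d}))$ denotes such curves with values in $\mathcal P_2(\mathbf R^{2d})$. With $\mathsf Z=\mathcal P_2(\mathbf R^{2d})\times\mathbf R$, $\mathsf z=(\rho,e)\in AC([0,T];\mathsf Z)$ means $\rho\in AC([0,T];\mathcal P_2(\mathbf R^{2d}))$ and $e:[0,T]\to\mathbf R$ absolutely continuous. Rate function $I$: for $\nu\in\mathcal P(\mathbf R^{2d})$, $$A_\nu f=\frac pm\cdot\nabla_qf-\Bigl[\nabla_qV+\nabla_q\psi*\nu+\gamma\frac pm\Bigr]\cdot\nabla_pf+\gamma\theta\Delta_pf,\qquad\langle A_\rho^\tau\rho,f\rangle=\int A_\rho f\,d\rho\quad(f\in C_c^\infty(\mathbf R^{2d})),$$ $\|\mathcal T\|_{-1,\rho}^2:=\sup_{f\in C_c^\infty(\mathbf R^{2d})}\bigl(2\langle\mathcal T,f\rangle-\int|\nabla_pf|^2\,d\rho\bigr)$ for $\mathcal T\in\mathcal D'(\mathbf R^{2d})$, and $$ I(\rho)=\begin{cases} \displaystyle\frac1{4\gamma\theta}\int_0^T\bigl\|\partial_t\rho_t-A_{\rho_t}^\tau\rho_t\bigr\|_{-1,\rho_t}^2\,dt & \text{if }\rho\in AC([0,T];\mathcal P(\mathbf R^{2d}))\text{ with }\rho|_{t=0}=\rho^0,\\ +\infty&\text{otherwise.} \end{cases} $$ GENERIC building blocks: $\mathsf E(\rho,e)=\mathcal H(\rho)+e$ and $\mathsf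 S(\rho,e)=\mathcal S(\rho)+e$, with $\mathcal S(\rho)=-\theta\int f\log f\,dx$ when $\rho$ has Lebesgue density $f$. At $(\rho,e)$, $$\mathsf L=\begin{pmatrix}\mathsf L_{\rho\rho}&0\\0&0\end{pmatrix},\quad\mathsf M=\gamma\begin{pmatrix}\mathsf M_{\rho\rho}&\mathsf M_{\rho e}\\ \mathsf M_{e\rho}&\mathsf M_{ee}\end{pmatrix},\quad\mathsf L_{\rho\rho}\xi=\operatorname{div}(\rho\,\mathbf J\nabla\xi),\quad\mathbf J=\begin{pmatrix}0&-I_d\\ I_d&0\end{pmatrix},$$ $$\mathsf M_{\rho\rho}\xi=-\operatorname{div}_p(\rho\nabla_p\xi),\quad\mathsf M_{\rho e}r=r\operatorname{div}_p\Bigl(\rho\frac pm\Bigr),\quad\mathsf M_{e\rho}\xi=-\int\frac pm\cdot\nabla_p\xi\,d\rho,\quad\mathsf M_{ee}r=r\int\frac{p^2}{m^2}\,d\rho.$$ $\operatorname{grad}$ is the (formal) $L^2$-gradient, i.e. variational derivative. The expressions $\mathsf L\operatorname{grad}\mathsf E$ and $\mathsf M\operatorname{grad}\mathsf S$ are understood as the following elements of $\mathcal D'(\mathbf R^{2d})\times\mathbf R$: $$\mathsf L\operatorname{grad}\mathsf E=\Bigl(-\operatorname{div}_q\bigl(\rho\tfrac pm\bigr)+\operatorname{div}_p\bigl(\rho(\nabla_qV+\nabla_q\psi*\rho)\bigr),\ 0\Bigr),$$ $$\mathsf M\operatorname{grad}\mathsf S=\Bigl(\gamma\operatorname{div}_p\bigl(\rho\tfrac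 pm\bigr)+\gamma\theta\Delta_p\rho,\ \gamma\int\frac{p^2}{m^2}\,d\rho-\frac{\gamma\theta d}m\Bigr).$$ Seminorms: for $(\xi,r)\in C_c^\infty(\mathbf R^{2d})\times\mathbf R$, $\|(\xi,r)\|_{\mathsf M(\mathsf z)}^2:=\gamma\int|\nabla_p\xi-r\frac pm|^2\,d\rho$; for $(\mathcal T,s)\in\mathcal D'(\mathbf R^{2d})\times\mathbf R$, $$\|(\mathcal T,s)\|_{\mathsf M(\mathsf z)^{-1}}^2:=\sup_{\xi\in C_c^\infty(\mathbf R^{2d}),\ r\in\mathbf R}\bigl(2\langle\mathcal T,\xi\rangle+2sr-\|(\xi,r)\|_{\mathsf M(\mathsf z)}^2\bigr).$$
   Formalization: The interaction potential ψ is additionally assumed even, ψ(-q)=ψ(q); without this the claim fails, e.g. for V=0, ψ(q)=2+sin q_1 and a freely transported Gaussian with nonzero mean momentum, where J is finite but H(ρ_t)+e_t is not constant. *)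

theory Defs
  imports "HOL-Probability.Probability"
begin

section \<open>Calculus on Euclidean spaces\<close>

text \<open>\<open>partials [b\<^sub>1, \<dots>, b\<^sub>n] f\<close> is the iterated directional derivative of f along
  \<open>b\<^sub>1, \<dots>, b\<^sub>n\<close>; lists over \<open>Basis\<close> play the role of multi-indices. A derivative is the junk value
  of \<open>frechet_derivative\<close> where f is not differentiable, so regularity is always stated separately.\<close>

primrec partials :: "'a::euclidean_space list \<Rightarrow> ('a \<Rightarrow> real) \<Rightarrow> 'a \<Rightarrow> real" where
  "partials [] f = f"
| "partials (b # bs) f = (\<lambda>x. frechet_derivative (partials bs f) (at x) b)"

definition C_k :: "nat \<Rightarrow> ('a::euclidean_space \<Rightarrow> real) \<Rightarrow> bool" where
  "C_k k f \<longleftrightarrow>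
     (\<forall>bs. set bs \<subseteq> Basis \<and> length bs < k \<longrightarrow> (\<forall>x. partials bs f differentiable (at x))) \<and>
     (\<forall>bs. set bs \<subseteq> Basis \<and> length bs \<le> k \<longrightarrow> continuous_on UNIV (partials bs f))"

definition bounded_partials :: "nat \<Rightarrow> ('a::euclidean_space \<Rightarrow> real) \<Rightarrow> bool" where
  "bounded_partials k f \<longleftrightarrow>
     (\<exists>C. \<forall>bs x. set bs \<subseteq> Basis \<and> length bs = k \<longrightarrow> \<bar>partials bs f x\<bar> \<le> C)"

definition grad :: "('a::euclidean_space \<Rightarrow> real) \<Rightarrow> 'a \<Rightarrow> 'a" where
  "grad f x = (\<Sum>b\<in>Basis. partials [b] f x *\<^sub>R b)"

definition laplacian :: "('a::euclidean_space \<Rightarrow> real) \<Rightarrow> 'a \<Rightarrow> real" where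
  "laplacian f x = (\<Sum>b\<in>Basis. partials [b, b] f x)"

definition absolutely_continuous_on :: "real \<Rightarrow> real \<Rightarrow> (real \<Rightarrow> real) \<Rightarrow> bool" where
  "absolutely_continuous_on c d g \<longleftrightarrow>
     (\<forall>\<epsilon>>0. \<exists>\<delta>>0. \<forall>(n::nat) a b.
        (\<forall>i<n. c \<le> a i \<and> a i \<le> b i \<and> b i \<le> d) \<and>
        disjoint_family_on (\<lambda>i. {a i<..<b i}) {..<n} \<and>
        (\<Sum>i<n. b i - a i) < \<delta> \<longrightarrow>
        (\<Sum>i<n. \<bar>g (b i) - g (a i)\<bar>) < \<epsilon>)"

section \<open>Test functions and probability measures\<close>

definition test_functions_on :: "'a::euclidean_space set \<Rightarrow> ('a \<Rightarrow> real) set" where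
  "test_functions_on K =
     {f. (\<forall>k. C_k k f) \<and> compact (closure {x. f x \<noteq> 0}) \<and> closure {x. f x \<noteq> 0} \<subseteq> K}"

abbreviation test_functions :: "('a::euclidean_space \<Rightarrow> real) set" where
  "test_functions \<equiv> test_functions_on UNIV"

text \<open>Neighbourhoods of 0 in the Frechet topology of uniform convergence of all derivatives.\<close>

definition zero_nbhd :: "'a::euclidean_space set \<Rightarrow> ('a \<Rightarrow> real) set \<Rightarrow> bool" where
  "zero_nbhd K U \<longleftrightarrow> U \<subseteq> test_functions_on K \<and>
     (\<exists>N. \<exists>\<epsilon>>0. \<forall>f\<in>test_functions_on K.
        (\<forall>bs x. set bs \<subseteq> Basis \<and> length bs \<le> N \<longrightarrow> \<bar>partials bs f x\<bar> < \<epsilon>) \<longrightarrow> f \<in> U)"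

type_synonym 'd phase = "(real ^ 'd) \<times> (real ^ 'd)"

definition prob_measures :: "'a::topological_space measure set" where
  "prob_measures = {\<rho>. prob_space \<rho> \<and> sets \<rho> = sets borel}"

text \<open>Only the momentum variable is required to have a second moment.\<close>

definition P2 :: "'d::finite phase measure set" where
  "P2 = {\<rho> \<in> prob_measures. (\<integral>\<^sup>+(q, p). ennreal ((norm p)\<^sup>2) \<partial>\<rho>) < \<infinity>}"

definition AC_curve :: "real \<Rightarrow> 'a::euclidean_space measure set \<Rightarrow> (real \<Rightarrow> 'a measure) \<Rightarrow> bool" where
  "AC_curve T X \<rho> \<longleftrightarrow> (\<forall>t\<in>{0..T}. \<rho> t \<in> X) \<and>
     (\<forall>K. compact K \<longrightarrow>
        (\<exists>U G. zero_nbhd K U \<and> absolutely_continuous_on 0 T G \<and>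
           (\<forall>t1 t2 f. 0 \<le> t1 \<and> t1 \<le> t2 \<and> t2 \<le> T \<and> f \<in> U \<longrightarrow>
              \<bar>(\<integral>x. f x \<partial>\<rho> t1) - (\<integral>x. f x \<partial>\<rho> t2)\<bar> \<le> \<bar>G t1 - G t2\<bar>)))"

section \<open>Distributions\<close>

text \<open>Distributions are represented by their action on test functions. The time derivative of a
  curve of measures is taken weakly; for absolutely continuous curves it exists for a.e. t,
  simultaneously for all test functions.\<close>

type_synonym 'd distrib = "('d phase \<Rightarrow> real) \<Rightarrow> real"

definition time_deriv :: "real \<Rightarrow> (real \<Rightarrow> 'd::finite phase measure) \<Rightarrow> real \<Rightarrow> 'd distrib" where
  "time_deriv T \<rho> t f = vector_derivative (\<lambda>s. \<integral>x. f x \<partial>\<rho> s) (at t within {0..T})"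

definition grad_q :: "('d::finite phase \<Rightarrow> real) \<Rightarrow> 'd phase \<Rightarrow> real ^ 'd" where
  "grad_q f = (\<lambda>(q, p). grad (\<lambda>q'. f (q', p)) q)"

definition grad_p :: "('d::finite phase \<Rightarrow> real) \<Rightarrow> 'd phase \<Rightarrow> real ^ 'd" where
  "grad_p f = (\<lambda>(q, p). grad (\<lambda>p'. f (q, p')) p)"

definition laplacian_p :: "('d::finite phase \<Rightarrow> real) \<Rightarrow> 'd phase \<Rightarrow> real" where
  "laplacian_p f = (\<lambda>(q, p). laplacian (\<lambda>p'. f (q, p')) p)"

text \<open>\<open>div_q \<rho> F\<close> is the distribution div\_q(rho F), likewise \<open>div_p\<close>; \<open>lap_p \<rho>\<close> is the p-Laplacian
  of the measure.\<close>

definition div_q :: "'d::finite phase measure \<Rightarrow> ('d phase \<Rightarrow> real ^ 'd) \<Rightarrow> 'd distrib" where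
  "div_q \<rho> F f = - (\<integral>x. F x \<bullet> grad_q f x \<partial>\<rho>)"

definition div_p :: "'d::finite phase measure \<Rightarrow> ('d phase \<Rightarrow> real ^ 'd) \<Rightarrow> 'd distrib" where
  "div_p \<rho> F f = - (\<integral>x. F x \<bullet> grad_p f x \<partial>\<rho>)"

definition lap_p :: "'d::finite phase measure \<Rightarrow> 'd distrib" where
  "lap_p \<rho> f = (\<integral>x. laplacian_p f x \<partial>\<rho>)"

section \<open>Energy, generator and rate function\<close>

text \<open>All terms of the Hamiltonian are nonnegative, so it is an extended nonnegative real; the value
  infinity occurs.\<close>

definition hamiltonian ::
  "real \<Rightarrow> (real ^ 'd \<Rightarrow> real) \<Rightarrow> (real ^ 'd \<Rightarrow> real) \<Rightarrow> 'd::finite phase measure \<Rightarrow> ennreal" where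
  "hamiltonian m V \<psi> \<rho> =
     (\<integral>\<^sup>+(q, p). ennreal ((norm p)\<^sup>2 / (2 * m)) + ennreal (V q)
        + (\<integral>\<^sup>+(q', p'). ennreal (\<psi> (q - q')) \<partial>\<rho>) / 2 \<partial>\<rho>)"

definition grad_conv ::
  "(real ^ 'd \<Rightarrow> real) \<Rightarrow> 'd::finite phase measure \<Rightarrow> real ^ 'd \<Rightarrow> real ^ 'd" where
  "grad_conv \<psi> \<nu> q = (\<integral>(q', p'). grad \<psi> (q - q') \<partial>\<nu>)"

definition generator ::
  "real \<Rightarrow> real \<Rightarrow> real \<Rightarrow> (real ^ 'd \<Rightarrow> real) \<Rightarrow> (real ^ 'd \<Rightarrow> real) \<Rightarrow> 'd::finite phase measure
     \<Rightarrow> ('d phase \<Rightarrow> real) \<Rightarrow> 'd phase \<Rightarrow> real" where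
  "generator m \<gamma> \<theta> V \<psi> \<nu> f = (\<lambda>(q, p).
     (p /\<^sub>R m) \<bullet> grad_q f (q, p)
     - (grad V q + grad_conv \<psi> \<nu> q + \<gamma> *\<^sub>R (p /\<^sub>R m)) \<bullet> grad_p f (q, p)
     + \<gamma> * \<theta> * laplacian_p f (q, p))"

definition generator_adjoint ::
  "real \<Rightarrow> real \<Rightarrow> real \<Rightarrow> (real ^ 'd \<Rightarrow> real) \<Rightarrow> (real ^ 'd \<Rightarrow> real) \<Rightarrow> 'd::finite phase measure
     \<Rightarrow> 'd distrib" where
  "generator_adjoint m \<gamma> \<theta> V \<psi> \<rho> f = (\<integral>x. generator m \<gamma> \<theta> V \<psi> \<rho> f x \<partial>\<rho>)"

text \<open>\<open>ennreal\<close> truncates negative values to 0. This does not affect the suprema below, since the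
  zero test function contributes 0 for every linear functional.\<close>

definition dual_norm_sq :: "'d::finite phase measure \<Rightarrow> 'd distrib \<Rightarrow> ennreal" where
  "dual_norm_sq \<rho> \<T> =
     (SUP f\<in>test_functions. ennreal (2 * \<T> f - (\<integral>x. (norm (grad_p f x))\<^sup>2 \<partial>\<rho>)))"

definition rate_I ::
  "real \<Rightarrow> real \<Rightarrow> real \<Rightarrow> (real ^ 'd \<Rightarrow> real) \<Rightarrow> (real ^ 'd \<Rightarrow> real) \<Rightarrow> real
     \<Rightarrow> 'd::finite phase measure \<Rightarrow> (real \<Rightarrow> 'd phase measure) \<Rightarrow> ennreal" where
  "rate_I m \<gamma> \<theta> V \<psi> T \<rho>0 \<rho> =
     (if AC_curve T prob_measures \<rho> \<and> \<rho> 0 = \<rho>0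
      then ennreal (1 / (4 * \<gamma> * \<theta>)) *
        (\<integral>\<^sup>+t\<in>{0..T}. dual_norm_sq (\<rho> t)
           (\<lambda>f. time_deriv T \<rho> t f - generator_adjoint m \<gamma> \<theta> V \<psi> (\<rho> t) f) \<partial>lborel)
      else \<infinity>)"

section \<open>GENERIC structure\<close>

text \<open>The two vector fields L grad E and M grad S at z = (rho, e), as pairs of a distribution and a
  real number; neither depends on e. The operators L and M at rho are those in

    L (xi, r) = (div(rho J grad xi), 0),
    M (xi, r) = gamma (- div\_p(rho grad\_p xi) + r div\_p(rho p/m),
                       - int p/m . grad\_p xi drho + r int p^2/m^2 drho),

  the energy is E = H(rho) + e and the entropy is S = - theta int f log f + e for rho of density f.
  The formal gradients grad E = (p^2/(2m) + V + psi * rho, 1) and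
  grad S = (- theta (log f + 1), 1) are inserted and log f is eliminated through
  rho grad\_p log f = grad\_p rho. This formula for grad E, the variational derivative of E, requires
  psi to be even: in general the interaction part of the variational derivative of H is the
  convolution of rho with (psi(q) + psi(-q)) / 2.\<close>

definition L_grad_E ::
  "real \<Rightarrow> (real ^ 'd \<Rightarrow> real) \<Rightarrow> (real ^ 'd \<Rightarrow> real) \<Rightarrow> 'd::finite phase measure
     \<Rightarrow> 'd distrib \<times> real" where
  "L_grad_E m V \<psi> \<rho> =
     (\<lambda>f. - div_q \<rho> (\<lambda>(q, p). p /\<^sub>R m) f + div_p \<rho> (\<lambda>(q, p). grad V q + grad_conv \<psi> \<rho> q) f,
      0)"

definition M_grad_S ::
  "real \<Rightarrow> real \<Rightarrow> real \<Rightarrow> 'd::finite phase measure \<Rightarrow> 'd distrib \<times> real" where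
  "M_grad_S m \<gamma> \<theta> \<rho> =
     (\<lambda>f. \<gamma> * div_p \<rho> (\<lambda>(q, p). p /\<^sub>R m) f + \<gamma> * \<theta> * lap_p \<rho> f,
      \<gamma> * (\<integral>(q, p). (norm p)\<^sup>2 / m\<^sup>2 \<partial>\<rho>) - \<gamma> * \<theta> * real CARD('d) / m)"

definition M_norm_sq ::
  "real \<Rightarrow> real \<Rightarrow> 'd::finite phase measure \<Rightarrow> ('d phase \<Rightarrow> real) \<times> real \<Rightarrow> real" where
  "M_norm_sq m \<gamma> \<rho> = (\<lambda>(\<xi>, r).
     \<gamma> * (\<integral>(q, p). (norm (grad_p \<xi> (q, p) - r *\<^sub>R (p /\<^sub>R m)))\<^sup>2 \<partial>\<rho>))"

definition M_dual_norm_sq ::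
  "real \<Rightarrow> real \<Rightarrow> 'd::finite phase measure \<Rightarrow> 'd distrib \<times> real \<Rightarrow> ennreal" where
  "M_dual_norm_sq m \<gamma> \<rho> = (\<lambda>(\<T>, s).
     (SUP (\<xi>, r)\<in>test_functions \<times> UNIV.
        ennreal (2 * \<T> \<xi> + 2 * s * r - M_norm_sq m \<gamma> \<rho> (\<xi>, r))))"

definition rate_J ::
  "real \<Rightarrow> real \<Rightarrow> real \<Rightarrow> (real ^ 'd \<Rightarrow> real) \<Rightarrow> (real ^ 'd \<Rightarrow> real) \<Rightarrow> real
     \<Rightarrow> 'd::finite phase measure \<Rightarrow> (real \<Rightarrow> 'd phase measure) \<times> (real \<Rightarrow> real) \<Rightarrow> ennreal" where
  "rate_J m \<gamma> \<theta> V \<psi> T \<rho>0 = (\<lambda>(\<rho>, e).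
     if AC_curve T P2 \<rho> \<and> absolutely_continuous_on 0 T e \<and> \<rho> 0 = \<rho>0
     then \<integral>\<^sup>+t\<in>{0..T}. ennreal (1 / (4 * \<theta>)) *
        M_dual_norm_sq m \<gamma> (\<rho> t)
          (\<lambda>f. time_deriv T \<rho> t f - fst (L_grad_E m V \<psi> (\<rho> t)) f - fst (M_grad_S m \<gamma> \<theta> (\<rho> t)) f,
           vector_derivative e (at t within {0..T})
             - snd (L_grad_E m V \<psi> (\<rho> t)) - snd (M_grad_S m \<gamma> \<theta> (\<rho> t))) \<partial>lborel
     else \<infinity>)"

end

theory Submission
  imports Defs
begin

text \<open>The second component of \<open>\<partial>\<^sub>t z - L grad E - M grad S\<close> is paired with the direction \<open>(p\<^sup>2 / (2 m), 1)\<close> on which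
  the seminorm \<open>M(z)\<close> degenerates. Hence the dual norm is finite only if this component equals minus the
  value of the first component (the defect of the curve) on the kinetic energy, and then it coincides with
  the norm of the defect alone. Testing the defect equation against truncations of the Hamiltonian shows that
  the rate of change of the Hamiltonian is the prescribed one plus the defect of the kinetic energy, so that
  the condition on the second component is conservation of the total energy.\<close>

section \<open>Absolutely continuous functions\<close>

text \<open>The kinetic energy is not a test function, so its pairing with the defect is a limit:
  where the defect is bounded by the momentum gradient in L2, its values converge along test
  functions whose momentum gradients converge to \<open>p/m\<close>. Finiteness of the Hamiltonian
  is known at time 0 only, and no momentum bound uniform in time is given. Each truncation therefore
  has a nonnegative weight \<open>c\<close> in \<open>grad_p f = c p/m\<close>; friction then keeps
  its sign, absorbs force and defect, and yields a one-sided bound that propagates finiteness before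
  any limit in time is taken. It can absorb only bounded forces, so V is part of the truncated
  energy, where its gradient cancels; being merely C^2, it is mollified first. The interaction stays
  outside and contributes a bounded force. Being quadratic in the curve, its energy is recovered
  afterwards from the symmetric pairing of the measures at two times, one of them frozen. If the
  dual norm of the defect is not integrable in time, none of this is available, but then both rate
  functions are infinite, since I is at most J in any case.\<close>

lemma indefinite_integral_bad_set_negligible:
  fixes h :: "real \<Rightarrow> real"
  assumes h: "h integrable_on {a..b}" and \<epsilon>: "\<epsilon> > 0"
  shows "negligible {x \<in> {a..b}. \<forall>d>0. \<exists>y\<in>{a..b}. y \<noteq> x \<and> \<bar>y - x\<bar> < d \<and>
     \<epsilon> * \<bar>y - x\<bar> \<le> \<bar>integral {a..y} h - integral {a..x} h - h x * (y - x)\<bar>}" (is "negligible ?E")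
  unfolding negligible_outer_le
proof (intro allI impI)
  fix \<eta> :: real assume \<eta>: "\<eta> > 0"
  \<comment> \<open>Vitali's lemma enlarges the selected intervals by the factor 5, which the bound
    \<open>\<epsilon> * \<eta> / 5\<close> compensates: on a bad interval the Henstock error is at
    least \<epsilon> times its length.\<close>
  have "\<epsilon> * \<eta> / 5 > 0" using \<epsilon> \<eta> by simp
  from this obtain g where g: "gauge g"
    and H: "\<And>p. \<lbrakk>p tagged_partial_division_of (cbox a b); g fine p\<rbrakk> \<Longrightarrow>
             sum (\<lambda>(x,k). norm(measure lborel k *\<^sub>R h x - integral k h)) p < \<epsilon> * \<eta> / 5"
    by (rule Henstock_lemma[OF h[folded cbox_interval]]) (rule that; assumption)
  \<comment> \<open>The interval between \<open>x\<close> and \<open>y\<close> is written as a ball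
    for the covering lemma. It has to lie inside the gauge at \<open>x\<close>, and the bound 1 on
    its length keeps the radii bounded.\<close>
  have ex: "\<exists>y. x \<in> ?E \<longrightarrow> y\<in>{a..b} \<and> y \<noteq> x \<and> \<bar>y - x\<bar> < 1 \<and> cball ((x + y)/2) (\<bar>y - x\<bar>/2) \<subseteq> g x \<and>
     \<epsilon> * \<bar>y - x\<bar> \<le> \<bar>integral {a..y} h - integral {a..x} h - h x * (y - x)\<bar>" for x
  proof (cases "x \<in> ?E")
    case True
    from g have "open (g x)" "x \<in> g x" by (auto simp: gauge_def)
    then obtain r where r: "r > 0" "ball x r \<subseteq> g x" using open_contains_ball by blast
    then have "min r 1 > 0" by simp
    with True obtain y where y: "y\<in>{a..b}" "y \<noteq> x" "\<bar>y - x\<bar> < min r 1"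
     "\<epsilon> * \<bar>y - x\<bar> \<le> \<bar>integral {a..y} h - integral {a..x} h - h x * (y - x)\<bar>" by blast
    have "cball ((x + y)/2) (\<bar>y - x\<bar>/2) \<subseteq> ball x r"
    proof
      fix z assume "z \<in> cball ((x + y)/2) (\<bar>y - x\<bar>/2)"
      then have "\<bar>(x + y)/2 - z\<bar> \<le> \<bar>y - x\<bar>/2" by (simp add: dist_real_def)
      then have "\<bar>x - z\<bar> \<le> \<bar>y - x\<bar>" by (simp add: field_simps abs_if split: if_splits)
      then show "z \<in> ball x r" using y(3) by (simp add: dist_real_def)
    qed
    then have "cball ((x + y)/2) (\<bar>y - x\<bar>/2) \<subseteq> g x" using r(2) by (rule subset_trans)
    with y show ?thesis by (intro exI[of _ y]) simp
  qed auto
  define Y where "Y x = (SOME y. x \<in> ?E \<longrightarrow> y\<in>{a..b} \<and> y \<noteq> x \<and> \<bar>y - x\<bar> < 1 \<and> cball ((x + y)/2) (\<bar>y - x\<bar>/2) \<subseteq> g x \<and>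
     \<epsilon> * \<bar>y - x\<bar> \<le> \<bar>integral {a..y} h - integral {a..x} h - h x * (y - x)\<bar>)" for x
  have Y: "Y x\<in>{a..b}" "Y x \<noteq> x" "\<bar>Y x - x\<bar> < 1" "cball ((x + Y x)/2) (\<bar>Y x - x\<bar>/2) \<subseteq> g x"
     "\<epsilon> * \<bar>Y x - x\<bar> \<le> \<bar>integral {a..Y x} h - integral {a..x} h - h x * (Y x - x)\<bar>" if "x \<in> ?E" for x
    using someI_ex[OF ex[of x], folded Y_def] that by blast+
  define c where "c x = (x + Y x)/2" for x
  define r where "r x = \<bar>Y x - x\<bar>/2" for x
  have "?E \<subseteq> (\<Union>i\<in>?E. cball (c i) (r i))"
  proof
    fix x assume "x \<in> ?E"
    moreover have "x \<in> cball (c x) (r x)" by (auto simp: c_def r_def dist_real_def field_simps abs_if)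
    ultimately show "x \<in> (\<Union>i\<in>?E. cball (c i) (r i))" by blast
  qed
  moreover have "0 < r x \<and> r x \<le> 1" if "x \<in> ?E" for x using Y(2,3)[OF that] by (auto simp: r_def)
  ultimately obtain C where C: "countable C" "C \<subseteq> ?E"
     "pairwise (\<lambda>i j. disjnt (cball (c i) (r i)) (cball (c j) (r j))) C"
     "?E \<subseteq> (\<Union>i\<in>C. cball (c i) (5 * r i))"
    by (rule Vitali_covering_lemma_cballs)
  have cb: "cball (c x) (r x) = cbox (min x (Y x)) (max x (Y x))" for x
    unfolding c_def r_def cball_eq_atLeastAtMost cbox_interval
    by (cases "x \<le> Y x") (simp_all add: field_simps min_def max_def abs_if)
  have fin: "(\<Sum>i\<in>I. measure lebesgue (cball (c i) (5 * r i))) \<le> \<eta>" if I: "I \<subseteq> C" "finite I" for I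
  proof -
    have IE: "I \<subseteq> ?E" using I C by blast
    \<comment> \<open>Each interval is tagged with \<open>x\<close>, one of its endpoints, so that
      the Henstock error is exactly the error of the linear approximation at
      \<open>x\<close>.\<close>
    define p where "p = (\<lambda>i. (i, cball (c i) (r i))) ` I"
    have "p tagged_partial_division_of (cbox a b)"
      unfolding tagged_partial_division_of_def
    proof (intro conjI allI impI)
      show "finite p" using I by (simp add: p_def)
    next
      fix x k assume "(x, k) \<in> p"
      then have x: "x \<in> I" and k: "k = cball (c x) (r x)" by (auto simp: p_def)
      have xE: "x \<in> ?E" using x IE by blast
      show "x \<in> k" by (simp add: k cb)
      have "a \<le> x" "x \<le> b" "a \<le> Y x" "Y x \<le> b" using Y(1)[OF xE] xE by simp_all
      then show "k \<subseteq> cbox a b" unfolding k cb cbox_interval by (intro atLeastatMost_subset_iff[THEN iffD2]) simp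
      show "\<exists>a b. k = cbox a b" using k cb by blast
    next
      fix x1 k1 x2 k2 assume *: "(x1, k1) \<in> p \<and> (x2, k2) \<in> p \<and> (x1, k1) \<noteq> (x2, k2)"
      then have "x1 \<in> C" "x2 \<in> C" "x1 \<noteq> x2" using I by (auto simp: p_def)
      then have "disjnt k1 k2" using C(3) * by (auto simp: p_def pairwise_def)
      then show "interior k1 \<inter> interior k2 = {}" unfolding disjnt_def using interior_subset by blast
    qed
    moreover have "g fine p"
      unfolding fine_def p_def
    proof safe
      fix x z assume "x \<in> I" and z: "z \<in> cball (c x) (r x)"
      then have "x \<in> ?E" using IE by blast
      from Y(4)[OF this] z show "z \<in> g x" unfolding c_def r_def by blast
    qed
    ultimately have "sum (\<lambda>(x,k). norm(measure lborel k *\<^sub>R h x - integral k h)) p < \<epsilon> * \<eta> / 5" by (rule H)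
    also have "sum (\<lambda>(x,k). norm(measure lborel k *\<^sub>R h x - integral k h)) p
       = (\<Sum>i\<in>I. norm (measure lborel (cball (c i) (r i)) *\<^sub>R h i - integral (cball (c i) (r i)) h))"
      unfolding p_def by (subst sum.reindex) (auto simp: inj_on_def)
    finally have "(\<Sum>i\<in>I. norm (measure lborel (cball (c i) (r i)) *\<^sub>R h i - integral (cball (c i) (r i)) h)) < \<epsilon> * \<eta> / 5" .
    moreover have "(\<Sum>i\<in>I. \<epsilon> * (2 * r i)) \<le> (\<Sum>i\<in>I. norm (measure lborel (cball (c i) (r i)) *\<^sub>R h i - integral (cball (c i) (r i)) h))"
    proof (rule sum_mono)
      fix x assume "x \<in> I"
      then have xE: "x \<in> ?E" using IE by blast
      have xy: "x \<in> {a..b}" "Y x \<in> {a..b}" using xE Y(1)[OF xE] by auto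
      have F: "integral {a..v} h - integral {a..u} h = integral {u..v} h" if "a \<le> u" "u \<le> v" "v \<le> b" for u v
      proof -
        have "h integrable_on {a..v}" using h by (rule integrable_on_subinterval) (use that in auto)
        from Henstock_Kurzweil_Integration.integral_combine[OF _ _ this, of u] that show ?thesis by simp
      qed
      have "\<bar>integral {a..Y x} h - integral {a..x} h - h x * (Y x - x)\<bar> =
         norm (measure lborel (cball (c x) (r x)) *\<^sub>R h x - integral (cball (c x) (r x)) h)"
        using F[of x "Y x"] F[of "Y x" x] xy unfolding cb
        by (cases "x \<le> Y x") (auto simp: min_def max_def algebra_simps abs_if)
      with Y(5)[OF xE] show "\<epsilon> * (2 * r x) \<le> norm (measure lborel (cball (c x) (r x)) *\<^sub>R h x - integral (cball (c x) (r x)) h)"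
        by (simp add: r_def)
    qed
    ultimately have "\<epsilon> * (\<Sum>i\<in>I. 2 * r i) < \<epsilon> * (\<eta> / 5)" by (simp add: sum_distrib_left)
    then have "(\<Sum>i\<in>I. 2 * r i) < \<eta> / 5" using \<epsilon> by simp
    moreover have "(\<Sum>i\<in>I. measure lebesgue (cball (c i) (5 * r i))) = 5 * (\<Sum>i\<in>I. 2 * r i)"
      unfolding sum_distrib_left
    proof (rule sum.cong[OF refl])
      fix i
      have "r i \<ge> 0" by (simp add: r_def)
      then show "measure lebesgue (cball (c i) (5 * r i)) = 5 * (2 * r i)"
        by (simp add: cball_eq_atLeastAtMost)
    qed
    ultimately show ?thesis by simp
  qed
  show "\<exists>T. ?E \<subseteq> T \<and> T \<in> lmeasurable \<and> measure lebesgue T \<le> \<eta>"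
  proof (intro exI conjI)
    show "?E \<subseteq> (\<Union>i\<in>C. cball (c i) (5 * r i))" by (rule C)
    have *: "\<And>i. i \<in> C \<Longrightarrow> cball (c i) (5 * r i) \<in> lmeasurable" by simp
    have fin: "measure lebesgue (\<Union>i\<in>I. cball (c i) (5 * r i)) \<le> \<eta>" if I: "I \<subseteq> C" "finite I" for I
      by (rule order_trans[OF measure_UNION_le fin[OF I]]) (use I in auto)
    show "(\<Union>i\<in>C. cball (c i) (5 * r i)) \<in> lmeasurable"
      using fmeasurable_UN_bound[OF C(1) * fin] by blast
    show "measure lebesgue (\<Union>i\<in>C. cball (c i) (5 * r i)) \<le> \<eta>"
      using measure_UN_bound[OF C(1) * fin] by blast
  qed
qed

lemma indefinite_integral_AE_differentiable:
  fixes h :: "real \<Rightarrow> real"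
  assumes h: "h integrable_on {a..b}"
  shows "AE x in lborel. x \<in> {a..b} \<longrightarrow>
    ((\<lambda>y. integral {a..y} h) has_vector_derivative h x) (at x within {a..b})"
proof -
  let ?E = "\<lambda>\<epsilon>. {x \<in> {a..b}. \<forall>d>0. \<exists>y\<in>{a..b}. y \<noteq> x \<and> \<bar>y - x\<bar> < d \<and>
     \<epsilon> * \<bar>y - x\<bar> \<le> \<bar>integral {a..y} h - integral {a..x} h - h x * (y - x)\<bar>}"
  have "negligible (\<Union>n. ?E (inverse (real (Suc n))))"
    by (rule negligible_countable_Union)
       (use indefinite_integral_bad_set_negligible[OF h] in auto)
  then have "AE x in lebesgue. x \<notin> (\<Union>n. ?E (inverse (real (Suc n))))"
    unfolding negligible_iff_null_sets by (rule AE_not_in)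
  then have "AE x in lborel. x \<notin> (\<Union>n. ?E (inverse (real (Suc n))))"
    by (simp add: AE_completion_iff)
  then show ?thesis
  proof eventually_elim
    case (elim x)
    show ?case
    proof
      assume x: "x \<in> {a..b}"
      show "((\<lambda>y. integral {a..y} h) has_vector_derivative h x) (at x within {a..b})"
        unfolding has_vector_derivative_def has_derivative_within_alt2
      proof (intro conjI allI impI)
        show "bounded_linear (\<lambda>xa. xa *\<^sub>R h x)" by (rule bounded_linear_scaleR_left)
        fix e :: real assume "e > 0"
        then obtain n where n: "inverse (real (Suc n)) < e" using reals_Archimedean by blast
        from elim x have "\<exists>d>0. \<forall>y\<in>{a..b}. y \<noteq> x \<and> \<bar>y - x\<bar> < d \<longrightarrow>
          \<bar>integral {a..y} h - integral {a..x} h - h x * (y - x)\<bar> < inverse (real (Suc n)) * \<bar>y - x\<bar>"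
          by (simp add: not_le del: of_nat_Suc) (metis not_le)
        then obtain d where d: "d > 0" "\<And>y. y\<in>{a..b} \<Longrightarrow> y \<noteq> x \<Longrightarrow> \<bar>y - x\<bar> < d \<Longrightarrow>
          \<bar>integral {a..y} h - integral {a..x} h - h x * (y - x)\<bar> < inverse (real (Suc n)) * \<bar>y - x\<bar>" by blast
        show "\<forall>\<^sub>F y in at x within {a..b}. norm (integral {a..y} h - integral {a..x} h - (y - x) *\<^sub>R h x) \<le> e * norm (y - x)"
          unfolding eventually_at
        proof (intro exI[of _ d] conjI ballI impI d(1))
          fix y assume y: "y \<in> {a..b}" "y \<noteq> x \<and> dist y x < d"
          then have "\<bar>integral {a..y} h - integral {a..x} h - h x * (y - x)\<bar> < inverse (real (Suc n)) * \<bar>y - x\<bar>"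
            by (intro d) (auto simp: dist_real_def)
          also have "\<dots> \<le> e * \<bar>y - x\<bar>" using n by (intro mult_right_mono) auto
          finally show "norm (integral {a..y} h - integral {a..x} h - (y - x) *\<^sub>R h x) \<le> e * norm (y - x)"
            by (simp add: mult.commute)
        qed
      qed
    qed
  qed
qed

section \<open>Total variation and the Radon-Nikodym density\<close>

definition interval_family :: "nat \<Rightarrow> (nat \<Rightarrow> real) \<Rightarrow> (nat \<Rightarrow> real) \<Rightarrow> real set \<Rightarrow> bool" where
  "interval_family n a b S \<longleftrightarrow> (\<forall>i<n. a i \<le> b i \<and> {a i<..<b i} \<subseteq> S) \<and>
     disjoint_family_on (\<lambda>i. {a i<..<b i}) {..<n}"

text \<open>Only the open intervals have to lie in \<open>S\<close>, so the endpoints of an open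
  interval count: \<open>variation_on g {a<..<b}\<close> sees the increment from \<open>a\<close> to
  \<open>b\<close>. Arbitrary sets \<open>S\<close> are allowed so that the variation can be
  compared with Lebesgue measure.\<close>

definition variation_on :: "(real \<Rightarrow> real) \<Rightarrow> real set \<Rightarrow> ennreal" where
  "variation_on g S = (SUP (n, a, b) \<in> {(n, a, b). interval_family n a b S}.
     ennreal (\<Sum>i<n. \<bar>g (b i) - g (a i)\<bar>))"

definition globally_AC :: "(real \<Rightarrow> real) \<Rightarrow> bool" where
  "globally_AC g \<longleftrightarrow> (\<forall>\<epsilon>>0. \<exists>\<delta>>0. \<forall>n a b. interval_family n a b UNIV \<and> (\<Sum>i<n. b i - a i) < \<delta> \<longrightarrow>
     (\<Sum>i<n. \<bar>g (b i) - g (a i)\<bar>) < \<epsilon>)"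

lemma variation_on_ge:
  "interval_family n a b S \<Longrightarrow> ennreal (\<Sum>i<n. \<bar>g (b i) - g (a i)\<bar>) \<le> variation_on g S"
  unfolding variation_on_def by (rule SUP_upper2[of "(n, a, b)"]) auto

lemma variation_on_le:
  "(\<And>n a b. interval_family n a b S \<Longrightarrow> ennreal (\<Sum>i<n. \<bar>g (b i) - g (a i)\<bar>) \<le> c) \<Longrightarrow> variation_on g S \<le> c"
  unfolding variation_on_def by (rule SUP_least) auto

lemma variation_on_mono: "S \<subseteq> S' \<Longrightarrow> variation_on g S \<le> variation_on g S'"
  by (rule variation_on_le, rule variation_on_ge) (auto simp: interval_family_def)

lemma variation_on_empty [simp]: "variation_on g {} = 0"
proof -
  have "variation_on g {} \<le> 0"
  proof (rule variation_on_le)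
    fix n a b assume "interval_family n a b {}"
    then have "a i = b i" if "i < n" for i using that by (force simp: interval_family_def)
    then show "ennreal (\<Sum>i<n. \<bar>g (b i) - g (a i)\<bar>) \<le> 0" by simp
  qed
  then show ?thesis by simp
qed

lemma sum_append:
  fixes f :: "nat \<Rightarrow> 'a::comm_monoid_add"
  shows "(\<Sum>i<n + m. f i) = (\<Sum>i<n. f i) + (\<Sum>i<m. f (n + i))"
  by (induction m) (auto simp: add.assoc)

lemma interval_family_append:
  assumes 1: "interval_family n a b S" and 2: "interval_family m c d S'" and dj: "S \<inter> S' = {}"
  shows "interval_family (n + m) (\<lambda>i. if i < n then a i else c (i - n)) (\<lambda>i. if i < n then b i else d (i - n)) (S \<union> S')"
  unfolding interval_family_def
proof (intro conjI allI impI)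
  fix i assume "i < n + m"
  then have "i < n \<or> i - n < m" by auto
  then show "(if i < n then a i else c (i - n)) \<le> (if i < n then b i else d (i - n))"
    "{if i < n then a i else c (i - n)<..<if i < n then b i else d (i - n)} \<subseteq> S \<union> S'"
    using 1 2 by (auto simp: interval_family_def subset_eq)
next
  show "disjoint_family_on (\<lambda>i. {if i < n then a i else c (i - n)<..<if i < n then b i else d (i - n)}) {..<n + m}"
    unfolding disjoint_family_on_def
  proof (intro ballI impI)
    fix i j assume ij: "i \<in> {..<n + m}" "j \<in> {..<n + m}" "i \<noteq> j"
    define P where "P i = {if i < n then a i else c (i - n)<..<if i < n then b i else d (i - n)}" for i
    have S: "P k \<subseteq> S" if "k < n" for k using that 1 by (simp add: P_def interval_family_def)
    have S': "P k \<subseteq> S'" if k: "n \<le> k" "k < n + m" for k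
    proof -
      have "k - n < m" using k by auto
      then show ?thesis using k 2 by (simp add: P_def interval_family_def)
    qed
    have "P i \<inter> P j = {}"
    proof (cases "i < n"; cases "j < n")
      assume "i < n" "j < n"
      then show ?thesis using 1 ij by (auto simp: P_def interval_family_def disjoint_family_on_def)
    next
      assume *: "\<not> i < n" "\<not> j < n"
      then have "i - n \<noteq> j - n" "i - n < m" "j - n < m" using ij by auto
      then show ?thesis using 2 * by (auto simp: P_def interval_family_def disjoint_family_on_def)
    next
      assume "i < n" "\<not> j < n" then show ?thesis using S[of i] S'[of j] ij dj by auto
    next
      assume "\<not> i < n" "j < n" then show ?thesis using S[of j] S'[of i] ij dj by auto
    qed
    then show "{if i < n then a i else c (i - n)<..<if i < n then b i else d (i - n)} \<inter>
       {if j < n then a j else c (j - n)<..<if j < n then b j else d (j - n)} = {}" by (simp add: P_def)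
  qed
qed

lemma variation_on_superadditive:
  assumes dj: "S \<inter> S' = {}"
  shows "variation_on g S + variation_on g S' \<le> variation_on g (S \<union> S')"
proof -
  have *: "ennreal (\<Sum>i<n. \<bar>g (b i) - g (a i)\<bar>) + ennreal (\<Sum>i<m. \<bar>g (d i) - g (c i)\<bar>) \<le> variation_on g (S \<union> S')"
    if "interval_family n a b S" "interval_family m c d S'" for n m a b c d
    using variation_on_ge[OF interval_family_append[OF that dj], of g]
    by (simp add: sum_append ennreal_plus[symmetric] sum_nonneg del: ennreal_plus cong: if_cong)
  have ne: "{(n, a, b). interval_family n a b S} \<noteq> {}" for S
    by (auto simp: interval_family_def disjoint_family_on_def intro!: exI[of _ 0])
  have "variation_on g S' + ennreal (\<Sum>i<n. \<bar>g (b i) - g (a i)\<bar>) \<le> variation_on g (S \<union> S')"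
    if "interval_family n a b S" for n a b
    unfolding variation_on_def[of g S'] using *[OF that]
    by (subst ennreal_SUP_add_left[symmetric, OF ne]) (auto intro!: SUP_least simp: add.commute split: prod.splits)
  then show ?thesis
    unfolding variation_on_def[of g S]
    by (subst ennreal_SUP_add_left[symmetric, OF ne]) (auto intro!: SUP_least simp: add.commute split: prod.splits)
qed

lemma variation_on_sum_le:
  "interval_family n a b S \<Longrightarrow> (\<Sum>i<n. variation_on g {a i<..<b i}) \<le> variation_on g (\<Union>i<n. {a i<..<b i})"
proof (induction n)
  case (Suc n)
  then have fam: "interval_family n a b S"
    by (auto simp: interval_family_def disjoint_family_on_def)
  have "{a i<..<b i} \<inter> {a n<..<b n} = {}" if "i < n" for i
    using Suc.prems that unfolding interval_family_def disjoint_family_on_def by (metis lessI lessThan_iff less_SucI less_irrefl)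
  then have dj: "(\<Union>i<n. {a i<..<b i}) \<inter> {a n<..<b n} = {}" by blast
  have "(\<Sum>i<Suc n. variation_on g {a i<..<b i}) \<le> variation_on g (\<Union>i<n. {a i<..<b i}) + variation_on g {a n<..<b n}"
    using Suc.IH[OF fam] by (simp add: add_right_mono)
  also have "\<dots> \<le> variation_on g ((\<Union>i<n. {a i<..<b i}) \<union> {a n<..<b n})"
    by (rule variation_on_superadditive[OF dj])
  finally show ?case by (simp add: lessThan_Suc Un_commute)
qed auto

text \<open>Every interval is clipped at \<open>c\<close> into a left and a right part; one that
  lies on a single side degenerates on the other, where it contributes nothing.\<close>

lemma variation_on_split:
  assumes "a \<le> c" "c \<le> b"
  shows "variation_on g {a<..<b} \<le> variation_on g {a<..<c} + variation_on g {c<..<b}"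
proof (rule variation_on_le)
  fix n u v assume *: "interval_family n u v {a<..<b}"
  have uv: "u i \<le> v i" "{u i<..<v i} \<subseteq> {a<..<b}" if "i < n" for i using * that by (auto simp: interval_family_def)
  have dj: "{u i<..<v i} \<inter> {u j<..<v j} = {}" if "i < n" "j < n" "i \<noteq> j" for i j
    using * that by (auto simp: interval_family_def disjoint_family_on_def)
  have 1: "interval_family n (\<lambda>i. min c (u i)) (\<lambda>i. min c (v i)) {a<..<c}"
    unfolding interval_family_def disjoint_family_on_def
  proof (intro conjI allI impI ballI)
    fix i assume i: "i < n" show "min c (u i) \<le> min c (v i)" using uv(1)[OF i] by auto
    show "{min c (u i)<..<min c (v i)} \<subseteq> {a<..<c}" using uv(2)[OF i] by (auto simp: min_def subset_eq split: if_splits)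
  next
    fix i j assume "i \<in> {..<n}" "j \<in> {..<n}" "i \<noteq> j"
    then have "{u i<..<v i} \<inter> {u j<..<v j} = {}" by (intro dj) auto
    moreover have "{min c (u k)<..<min c (v k)} \<subseteq> {u k<..<v k}" for k by auto
    ultimately show "{min c (u i)<..<min c (v i)} \<inter> {min c (u j)<..<min c (v j)} = {}" by blast
  qed
  have 2: "interval_family n (\<lambda>i. max c (u i)) (\<lambda>i. max c (v i)) {c<..<b}"
    unfolding interval_family_def disjoint_family_on_def
  proof (intro conjI allI impI ballI)
    fix i assume i: "i < n" show "max c (u i) \<le> max c (v i)" using uv(1)[OF i] by auto
    show "{max c (u i)<..<max c (v i)} \<subseteq> {c<..<b}" using uv(2)[OF i] by (auto simp: max_def subset_eq split: if_splits)
  next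
    fix i j assume "i \<in> {..<n}" "j \<in> {..<n}" "i \<noteq> j"
    then have "{u i<..<v i} \<inter> {u j<..<v j} = {}" by (intro dj) auto
    moreover have "{max c (u k)<..<max c (v k)} \<subseteq> {u k<..<v k}" for k by auto
    ultimately show "{max c (u i)<..<max c (v i)} \<inter> {max c (u j)<..<max c (v j)} = {}" by blast
  qed
  have "(\<Sum>i<n. \<bar>g (v i) - g (u i)\<bar>) \<le> (\<Sum>i<n. \<bar>g (min c (v i)) - g (min c (u i))\<bar> + \<bar>g (max c (v i)) - g (max c (u i))\<bar>)"
    using uv(1) by (intro sum_mono) (force simp: min_def max_def)
  then have "ennreal (\<Sum>i<n. \<bar>g (v i) - g (u i)\<bar>) \<le> ennreal (\<Sum>i<n. \<bar>g (min c (v i)) - g (min c (u i))\<bar>) + ennreal (\<Sum>i<n. \<bar>g (max c (v i)) - g (max c (u i))\<bar>)"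
    by (simp add: ennreal_plus[symmetric] sum_nonneg sum.distrib ennreal_leI del: ennreal_plus)
  also have "\<dots> \<le> variation_on g {a<..<c} + variation_on g {c<..<b}"
    by (intro add_mono variation_on_ge 1 2)
  finally show "ennreal (\<Sum>i<n. \<bar>g (v i) - g (u i)\<bar>) \<le> variation_on g {a<..<c} + variation_on g {c<..<b}" .
qed

lemma interval_family_emeasure:
  assumes "interval_family n a b S"
  shows "ennreal (\<Sum>i<n. b i - a i) = emeasure lborel (\<Union>i<n. {a i<..<b i})"
proof -
  have "emeasure lborel (\<Union>i<n. {a i<..<b i}) = (\<Sum>i<n. emeasure lborel {a i<..<b i})"
    using assms by (intro sum_emeasure[symmetric]) (auto simp: interval_family_def)
  also have "\<dots> = (\<Sum>i<n. ennreal (b i - a i))"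
    using assms by (intro sum.cong) (auto simp: interval_family_def)
  also have "\<dots> = ennreal (\<Sum>i<n. b i - a i)" using assms by (intro sum_ennreal) (auto simp: interval_family_def)
  finally show ?thesis ..
qed

text \<open>A family inside \<open>S\<close> has total length at most the measure of
  \<open>S\<close>, so absolute continuity of \<open>g\<close> becomes absolute continuity of its
  variation as a set function.\<close>

lemma variation_on_small:
  assumes g: "globally_AC g" and "\<epsilon> > 0"
  obtains \<delta> where "\<delta> > 0" "\<And>S. S \<in> sets borel \<Longrightarrow> emeasure lborel S < ennreal \<delta> \<Longrightarrow> variation_on g S \<le> ennreal \<epsilon>"
proof -
  from assms obtain \<delta> where \<delta>: "\<delta> > 0" "\<And>n a b. interval_family n a b UNIV \<Longrightarrow> (\<Sum>i<n. b i - a i) < \<delta> \<Longrightarrow>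
     (\<Sum>i<n. \<bar>g (b i) - g (a i)\<bar>) < \<epsilon>" unfolding globally_AC_def by meson
  have "variation_on g S \<le> ennreal \<epsilon>" if S: "S \<in> sets borel" "emeasure lborel S < ennreal \<delta>" for S
  proof (rule variation_on_le)
    fix n a b assume *: "interval_family n a b S"
    have "ennreal (\<Sum>i<n. b i - a i) = emeasure lborel (\<Union>i<n. {a i<..<b i})" by (rule interval_family_emeasure[OF *])
    also have "\<dots> \<le> emeasure lborel S" using * S by (intro emeasure_mono) (auto simp: interval_family_def)
    finally have "ennreal (\<Sum>i<n. b i - a i) < ennreal \<delta>" using S by (auto elim: order_le_less_trans)
    then have "(\<Sum>i<n. b i - a i) < \<delta>" using * by (subst (asm) ennreal_less_iff) (auto intro!: sum_nonneg simp: interval_family_def)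
    with \<delta>(2)[of n a b] * have "(\<Sum>i<n. \<bar>g (b i) - g (a i)\<bar>) < \<epsilon>" by (auto simp: interval_family_def)
    then show "ennreal (\<Sum>i<n. \<bar>g (b i) - g (a i)\<bar>) \<le> ennreal \<epsilon>" by (intro ennreal_leI) simp
  qed
  with \<delta>(1) show ?thesis by (rule that)
qed

text \<open>Intervals of length \<open>\<delta>/2\<close> have variation at most 1, and finitely
  many of them cover a bounded interval.\<close>

lemma variation_on_finite:
  assumes g: "globally_AC g"
  shows "variation_on g {a<..<b} < \<infinity>"
proof -
  obtain \<delta> where \<delta>: "\<delta> > 0" "\<And>S. S \<in> sets borel \<Longrightarrow> emeasure lborel S < ennreal \<delta> \<Longrightarrow> variation_on g S \<le> ennreal 1"
    using variation_on_small[OF g, of 1] by auto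
  have *: "variation_on g {a<..<a + real k * (\<delta>/2)} < \<infinity>" for k
  proof (induction k)
    case (Suc k)
    have "variation_on g {a<..<a + real (Suc k) * (\<delta>/2)} \<le> variation_on g {a<..<a + real k * (\<delta>/2)} +
       variation_on g {a + real k * (\<delta>/2)<..<a + real (Suc k) * (\<delta>/2)}"
      using \<delta>(1) by (intro variation_on_split) (auto simp: field_simps)
    also have "variation_on g {a + real k * (\<delta>/2)<..<a + real (Suc k) * (\<delta>/2)} \<le> ennreal 1"
      using \<delta>(1) by (intro \<delta>(2)) (auto simp: field_simps ennreal_less_iff)
    finally show ?case using Suc by (simp add: ennreal_add_eq_top less_top[symmetric] top_unique) (metis ennreal_add_eq_top ennreal_one_neq_top infinity_ennreal_def top.extremum_unique)
  qed simp
  obtain k :: nat where "(b - a) / (\<delta>/2) < real k" using reals_Archimedean2 by blast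
  then have "b \<le> a + real k * (\<delta>/2)" using \<delta>(1) by (simp add: field_simps)
  then have "variation_on g {a<..<b} \<le> variation_on g {a<..<a + real k * (\<delta>/2)}" by (intro variation_on_mono) auto
  with *[of k] show ?thesis by order
qed

text \<open>Jordan decomposition with \<open>V\<close>, the variation from 0, and
  \<open>V - g\<close>. As \<open>g\<close> is constant on the negative axis, measuring from 0 loses
  nothing. Absolute continuity of \<open>V\<close> holds because the variations over disjoint
  intervals add up to at most the variation over their union, whose measure is small.\<close>

lemma globally_AC_monotone_decomposition:
  assumes g: "globally_AC g" and const: "\<And>t. t \<le> 0 \<Longrightarrow> g t = g 0"
  obtains u v where "mono u" "mono v" "globally_AC u" "globally_AC v" "g = (\<lambda>t. u t - v t)"
proof -
  define V where "V t = enn2real (variation_on g {0<..<t})" for t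
  have V: "ennreal (V t) = variation_on g {0<..<t}" for t
    unfolding V_def using variation_on_finite[OF g, of 0 t] by simp
  have up: "ennreal (V t - V s) \<le> variation_on g {s<..<t}" if "s \<le> t" for s t
  proof (cases "s \<le> 0")
    case True
    then have "V s = 0" by (simp add: V_def)
    then show ?thesis using True by (simp add: V) (intro variation_on_mono, auto)
  next
    case False
    then have "ennreal (V t) \<le> ennreal (V s) + variation_on g {s<..<t}"
      using variation_on_split[of 0 s t g] that by (simp add: V)
    then show ?thesis
      by (subst ennreal_minus[symmetric]) (auto simp: V_def ennreal_minus_le_iff)
  qed
  have lo: "\<bar>g t - g s\<bar> \<le> V t - V s" if st: "s \<le> t" for s t
  proof (cases "t \<le> 0")
    case True then show ?thesis using const[of s] const[of t] that by (simp add: V_def)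
  next
    case False
    define s' where "s' = max 0 s"
    have s': "0 \<le> s'" "s' \<le> t" using False st by (auto simp: s'_def)
    have gs: "g s' = g s" using const[of s] by (simp add: s'_def max_def)
    have Vs: "V s' = V s" by (simp add: s'_def V_def max_def)
    have "ennreal \<bar>g t - g s'\<bar> \<le> variation_on g {s'<..<t}"
      using variation_on_ge[of 1 "\<lambda>_. s'" "\<lambda>_. t" "{s'<..<t}" g] s' by (auto simp: interval_family_def disjoint_family_on_def)
    then have "ennreal (V s') + ennreal \<bar>g t - g s'\<bar> \<le> variation_on g {0<..<s'} + variation_on g {s'<..<t}"
      by (simp add: V)
    also have "\<dots> \<le> variation_on g ({0<..<s'} \<union> {s'<..<t})" by (rule variation_on_superadditive) auto
    also have "\<dots> \<le> variation_on g {0<..<t}" using s' by (intro variation_on_mono) auto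
    also have "\<dots> = ennreal (V t)" by (simp add: V)
    finally have "V s' + \<bar>g t - g s'\<bar> \<le> V t"
      by (simp add: ennreal_plus[symmetric] V_def del: ennreal_plus)
    then show ?thesis using gs Vs by simp
  qed
  have mV: "mono V" using lo by (intro monoI) (smt (verit))
  have AV: "globally_AC V"
    unfolding globally_AC_def
  proof (intro allI impI)
    fix \<epsilon> :: real assume "\<epsilon> > 0"
    then obtain \<delta> where \<delta>: "\<delta> > 0" "\<And>S. S \<in> sets borel \<Longrightarrow> emeasure lborel S < ennreal \<delta> \<Longrightarrow> variation_on g S \<le> ennreal (\<epsilon>/2)"
      using variation_on_small[OF g, of "\<epsilon>/2"] by auto
    show "\<exists>\<delta>>0. \<forall>n a b. interval_family n a b UNIV \<and> (\<Sum>i<n. b i - a i) < \<delta> \<longrightarrow> (\<Sum>i<n. \<bar>V (b i) - V (a i)\<bar>) < \<epsilon>"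
    proof (intro exI[of _ \<delta>] conjI allI impI \<delta>(1))
      fix n a b assume *: "interval_family n a b UNIV \<and> (\<Sum>i<n. b i - a i) < \<delta>"
      have ab: "a i \<le> b i" if "i < n" for i using that * by (auto simp: interval_family_def)
      have "ennreal (\<Sum>i<n. \<bar>V (b i) - V (a i)\<bar>) = (\<Sum>i<n. ennreal (V (b i) - V (a i)))"
        using ab monoD[OF mV] by (subst sum_ennreal[symmetric]) (auto intro!: sum.cong)
      also have "\<dots> \<le> (\<Sum>i<n. variation_on g {a i<..<b i})" using ab by (intro sum_mono up) auto
      also have "\<dots> \<le> variation_on g (\<Union>i<n. {a i<..<b i})" using variation_on_sum_le * by blast
      also have "\<dots> \<le> ennreal (\<epsilon>/2)"
      proof (rule \<delta>(2))
        have "emeasure lborel (\<Union>i<n. {a i<..<b i}) = ennreal (\<Sum>i<n. b i - a i)"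
          using interval_family_emeasure[of n a b UNIV] * by simp
        then show "emeasure lborel (\<Union>i<n. {a i<..<b i}) < ennreal \<delta>" using * \<delta>(1)
          by (simp add: ennreal_lessI)
      qed auto
      finally have "(\<Sum>i<n. \<bar>V (b i) - V (a i)\<bar>) \<le> \<epsilon>/2" using \<open>\<epsilon> > 0\<close> by (subst (asm) ennreal_le_iff) auto
      then show "(\<Sum>i<n. \<bar>V (b i) - V (a i)\<bar>) < \<epsilon>" using \<open>\<epsilon> > 0\<close> by simp
    qed
  qed
  have AVg: "globally_AC (\<lambda>t. V t - g t)"
    unfolding globally_AC_def
  proof (intro allI impI)
    fix \<epsilon> :: real assume "\<epsilon> > 0"
    then have "\<epsilon>/2 > 0" by simp
    from AV[unfolded globally_AC_def, rule_format, OF this] obtain d1 where d1: "d1 > 0"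
      "\<And>n a b. interval_family n a b UNIV \<Longrightarrow> (\<Sum>i<n. b i - a i) < d1 \<Longrightarrow> (\<Sum>i<n. \<bar>V (b i) - V (a i)\<bar>) < \<epsilon>/2" by meson
    from g[unfolded globally_AC_def, rule_format, OF \<open>\<epsilon>/2 > 0\<close>] obtain d2 where d2: "d2 > 0"
      "\<And>n a b. interval_family n a b UNIV \<Longrightarrow> (\<Sum>i<n. b i - a i) < d2 \<Longrightarrow> (\<Sum>i<n. \<bar>g (b i) - g (a i)\<bar>) < \<epsilon>/2" by meson
    show "\<exists>\<delta>>0. \<forall>n a b. interval_family n a b UNIV \<and> (\<Sum>i<n. b i - a i) < \<delta> \<longrightarrow>
       (\<Sum>i<n. \<bar>(V (b i) - g (b i)) - (V (a i) - g (a i))\<bar>) < \<epsilon>"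
    proof (intro exI[of _ "min d1 d2"] conjI allI impI)
      fix n a b assume *: "interval_family n a b UNIV \<and> (\<Sum>i<n. b i - a i) < min d1 d2"
      have "(\<Sum>i<n. \<bar>(V (b i) - g (b i)) - (V (a i) - g (a i))\<bar>) \<le> (\<Sum>i<n. \<bar>V (b i) - V (a i)\<bar> + \<bar>g (b i) - g (a i)\<bar>)"
        by (intro sum_mono) linarith
      also have "\<dots> < \<epsilon>" using d1(2)[of n a b] d2(2)[of n a b] * by (simp add: sum.distrib)
      finally show "(\<Sum>i<n. \<bar>(V (b i) - g (b i)) - (V (a i) - g (a i))\<bar>) < \<epsilon>" .
    qed (use d1 d2 in auto)
  qed
  have "mono (\<lambda>t. V t - g t)" using lo by (intro monoI) (smt (verit))
  from that[OF mV this AV AVg] show ?thesis by auto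
qed

lemma globally_AC_isCont:
  assumes ac: "globally_AC u"
  shows "isCont u x"
  unfolding continuous_at_eps_delta
proof (intro allI impI)
  fix \<epsilon> :: real assume "\<epsilon> > 0"
  from ac[unfolded globally_AC_def, rule_format, OF this] obtain d where d: "d > 0"
    "\<And>n a b. interval_family n a b UNIV \<Longrightarrow> (\<Sum>i<n. b i - a i) < d \<Longrightarrow> (\<Sum>i<n. \<bar>u (b i) - u (a i)\<bar>) < \<epsilon>" by meson
  show "\<exists>d>0. \<forall>x'. dist x' x < d \<longrightarrow> dist (u x') (u x) < \<epsilon>"
  proof (intro exI[of _ d] conjI allI impI d(1))
    fix y assume "dist y x < d"
    then show "dist (u y) (u x) < \<epsilon>"
      using d(2)[of 1 "\<lambda>_. min x y" "\<lambda>_. max x y"]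
      by (cases "x \<le> y") (auto simp: interval_family_def disjoint_family_on_def dist_real_def min_def max_def abs_minus_commute)
  qed
qed

text \<open>The Stieltjes measure of \<open>u\<close> charges no Lebesgue null set: a bounded null
  set is covered by non-overlapping intervals of small total length, absolute continuity bounds the
  mass of every finite subfamily, and the bound passes to the countable union. Radon-Nikodym then
  supplies the density.\<close>

lemma mono_globally_AC_density:
  assumes m: "mono u" and ac: "globally_AC u"
  obtains h where "h \<in> borel_measurable borel" "\<And>a b. a \<le> b \<Longrightarrow> set_integrable lborel {a..b} h"
    "\<And>a b. a \<le> b \<Longrightarrow> u b - u a = (LINT s:{a..b}|lborel. h s)"
proof -
  have cont: "isCont u x" for x by (rule globally_AC_isCont[OF ac])
  have contU: "continuous_on UNIV u" using cont by (simp add: continuous_at_imp_continuous_on)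
  define \<mu> where "\<mu> = interval_measure u"
  have sets[simp]: "sets \<mu> = sets borel" by (simp add: \<mu>_def)
  have Icc: "emeasure \<mu> {a..b} = ennreal (u b - u a)" if "a \<le> b" for a b
    unfolding \<mu>_def by (rule emeasure_interval_measure_Icc[OF that]) (use monoD[OF m] contU in auto)
  have small: "emeasure \<mu> S \<le> ennreal \<epsilon>" if S: "S \<in> null_sets lborel" "S \<subseteq> {-M..M}" and \<epsilon>: "\<epsilon> > 0" for S M \<epsilon>
  proof (cases "M > 0")
    case False
    then have "S \<subseteq> {0..0}" using S by auto
    then have "emeasure \<mu> S \<le> emeasure \<mu> {0..0}" by (intro emeasure_mono) auto
    moreover have "emeasure \<mu> {0..0} = 0" by (subst Icc) auto
    ultimately show ?thesis by simp
  next
    case True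
    from ac[unfolded globally_AC_def, rule_format, OF \<epsilon>] obtain d where d: "d > 0"
      "\<And>n a b. interval_family n a b UNIV \<Longrightarrow> (\<Sum>i<n. b i - a i) < d \<Longrightarrow> (\<Sum>i<n. \<bar>u (b i) - u (a i)\<bar>) < \<epsilon>" by meson
    have nl: "S \<in> null_sets lebesgue" using S null_sets_completionI by blast
    then have Sl: "S \<in> lmeasurable" and S0: "measure lebesgue S = 0"
      by (auto simp: fmeasurable_def measure_eq_0_null_sets)
    obtain D where D: "countable D"
        "\<And>K. K \<in> D \<Longrightarrow> K \<subseteq> cbox (-M) M \<and> K \<noteq> {} \<and> (\<exists>c d. K = cbox c d)"
        "pairwise (\<lambda>A B. interior A \<inter> interior B = {}) D"
        "S \<subseteq> \<Union>D" "\<Union>D \<in> lmeasurable" "measure lebesgue (\<Union>D) \<le> measure lebesgue S + d/2"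
      by (rule measurable_outer_intervals_bounded[OF Sl, of "-M" M "d/2"]) (use S d(1) in auto)
    have Dm: "K \<in> fmeasurable \<mu>" if "K \<in> D" for K
      using D(2)[OF that] Icc by (auto simp: fmeasurable_def less_top[symmetric])
    have fin: "measure \<mu> (\<Union>K\<in>I. K) \<le> \<epsilon>" if I: "I \<subseteq> D" "finite I" for I
    proof -
      obtain f where f: "bij_betw f {..<card I} I" using I(2) ex_bij_betw_nat_finite atLeast0LessThan by metis
      define n where "n = card I"
      have "\<exists>c d. f i = {c..d} \<and> c \<le> d" if "i < n" for i
      proof -
        have "f i \<in> D" using f that I by (auto simp: n_def bij_betw_def)
        then show ?thesis using D(2)[of "f i"] by fastforce
      qed
      then obtain a b where ab: "\<And>i. i < n \<Longrightarrow> f i = {a i..b i} \<and> a i \<le> b i" by metis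
      have fam: "interval_family n a b UNIV"
        unfolding interval_family_def disjoint_family_on_def
      proof (intro conjI allI impI ballI)
        fix i j assume ij: "i \<in> {..<n}" "j \<in> {..<n}" "i \<noteq> j"
        then have "f i \<in> D" "f j \<in> D" "f i \<noteq> f j" using f I by (auto simp: n_def bij_betw_def inj_on_def)
        then have "interior (f i) \<inter> interior (f j) = {}" using D(3) by (auto simp: pairwise_def)
        then show "{a i<..<b i} \<inter> {a j<..<b j} = {}" using ab ij by (simp add: interior_atLeastAtMost_real)
      qed (use ab in auto)
      have sm: "(\<Union>i<n. {a i<..<b i}) \<subseteq> \<Union>D"
      proof
        fix x assume "x \<in> (\<Union>i<n. {a i<..<b i})"
        then obtain i where i: "i < n" "x \<in> {a i<..<b i}" by auto
        then have "x \<in> f i" using ab by auto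
        moreover have "f i \<in> D" using f i I by (auto simp: n_def bij_betw_def)
        ultimately show "x \<in> \<Union>D" by blast
      qed
      have "ennreal (\<Sum>i<n. b i - a i) = emeasure lebesgue (\<Union>i<n. {a i<..<b i})"
        using interval_family_emeasure[OF fam] by simp
      also have "\<dots> \<le> emeasure lebesgue (\<Union>D)" using sm D(5) by (intro emeasure_mono) (auto simp: fmeasurable_def)
      also have "\<dots> = ennreal (measure lebesgue (\<Union>D))" using D(5) by (simp add: emeasure_eq_measure2)
      also have "\<dots> \<le> ennreal (d/2)" using D(6) S0 by (simp add: ennreal_leI)
      finally have "(\<Sum>i<n. b i - a i) \<le> d/2" using d(1) by simp
      then have "(\<Sum>i<n. \<bar>u (b i) - u (a i)\<bar>) < \<epsilon>" using d fam by (intro d(2)) auto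
      moreover have "measure \<mu> (\<Union>K\<in>I. K) \<le> (\<Sum>K\<in>I. measure \<mu> K)"
        using I Dm by (intro measure_UNION_le) (auto simp: fmeasurable_def subset_eq)
      moreover have "(\<Sum>K\<in>I. measure \<mu> K) = (\<Sum>i<n. measure \<mu> (f i))"
        using sum.reindex_bij_betw[OF f, of "measure \<mu>"] by (simp add: n_def)
      moreover have "\<dots> = (\<Sum>i<n. \<bar>u (b i) - u (a i)\<bar>)"
        using ab Icc monoD[OF m] by (intro sum.cong) (auto simp: measure_def)
      ultimately show ?thesis by linarith
    qed
    have "(\<Union>K\<in>D. K) \<in> fmeasurable \<mu>" by (rule fmeasurable_UN_bound[OF D(1) Dm fin])
    moreover have "measure \<mu> (\<Union>K\<in>D. K) \<le> \<epsilon>" by (rule measure_UN_bound[OF D(1) Dm fin])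
    ultimately have "emeasure \<mu> (\<Union>K\<in>D. K) \<le> ennreal \<epsilon>" by (simp add: emeasure_eq_measure2 ennreal_leI)
    moreover have "emeasure \<mu> S \<le> emeasure \<mu> (\<Union>K\<in>D. K)"
      using D(4) \<open>(\<Union>K\<in>D. K) \<in> fmeasurable \<mu>\<close> by (intro emeasure_mono) (auto simp: fmeasurable_def)
    ultimately show ?thesis by order
  qed
  have "absolutely_continuous lborel \<mu>"
    unfolding absolutely_continuous_def
  proof
    fix S :: "real set" assume S: "S \<in> null_sets lborel"
    have "S \<inter> {- real k..real k} \<in> null_sets \<mu>" for k
    proof -
      have "S \<inter> {- real k..real k} \<in> null_sets lborel" using S by (auto intro: null_set_Int2 simp: Int_commute)
      then have "emeasure \<mu> (S \<inter> {- real k..real k}) \<le> ennreal \<epsilon>" if "\<epsilon> > 0" for \<epsilon>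
        using small that by blast
      then have "emeasure \<mu> (S \<inter> {- real k..real k}) = 0"
        by (metis ennreal_le_epsilon add_0 zero_le le_zero_eq)
      then show ?thesis using S by (auto simp: null_sets_def)
    qed
    then have "(\<Union>k. S \<inter> {- real k..real k}) \<in> null_sets \<mu>" by blast
    moreover have "(\<Union>k. S \<inter> {- real k..real k}) = S"
    proof -
      have "\<exists>k. -real k \<le> x \<and> x \<le> real k" for x using real_arch_simple[of "\<bar>x\<bar>"] by (auto simp: abs_le_iff minus_le_iff)
      then show ?thesis by auto
    qed
    ultimately show "S \<in> null_sets \<mu>" by simp
  qed
  then have "\<exists>f\<in>borel_measurable lborel. density lborel f = \<mu>"
    by (rule sigma_finite_measure.Radon_Nikodym[OF sigma_finite_lborel]) simp
  then obtain f where f: "f \<in> borel_measurable lborel" "density lborel f = \<mu>" by blast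
  have fI: "(\<integral>\<^sup>+s\<in>{a..b}. f s \<partial>lborel) = ennreal (u b - u a)" if "a \<le> b" for a b
  proof -
    have "emeasure (density lborel f) {a..b} = (\<integral>\<^sup>+s\<in>{a..b}. f s \<partial>lborel)"
      by (rule emeasure_density) (use f(1) in auto)
    then show ?thesis unfolding f(2) Icc[OF that] ..
  qed
  define h where "h s = enn2real (f s)" for s
  have hm[measurable]: "h \<in> borel_measurable borel" using f(1) unfolding h_def by simp
  have h: "(\<integral>\<^sup>+s. ennreal (indicator {a..b} s * h s) \<partial>lborel) = ennreal (u b - u a)" if ab: "a \<le> b" for a b
  proof -
    have "AE s in lborel. f s * indicator {a..b} s \<noteq> \<infinity>"
      by (rule nn_integral_PInf_AE) (use f(1) fI[OF ab] in auto)
    then have "(\<integral>\<^sup>+s. ennreal (indicator {a..b} s * h s) \<partial>lborel) = (\<integral>\<^sup>+s\<in>{a..b}. f s \<partial>lborel)"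
      by (intro nn_integral_cong_AE, eventually_elim) (auto simp: h_def indicator_def less_top)
    then show ?thesis using fI[OF ab] by simp
  qed
  have "has_bochner_integral lborel (\<lambda>s. indicator {a..b} s * h s) (u b - u a)" if ab: "a \<le> b" for a b
  proof (rule has_bochner_integral_nn_integral)
    show "(\<lambda>s. indicator {a..b} s * h s) \<in> borel_measurable lborel" by simp
    show "AE s in lborel. 0 \<le> indicator {a..b} s * h s" by (simp add: h_def indicator_def)
  qed (use h[OF ab] monoD[OF m ab] in auto)
  then show ?thesis
    by (intro that[of h] hm)
       (auto simp: set_integrable_def set_lebesgue_integral_def has_bochner_integral_iff)
qed

text \<open>Continuation by constants removes the endpoints, so that variations and Stieltjes
  measures can be formed on the whole line.\<close>

lemma globally_AC_clamp:
  assumes g: "absolutely_continuous_on 0 T g" and T: "0 \<le> T"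
  shows "globally_AC (\<lambda>t. g (max 0 (min T t)))"
  unfolding globally_AC_def
proof (intro allI impI)
  fix \<epsilon> :: real assume "\<epsilon> > 0"
  with g obtain \<delta> where \<delta>: "\<delta> > 0" "\<And>n a b. (\<forall>i<n::nat. 0 \<le> a i \<and> a i \<le> b i \<and> b i \<le> T) \<Longrightarrow>
        disjoint_family_on (\<lambda>i. {a i<..<b i}) {..<n} \<Longrightarrow>
        (\<Sum>i<n. b i - a i) < \<delta> \<Longrightarrow> (\<Sum>i<n. \<bar>g (b i) - g (a i)\<bar>) < \<epsilon>"
    unfolding absolutely_continuous_on_def by meson
  show "\<exists>\<delta>>0. \<forall>n a b. interval_family n a b UNIV \<and> (\<Sum>i<n. b i - a i) < \<delta> \<longrightarrow>
       (\<Sum>i<n. \<bar>g (max 0 (min T (b i))) - g (max 0 (min T (a i)))\<bar>) < \<epsilon>"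
  proof (intro exI[of _ \<delta>] conjI \<delta>(1) allI impI)
    fix n a b assume *: "interval_family n a b UNIV \<and> (\<Sum>i<n. b i - a i) < \<delta>"
    have ab: "a i \<le> b i" if "i < n" for i using * that by (auto simp: interval_family_def)
    show "(\<Sum>i<n. \<bar>g (max 0 (min T (b i))) - g (max 0 (min T (a i)))\<bar>) < \<epsilon>"
    proof (rule \<delta>(2))
      show "\<forall>i<n. 0 \<le> max 0 (min T (a i)) \<and> max 0 (min T (a i)) \<le> max 0 (min T (b i)) \<and> max 0 (min T (b i)) \<le> T"
        using ab T by (force simp: max_def min_def)
      show "disjoint_family_on (\<lambda>i. {max 0 (min T (a i))<..<max 0 (min T (b i))}) {..<n}"
        unfolding disjoint_family_on_def
      proof (intro ballI impI)
        fix i j assume "i \<in> {..<n}" "j \<in> {..<n}" "i \<noteq> j"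
        then have "{a i<..<b i} \<inter> {a j<..<b j} = {}" using * by (auto simp: interval_family_def disjoint_family_on_def)
        moreover have "{max 0 (min T (a k))<..<max 0 (min T (b k))} \<subseteq> {a k<..<b k}" for k by (auto simp: max_def min_def split: if_splits)
        ultimately show "{max 0 (min T (a i))<..<max 0 (min T (b i))} \<inter> {max 0 (min T (a j))<..<max 0 (min T (b j))} = {}" by blast
      qed
      have "(\<Sum>i<n. max 0 (min T (b i)) - max 0 (min T (a i))) \<le> (\<Sum>i<n. b i - a i)"
        using ab by (intro sum_mono) (force simp: max_def min_def)
      then show "(\<Sum>i<n. max 0 (min T (b i)) - max 0 (min T (a i))) < \<delta>" using * by linarith
    qed
  qed
qed

text \<open>The density comes from the two monotone parts; that it is also the pointwise derivative,
  one-sided at the ends, is the differentiation theorem for indefinite integrals. It thus serves as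
  a measurable version of the derivative.\<close>

lemma absolutely_continuous_on_eq_integral:
  assumes g: "absolutely_continuous_on 0 T g" and T: "0 \<le> T"
  obtains h where "h \<in> borel_measurable borel" "set_integrable lborel {0..T} h"
    "\<And>t. t \<in> {0..T} \<Longrightarrow> g t = g 0 + (LINT s:{0..t}|lborel. h s)"
    "AE t in lborel. t \<in> {0..T} \<longrightarrow> (g has_vector_derivative h t) (at t within {0..T})"
proof -
  define G where "G t = g (max 0 (min T t))" for t
  have "globally_AC G" unfolding G_def by (rule globally_AC_clamp[OF g T])
  moreover have "G t = G 0" if "t \<le> 0" for t using that T by (simp add: G_def)
  ultimately obtain u v where uv: "mono u" "mono v" "globally_AC u" "globally_AC v" "G = (\<lambda>t. u t - v t)"
    by (rule globally_AC_monotone_decomposition)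
  obtain h1 where h1: "h1 \<in> borel_measurable borel" "\<And>a b. a \<le> b \<Longrightarrow> set_integrable lborel {a..b} h1"
    "\<And>a b. a \<le> b \<Longrightarrow> u b - u a = (LINT s:{a..b}|lborel. h1 s)"
    using mono_globally_AC_density[OF uv(1,3)] by blast
  obtain h2 where h2: "h2 \<in> borel_measurable borel" "\<And>a b. a \<le> b \<Longrightarrow> set_integrable lborel {a..b} h2"
    "\<And>a b. a \<le> b \<Longrightarrow> v b - v a = (LINT s:{a..b}|lborel. h2 s)"
    using mono_globally_AC_density[OF uv(2,4)] by blast
  define h where "h = (\<lambda>s. h1 s - h2 s)"
  have hm: "h \<in> borel_measurable borel" using h1 h2 by (simp add: h_def)
  have hi: "set_integrable lborel {a..b} h" if "a \<le> b" for a b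
    unfolding h_def using h1(2) h2(2) that by (intro set_integral_diff) auto
  have hG: "G t = G 0 + (LINT s:{0..t}|lborel. h s)" if "0 \<le> t" for t
    unfolding h_def using h1(2,3)[OF that] h2(2,3)[OF that] uv(5) by (subst set_integral_diff) auto
  have hg: "g t = g 0 + integral {0..t} h" if "t \<in> {0..T}" for t
    using hG[of t] that set_borel_integral_eq_integral(2)[OF hi, of 0 t] by (simp add: G_def)
  have "AE t in lborel. t \<in> {0..T} \<longrightarrow>
    ((\<lambda>y. integral {0..y} h) has_vector_derivative h t) (at t within {0..T})"
    using indefinite_integral_AE_differentiable set_borel_integral_eq_integral(1)[OF hi[OF T]] by blast
  then have der: "AE t in lborel. t \<in> {0..T} \<longrightarrow> (g has_vector_derivative h t) (at t within {0..T})"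
  proof eventually_elim
    case (elim t)
    show ?case
    proof
      assume t: "t \<in> {0..T}"
      with elim have "((\<lambda>y. g 0 + integral {0..y} h) has_vector_derivative h t) (at t within {0..T})"
        by (auto intro!: derivative_eq_intros)
      then show "(g has_vector_derivative h t) (at t within {0..T})"
        by (rule has_vector_derivative_transform[rotated 2]) (use t in \<open>auto intro: hg\<close>)
    qed
  qed
  show ?thesis
  proof (rule that[OF hm hi[OF T] _ der])
    fix t assume t: "t \<in> {0..T}"
    then have "G t = G 0 + (LINT s:{0..t}|lborel. h s)" by (intro hG) simp
    then show "g t = g 0 + (LINT s:{0..t}|lborel. h s)" using t by (simp add: G_def)
  qed
qed

section \<open>Absolute continuity of indefinite integrals\<close>

lemma set_integral_small:
  fixes h :: "'a \<Rightarrow> real"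
  assumes h: "integrable M h" and "\<epsilon> > 0"
  obtains \<delta> where "\<delta> > 0"
    "\<And>A. A \<in> sets M \<Longrightarrow> emeasure M A < ennreal \<delta> \<Longrightarrow> (LINT x:A|M. \<bar>h x\<bar>) < \<epsilon>"
proof -
  have hm[measurable]: "h \<in> borel_measurable M" using h by auto
  have "(\<lambda>k. \<integral>x. indicator {x. real k < \<bar>h x\<bar>} x * \<bar>h x\<bar> \<partial>M) \<longlonglongrightarrow> (\<integral>x. 0 \<partial>M)"
  proof (rule integral_dominated_convergence[where w="\<lambda>x. \<bar>h x\<bar>"])
    show "AE x in M. (\<lambda>k. indicator {x. real k < \<bar>h x\<bar>} x * \<bar>h x\<bar>) \<longlonglongrightarrow> 0"
    proof (rule AE_I2)
      fix x
      obtain N where "\<bar>h x\<bar> \<le> real N" using real_arch_simple by blast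
      then have "\<forall>k\<ge>N. indicator {x. real k < \<bar>h x\<bar>} x * \<bar>h x\<bar> = 0" by (auto simp: indicator_def)
      then show "(\<lambda>k. indicator {x. real k < \<bar>h x\<bar>} x * \<bar>h x\<bar>) \<longlonglongrightarrow> 0"
        by (intro tendsto_eventually) (auto simp: eventually_sequentially intro!: exI[of _ N])
    qed
  qed (use h in \<open>auto simp: indicator_def\<close>)
  then have "\<forall>\<^sub>F k in sequentially. (\<integral>x. indicator {x. real k < \<bar>h x\<bar>} x * \<bar>h x\<bar> \<partial>M) < \<epsilon>/2"
    using \<open>\<epsilon> > 0\<close> by (intro order_tendstoD) auto
  then obtain k where k: "(\<integral>x. indicator {x. real k < \<bar>h x\<bar>} x * \<bar>h x\<bar> \<partial>M) < \<epsilon>/2"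
    by (auto simp: eventually_sequentially)
  \<comment> \<open>Half of \<epsilon> pays for the part of \<open>h\<close> above the level
    \<open>k\<close>, the other half for values up to \<open>k\<close> on a set of measure below
    \<delta>.\<close>
  define \<delta> where "\<delta> = \<epsilon> / (2 * (real k + 1))"
  have "\<delta> > 0" using \<open>\<epsilon> > 0\<close> by (simp add: \<delta>_def)
  have "(LINT x:A|M. \<bar>h x\<bar>) < \<epsilon>" if A[measurable]: "A \<in> sets M" and mA: "emeasure M A < ennreal \<delta>" for A
  proof -
    have fin: "emeasure M A < \<infinity>" using mA by (auto simp: less_top[symmetric])
    have mA': "measure M A < \<delta>" using mA fin \<open>\<delta> > 0\<close>
      by (simp add: emeasure_eq_ennreal_measure less_top ennreal_less_iff)
    have i1: "integrable M (\<lambda>x. indicator {x. real k < \<bar>h x\<bar>} x * \<bar>h x\<bar>)"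
      by (rule Bochner_Integration.integrable_bound[OF h]) (auto simp: indicator_def)
    have i2: "integrable M (\<lambda>x. real k * indicator A x)" using fin by (auto simp: less_top)
    have i3: "integrable M (\<lambda>x. indicator A x * \<bar>h x\<bar>)"
      by (rule Bochner_Integration.integrable_bound[OF h]) (auto simp: indicator_def)
    have "(LINT x:A|M. \<bar>h x\<bar>) = (\<integral>x. indicator A x * \<bar>h x\<bar> \<partial>M)" by (simp add: set_lebesgue_integral_def)
    also have "\<dots> \<le> (\<integral>x. real k * indicator A x + indicator {x. real k < \<bar>h x\<bar>} x * \<bar>h x\<bar> \<partial>M)"
      by (rule integral_mono[OF i3 Bochner_Integration.integrable_add[OF i2 i1]]) (auto simp: indicator_def)
    also have "\<dots> = real k * measure M A + (\<integral>x. indicator {x. real k < \<bar>h x\<bar>} x * \<bar>h x\<bar> \<partial>M)"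
      by (subst Bochner_Integration.integral_add[OF i2 i1]) (simp add: measure_def)
    also have "real k * measure M A \<le> real k * \<delta>" using mA' by (intro mult_left_mono) auto
    also have "\<dots> \<le> \<epsilon>/2" using \<open>\<epsilon> > 0\<close> by (simp add: \<delta>_def field_simps)
    finally show ?thesis using k by linarith
  qed
  with \<open>\<delta> > 0\<close> show ?thesis by (rule that)
qed

lemma absolutely_continuous_on_integral:
  assumes h: "set_integrable lborel {0..T} h"
    and g: "\<And>t. t \<in> {0..T} \<Longrightarrow> g t = c + (LINT s:{0..t}|lborel. h s)"
  shows "absolutely_continuous_on 0 T g"
  unfolding absolutely_continuous_on_def
proof (intro allI impI)
  fix \<epsilon> :: real assume "\<epsilon> > 0"
  define H where "H = (\<lambda>s. indicator {0..T} s * h s)"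
  have H: "integrable lborel H" using h by (simp add: H_def set_integrable_def)
  obtain \<delta> where \<delta>: "\<delta> > 0"
    "\<And>A. A \<in> sets lborel \<Longrightarrow> emeasure lborel A < ennreal \<delta> \<Longrightarrow> (LINT x:A|lborel. \<bar>H x\<bar>) < \<epsilon>"
    using set_integral_small[OF H \<open>\<epsilon> > 0\<close>] by blast
  show "\<exists>\<delta>>0. \<forall>(n::nat) a b. (\<forall>i<n. 0 \<le> a i \<and> a i \<le> b i \<and> b i \<le> T) \<and>
        disjoint_family_on (\<lambda>i. {a i<..<b i}) {..<n} \<and> (\<Sum>i<n. b i - a i) < \<delta> \<longrightarrow>
        (\<Sum>i<n. \<bar>g (b i) - g (a i)\<bar>) < \<epsilon>"
  proof (intro exI[of _ \<delta>] conjI \<delta>(1) allI impI)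
    fix n :: nat and a b :: "nat \<Rightarrow> real"
    assume *: "(\<forall>i<n. 0 \<le> a i \<and> a i \<le> b i \<and> b i \<le> T) \<and>
        disjoint_family_on (\<lambda>i. {a i<..<b i}) {..<n} \<and> (\<Sum>i<n. b i - a i) < \<delta>"
    then have fam: "interval_family n a b UNIV" by (auto simp: interval_family_def)
    have Hint: "integrable lborel (\<lambda>s. indicator A s * H s)" if "A \<in> sets borel" for A
      by (rule Bochner_Integration.integrable_bound[OF H]) (use that H in \<open>auto simp: indicator_def\<close>)
    have 1: "\<bar>g (b i) - g (a i)\<bar> \<le> (\<integral>s. indicator {a i<..<b i} s * \<bar>H s\<bar> \<partial>lborel)" if i: "i < n" for i
    proof -
      have ab: "0 \<le> a i" "a i \<le> b i" "b i \<le> T" using * i by auto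
      have gH: "g t = c + (\<integral>s. indicator {0..t} s * H s \<partial>lborel)" if "t \<in> {0..T}" for t
        unfolding g[OF that] set_lebesgue_integral_def using that
        by (auto simp: H_def indicator_def intro!: Bochner_Integration.integral_cong)
      have "g (b i) - g (a i) = (\<integral>s. indicator {0..b i} s * H s - indicator {0..a i} s * H s \<partial>lborel)"
        using ab by (simp add: gH Hint)
      also have "\<dots> = (\<integral>s. indicator {a i<..<b i} s * H s \<partial>lborel)"
      proof (rule integral_cong_AE)
        show "AE s in lborel. indicator {0..b i} s * H s - indicator {0..a i} s * H s = indicator {a i<..<b i} s * H s"
          using AE_lborel_singleton[of "a i"] AE_lborel_singleton[of "b i"]
          by eventually_elim (use ab in \<open>auto simp: indicator_def\<close>)
      qed (use H in auto)
      also have "\<bar>\<dots>\<bar> \<le> (\<integral>s. \<bar>indicator {a i<..<b i} s * H s\<bar> \<partial>lborel)" by (rule integral_abs_bound)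
      also have "\<dots> = (\<integral>s. indicator {a i<..<b i} s * \<bar>H s\<bar> \<partial>lborel)" by (simp add: abs_mult)
      finally show ?thesis .
    qed
    have Habs: "integrable lborel (\<lambda>s. indicator A s * \<bar>H s\<bar>)" if "A \<in> sets borel" for A
      by (rule Bochner_Integration.integrable_bound[OF H]) (use that H in \<open>auto simp: indicator_def\<close>)
    have "(\<Sum>i<n. \<bar>g (b i) - g (a i)\<bar>) \<le> (\<Sum>i<n. \<integral>s. indicator {a i<..<b i} s * \<bar>H s\<bar> \<partial>lborel)"
      by (intro sum_mono 1) auto
    also have "\<dots> = (\<integral>s. (\<Sum>i<n. indicator {a i<..<b i} s * \<bar>H s\<bar>) \<partial>lborel)"
      by (intro Bochner_Integration.integral_sum[symmetric] Habs) auto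
    also have "\<dots> = (LINT s:(\<Union>i<n. {a i<..<b i})|lborel. \<bar>H s\<bar>)"
    proof -
      have "indicator (\<Union>i<n. {a i<..<b i}) s = (\<Sum>i<n. indicator {a i<..<b i} s :: real)" for s
        using * by (intro indicator_UN_disjoint) auto
      then show ?thesis by (simp add: set_lebesgue_integral_def sum_distrib_right)
    qed
    also have "\<dots> < \<epsilon>"
    proof (rule \<delta>(2))
      show "emeasure lborel (\<Union>i<n. {a i<..<b i}) < ennreal \<delta>"
        using interval_family_emeasure[OF fam] * \<delta>(1) by (metis ennreal_lessI)
    qed auto
    finally show "(\<Sum>i<n. \<bar>g (b i) - g (a i)\<bar>) < \<epsilon>" .
  qed
qed

lemma AE_derivative_integral:
  fixes g h :: "real \<Rightarrow> real"
  assumes h: "set_integrable lborel {0..T} h"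
    and g: "\<And>t. t \<in> {0..T} \<Longrightarrow> g t = c + (LINT s:{0..t}|lborel. h s)"
  shows "AE t in lborel. t \<in> {0..T} \<longrightarrow> (g has_vector_derivative h t) (at t within {0..T})"
proof -
  have hg: "g t = c + integral {0..t} h" if t: "t \<in> {0..T}" for t
  proof -
    have "set_integrable lborel {0..t} h" by (rule set_integrable_subset[OF h]) (use t in auto)
    then show ?thesis using g[OF t] by (simp add: set_borel_integral_eq_integral)
  qed
  have "AE t in lborel. t \<in> {0..T} \<longrightarrow>
    ((\<lambda>y. integral {0..y} h) has_vector_derivative h t) (at t within {0..T})"
    using indefinite_integral_AE_differentiable set_borel_integral_eq_integral(1)[OF h] by blast
  then show ?thesis
  proof eventually_elim
    case (elim t)
    show ?case
    proof
      assume t: "t \<in> {0..T}"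
      with elim have "((\<lambda>y. c + integral {0..y} h) has_vector_derivative h t) (at t within {0..T})"
        by (auto intro!: derivative_eq_intros)
      then show "(g has_vector_derivative h t) (at t within {0..T})"
        by (rule has_vector_derivative_transform[rotated 2]) (use t in \<open>auto intro: hg\<close>)
    qed
  qed
qed

section \<open>Smooth functions and test functions\<close>

definition smooth :: "('a::euclidean_space \<Rightarrow> real) \<Rightarrow> bool" where
  "smooth f \<longleftrightarrow> (\<forall>k. C_k k f)"

lemma smooth_iff:
  "smooth f \<longleftrightarrow> (\<forall>bs x. set bs \<subseteq> Basis \<longrightarrow> partials bs f differentiable (at x))" (is "?L \<longleftrightarrow> ?R")
proof
  assume ?L then show ?R by (auto simp: smooth_def C_k_def)
next
  assume R: ?R
  then have "continuous_on UNIV (partials bs f)" if "set bs \<subseteq> Basis" for bs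
    using that by (meson continuous_at_imp_continuous_on differentiable_imp_continuous_within)
  with R show ?L by (auto simp: smooth_def C_k_def)
qed

lemma partials_append: "partials (as @ bs) f = partials as (partials bs f)"
  by (induction as) auto

lemma smooth_partials: "smooth f \<Longrightarrow> set bs \<subseteq> Basis \<Longrightarrow> smooth (partials bs f)"
  by (simp add: smooth_iff partials_append[symmetric])

lemma smooth_differentiable: "smooth f \<Longrightarrow> f differentiable (at x)"
  unfolding smooth_iff by (metis empty_set empty_subsetI partials.simps(1))

lemma smooth_has_derivative: "smooth f \<Longrightarrow> (f has_derivative frechet_derivative f (at x)) (at x)"
  using smooth_differentiable frechet_derivative_works by blast

lemma smooth_continuous_on: "smooth f \<Longrightarrow> continuous_on S f"
  by (meson continuous_at_imp_continuous_on differentiable_imp_continuous_within smooth_differentiable)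

text \<open>Smoothness asks for all iterated partial derivatives; a class of differentiable
  functions closed under first partial derivatives supplies them by induction. In each application
  only the class has to be found.\<close>

lemma smoothI_closed:
  assumes "f \<in> S"
    and S: "\<And>f x. f \<in> S \<Longrightarrow> f differentiable (at x)"
      "\<And>f b. f \<in> S \<Longrightarrow> b \<in> Basis \<Longrightarrow> (\<lambda>x. frechet_derivative f (at x) b) \<in> S"
  shows "smooth f"
proof -
  have "partials bs f \<in> S" if "set bs \<subseteq> Basis" for bs
    using that by (induction bs) (auto intro: assms)
  then show ?thesis using S by (auto simp: smooth_iff)
qed

text \<open>The algebra generated by \<open>B\<close> and the constants. By the product rule it is
  closed under differentiation as soon as the derivatives of the generators lie in it, which
  replaces multi-index formulas for products and compositions.\<close>

inductive_set polys_in :: "('a \<Rightarrow> real) set \<Rightarrow> ('a \<Rightarrow> real) set" for B where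
  base: "f \<in> B \<Longrightarrow> f \<in> polys_in B"
| const: "(\<lambda>x. c) \<in> polys_in B"
| add: "f \<in> polys_in B \<Longrightarrow> g \<in> polys_in B \<Longrightarrow> (\<lambda>x. f x + g x) \<in> polys_in B"
| mult: "f \<in> polys_in B \<Longrightarrow> g \<in> polys_in B \<Longrightarrow> (\<lambda>x. f x * g x) \<in> polys_in B"

lemma polys_in_sum:
  "finite A \<Longrightarrow> (\<And>a. a \<in> A \<Longrightarrow> f a \<in> polys_in B) \<Longrightarrow> (\<lambda>x. \<Sum>a\<in>A. f a x) \<in> polys_in B"
  by (induction A rule: finite_induct) (auto intro: polys_in.intros)

lemma polys_in_smooth:
  assumes B: "\<And>f x. f \<in> B \<Longrightarrow> f differentiable (at x)"
      "\<And>f b. f \<in> B \<Longrightarrow> b \<in> Basis \<Longrightarrow> (\<lambda>x. frechet_derivative f (at x) b) \<in> polys_in B"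
    and f: "f \<in> polys_in B"
  shows "smooth f"
proof (rule smoothI_closed[OF f])
  fix f x assume "f \<in> polys_in B"
  then show "f differentiable (at x)" by (induction) (auto intro: B)
next
  fix f :: "'a \<Rightarrow> real" and b :: 'a assume f: "f \<in> polys_in B" and b: "b \<in> Basis"
  have d: "f differentiable (at x)" if "f \<in> polys_in B" for f x
    using that by (induction) (auto intro: B)
  have D: "(f has_derivative frechet_derivative f (at x)) (at x)" if "f \<in> polys_in B" for f x
    using d[OF that] frechet_derivative_works by blast
  show "(\<lambda>x. frechet_derivative f (at x) b) \<in> polys_in B"
    using f
  proof induction
    case (base f) then show ?case using B(2) b by blast
  next
    case (const c)
    have "frechet_derivative (\<lambda>x. c) (at x) b = 0" for x :: 'a and c :: real by simp
    then show ?case using polys_in.const[of 0] by simp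
  next
    case (add f g)
    have "frechet_derivative (\<lambda>x. f x + g x) (at x) = (\<lambda>h. frechet_derivative f (at x) h + frechet_derivative g (at x) h)" for x
      by (rule frechet_derivative_at[symmetric]) (intro has_derivative_add D add)
    then show ?case using polys_in.add[OF add.IH] by simp
  next
    case (mult f g)
    have "frechet_derivative (\<lambda>x. f x * g x) (at x) = (\<lambda>h. f x * frechet_derivative g (at x) h + frechet_derivative f (at x) h * g x)" for x
      by (rule frechet_derivative_at[symmetric]) (intro has_derivative_mult D mult)
    then show ?case
      using polys_in.add[OF polys_in.mult[OF mult.hyps(1) mult.IH(2)] polys_in.mult[OF mult.IH(1) mult.hyps(2)]] by simp
  qed
qed

lemma partials_Cons_closed:
  assumes "smooth f" "g \<in> {partials bs f |bs. set bs \<subseteq> Basis}"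
  shows "g differentiable (at x)" "b \<in> Basis \<Longrightarrow> (\<lambda>x. frechet_derivative g (at x) b) \<in> {partials bs f |bs. set bs \<subseteq> Basis}"
proof -
  obtain bs where bs: "g = partials bs f" "set bs \<subseteq> Basis" using assms by blast
  show "g differentiable (at x)" using bs assms(1) by (simp add: smooth_iff)
  assume "b \<in> Basis"
  then have "(\<lambda>x. frechet_derivative g (at x) b) = partials (b # bs) f" "set (b # bs) \<subseteq> Basis" using bs by auto
  then show "(\<lambda>x. frechet_derivative g (at x) b) \<in> {partials bs f |bs. set bs \<subseteq> Basis}" by (intro CollectI exI conjI)
qed

lemma polys_in_partials_self: "f \<in> polys_in ({partials bs f |bs. set bs \<subseteq> Basis} \<union> B)"
  by (rule polys_in.base) (auto intro!: exI[of _ "[]"])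

lemma smooth_polys_in_partials:
  assumes "smooth f" "smooth g"
    and h: "h \<in> polys_in ({partials bs f |bs. set bs \<subseteq> Basis} \<union> {partials bs g |bs. set bs \<subseteq> Basis})"
  shows "smooth h"
proof (rule polys_in_smooth[OF _ _ h])
  let ?B = "{partials bs f |bs. set bs \<subseteq> Basis} \<union> {partials bs g |bs. set bs \<subseteq> Basis}"
  fix k x assume "k \<in> ?B"
  then show "k differentiable (at x)"
    using partials_Cons_closed(1)[OF assms(1), of k x] partials_Cons_closed(1)[OF assms(2), of k x] by (elim UnE)
next
  let ?B = "{partials bs f |bs. set bs \<subseteq> Basis} \<union> {partials bs g |bs. set bs \<subseteq> Basis}"
  fix k and b :: 'a assume "k \<in> ?B" and b: "b \<in> Basis"
  then have "(\<lambda>x. frechet_derivative k (at x) b) \<in> ?B"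
    using partials_Cons_closed(2)[OF assms(1) _ b, of k] partials_Cons_closed(2)[OF assms(2) _ b, of k]
    by (elim UnE) (rule UnI1 UnI2, simp)+
  then show "(\<lambda>x. frechet_derivative k (at x) b) \<in> polys_in ?B" by (rule polys_in.base)
qed
lemma smooth_const [intro]: "smooth (\<lambda>x. c)"
  by (rule polys_in_smooth[of "{}"]) (auto intro: polys_in.const)

lemma smooth_add [intro]: "smooth f \<Longrightarrow> smooth g \<Longrightarrow> smooth (\<lambda>x. f x + g x)"
  by (erule (1) smooth_polys_in_partials)
    (intro polys_in.add polys_in_partials_self, subst Un_commute, rule polys_in_partials_self)

lemma smooth_mult [intro]: "smooth f \<Longrightarrow> smooth g \<Longrightarrow> smooth (\<lambda>x. f x * g x)"
  by (erule (1) smooth_polys_in_partials)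
    (intro polys_in.mult polys_in_partials_self, subst Un_commute, rule polys_in_partials_self)

lemma smooth_cmult [intro]: "smooth f \<Longrightarrow> smooth (\<lambda>x. c * f x)" by (intro smooth_mult smooth_const)

lemma smooth_minus [intro]: "smooth f \<Longrightarrow> smooth (\<lambda>x. - f x)" using smooth_cmult[of f "-1"] by simp

lemma smooth_diff [intro]: "smooth f \<Longrightarrow> smooth g \<Longrightarrow> smooth (\<lambda>x. f x - g x)"
  using smooth_add[OF _ smooth_minus, of f g] by simp

lemma smooth_sum [intro]: "(\<And>i. i \<in> A \<Longrightarrow> smooth (f i)) \<Longrightarrow> smooth (\<lambda>x. \<Sum>i\<in>A. f i x)"
  by (induction A rule: infinite_finite_induct) auto

lemma smooth_bounded_linear:
  assumes f: "bounded_linear f" shows "smooth f"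
proof (rule polys_in_smooth[of "{f}"])
  fix g b assume "g \<in> {f}"
  have "frechet_derivative f (at x) = f" for x
    by (rule frechet_derivative_at[symmetric]) (rule bounded_linear_imp_has_derivative[OF f])
  then show "(\<lambda>x. frechet_derivative g (at x) b) \<in> polys_in {f}" using \<open>g \<in> {f}\<close> by (auto intro: polys_in.const)
qed (auto intro: polys_in.base bounded_linear_imp_differentiable f)

lemma smooth_inner_left [intro]: "smooth (\<lambda>x. x \<bullet> b)"
  by (rule smooth_bounded_linear) (rule bounded_linear_inner_left)

lemma smooth_norm_sq: "smooth (\<lambda>x::'a::euclidean_space. (norm x)\<^sup>2)"
proof -
  have "(\<lambda>x::'a. (norm x)\<^sup>2) = (\<lambda>x. \<Sum>b\<in>Basis. (x \<bullet> b) * (x \<bullet> b))"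
    by (rule ext) (subst power2_norm_eq_inner, rule euclidean_inner)
  then show ?thesis by (simp add: smooth_sum smooth_mult smooth_inner_left)
qed

text \<open>The generators are the derivatives of \<open>u\<close> evaluated at \<open>f\<close> and
  the derivatives of \<open>f\<close>; the chain rule sends a generator of the first kind to a
  product of two generators.\<close>

lemma smooth_compose:
  fixes u :: "real \<Rightarrow> real" and f :: "'b::euclidean_space \<Rightarrow> real"
  assumes u: "smooth u" and f: "smooth f"
  shows "smooth (\<lambda>x. u (f x))"
proof -
  let ?U = "{\<lambda>x. partials bs u (f x) |bs. set bs \<subseteq> Basis}" and ?F = "{partials bs f |bs. set bs \<subseteq> Basis}"
  have D: "((\<lambda>x. partials bs u (f x)) has_derivative
       (\<lambda>h. frechet_derivative (partials bs u) (at (f x)) (frechet_derivative f (at x) h))) (at x)" if "set bs \<subseteq> Basis" for bs x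
    by (rule has_derivative_compose[OF smooth_has_derivative[OF f] smooth_has_derivative[OF smooth_partials[OF u that]]])
  show ?thesis
  proof (rule polys_in_smooth[of "?U \<union> ?F"])
    show "(\<lambda>x. u (f x)) \<in> polys_in (?U \<union> ?F)" by (rule polys_in.base) (auto intro!: exI[of _ "[]"])
  next
    fix g x assume "g \<in> ?U \<union> ?F"
    then show "g differentiable (at x)"
    proof
      assume "g \<in> ?U" then show ?thesis using D unfolding differentiable_def by blast
    qed (rule partials_Cons_closed(1)[OF f])
  next
    fix g and b :: 'b assume g: "g \<in> ?U \<union> ?F" and b: "b \<in> Basis"
    show "(\<lambda>x. frechet_derivative g (at x) b) \<in> polys_in (?U \<union> ?F)"
    proof (cases "g \<in> ?F")
      case True then show ?thesis using partials_Cons_closed(2)[OF f _ b] by (blast intro: polys_in.base)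
    next
      case False
      then obtain bs where bs: "g = (\<lambda>x. partials bs u (f x))" "set bs \<subseteq> Basis" using g by blast
      have "frechet_derivative g (at x) b = partials (1 # bs) u (f x) * partials [b] f x" for x
      proof -
        have "frechet_derivative g (at x) = (\<lambda>h. frechet_derivative (partials bs u) (at (f x)) (frechet_derivative f (at x) h))"
          unfolding bs by (rule frechet_derivative_at[symmetric]) (rule D[OF bs(2)])
        moreover have "linear (frechet_derivative (partials bs u) (at (f x)))"
          using smooth_has_derivative[OF smooth_partials[OF u bs(2)]] has_derivative_linear by blast
        then have "frechet_derivative (partials bs u) (at (f x)) (frechet_derivative f (at x) b *\<^sub>R 1) =
            frechet_derivative f (at x) b *\<^sub>R frechet_derivative (partials bs u) (at (f x)) 1"
          by (rule linear_scale)
        ultimately show ?thesis by simp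
      qed
      then have "(\<lambda>x. frechet_derivative g (at x) b) = (\<lambda>x. partials (1 # bs) u (f x) * partials [b] f x)" by blast
      also have "\<dots> \<in> polys_in (?U \<union> ?F)"
      proof (rule polys_in.mult; rule polys_in.base)
        show "(\<lambda>x. partials (1 # bs) u (f x)) \<in> ?U \<union> ?F" using bs(2) by (intro UnI1) (auto intro!: exI[of _ "1 # bs"])
        show "partials [b] f \<in> ?U \<union> ?F" using b by (intro UnI2) (auto intro!: exI[of _ "[b]"])
      qed
      finally show ?thesis .
    qed
  qed
qed

lemma smooth_compose_affine:
  fixes f :: "'b::euclidean_space \<Rightarrow> real" and L :: "'a::euclidean_space \<Rightarrow> 'b"
  assumes f: "smooth f" and L: "bounded_linear L"
  shows "smooth (\<lambda>x. f (L x + c))"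
proof -
  let ?F = "{\<lambda>x. partials bs f (L x + c) |bs. set bs \<subseteq> Basis}"
  have D: "((\<lambda>x. partials bs f (L x + c)) has_derivative
       (\<lambda>h. frechet_derivative (partials bs f) (at (L x + c)) (L h))) (at x)" if "set bs \<subseteq> Basis" for bs x
    by (rule has_derivative_compose[of "\<lambda>x. L x + c" L, OF _ smooth_has_derivative[OF smooth_partials[OF f that]]])
      (auto intro!: derivative_eq_intros bounded_linear_imp_has_derivative L)
  show ?thesis
  proof (rule polys_in_smooth[of ?F])
    show "(\<lambda>x. f (L x + c)) \<in> polys_in ?F" by (rule polys_in.base) (auto intro!: exI[of _ "[]"])
  next
    fix g x assume "g \<in> ?F"
    then show "g differentiable (at x)" using D unfolding differentiable_def by blast
  next
    fix g and b :: 'a assume g: "g \<in> ?F" and b: "b \<in> Basis"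
    then obtain bs where bs: "g = (\<lambda>x. partials bs f (L x + c))" "set bs \<subseteq> Basis" by blast
    have "frechet_derivative g (at x) b = (\<Sum>i\<in>Basis. (L b \<bullet> i) * partials (i # bs) f (L x + c))" for x
    proof -
      have "frechet_derivative g (at x) = (\<lambda>h. frechet_derivative (partials bs f) (at (L x + c)) (L h))"
        unfolding bs by (rule frechet_derivative_at[symmetric]) (rule D[OF bs(2)])
      moreover have lin: "linear (frechet_derivative (partials bs f) (at (L x + c)))"
        using smooth_has_derivative[OF smooth_partials[OF f bs(2)]] has_derivative_linear by blast
      moreover have "L b = (\<Sum>i\<in>Basis. (L b \<bullet> i) *\<^sub>R i)" by (simp add: euclidean_representation)
      ultimately have "frechet_derivative g (at x) b = frechet_derivative (partials bs f) (at (L x + c)) (\<Sum>i\<in>Basis. (L b \<bullet> i) *\<^sub>R i)"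
        by simp
      then show ?thesis by (simp add: linear_sum[OF lin] linear_scale[OF lin] o_def)
    qed
    then have "(\<lambda>x. frechet_derivative g (at x) b) = (\<lambda>x. \<Sum>i\<in>Basis. (L b \<bullet> i) * partials (i # bs) f (L x + c))" by blast
    also have "\<dots> \<in> polys_in ?F"
    proof (intro polys_in_sum polys_in.mult polys_in.const polys_in.base finite_Basis)
      fix i :: 'b assume "i \<in> Basis"
      then show "(\<lambda>x. partials (i # bs) f (L x + c)) \<in> ?F" using bs(2) by (auto intro!: exI[of _ "i # bs"])
    qed
    finally show "(\<lambda>x. frechet_derivative g (at x) b) \<in> polys_in ?F" .
  qed
qed

lemma smooth_fst: "smooth f \<Longrightarrow> smooth (\<lambda>x. f (fst x))"
  using smooth_compose_affine[of f fst 0] bounded_linear_fst by simp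

lemma smooth_snd: "smooth f \<Longrightarrow> smooth (\<lambda>x. f (snd x))"
  using smooth_compose_affine[of f snd 0] bounded_linear_snd by simp

section \<open>Bump functions on the line\<close>

definition exp_bump :: "nat \<Rightarrow> real \<Rightarrow> real" where
  "exp_bump k x = (if x > 0 then exp (- 1 / x) / x ^ k else 0)"

lemma exp_bump_limit: "((\<lambda>x. exp_bump k x) \<longlongrightarrow> 0) (at 0)"
proof (rule filterlim_split_at)
  have "((\<lambda>x. inverse x ^ k / exp (inverse x)) \<longlongrightarrow> 0) (at_right (0::real))"
    by (rule filterlim_compose[OF tendsto_power_div_exp_0 filterlim_inverse_at_top_right])
  then have "((\<lambda>x. exp (- 1 / x) / x ^ k) \<longlongrightarrow> 0) (at_right (0::real))"
    by (simp add: divide_inverse exp_minus power_inverse mult.commute)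
  moreover have "\<forall>\<^sub>F x in at_right 0. exp (- 1 / x) / x ^ k = exp_bump k x"
    unfolding eventually_at_filter by (auto simp: exp_bump_def)
  ultimately show "(exp_bump k \<longlongrightarrow> 0) (at_right 0)" by (rule Lim_transform_eventually)
  have "\<forall>\<^sub>F x in at_left 0. 0 = exp_bump k x"
    unfolding eventually_at_filter by (auto simp: exp_bump_def)
  then show "(exp_bump k \<longlongrightarrow> 0) (at_left 0)" by (rule Lim_transform_eventually[OF tendsto_const])
qed

text \<open>The exponent \<open>k\<close> is carried along so that derivatives stay in the linear
  span of the family. At 0 the difference quotient for the exponent \<open>k\<close> is the function
  for \<open>k + 1\<close>, which tends to 0.\<close>

lemma exp_bump_derivative:
  "(exp_bump k has_real_derivative exp_bump (k + 2) x - real k * exp_bump (k + 1) x) (at x)"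
proof -
  consider "x > 0" | "x < 0" | "x = 0" by linarith
  then show ?thesis
  proof cases
    case 1
    have "((\<lambda>x. exp (- 1 / x) / x ^ k) has_real_derivative exp_bump (k + 2) x - real k * exp_bump (k + 1) x) (at x)"
    proof -
      have pw: "real k * x ^ (k - Suc 0) = real k * x ^ k / x" using 1 by (cases k) auto
      have "((\<lambda>x. exp (- 1 / x) / x ^ k) has_real_derivative
        (exp (- 1 / x) * (1 / x\<^sup>2) * x ^ k - exp (- 1 / x) * (real k * x ^ k / x)) / (x ^ k * x ^ k)) (at x)"
        unfolding pw[symmetric] using 1 by (auto intro!: derivative_eq_intros simp: power2_eq_square)
      also have "(exp (- 1 / x) * (1 / x\<^sup>2) * x ^ k - exp (- 1 / x) * (real k * x ^ k / x)) / (x ^ k * x ^ k)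
        = exp_bump (k + 2) x - real k * exp_bump (k + 1) x"
        using 1 by (simp add: exp_bump_def field_simps power2_eq_square)
      finally show ?thesis .
    qed
    then show ?thesis
      by (rule DERIV_cong_ev[THEN iffD1, OF refl _ refl, rotated])
         (use eventually_nhds_in_open[of "{0<..}" x] 1 in \<open>auto elim!: eventually_mono simp: exp_bump_def\<close>)
  next
    case 2
    have "((\<lambda>x. 0) has_real_derivative exp_bump (k + 2) x - real k * exp_bump (k + 1) x) (at x)"
      using 2 by (auto simp: exp_bump_def)
    then show ?thesis
      by (rule DERIV_cong_ev[THEN iffD1, OF refl _ refl, rotated])
         (use eventually_nhds_in_open[of "{..<0}" x] 2 in \<open>auto elim!: eventually_mono simp: exp_bump_def\<close>)
  next
    case 3
    have "(\<lambda>h. (exp_bump k (0 + h) - exp_bump k 0) / h) = exp_bump (Suc k)"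
      by (auto simp: exp_bump_def fun_eq_iff field_simps)
    moreover have "exp_bump (k + 2) 0 - real k * exp_bump (k + 1) 0 = 0" by (simp add: exp_bump_def)
    ultimately show ?thesis unfolding 3 DERIV_def using exp_bump_limit[of "Suc k"] by metis
  qed
qed

lemma real_derivative_partial:
  fixes f :: "real \<Rightarrow> real"
  assumes "\<And>x. (f has_real_derivative f' x) (at x)"
  shows "f differentiable (at x)" "b \<in> Basis \<Longrightarrow> (\<lambda>x. frechet_derivative f (at x) b) = f'"
proof -
  have D: "(f has_derivative (*) (f' x)) (at x)" for x using assms[of x] by (simp add: has_field_derivative_def)
  then show "f differentiable (at x)" by (auto simp: differentiable_def)
  assume "b \<in> Basis"
  then show "(\<lambda>x. frechet_derivative f (at x) b) = f'"
    using frechet_derivative_at[OF D] by (auto simp: fun_eq_iff) (metis mult_1_right)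
qed

lemma smooth_real_derivative:
  fixes f :: "real \<Rightarrow> real"
  assumes f: "smooth f"
  shows "(f has_real_derivative deriv f x) (at x)" "smooth (deriv f)"
proof -
  have *: "(f has_real_derivative deriv f x) (at x)" for x
    using smooth_differentiable[OF f] by (metis DERIV_imp_deriv real_differentiable_def)
  then show "(f has_real_derivative deriv f x) (at x)" .
  have "partials [1] f = deriv f" using real_derivative_partial(2)[OF *, of 1] by simp
  then show "smooth (deriv f)" using smooth_partials[OF f, of "[1]"] by simp
qed

lemma smooth_of_derivative:
  fixes f :: "real \<Rightarrow> real"
  assumes f: "\<And>x. (f has_real_derivative g x) (at x)" and g: "smooth g"
  shows "smooth f"
proof (rule polys_in_smooth[of "{f} \<union> {partials bs g |bs. set bs \<subseteq> Basis}"])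
  show "f \<in> polys_in ({f} \<union> {partials bs g |bs. set bs \<subseteq> Basis})" by (rule polys_in.base) simp
next
  fix h x assume "h \<in> {f} \<union> {partials bs g |bs. set bs \<subseteq> Basis}"
  then show "h differentiable (at x)" using real_derivative_partial(1)[OF f] partials_Cons_closed(1)[OF g] by blast
next
  fix h and b :: real assume h: "h \<in> {f} \<union> {partials bs g |bs. set bs \<subseteq> Basis}" and b: "b \<in> Basis"
  show "(\<lambda>x. frechet_derivative h (at x) b) \<in> polys_in ({f} \<union> {partials bs g |bs. set bs \<subseteq> Basis})"
  proof (cases "h = f")
    case True
    then have "(\<lambda>x. frechet_derivative h (at x) b) = g" using real_derivative_partial(2)[OF f b] by simp
    then show ?thesis by (auto intro!: polys_in.base exI[of _ "[]"])
  next
    case False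
    then show ?thesis using h partials_Cons_closed(2)[OF g _ b, of h] by (blast intro: polys_in.base)
  qed
qed

lemma smooth_exp_bump: "smooth (exp_bump k)"
proof (rule polys_in_smooth[of "range exp_bump"])
  show "exp_bump k \<in> polys_in (range exp_bump)" by (auto intro: polys_in.base)
next
  fix f x assume "f \<in> range exp_bump"
  then show "f differentiable (at x)" using real_derivative_partial(1)[OF exp_bump_derivative] by auto
next
  fix f and b :: real assume "f \<in> range exp_bump" "b \<in> Basis"
  then obtain k where "(\<lambda>x. frechet_derivative f (at x) b) = (\<lambda>x. exp_bump (k + 2) x + (- real k) * exp_bump (k + 1) x)"
    using real_derivative_partial(2)[OF exp_bump_derivative] by auto
  then show "(\<lambda>x. frechet_derivative f (at x) b) \<in> polys_in (range exp_bump)"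
    by (simp only:) (intro polys_in.add polys_in.mult polys_in.const polys_in.base rangeI)
qed

lemma exp_bump_pos_iff: "exp_bump k x > 0 \<longleftrightarrow> x > 0" "exp_bump k x \<ge> 0"
  by (auto simp: exp_bump_def)

section \<open>Gradients and functions with Lipschitz gradient\<close>

lemma grad_eqI:
  assumes "(f has_derivative (\<lambda>h. v \<bullet> h)) (at x)" shows "grad f x = v"
proof -
  have "frechet_derivative f (at x) = (\<lambda>h. v \<bullet> h)" by (rule frechet_derivative_at[OF assms, symmetric])
  then show ?thesis by (simp add: grad_def euclidean_representation)
qed

lemma linear_eq_inner_basis:
  fixes f :: "'a::euclidean_space \<Rightarrow> real"
  assumes f: "linear f" shows "f h = (\<Sum>b\<in>Basis. f b *\<^sub>R b) \<bullet> h"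
proof -
  have "f h = f (\<Sum>b\<in>Basis. (h \<bullet> b) *\<^sub>R b)" by (simp add: euclidean_representation)
  also have "\<dots> = (\<Sum>b\<in>Basis. (h \<bullet> b) * f b)" by (simp add: linear_sum[OF f] linear_scale[OF f])
  also have "\<dots> = (\<Sum>b\<in>Basis. f b *\<^sub>R b) \<bullet> h" 
    by (simp only: inner_sum_left inner_scaleR_left) (intro sum.cong, auto simp: inner_commute mult.commute)
  finally show ?thesis .
qed

lemma differentiable_grad:
  assumes "f differentiable (at x)" shows "(f has_derivative (\<lambda>h. grad f x \<bullet> h)) (at x)"
proof -
  have D: "(f has_derivative frechet_derivative f (at x)) (at x)" using assms frechet_derivative_works by blast
  then have "frechet_derivative f (at x) = (\<lambda>h. grad f x \<bullet> h)"
    unfolding grad_def partials.simps by (intro ext linear_eq_inner_basis has_derivative_linear[OF D])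
  with D show ?thesis by simp
qed

lemma smooth_grad: "smooth f \<Longrightarrow> (f has_derivative (\<lambda>h. grad f x \<bullet> h)) (at x)"
  by (intro differentiable_grad smooth_differentiable)

lemma grad_inner_Basis: "b \<in> Basis \<Longrightarrow> grad f x \<bullet> b = partials [b] f x"
  by (simp add: grad_def inner_sum_left inner_Basis if_distrib cong: if_cong)

lemma continuous_on_grad:
  "(\<And>b. b \<in> Basis \<Longrightarrow> continuous_on S (partials [b] f)) \<Longrightarrow> continuous_on S (grad f)"
  unfolding grad_def by (intro continuous_intros) auto

lemma norm_grad_le:
  assumes "\<And>b. b \<in> Basis \<Longrightarrow> \<bar>partials [b] f x\<bar> \<le> C"
  shows "norm (grad (f::'a::euclidean_space \<Rightarrow> real) x) \<le> real DIM('a) * C"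
proof -
  have "norm (grad f x) \<le> (\<Sum>b\<in>Basis. norm (partials [b] f x *\<^sub>R b))" unfolding grad_def by (rule norm_sum)
  also have "\<dots> \<le> (\<Sum>b\<in>(Basis::'a set). C)" by (intro sum_mono) (use assms in auto)
  finally show ?thesis by simp
qed

text \<open>The class C^{1,1} with its constant. The gradient is an argument of its own because the
  potential of a measure comes with the explicit gradient \<open>grad_conv\<close>.\<close>

definition lipschitz_grad :: "real \<Rightarrow> ('a::euclidean_space \<Rightarrow> real) \<Rightarrow> ('a \<Rightarrow> 'a) \<Rightarrow> bool" where
  "lipschitz_grad L f G \<longleftrightarrow> 0 \<le> L \<and> (\<forall>x. (f has_derivative (\<lambda>h. G x \<bullet> h)) (at x)) \<and>
     (\<forall>x y. norm (G x - G y) \<le> L * norm (x - y))"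

lemma lipschitz_grad_continuous:
  assumes "lipschitz_grad L f G" shows "continuous_on S f" "continuous_on S G"
proof -
  show "continuous_on S f" using assms unfolding lipschitz_grad_def
    by (meson continuous_at_imp_continuous_on has_derivative_continuous)
  have "L-lipschitz_on UNIV G" using assms by (intro lipschitz_onI) (auto simp: lipschitz_grad_def dist_norm)
  then show "continuous_on S G" by (meson continuous_on_subset lipschitz_on_continuous_on subset_UNIV)
qed

lemma lipschitz_grad_add:
  assumes "lipschitz_grad L f G" "lipschitz_grad L' f' G'"
  shows "lipschitz_grad (L + L') (\<lambda>x. f x + f' x) (\<lambda>x. G x + G' x)"
  unfolding lipschitz_grad_def
proof (intro conjI allI)
  show "((\<lambda>x. f x + f' x) has_derivative (\<lambda>h. (G x + G' x) \<bullet> h)) (at x)" for x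
    using assms unfolding lipschitz_grad_def inner_add_left by (intro has_derivative_add) auto
  show "norm (G x + G' x - (G y + G' y)) \<le> (L + L') * norm (x - y)" for x y
  proof -
    have "norm (G x + G' x - (G y + G' y)) \<le> norm (G x - G y) + norm (G' x - G' y)"
      by (metis add_diff_add norm_triangle_ineq)
    also have "\<dots> \<le> L * norm (x - y) + L' * norm (x - y)" using assms unfolding lipschitz_grad_def by (intro add_mono) auto
    finally show ?thesis by (simp add: distrib_right)
  qed
qed (use assms in \<open>auto simp: lipschitz_grad_def\<close>)

text \<open>Mean value inequality for \<open>f\<close> minus its linear part on the ball of radius
  \<open>norm h\<close>, where the gradient of the difference is at most \<open>L * norm h\<close>;
  this gives the constant L instead of the sharp L/2.\<close>

lemma lipschitz_grad_taylor:
  assumes "lipschitz_grad L f G"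
  shows "\<bar>f (x + h) - f x - G x \<bullet> h\<bar> \<le> L * (norm h)\<^sup>2"
proof -
  have D: "(f has_derivative (\<lambda>h. G x \<bullet> h)) (at x)" and L: "norm (G x - G y) \<le> L * norm (x - y)" "L \<ge> 0" for x y
    using assms by (auto simp: lipschitz_grad_def)
  have "norm ((f (x + h) - G x \<bullet> (x + h)) - (f x - G x \<bullet> x)) \<le> (L * norm h) * norm ((x + h) - x)"
  proof (rule differentiable_bound[where S="cball x (norm h)" and f'="\<lambda>y k. (G y - G x) \<bullet> k"])
    show "((\<lambda>y. f y - G x \<bullet> y) has_derivative (\<lambda>k. (G y - G x) \<bullet> k)) (at y within cball x (norm h))" for y
      by (rule has_derivative_at_withinI) (auto intro!: derivative_eq_intros D simp: inner_diff_left)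
    show "onorm (\<lambda>k. (G y - G x) \<bullet> k) \<le> L * norm h" if "y \<in> cball x (norm h)" for y
    proof (rule onorm_bound)
      fix k
      have "norm ((G y - G x) \<bullet> k) \<le> norm (G y - G x) * norm k" by (rule Cauchy_Schwarz_ineq2[folded real_norm_def])
      also have "norm (G y - G x) \<le> L * norm h"
        using L(1)[of y x] that mult_left_mono[OF _ L(2), of "norm (y - x)" "norm h"]
        by (simp add: dist_norm norm_minus_commute)
      finally show "norm ((G y - G x) \<bullet> k) \<le> L * norm h * norm k" by (simp add: mult_right_mono)
    qed (use L in auto)
  qed (auto simp: dist_norm)
  then show ?thesis by (simp add: inner_add_right power2_eq_square algebra_simps)
qed

lemma lipschitz_grad_neg_inner_le:
  assumes "lipschitz_grad L f G" shows "L \<ge> 0" "(f has_derivative (\<lambda>h. G x \<bullet> h)) (at x)"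
    "norm (G x - G y) \<le> L * norm (x - y)"
  using assms by (auto simp: lipschitz_grad_def)

lemma lipschitz_bounded_derivative:
  assumes D: "\<And>x. (f has_derivative (\<lambda>h. G x \<bullet> h)) (at x)" and C: "\<And>x. norm (G x) \<le> C"
  shows "\<bar>f x - f y\<bar> \<le> C * norm (x - y)"
proof -
  have "norm (f x - f y) \<le> C * norm (x - y)"
  proof (rule differentiable_bound[where S=UNIV and f'="\<lambda>y k. G y \<bullet> k"])
    show "onorm (\<lambda>k. G y \<bullet> k) \<le> C" for y
    proof (rule onorm_bound)
      show "0 \<le> C" using C[of y] norm_ge_zero order_trans by blast
      show "norm (G y \<bullet> k) \<le> C * norm k" for k
        using Cauchy_Schwarz_ineq2[of "G y" k] C[of y] mult_right_mono[OF C[of y] norm_ge_zero[of k]] by simp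
    qed
  qed (auto intro: has_derivative_at_withinI D)
  then show ?thesis by simp
qed

lemma C2_lipschitz_grad:
  fixes f :: "'a::euclidean_space \<Rightarrow> real"
  assumes f: "C_k 2 f" and C: "bounded_partials 2 f"
  obtains L where "lipschitz_grad L f (grad f)"
proof -
  from C obtain C where C: "\<And>bs x. set bs \<subseteq> Basis \<Longrightarrow> length bs = 2 \<Longrightarrow> \<bar>partials bs f x\<bar> \<le> C"
    unfolding bounded_partials_def by blast
  have d0: "f differentiable (at x)" for x
    using f[unfolded C_k_def, THEN conjunct1, rule_format, of "[]"] by simp
  have d1: "partials [b] f differentiable (at x)" if "b \<in> Basis" for b x
    using f[unfolded C_k_def, THEN conjunct1, rule_format, of "[b]"] that by simp
  define K where "K = real DIM('a) * C"
  have C0: "C \<ge> 0" using C[of "[SOME b. b \<in> Basis, SOME b. b \<in> Basis]" 0] SOME_Basis by (auto intro: order_trans[OF abs_ge_zero])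
  have lip: "\<bar>partials [b] f x - partials [b] f y\<bar> \<le> K * norm (x - y)" if b: "b \<in> Basis" for b x y
  proof (rule lipschitz_bounded_derivative[where G="grad (partials [b] f)"])
    show "(partials [b] f has_derivative (\<lambda>h. grad (partials [b] f) x \<bullet> h)) (at x)" for x
      by (rule differentiable_grad[OF d1[OF b]])
    show "norm (grad (partials [b] f) x) \<le> K" for x
      unfolding K_def using C[of "[c, b]" x for c] b by (intro norm_grad_le) auto
  qed
  have "lipschitz_grad (real DIM('a) * K) f (grad f)"
    unfolding lipschitz_grad_def
  proof (intro conjI allI)
    show "0 \<le> real DIM('a) * K" using C0 by (simp add: K_def)
    show "(f has_derivative (\<lambda>h. grad f x \<bullet> h)) (at x)" for x by (rule differentiable_grad[OF d0])
    show "norm (grad f x - grad f y) \<le> real DIM('a) * K * norm (x - y)" for x y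
    proof -
      have "grad f x - grad f y = (\<Sum>b\<in>Basis. (partials [b] f x - partials [b] f y) *\<^sub>R b)"
        by (simp add: grad_def sum_subtractf scaleR_diff_left)
      also have "norm \<dots> \<le> (\<Sum>b\<in>Basis. norm ((partials [b] f x - partials [b] f y) *\<^sub>R b))" by (rule norm_sum)
      also have "\<dots> \<le> (\<Sum>b\<in>(Basis::'a set). K * norm (x - y))" by (intro sum_mono) (use lip in auto)
      finally show ?thesis by simp
    qed
  qed
  then show ?thesis by (rule that)
qed

text \<open>A uniform Taylor bound survives integration over a parameter, so convolutions and
  potentials are differentiated by this criterion instead of under the integral sign.\<close>

lemma has_derivative_quadratic:
  fixes f :: "'a::real_normed_vector \<Rightarrow> 'b::real_normed_vector"
  assumes D: "bounded_linear D" and "\<delta> > 0"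
    and b: "\<And>h. norm h < \<delta> \<Longrightarrow> norm (f (x + h) - f x - D h) \<le> C * (norm h)\<^sup>2"
  shows "(f has_derivative D) (at x)"
  unfolding has_derivative_within_alt2
proof (intro conjI D allI impI)
  fix e :: real assume "e > 0"
  have C: "C \<le> \<bar>C\<bar> + 1" "0 < \<bar>C\<bar> + 1" by auto
  show "\<forall>\<^sub>F y in at x. norm (f y - f x - D (y - x)) \<le> e * norm (y - x)"
    unfolding eventually_at
  proof (intro exI[of _ "min \<delta> (e / (\<bar>C\<bar> + 1))"] conjI ballI impI)
    show "0 < min \<delta> (e / (\<bar>C\<bar> + 1))" using \<open>\<delta> > 0\<close> \<open>e > 0\<close> by auto
    fix y assume "y \<noteq> x \<and> dist y x < min \<delta> (e / (\<bar>C\<bar> + 1))"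
    then have y: "norm (y - x) < \<delta>" "norm (y - x) < e / (\<bar>C\<bar> + 1)" by (auto simp: dist_norm)
    have "norm (f y - f x - D (y - x)) \<le> C * (norm (y - x))\<^sup>2" using b[OF y(1)] by simp
    also have "\<dots> \<le> ((\<bar>C\<bar> + 1) * norm (y - x)) * norm (y - x)"
      using mult_right_mono[OF C(1), of "(norm (y - x))\<^sup>2"] by (simp add: power2_eq_square mult.assoc)
    also have "\<dots> \<le> e * norm (y - x)"
      using y(2) C(2) by (intro mult_right_mono) (auto simp: field_simps)
    finally show "norm (f y - f x - D (y - x)) \<le> e * norm (y - x)" .
  qed
qed

section \<open>Test functions\<close>

lemma test_functions_onI:
  assumes "smooth f" "\<And>x. norm x > R \<Longrightarrow> f x = 0"
  shows "f \<in> test_functions_on (cball 0 R)"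
proof -
  have "{x. f x \<noteq> 0} \<subseteq> cball 0 R" using assms(2) by (force simp: not_less[symmetric])
  then have *: "closure {x. f x \<noteq> 0} \<subseteq> cball 0 R" by (simp add: closure_minimal)
  then have "compact (closure {x. f x \<noteq> 0})" by (meson bounded_cball bounded_subset closed_closure compact_eq_bounded_closed)
  with * show ?thesis using assms(1) by (simp add: test_functions_on_def smooth_def)
qed

lemma test_functionsI:
  "smooth f \<Longrightarrow> (\<And>x. norm x > R \<Longrightarrow> f x = 0) \<Longrightarrow> f \<in> test_functions"
  using test_functions_onI[of f R] by (auto simp: test_functions_on_def)

lemma test_functionsE:
  assumes "f \<in> test_functions"
  obtains R where "smooth f" "R > 0" "\<And>x. norm x > R \<Longrightarrow> f x = 0" "f \<in> test_functions_on (cball 0 R)"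
proof -
  have s: "smooth f" and "bounded (closure {x. f x \<noteq> 0})" using assms by (auto simp: test_functions_on_def smooth_def compact_eq_bounded_closed)
  then obtain R where R: "R > 0" "\<And>x. x \<in> closure {x. f x \<noteq> 0} \<Longrightarrow> norm x \<le> R" by (auto simp: bounded_pos)
  then have "f x = 0" if "norm x > R" for x using that closure_subset[of "{x. f x \<noteq> 0}"] by force
  with that[OF s R(1)] test_functions_onI[OF s] show ?thesis by blast
qed

lemma test_functions_smooth: "f \<in> test_functions \<Longrightarrow> smooth f"
  by (auto simp: test_functions_on_def smooth_def)

text \<open>The strict inequality makes the exterior of the ball open, so the function vanishes near
  each such point and its derivatives vanish there as well.\<close>

lemma partials_zero_outside:
  assumes "\<And>x. norm x > R \<Longrightarrow> f x = 0" shows "norm x > R \<Longrightarrow> partials bs f x = 0"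
proof (induction bs arbitrary: x)
  case (Cons b bs)
  have "\<forall>\<^sub>F y in nhds x. R < norm y"
    using Cons.prems eventually_nhds_in_open[of "{y. R < norm y}" x] open_Collect_less[of "\<lambda>_. R" norm] by (simp add: continuous_intros)
  then have "\<forall>\<^sub>F y in nhds x. 0 = partials bs f y" by eventually_elim (simp add: Cons.IH)
  then have ev: "\<forall>\<^sub>F y in at x. 0 = partials bs f y" by (auto simp: eventually_at_filter elim: eventually_mono)
  have "(partials bs f has_derivative (\<lambda>_. 0)) (at x)"
    by (rule has_derivative_transform_eventually[OF has_derivative_const[of 0 "at x"] ev])
       (use Cons in simp_all)
  then have "frechet_derivative (partials bs f) (at x) = (\<lambda>_. 0)" by (rule frechet_derivative_at[symmetric])
  then show ?case by simp
qed (use assms in simp)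

lemma test_functions_partials: "f \<in> test_functions \<Longrightarrow> set bs \<subseteq> Basis \<Longrightarrow> partials bs f \<in> test_functions"
  by (erule test_functionsE, rule test_functionsI) (auto intro: smooth_partials partials_zero_outside)

lemma continuous_compact_support_bounded:
  fixes f :: "'a::euclidean_space \<Rightarrow> 'b::real_normed_vector"
  assumes "continuous_on UNIV f" "\<And>x. norm x > R \<Longrightarrow> f x = 0"
  obtains C where "C > 0" "\<And>x. norm (f x) \<le> C"
proof -
  have "compact (f ` cball 0 R)" by (rule compact_continuous_image) (auto intro: continuous_on_subset[OF assms(1)])
  then obtain C where C: "C > 0" "\<And>x. x \<in> cball 0 R \<Longrightarrow> norm (f x) \<le> C" by (auto simp: bounded_pos dest!: compact_imp_bounded)
  have "norm (f x) \<le> C" for x using C(2)[of x] C(1) assms(2)[of x] by (cases "norm x \<le> R") auto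
  with C(1) show ?thesis by (rule that)
qed

lemma test_functions_bounded:
  assumes "f \<in> test_functions" obtains C where "C > 0" "\<And>x. \<bar>f x\<bar> \<le> C"
proof (rule test_functionsE[OF assms])
  fix R assume R: "smooth f" "\<And>x. norm x > R \<Longrightarrow> f x = 0"
  obtain C where "C > 0" "\<And>x. norm (f x) \<le> C"
    by (rule continuous_compact_support_bounded[of f R]) (use R smooth_continuous_on in auto)
  then show thesis by (intro that[of C]) auto
qed

lemma test_functions_add: "f \<in> test_functions \<Longrightarrow> g \<in> test_functions \<Longrightarrow> (\<lambda>x. f x + g x) \<in> test_functions"
proof (elim test_functionsE)
  fix R R' assume *: "smooth f" "smooth g" "\<And>x. norm x > R \<Longrightarrow> f x = 0" "\<And>x. norm x > R' \<Longrightarrow> g x = 0"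
  show ?thesis by (rule test_functionsI[of _ "max R R'"]) (use * in auto)
qed

lemma test_functions_smooth_mult: "f \<in> test_functions \<Longrightarrow> smooth g \<Longrightarrow> (\<lambda>x. g x * f x) \<in> test_functions"
  by (erule test_functionsE, rule test_functionsI) auto

lemma test_functions_cmult: "f \<in> test_functions \<Longrightarrow> (\<lambda>x. c * f x) \<in> test_functions"
  by (rule test_functions_smooth_mult) auto

lemma test_functions_diff: "f \<in> test_functions \<Longrightarrow> g \<in> test_functions \<Longrightarrow> (\<lambda>x. f x - g x) \<in> test_functions"
  using test_functions_add[OF _ test_functions_cmult[of g "-1"]] by simp

lemma test_functions_lipschitz_grad:
  fixes f :: "'a::euclidean_space \<Rightarrow> real"
  assumes f: "f \<in> test_functions"
  obtains L where "lipschitz_grad L f (grad f)"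
proof (rule C2_lipschitz_grad)
  show "C_k 2 f" using test_functions_smooth[OF f] by (simp add: smooth_def)
  have "finite {bs::'a list. set bs \<subseteq> Basis \<and> length bs = 2}" by (rule finite_lists_length_eq) simp
  moreover have "\<exists>C. \<forall>x. \<bar>partials bs f x\<bar> \<le> C" if "bs \<in> {bs. set bs \<subseteq> Basis \<and> length bs = 2}" for bs
    by (rule test_functions_bounded[OF test_functions_partials[OF f, of bs]]) (use that in auto)
  then obtain C where C: "\<And>bs x. bs \<in> {bs. set bs \<subseteq> Basis \<and> length bs = 2} \<Longrightarrow> \<bar>partials bs f x\<bar> \<le> C bs" by metis
  ultimately show "bounded_partials 2 f"
    unfolding bounded_partials_def
    by (intro exI[of _ "Max (C ` {bs. set bs \<subseteq> Basis \<and> length bs = 2})"] allI impI order_trans[OF C Max_ge]) auto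
qed

section \<open>Convolution and mollification\<close>

lemma integrable_compact_support:
  fixes f :: "'a::euclidean_space \<Rightarrow> 'b::{banach, second_countable_topology}"
  assumes "continuous_on UNIV f" "\<And>x. norm x > R \<Longrightarrow> f x = 0"
  shows "integrable lborel f"
proof -
  have "integrable lborel (\<lambda>x. indicator (cball 0 R) x *\<^sub>R f x)"
    by (rule borel_integrable_compact) (auto intro: continuous_on_subset[OF assms(1)])
  moreover have "(\<lambda>x. indicator (cball 0 R) x *\<^sub>R f x) = f" using assms(2) by (force simp: indicator_def fun_eq_iff)
  ultimately show ?thesis by simp
qed

lemma lborel_distr_reflect: "distr lborel borel (\<lambda>x. c - x) = (lborel :: 'a::euclidean_space measure)"
  by (subst (2) lborel_affine[of "-1" c]) (auto simp: density_1)

lemma lborel_integral_reflect: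
  fixes f :: "'a::euclidean_space \<Rightarrow> 'b::{banach, second_countable_topology}"
  assumes [measurable]: "f \<in> borel_measurable borel"
  shows "(\<integral>x. f (c - x) \<partial>lborel) = (\<integral>x. f x \<partial>lborel)"
  by (subst (2) lborel_distr_reflect[of c, symmetric], subst integral_distr) auto

lemma convolution_has_derivative:
  fixes W :: "'a::euclidean_space \<Rightarrow> real"
  assumes W: "continuous_on UNIV W" and k: "k \<in> test_functions"
  shows "((\<lambda>q. \<integral>z. W z * k (q - z) \<partial>lborel) has_derivative
     (\<lambda>h. \<integral>z. W z * (grad k (q - z) \<bullet> h) \<partial>lborel)) (at q)"
proof -
  obtain R where R: "smooth k" "R > 0" "\<And>x. norm x > R \<Longrightarrow> k x = 0" using test_functionsE[OF k] by blast
  obtain L where L: "lipschitz_grad L k (grad k)" using test_functions_lipschitz_grad[OF k] by blast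
  have gz: "grad k x = 0" if "norm x > R" for x
    using partials_zero_outside[of R k, OF R(3) that] by (simp add: grad_def del: partials.simps)
  have ck: "continuous_on UNIV k" "continuous_on UNIV (grad k)" by (rule lipschitz_grad_continuous[OF L])+
  have out: "norm (q - z) > R" if "norm z > norm q + R" for q z
    using that norm_triangle_ineq2[of z q] by (simp add: norm_minus_commute)
  have i1: "integrable lborel (\<lambda>z. W z * k (q - z))" for q
  proof (rule integrable_compact_support[of _ "norm q + R"])
    show "continuous_on UNIV (\<lambda>z. W z * k (q - z))" by (intro continuous_intros W continuous_on_compose2[OF ck(1)]) auto
  qed (simp add: R(3) out)
  have ig: "integrable lborel (\<lambda>z. W z *\<^sub>R grad k (q - z))" for q
  proof (rule integrable_compact_support[of _ "norm q + R"])
    show "continuous_on UNIV (\<lambda>z. W z *\<^sub>R grad k (q - z))" by (intro continuous_intros W continuous_on_compose2[OF ck(2)]) auto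
  qed (simp add: gz out)
  have i2: "integrable lborel (\<lambda>z. W z * (grad k (q - z) \<bullet> h))" for q h
    using integrable_inner_left[OF ig[of q], of h] by simp
  have lin: "(\<integral>z. W z * (grad k (q - z) \<bullet> h) \<partial>lborel) = (\<integral>z. W z *\<^sub>R grad k (q - z) \<partial>lborel) \<bullet> h" for h
    using integral_inner_left[OF ig[of q], of h] by simp
  \<comment> \<open>For \<open>norm h < 1\<close> the Taylor remainder of the kernel vanishes for
    \<open>z\<close> outside this ball, so only the values of \<open>W\<close> on a compact set
    matter.\<close>
  define S where "S = cball q (R + 1)"
  define C where "C = (\<integral>z. indicator S z * \<bar>W z\<bar> \<partial>lborel)"
  have iS: "integrable lborel (\<lambda>z. indicator S z * \<bar>W z\<bar>)"
    using borel_integrable_compact[of S "\<lambda>z. \<bar>W z\<bar>"] by (auto simp: S_def intro!: continuous_intros continuous_on_subset[OF W])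
  show ?thesis
  proof (rule has_derivative_quadratic[where \<delta>=1 and C="L * C"])
    show "bounded_linear (\<lambda>h. \<integral>z. W z * (grad k (q - z) \<bullet> h) \<partial>lborel)"
      unfolding lin by (rule bounded_linear_inner_right)
    fix h :: 'a assume h: "norm h < 1"
    have "(\<integral>z. W z * k (q + h - z) \<partial>lborel) - (\<integral>z. W z * k (q - z) \<partial>lborel) - (\<integral>z. W z * (grad k (q - z) \<bullet> h) \<partial>lborel)
      = (\<integral>z. W z * k (q + h - z) - W z * k (q - z) - W z * (grad k (q - z) \<bullet> h) \<partial>lborel)"
      by (simp add: i1 i2)
    also have "norm \<dots> \<le> (\<integral>z. L * (norm h)\<^sup>2 * (indicator S z * \<bar>W z\<bar>) \<partial>lborel)"
    proof (rule Bochner_Integration.integral_norm_bound_integral)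
      fix z
      have "norm (W z * k (q + h - z) - W z * k (q - z) - W z * (grad k (q - z) \<bullet> h)) =
        \<bar>W z\<bar> * \<bar>k ((q - z) + h) - k (q - z) - grad k (q - z) \<bullet> h\<bar>"
        by (simp add: abs_mult[symmetric] algebra_simps)
      also have "\<dots> \<le> L * (norm h)\<^sup>2 * (indicator S z * \<bar>W z\<bar>)"
      proof (cases "z \<in> S")
        case True
        then show ?thesis using mult_left_mono[OF lipschitz_grad_taylor[OF L, of "q - z" h] abs_ge_zero[of "W z"]]
          by (simp add: mult_ac)
      next
        case False
        then have n: "R + 1 < norm (q - z)" by (simp add: S_def dist_norm)
        moreover have "norm (q - z) \<le> norm (q - z + h) + norm h" by (metis add_diff_cancel_right' norm_triangle_ineq4)
        ultimately have "R < norm (q - z + h)" "R < norm (q - z)" using h by linarith+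
        then have "k (q - z + h) = 0" "k (q - z) = 0" "grad k (q - z) = 0" using R(3) gz by blast+
        then show ?thesis using lipschitz_grad_neg_inner_le(1)[OF L] by simp
      qed
      finally show "norm (W z * k (q + h - z) - W z * k (q - z) - W z * (grad k (q - z) \<bullet> h)) \<le> L * (norm h)\<^sup>2 * (indicator S z * \<bar>W z\<bar>)" .
    qed (use i1 i2 iS in auto)
    also have "\<dots> = L * C * (norm h)\<^sup>2" by (simp add: C_def)
    finally show "norm ((\<integral>z. W z * k (q + h - z) \<partial>lborel) - (\<integral>z. W z * k (q - z) \<partial>lborel) - (\<integral>z. W z * (grad k (q - z) \<bullet> h) \<partial>lborel)) \<le> L * C * (norm h)\<^sup>2" .
  qed simp
qed

text \<open>The convolutions of \<open>W\<close> with test functions form a class closed under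
  differentiation, since all derivatives fall on the kernel.\<close>

lemma smooth_convolution:
  fixes W :: "'a::euclidean_space \<Rightarrow> real"
  assumes W: "continuous_on UNIV W" and k: "k \<in> test_functions"
  shows "smooth (\<lambda>q. \<integral>z. W z * k (q - z) \<partial>lborel)"
proof (rule smoothI_closed[where S="(\<lambda>k q. \<integral>z. W z * k (q - z) \<partial>lborel) ` test_functions"])
  fix f x assume "f \<in> (\<lambda>k q. \<integral>z. W z * k (q - z) \<partial>lborel) ` test_functions"
  then show "f differentiable (at x)" using convolution_has_derivative[OF W] by (auto simp: differentiable_def)
next
  fix f and b :: 'a assume f: "f \<in> (\<lambda>k q. \<integral>z. W z * k (q - z) \<partial>lborel) ` test_functions" and b: "b \<in> Basis"
  then obtain k where k: "k \<in> test_functions" "f = (\<lambda>q. \<integral>z. W z * k (q - z) \<partial>lborel)" by blast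
  have "frechet_derivative f (at q) b = (\<integral>z. W z * partials [b] k (q - z) \<partial>lborel)" for q
    unfolding k(2) frechet_derivative_at[OF convolution_has_derivative[OF W k(1)], symmetric]
    by (simp only: grad_inner_Basis[OF b])
  moreover have "partials [b] k \<in> test_functions" using test_functions_partials[OF k(1), of "[b]"] b by simp
  ultimately show "(\<lambda>x. frechet_derivative f (at x) b) \<in> (\<lambda>k q. \<integral>z. W z * k (q - z) \<partial>lborel) ` test_functions"
    by blast
qed (use k in blast)

lemma mollifier_exists:
  assumes \<epsilon>: "\<epsilon> > 0"
  obtains \<eta> :: "'a::euclidean_space \<Rightarrow> real" where "\<eta> \<in> test_functions" "\<And>x. \<eta> x \<ge> 0" "\<And>x. norm x > \<epsilon> \<Longrightarrow> \<eta> x = 0"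
    "\<And>x. \<eta> (- x) = \<eta> x" "(\<integral>x. \<eta> x \<partial>lborel) = 1"
proof -
  define k :: "'a \<Rightarrow> real" where "k x = exp_bump 0 (\<epsilon>\<^sup>2 - (norm x)\<^sup>2)" for x
  have sk: "smooth k" unfolding k_def
    by (rule smooth_compose[OF smooth_exp_bump]) (intro smooth_diff smooth_const smooth_norm_sq)
  have k0: "k x = 0" if "norm x > \<epsilon>" for x
  proof -
    have "\<epsilon>\<^sup>2 < (norm x)\<^sup>2" using that \<epsilon> by (intro power_strict_mono) auto
    then show ?thesis by (simp add: k_def exp_bump_def)
  qed
  have kn: "k x \<ge> 0" for x by (simp add: k_def exp_bump_pos_iff)
  have ik: "integrable lborel k" by (rule integrable_compact_support[OF smooth_continuous_on[OF sk] k0])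
  define Z where "Z = (\<integral>x. k x \<partial>lborel)"
  have "Z \<noteq> 0"
  proof
    assume "Z = 0"
    then have "AE x in lborel. k x = 0" unfolding Z_def using integral_nonneg_eq_0_iff_AE[OF ik] kn by auto
    then have "AE x in lborel. x \<notin> ball (0::'a) \<epsilon>"
    proof eventually_elim
      case (elim x)
      show ?case
      proof
        assume "x \<in> ball 0 \<epsilon>"
        then have "(norm x)\<^sup>2 < \<epsilon>\<^sup>2" by (intro power_strict_mono) auto
        then have "k x > 0" by (simp add: k_def exp_bump_pos_iff)
        with elim show False by simp
      qed
    qed
    then have "emeasure lborel {x::'a. norm x < \<epsilon>} = 0" by (subst (asm) AE_iff_measurable[OF _ refl]) auto
    also have "{x::'a. norm x < \<epsilon>} = ball 0 \<epsilon>" by auto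
    finally have "emeasure lborel (ball (0::'a) \<epsilon>) = 0" .
    then show False using content_ball_pos[OF \<epsilon>, of "0::'a"] by (simp add: measure_def)
  qed
  moreover have "Z \<ge> 0" unfolding Z_def by (rule integral_nonneg_AE) (use kn in auto)
  ultimately have Z: "Z > 0" by simp
  show ?thesis
  proof (rule that[of "\<lambda>x. (1 / Z) * k x"])
    show "(\<lambda>x. (1 / Z) * k x) \<in> test_functions"
      by (intro test_functions_cmult test_functionsI[OF sk k0])
    show "(\<integral>x. (1 / Z) * k x \<partial>lborel) = 1" using Z unfolding integral_mult_right_zero Z_def[symmetric] by simp
    show "(1 / Z) * k (- x) = (1 / Z) * k x" for x by (simp add: k_def)
  qed (use Z k0 kn in auto)
qed

text \<open>The kernel is even, so the first-order Taylor term integrates to zero and the error of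
  \<open>W'\<close> is quadratic in \<epsilon>. Both errors are uniform on the whole space although
  \<open>W\<close> may be unbounded, as they involve only the Lipschitz constant of
  \<open>G\<close>.\<close>

lemma smooth_approximation:
  fixes W :: "'a::euclidean_space \<Rightarrow> real"
  assumes W: "lipschitz_grad L W G" and \<epsilon>: "\<epsilon> > 0"
  obtains W' where "smooth W'" "\<And>q. \<bar>W' q - W q\<bar> \<le> L * \<epsilon>\<^sup>2" "\<And>q. norm (grad W' q - G q) \<le> L * \<epsilon>"
proof -
  obtain \<eta> :: "'a \<Rightarrow> real" where \<eta>: "\<eta> \<in> test_functions" "\<And>x. \<eta> x \<ge> 0" "\<And>x. norm x > \<epsilon> \<Longrightarrow> \<eta> x = 0"
    "\<And>x. \<eta> (- x) = \<eta> x" "(\<integral>x. \<eta> x \<partial>lborel) = 1" using mollifier_exists[OF \<epsilon>] by blast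
  have c\<eta>: "continuous_on S \<eta>" for S using \<eta>(1) by (intro smooth_continuous_on test_functions_smooth)
  have L0: "L \<ge> 0" using W by (simp add: lipschitz_grad_def)
  note cW = lipschitz_grad_continuous[OF W]
  define W' where "W' q = (\<integral>z. W z * \<eta> (q - z) \<partial>lborel)" for q
  have sm: "smooth W'" unfolding W'_def by (rule smooth_convolution[OF cW(1) \<eta>(1)])
  have int: "integrable lborel (\<lambda>y. \<eta> y *\<^sub>R f y)" if "continuous_on UNIV f" for f :: "'a \<Rightarrow> 'b::{banach, second_countable_topology}"
    by (rule integrable_compact_support[of _ \<epsilon>]) (use that \<eta>(3) in \<open>auto intro!: continuous_intros c\<eta>\<close>)
  have intr: "integrable lborel (\<lambda>y. \<eta> y * f y)" if "continuous_on UNIV f" for f :: "'a \<Rightarrow> real"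
    using int[OF that] by simp
  have int\<eta>: "integrable lborel \<eta>" using intr[of "\<lambda>_. 1"] by simp
  have W'2: "W' q = (\<integral>y. \<eta> y * W (q - y) \<partial>lborel)" for q
  proof -
    have "(\<integral>y. \<eta> y * W (q - y) \<partial>lborel) = (\<integral>y. (\<lambda>z. W z * \<eta> (q - z)) (q - y) \<partial>lborel)" by (simp add: mult.commute)
    also have "\<dots> = W' q" unfolding W'_def
      by (rule lborel_integral_reflect)
         (auto intro!: borel_measurable_continuous_onI continuous_intros cW continuous_on_compose2[OF c\<eta>])
    finally show ?thesis ..
  qed
  have cWq: "continuous_on UNIV (\<lambda>y. W (q - y))" "continuous_on UNIV (\<lambda>y. G (q - y))" for q
    by (auto intro!: continuous_intros continuous_on_compose2[OF cW(1)] continuous_on_compose2[OF cW(2)])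
  have bnd: "(\<integral>y. \<eta> y * c \<partial>lborel) = c" for c :: real using \<eta>(5) by simp
  have "((\<integral>y. \<eta> y *\<^sub>R y \<partial>lborel) :: 'a) = (\<integral>y. \<eta> (0 - y) *\<^sub>R (0 - y) \<partial>lborel)"
    by (rule lborel_integral_reflect[symmetric]) (auto intro!: borel_measurable_continuous_onI continuous_intros c\<eta>)
  also have "\<dots> = - (\<integral>y. \<eta> y *\<^sub>R y \<partial>lborel)" using \<eta>(4) by simp
  finally have neg: "((\<integral>y. \<eta> y *\<^sub>R y \<partial>lborel) :: 'a) = - (\<integral>y. \<eta> y *\<^sub>R y \<partial>lborel)" .
  have "x = 0" if "x = - x" for x :: 'a
    using that unfolding eq_neg_iff_add_eq_0 scaleR_2[symmetric] by simp
  from this[OF neg] have odd: "((\<integral>y. \<eta> y *\<^sub>R y \<partial>lborel) :: 'a) = 0" .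
  show ?thesis
  proof (rule that[OF sm])
    fix q
    have odd': "(\<integral>y. \<eta> y * (G q \<bullet> (- y)) \<partial>lborel) = 0"
    proof -
      have "(\<integral>y. G q \<bullet> (\<eta> y *\<^sub>R y) \<partial>lborel) = G q \<bullet> (\<integral>y. \<eta> y *\<^sub>R y \<partial>lborel)"
        by (rule integral_inner_right) (rule int, rule continuous_on_id)
      then show ?thesis by (simp add: odd)
    qed
    have "W' q - W q = (\<integral>y. \<eta> y * W (q - y) \<partial>lborel) - (\<integral>y. \<eta> y * W q \<partial>lborel) - (\<integral>y. \<eta> y * (G q \<bullet> (- y)) \<partial>lborel)"
      by (simp add: W'2 \<eta>(5) odd' del: inner_minus_right)
    also have "\<dots> = (\<integral>y. \<eta> y * (W (q + - y) - W q - G q \<bullet> (- y)) \<partial>lborel)"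
      
    proof -
      have i1: "integrable lborel (\<lambda>y. \<eta> y * W (q - y))" by (rule intr[OF cWq(1)])
      have i2: "integrable lborel (\<lambda>y. \<eta> y * W q)" by (rule intr) simp
      have i3: "integrable lborel (\<lambda>y. \<eta> y * (G q \<bullet> (- y)))" by (rule intr) (intro continuous_intros)
      show ?thesis
        unfolding Bochner_Integration.integral_diff[OF i1 i2, symmetric]
          Bochner_Integration.integral_diff[OF Bochner_Integration.integrable_diff[OF i1 i2] i3, symmetric]
        by (simp add: right_diff_distrib distrib_left)
    qed
    also have "norm \<dots> \<le> (\<integral>y. \<eta> y * (L * \<epsilon>\<^sup>2) \<partial>lborel)"
    proof (rule Bochner_Integration.integral_norm_bound_integral)
      show "norm (\<eta> y * (W (q + - y) - W q - G q \<bullet> (- y))) \<le> \<eta> y * (L * \<epsilon>\<^sup>2)" for y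
      proof (cases "norm y > \<epsilon>")
        case False
        have "norm (\<eta> y * (W (q + - y) - W q - G q \<bullet> (- y))) = \<eta> y * \<bar>W (q + - y) - W q - G q \<bullet> (- y)\<bar>"
          using \<eta>(2) by (simp add: abs_mult)
        also have "\<dots> \<le> \<eta> y * (L * (norm (- y))\<^sup>2)" by (intro mult_left_mono lipschitz_grad_taylor[OF W] \<eta>(2))
        also have "\<dots> \<le> \<eta> y * (L * \<epsilon>\<^sup>2)" using False L0 by (intro mult_left_mono power_mono \<eta>(2)) auto
        finally show ?thesis .
      qed (use \<eta>(3) in simp)
    qed (auto intro!: intr int\<eta> continuous_intros continuous_on_compose2[OF cW(1)])
    finally show "\<bar>W' q - W q\<bar> \<le> L * \<epsilon>\<^sup>2" by (simp add: \<eta>(5))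
  next
    fix q
    define G' where "G' = (\<integral>y. \<eta> y *\<^sub>R G (q - y) \<partial>lborel)"
    \<comment> \<open>Here the derivative falls on \<open>W\<close> and not on the kernel: the
      gradient of \<open>W'\<close> is an average of \<open>G\<close>.\<close>
    have "(W' has_derivative (\<lambda>h. G' \<bullet> h)) (at q)"
    proof (rule has_derivative_quadratic[where \<delta>=1 and C=L])
      fix h :: 'a
      have "G' \<bullet> h = (\<integral>y. \<eta> y * (G (q - y) \<bullet> h) \<partial>lborel)"
        using integral_inner_left[OF int[OF cWq(2)[of q]], of h] by (simp add: G'_def)
      then have "W' (q + h) - W' q - G' \<bullet> h = (\<integral>y. \<eta> y * W (q + h - y) \<partial>lborel) - (\<integral>y. \<eta> y * W (q - y) \<partial>lborel)
        - (\<integral>y. \<eta> y * (G (q - y) \<bullet> h) \<partial>lborel)" unfolding W'2 by simp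
      also have "\<dots> = (\<integral>y. \<eta> y * (W ((q - y) + h) - W (q - y) - G (q - y) \<bullet> h) \<partial>lborel)"
      proof -
        have i1: "integrable lborel (\<lambda>y. \<eta> y * W (q - y))" for q by (rule intr[OF cWq(1)])
        have i3: "integrable lborel (\<lambda>y. \<eta> y * (G (q - y) \<bullet> h))" by (rule intr) (intro continuous_intros cWq)
        show ?thesis
          unfolding Bochner_Integration.integral_diff[OF i1 i1, symmetric]
            Bochner_Integration.integral_diff[OF Bochner_Integration.integrable_diff[OF i1 i1] i3, symmetric]
          by (simp add: right_diff_distrib diff_add_eq)
      qed
      also have "norm \<dots> \<le> (\<integral>y. \<eta> y * (L * (norm h)\<^sup>2) \<partial>lborel)"
      proof (rule Bochner_Integration.integral_norm_bound_integral)
        show "norm (\<eta> y * (W ((q - y) + h) - W (q - y) - G (q - y) \<bullet> h)) \<le> \<eta> y * (L * (norm h)\<^sup>2)" for y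
          using mult_left_mono[OF lipschitz_grad_taylor[OF W, of "q - y" h] \<eta>(2)[of y]] \<eta>(2)[of y] by (simp add: abs_mult)
      qed (auto intro!: intr int\<eta> continuous_intros continuous_on_compose2[OF cW(1)] continuous_on_compose2[OF cW(2)])
      finally show "norm (W' (q + h) - W' q - G' \<bullet> h) \<le> L * (norm h)\<^sup>2" by (simp add: \<eta>(5))
    qed (auto intro: bounded_linear_inner_right)
    then have "grad W' q = G'" by (rule grad_eqI)
    also have "G' - G q = (\<integral>y. \<eta> y *\<^sub>R (G (q - y) - G q) \<partial>lborel)"
    proof -
      have "(\<integral>y. \<eta> y *\<^sub>R G q \<partial>lborel) = G q" using \<eta>(5) by (simp add: int\<eta>)
      then show ?thesis unfolding G'_def scaleR_diff_right
        by (subst Bochner_Integration.integral_diff) (auto intro!: int cWq int\<eta>)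
    qed
    finally have "norm (grad W' q - G q) \<le> (\<integral>y. \<eta> y * (L * \<epsilon>) \<partial>lborel)"
    proof (simp only:, intro Bochner_Integration.integral_norm_bound_integral)
      show "norm (\<eta> y *\<^sub>R (G (q - y) - G q)) \<le> \<eta> y * (L * \<epsilon>)" for y
      proof (cases "norm y > \<epsilon>")
        case False
        have "norm (G (q - y) - G q) \<le> L * norm y" using lipschitz_grad_neg_inner_le(3)[OF W, of "q - y" q] by simp
        also have "\<dots> \<le> L * \<epsilon>" using False L0 by (intro mult_left_mono) auto
        finally show ?thesis using \<eta>(2)[of y] by (simp add: mult_left_mono)
      qed (use \<eta>(3) in simp)
    qed (auto intro!: int intr int\<eta> continuous_intros cWq)
    then show "norm (grad W' q - G q) \<le> L * \<epsilon>" by (simp only: bnd)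
  qed
qed

section \<open>Cutoff functions\<close>

lemma smooth_step_exists:
  obtains \<sigma> :: "real \<Rightarrow> real" where "smooth \<sigma>" "\<And>x. x \<le> 0 \<Longrightarrow> \<sigma> x = 0" "\<And>x. x \<ge> 1 \<Longrightarrow> \<sigma> x = 1" "\<And>x. x > 0 \<Longrightarrow> \<sigma> x > 0"
    "\<And>x. deriv \<sigma> x \<ge> 0" "\<And>x. x \<le> 0 \<or> x \<ge> 1 \<Longrightarrow> deriv \<sigma> x = 0" "\<And>x. \<sigma> x \<le> 1" "\<And>x. \<sigma> x \<ge> 0"
proof -
  define b where "b s = exp_bump 0 s * exp_bump 0 (1 - s)" for s
  have "smooth (\<lambda>s. exp_bump 0 (1 - s))"
    by (rule smooth_compose[OF smooth_exp_bump]) (intro smooth_diff smooth_const smooth_bounded_linear bounded_linear_ident)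
  then have sb: "smooth b" unfolding b_def by (intro smooth_mult smooth_exp_bump)
  then have cb: "continuous_on S b" for S by (rule smooth_continuous_on)
  have b0: "b s \<ge> 0" "s \<le> 0 \<or> s \<ge> 1 \<Longrightarrow> b s = 0" "0 < s \<Longrightarrow> s < 1 \<Longrightarrow> b s > 0" for s
    by (auto simp: b_def exp_bump_def)
  \<comment> \<open>Starting at -1 instead of 0 puts every \<open>x \<ge> 0\<close> into the
    interior of \<open>{-1..x+1}\<close>, where the integral has a two-sided derivative.\<close>
  define F where "F x = integral {-1..x} b" for x
  have F0: "F x = 0" if "x \<le> 0" for x
  proof -
    have "integral {-1..x} b = integral {-1..x} (\<lambda>_. 0)" by (rule integral_cong) (use that b0(2) in auto)
    then show ?thesis by (simp add: F_def)
  qed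
  have DF: "(F has_real_derivative b x) (at x)" for x
  proof (cases "x < 0")
    case True
    have "((\<lambda>x. 0) has_real_derivative b x) (at x)" using True b0(2)[of x] by simp
    then show ?thesis
      by (rule DERIV_cong_ev[THEN iffD1, OF refl _ refl, rotated])
         (use eventually_nhds_in_open[of "{..<0}" x] True F0 in \<open>auto elim!: eventually_mono\<close>)
  next
    case False
    have "(F has_real_derivative b x) (at x within {-1..x+1})"
      unfolding F_def by (rule integral_has_real_derivative) (use False cb in auto)
    moreover have "at x within {-1..x+1} = at x" by (rule at_within_interior) (use False in \<open>auto simp: interior_atLeastAtMost_real\<close>)
    ultimately show ?thesis by simp
  qed
  have mono: "F x \<le> F y" if "x \<le> y" for x y
    by (rule DERIV_nonneg_imp_nondecreasing[OF that]) (use DF b0 in blast)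
  have F1: "F x = F 1" if "x \<ge> 1" for x
  proof (cases "x = 1")
    case False
    with that have "1 < x" by simp
    then obtain z where z: "1 < z" "z < x" "F x - F 1 = (x - 1) * b z"
      using MVT2[of 1 x F b] DF by blast
    then show ?thesis using b0(2)[of z] by simp
  qed simp
  have Fpos: "F x > 0" if "x > 0" for x
  proof -
    have "0 < min x (1/2)" using that by simp
    then obtain z where z: "0 < z" "z < min x (1/2)" "F (min x (1/2)) - F 0 = (min x (1/2) - 0) * b z"
      using MVT2[of 0 "min x (1/2)" F b] DF by blast
    then have "F (min x (1/2)) > 0" using b0(3)[of z] that by (auto simp: F0)
    then show ?thesis using mono[of "min x (1/2)" x] by linarith
  qed
  define Z where "Z = F 1"
  have Z: "Z > 0" using Fpos[of 1] by (simp add: Z_def)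
  have D: "((\<lambda>x. F x / Z) has_real_derivative b x / Z) (at x)" for x by (rule DERIV_cdivide[OF DF])
  have dd: "deriv (\<lambda>x. F x / Z) x = b x / Z" for x by (rule DERIV_imp_deriv[OF D])
  show ?thesis
  proof (rule that[of "\<lambda>x. F x / Z"])
    show "smooth (\<lambda>x. F x / Z)"
      by (rule smooth_of_derivative[OF D]) (use smooth_cmult[OF sb, of "1/Z"] in simp)
    show F1': "F x / Z = 1" if "x \<ge> 1" for x using F1[OF that] Z unfolding Z_def[symmetric] by simp
    show "F x / Z \<le> 1" for x
    proof (cases "x \<le> 1")
      case True then show ?thesis using Z mono[of x 1] unfolding Z_def[symmetric] by simp
    qed (use F1'[of x] in simp)
    show "F x / Z \<ge> 0" for x using Z Fpos[of x] F0[of x] by (cases "x \<le> 0") auto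
  qed (use Z b0 F0 Fpos in \<open>auto simp: dd\<close>)
qed

lemma smooth_real_bounded:
  fixes f :: "real \<Rightarrow> real"
  assumes "smooth f" "\<And>x. x < a \<or> x > b \<Longrightarrow> f x = 0"
  obtains K where "K > 0" "\<And>x. \<bar>f x\<bar> \<le> K"
proof -
  have "f x = 0" if "norm x > max \<bar>a\<bar> \<bar>b\<bar>" for x
    by (rule assms(2)) (use that in \<open>auto simp: abs_if split: if_splits\<close>)
  then obtain C where "C > 0" "\<And>x. norm (f x) \<le> C"
    using continuous_compact_support_bounded[of f "max \<bar>a\<bar> \<bar>b\<bar>"] smooth_continuous_on[OF assms(1)] by blast
  then show ?thesis by (intro that[of C]) auto
qed

lemma deriv_eq_of_eq_on_open:
  assumes "open S" "x \<in> S" "\<And>y. y \<in> S \<Longrightarrow> f y = g y"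
  shows "deriv f x = deriv g x"
  by (rule deriv_cong_ev) (use eventually_nhds_in_open[OF assms(1,2)] assms(3) in \<open>auto elim!: eventually_mono\<close>)

definition spatial_cutoff :: "real \<Rightarrow> (real \<Rightarrow> real) \<Rightarrow> bool" where
  "spatial_cutoff K \<zeta> \<longleftrightarrow> smooth \<zeta> \<and> (\<forall>s\<le>1. \<zeta> s = 1) \<and> (\<forall>s\<ge>2. \<zeta> s = 0) \<and>
     (\<forall>s. 0 \<le> \<zeta> s \<and> \<zeta> s \<le> 1 \<and> \<bar>deriv \<zeta> s\<bar> \<le> K) \<and> (\<forall>s\<ge>2. deriv \<zeta> s = 0)"

text \<open>The function vanishes beyond energy 2 and is nevertheless nondecreasing, because it
  starts at -2. The resulting truncation has compact support and keeps the sign of the friction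
  term, while the additive constant disappears in differences between probability measures.\<close>

definition energy_cutoff :: "real \<Rightarrow> (real \<Rightarrow> real) \<Rightarrow> bool" where
  "energy_cutoff K \<Theta> \<longleftrightarrow> smooth \<Theta> \<and> 1 \<le> K \<and> (\<forall>h\<le>1. \<Theta> h = h - 2) \<and> (\<forall>h\<ge>2. \<Theta> h = 0) \<and> mono \<Theta> \<and>
     (\<forall>h. 0 \<le> deriv \<Theta> h \<and> deriv \<Theta> h \<le> K \<and> \<bar>deriv (deriv \<Theta>) h\<bar> \<le> K) \<and>
     (\<forall>h\<ge>2. deriv \<Theta> h = 0 \<and> deriv (deriv \<Theta>) h = 0) \<and> (\<forall>h<1. deriv \<Theta> h = 1 \<and> deriv (deriv \<Theta>) h = 0)"

lemma cutoffs_exist: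
  obtains K \<zeta> \<Theta> where "spatial_cutoff K \<zeta>" "energy_cutoff K \<Theta>"
proof -
  obtain \<sigma> :: "real \<Rightarrow> real" where \<sigma>: "smooth \<sigma>" "\<And>x. x \<le> 0 \<Longrightarrow> \<sigma> x = 0" "\<And>x. x \<ge> 1 \<Longrightarrow> \<sigma> x = 1"
    "\<And>x. deriv \<sigma> x \<ge> 0" "\<And>x. x \<le> 0 \<or> x \<ge> 1 \<Longrightarrow> deriv \<sigma> x = 0" "\<And>x. \<sigma> x \<le> 1" "\<And>x. \<sigma> x \<ge> 0"
    using smooth_step_exists by metis
  define \<zeta> where "\<zeta> s = 1 - \<sigma> (s - 1)" for s
  \<comment> \<open>The derivative \<open>\<zeta> h + (h - 2) * deriv \<zeta> h\<close> is
    nonnegative because \<open>\<zeta>\<close> is nonincreasing and constant beyond 2.\<close>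
  define \<Theta> where "\<Theta> h = (h - 2) * \<zeta> h" for h
  have D\<sigma>: "(\<sigma> has_real_derivative deriv \<sigma> x) (at x)" for x by (rule smooth_real_derivative(1)[OF \<sigma>(1)])
  have D\<zeta>: "(\<zeta> has_real_derivative - deriv \<sigma> (s - 1)) (at s)" for s
    unfolding \<zeta>_def by (auto intro!: derivative_eq_intros DERIV_chain2[OF D\<sigma>])
  have d\<zeta>: "deriv \<zeta> s = - deriv \<sigma> (s - 1)" for s by (rule DERIV_imp_deriv[OF D\<zeta>])
  have sid: "smooth (\<lambda>x::real. x)" by (rule smooth_bounded_linear[OF bounded_linear_ident])
  have s\<zeta>: "smooth \<zeta>" unfolding \<zeta>_def
    by (intro smooth_diff smooth_const, rule smooth_compose[OF \<sigma>(1)]) (intro smooth_diff smooth_const sid)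
  have s\<Theta>: "smooth \<Theta>" unfolding \<Theta>_def by (intro smooth_mult smooth_diff smooth_const sid s\<zeta>)
  have d\<Theta>: "deriv \<Theta> h = \<zeta> h - (h - 2) * deriv \<sigma> (h - 1)" for h
    unfolding \<Theta>_def by (rule DERIV_imp_deriv) (auto intro!: derivative_eq_intros D\<zeta>)
  have d\<Theta>0: "deriv \<Theta> h = 0" if "h \<ge> 2" for h using that by (simp add: d\<Theta> \<zeta>_def \<sigma>)
  have d\<Theta>1: "deriv \<Theta> h = 1" if "h \<le> 1" for h using that by (simp add: d\<Theta> \<zeta>_def \<sigma>)
  have sd\<Theta>: "smooth (deriv \<Theta>)" and sdd\<Theta>: "smooth (deriv (deriv \<Theta>))" using smooth_real_derivative(2) s\<Theta> by blast+
  have dd2: "deriv (deriv \<Theta>) h = 0" if "h > 2" for h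
    using deriv_eq_of_eq_on_open[of "{2<..}" h "deriv \<Theta>" "\<lambda>_. 0"] that d\<Theta>0 by simp
  have dd1: "deriv (deriv \<Theta>) h = 0" if "h < 1" for h
    using deriv_eq_of_eq_on_open[of "{..<1}" h "deriv \<Theta>" "\<lambda>_. 1"] that d\<Theta>1 by simp
  \<comment> \<open>The formula for \<open>h > 2\<close> does not cover the endpoint; its value
    follows by continuity from the right.\<close>
  have dd2': "deriv (deriv \<Theta>) 2 = 0"
  proof -
    have "(deriv (deriv \<Theta>) \<longlongrightarrow> deriv (deriv \<Theta>) 2) (at_right 2)"
    proof (rule tendsto_mono[OF at_le])
      show "(deriv (deriv \<Theta>) \<longlongrightarrow> deriv (deriv \<Theta>) 2) (at 2)"
        using smooth_continuous_on[OF sdd\<Theta>, of UNIV] by (simp add: continuous_on_def)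
    qed simp
    moreover have "((\<lambda>_. 0) \<longlongrightarrow> (0::real)) (at_right (2::real))" by simp
    then have "(deriv (deriv \<Theta>) \<longlongrightarrow> 0) (at_right 2)"
      by (rule Lim_transform_eventually) (auto simp: eventually_at_filter dd2)
    ultimately show ?thesis using tendsto_unique trivial_limit_at_right_real by blast
  qed
  obtain K1 where K1: "K1 > 0" "\<And>s. \<bar>deriv \<zeta> s\<bar> \<le> K1"
    by (rule smooth_real_bounded[of "deriv \<zeta>" 1 2]) (use smooth_real_derivative(2)[OF s\<zeta>] \<sigma>(5) in \<open>auto simp: d\<zeta>\<close>)
  obtain K2 where K2: "K2 > 0" "\<And>h. \<bar>deriv (deriv \<Theta>) h\<bar> \<le> K2"
    by (rule smooth_real_bounded[of "deriv (deriv \<Theta>)" 1 2]) (use sdd\<Theta> dd1 dd2 in auto)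
  have d\<Theta>n: "0 \<le> deriv \<Theta> h" for h
  proof (cases "h \<le> 2")
    case True
    have "(2 - h) * deriv \<sigma> (h - 1) \<ge> 0" using True \<sigma>(4) by simp
    then show ?thesis using \<sigma>(6)[of "h - 1"] unfolding d\<Theta> \<zeta>_def by (simp add: algebra_simps)
  qed (use d\<Theta>0 in simp)
  have d\<Theta>b: "deriv \<Theta> h \<le> 1 + K1" for h
  proof (cases "h \<le> 1 \<or> h \<ge> 2")
    case False
    have "(2 - h) * deriv \<sigma> (h - 1) \<le> 1 * K1" using False K1(2)[of h] \<sigma>(4)[of "h - 1"] by (intro mult_mono) (auto simp: d\<zeta>)
    then show ?thesis using \<sigma>(7)[of "h - 1"] unfolding d\<Theta> \<zeta>_def by (simp add: algebra_simps)
  next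
    case True
    then show ?thesis using d\<Theta>0[of h] d\<Theta>1[of h] K1(1) by (elim disjE) simp_all
  qed
  have mono: "mono \<Theta>"
  proof (rule monoI)
    fix x y :: real assume "x \<le> y"
    then show "\<Theta> x \<le> \<Theta> y"
    proof (rule DERIV_nonneg_imp_nondecreasing)
      fix z show "\<exists>d. (\<Theta> has_real_derivative d) (at z) \<and> 0 \<le> d"
        by (rule exI[of _ "deriv \<Theta> z"]) (intro conjI smooth_real_derivative(1)[OF s\<Theta>] d\<Theta>n)
    qed
  qed
  have b1: "\<bar>deriv \<zeta> s\<bar> \<le> 1 + K1 + K2" for s using K1(2)[of s] K2(1) by linarith
  have b2: "deriv \<Theta> h \<le> 1 + K1 + K2" "\<bar>deriv (deriv \<Theta>) h\<bar> \<le> 1 + K1 + K2" for h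
    using K1(1) K2(1) K2(2)[of h] d\<Theta>b[of h] by linarith+
  have \<zeta>v: "s \<le> 1 \<Longrightarrow> \<zeta> s = 1" "s \<ge> 2 \<Longrightarrow> \<zeta> s = 0" "s \<ge> 2 \<Longrightarrow> deriv \<zeta> s = 0" "0 \<le> \<zeta> s" "\<zeta> s \<le> 1" for s
    using \<sigma>(2,3)[of "s - 1"] \<sigma>(5-7)[of "s - 1"] by (simp_all add: \<zeta>_def d\<zeta>)
  have \<Theta>v: "h \<le> 1 \<Longrightarrow> \<Theta> h = h - 2" "h \<ge> 2 \<Longrightarrow> \<Theta> h = 0" for h using \<zeta>v(1,2)[of h] by (simp_all add: \<Theta>_def)
  have ddv: "deriv (deriv \<Theta>) h = 0" if "h \<ge> 2" for h using that dd2[of h] dd2' by (cases "h = 2") auto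
  have "spatial_cutoff (1 + K1 + K2) \<zeta>"
    unfolding spatial_cutoff_def using s\<zeta> b1 \<zeta>v by simp
  moreover have "energy_cutoff (1 + K1 + K2) \<Theta>"
    unfolding energy_cutoff_def using s\<Theta> b2 \<Theta>v d\<Theta>n d\<Theta>0 d\<Theta>1 dd1 ddv mono K1(1) K2(1) by simp
  ultimately show ?thesis by (rule that)
qed

section \<open>Lower integrals\<close>

text \<open>For a function that is not measurable \<open>nn_integral\<close> is the supremum over
  simple minorants; the pointwise supremum of a maximising sequence attains it.\<close>

lemma lower_integral_attained:
  "\<exists>g. g \<in> borel_measurable M \<and> (\<forall>x. g x \<le> D x) \<and> (\<integral>\<^sup>+x. g x \<partial>M) = (\<integral>\<^sup>+x. D x \<partial>M)"
proof -
  let ?A = "{g. simple_function M g \<and> g \<le> D}"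
  have ne: "?A \<noteq> {}" by (auto intro!: exI[of _ "\<lambda>_. 0"] simp: le_fun_def)
  obtain S :: "nat \<Rightarrow> ennreal" where S1: "range S \<subseteq> integral\<^sup>S M ` ?A" "Sup (integral\<^sup>S M ` ?A) = Sup (range S)"
    using ennreal_SUP_countable_SUP[OF ne, of "integral\<^sup>S M"] by blast
  then have S: "range S \<subseteq> integral\<^sup>S M ` ?A" "(\<integral>\<^sup>+x. D x \<partial>M) = (SUP i. S i)"
    by (simp_all add: nn_integral_def)
  then have "\<forall>i. \<exists>g. simple_function M g \<and> g \<le> D \<and> S i = integral\<^sup>S M g" by (auto simp: image_subset_iff image_iff)
  then obtain G where G: "\<And>i. simple_function M (G i)" "\<And>i. G i \<le> D" "\<And>i. S i = integral\<^sup>S M (G i)" by metis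
  define g where "g x = (SUP i::nat. G i x)" for x
  have gm: "g \<in> borel_measurable M" unfolding g_def
    by (intro borel_measurable_SUP) (auto intro: borel_measurable_simple_function G)
  have gD: "g x \<le> D x" for x unfolding g_def using G(2) by (auto intro!: SUP_least simp: le_fun_def)
  show ?thesis
  proof (intro exI[of _ g] conjI allI gm gD antisym)
    show "(\<integral>\<^sup>+x. g x \<partial>M) \<le> (\<integral>\<^sup>+x. D x \<partial>M)" by (rule nn_integral_mono) (rule gD)
    show "(\<integral>\<^sup>+x. D x \<partial>M) \<le> (\<integral>\<^sup>+x. g x \<partial>M)"
      unfolding S(2)
    proof (rule SUP_least)
      fix i
      have "S i = (\<integral>\<^sup>+x. G i x \<partial>M)" using G by (simp add: nn_integral_eq_simple_integral)
      also have "\<dots> \<le> (\<integral>\<^sup>+x. g x \<partial>M)" by (rule nn_integral_mono) (auto simp: g_def intro: SUP_upper)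
      finally show "S i \<le> (\<integral>\<^sup>+x. g x \<partial>M)" .
    qed
  qed
qed

text \<open>Neither \<open>dual_norm_sq\<close> nor \<open>M_dual_norm_sq\<close> is obviously measurable in time, so
  their time integrals are lower integrals; a maximal measurable minorant takes their place.\<close>

lemma maximal_measurable_minorant:
  assumes fin: "(\<integral>\<^sup>+x. D x \<partial>M) < \<infinity>"
  obtains g :: "'a \<Rightarrow> real" where "g \<in> borel_measurable M" "\<And>x. 0 \<le> g x" "integrable M g"
    "\<And>h. h \<in> borel_measurable M \<Longrightarrow> (AE x in M. ennreal (h x) \<le> D x) \<Longrightarrow> AE x in M. h x \<le> g x"
proof -
  obtain g where g: "g \<in> borel_measurable M" "\<And>x. g x \<le> D x" "(\<integral>\<^sup>+x. g x \<partial>M) = (\<integral>\<^sup>+x. D x \<partial>M)"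
    using lower_integral_attained[of M D] by blast
  have gf: "AE x in M. g x \<noteq> \<infinity>" by (rule nn_integral_PInf_AE[OF g(1)]) (use fin g(3) in auto)
  \<comment> \<open>\<open>max (g x) (h x)\<close> is, up to a null set, again a measurable minorant
    of \<open>D\<close>, so its integral cannot exceed that of \<open>g\<close>, which is already
    maximal.\<close>
  have max: "AE x in M. h x \<le> g x" if h: "h \<in> borel_measurable M" "AE x in M. h x \<le> D x" for h
  proof -
    have "(\<integral>\<^sup>+x. (max (g x) (h x) - g x) \<partial>M) = (\<integral>\<^sup>+x. max (g x) (h x) \<partial>M) - (\<integral>\<^sup>+x. g x \<partial>M)"
      by (rule nn_integral_diff) (use g h fin in auto)
    moreover have "(\<integral>\<^sup>+x. max (g x) (h x) \<partial>M) \<le> (\<integral>\<^sup>+x. D x \<partial>M)"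
      by (rule nn_integral_mono_AE) (use h(2) g(2) in \<open>auto elim: eventually_mono\<close>)
    ultimately have "(\<integral>\<^sup>+x. (max (g x) (h x) - g x) \<partial>M) = 0" using g(3) fin
      by (metis diff_eq_0_iff_ennreal le_less_trans less_le_trans linorder_not_le infinity_ennreal_def top.not_eq_extremum)
    then have "AE x in M. max (g x) (h x) - g x = 0" using g h by (subst (asm) nn_integral_0_iff_AE) auto
    with gf show ?thesis
    proof eventually_elim
      case (elim x)
      then have "max (g x) (h x) \<le> g x" by (auto simp: diff_eq_0_iff_ennreal)
      then show ?case by simp
    qed
  qed
  show ?thesis
  proof (rule that[of "\<lambda>x. enn2real (g x)"])
    show m: "(\<lambda>x. enn2real (g x)) \<in> borel_measurable M" using g by simp
    have "(\<integral>\<^sup>+x. ennreal (enn2real (g x)) \<partial>M) = (\<integral>\<^sup>+x. g x \<partial>M)"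
      by (rule nn_integral_cong_AE) (use gf in \<open>auto elim!: eventually_mono simp: less_top\<close>)
    then show "integrable M (\<lambda>x. enn2real (g x))"
      by (intro integrableI_nonneg m) (use fin g(3) in auto)
    fix h :: "'a \<Rightarrow> real" assume h: "h \<in> borel_measurable M" "AE x in M. ennreal (h x) \<le> D x"
    then have "AE x in M. ennreal (h x) \<le> g x" by (intro max) auto
    with gf show "AE x in M. h x \<le> enn2real (g x)"
    proof eventually_elim
      case (elim x)
      then have "ennreal (h x) \<le> ennreal (enn2real (g x))" by (simp add: less_top)
      then show ?case by (simp add: ennreal_le_iff)
    qed
  qed simp
qed

text \<open>Inserting a maximal minorant gives one inequality for every factor; applied to
  \<open>1/c\<close> it also gives the other. No measurability of \<open>D\<close> enters.\<close>

lemma nn_integral_cmult_lower: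
  assumes "0 < c" shows "(\<integral>\<^sup>+x. ennreal c * D x \<partial>M) = ennreal c * (\<integral>\<^sup>+x. D x \<partial>M)"
proof -
  have ge: "ennreal c * (\<integral>\<^sup>+x. D x \<partial>M) \<le> (\<integral>\<^sup>+x. ennreal c * D x \<partial>M)" for c D
  proof -
    obtain g where g: "g \<in> borel_measurable M" "\<And>x. g x \<le> D x" "(\<integral>\<^sup>+x. g x \<partial>M) = (\<integral>\<^sup>+x. D x \<partial>M)"
      using lower_integral_attained[of M D] by blast
    have "ennreal c * (\<integral>\<^sup>+x. D x \<partial>M) = (\<integral>\<^sup>+x. ennreal c * g x \<partial>M)" using g by (simp add: nn_integral_cmult)
    also have "\<dots> \<le> (\<integral>\<^sup>+x. ennreal c * D x \<partial>M)" by (intro nn_integral_mono mult_left_mono g) auto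
    finally show ?thesis .
  qed
  have inv: "ennreal (1/c) * (ennreal c * y) = y" "ennreal c * (ennreal (1/c) * y) = y" for y
    using assms by (simp_all add: mult.assoc[symmetric] ennreal_mult[symmetric])
  have "ennreal (1/c) * (\<integral>\<^sup>+x. ennreal c * D x \<partial>M) \<le> (\<integral>\<^sup>+x. D x \<partial>M)"
    using ge[of "1/c" "\<lambda>x. ennreal c * D x"] by (simp add: inv)
  then have "(\<integral>\<^sup>+x. ennreal c * D x \<partial>M) \<le> ennreal c * (\<integral>\<^sup>+x. D x \<partial>M)"
    using mult_left_mono[of "ennreal (1/c) * (\<integral>\<^sup>+x. ennreal c * D x \<partial>M)" _ "ennreal c"] by (simp add: inv)
  with ge show ?thesis by (intro antisym)
qed

section \<open>Separability of the test functions and curves of measures\<close>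

lemma partials_cmult: "smooth f \<Longrightarrow> set bs \<subseteq> Basis \<Longrightarrow> partials bs (\<lambda>x. c * f x) = (\<lambda>x. c * partials bs f x)"
proof (induction bs)
  case (Cons b bs)
  have "((\<lambda>x. c * partials bs f x) has_derivative (\<lambda>h. c * frechet_derivative (partials bs f) (at x) h)) (at x)" for x
    using Cons.prems by (intro has_derivative_mult_right smooth_has_derivative smooth_partials) auto
  then have "frechet_derivative (\<lambda>x. c * partials bs f x) (at x) = (\<lambda>h. c * frechet_derivative (partials bs f) (at x) h)" for x
    by (rule frechet_derivative_at[symmetric])
  with Cons show ?case by simp
qed simp

lemma partials_diff:
  "smooth f \<Longrightarrow> smooth g \<Longrightarrow> set bs \<subseteq> Basis \<Longrightarrow> partials bs (\<lambda>x. f x - g x) = (\<lambda>x. partials bs f x - partials bs g x)"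
proof (induction bs)
  case (Cons b bs)
  have "((\<lambda>x. partials bs f x - partials bs g x) has_derivative
     (\<lambda>h. frechet_derivative (partials bs f) (at x) h - frechet_derivative (partials bs g) (at x) h)) (at x)" for x
    using Cons.prems by (intro has_derivative_diff smooth_has_derivative smooth_partials) auto
  then have "frechet_derivative (\<lambda>x. partials bs f x - partials bs g x) (at x) =
     (\<lambda>h. frechet_derivative (partials bs f) (at x) h - frechet_derivative (partials bs g) (at x) h)" for x
    by (rule frechet_derivative_at[symmetric])
  with Cons show ?case by simp
qed simp

abbreviation multi_indices :: "nat \<Rightarrow> 'a::euclidean_space list set" where
  "multi_indices N \<equiv> {bs. set bs \<subseteq> Basis \<and> length bs \<le> N}"

lemma finite_multi_indices: "finite (multi_indices N)"
  by (rule finite_lists_length_le) simp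

lemma test_functions_on_imp: "f \<in> test_functions_on K \<Longrightarrow> f \<in> test_functions"
  by (auto simp: test_functions_on_def)

lemma test_functions_on_partials_zero:
  assumes "f \<in> test_functions_on (cball 0 R)" "norm x > R"
  shows "partials bs f x = 0"
proof -
  have "f y = 0" if "norm y > R" for y
    using assms(1) that closure_subset[of "{x. f x \<noteq> 0}"] by (force simp: test_functions_on_def)
  then show ?thesis using partials_zero_outside assms(2) by blast
qed

lemma test_function_partials_bounded:
  assumes f: "f \<in> test_functions"
  obtains C where "C > 0" "\<And>bs x. bs \<in> multi_indices N \<Longrightarrow> \<bar>partials bs f x\<bar> \<le> C"
proof -
  have "\<exists>C. \<forall>x. \<bar>partials bs f x\<bar> \<le> C" if "bs \<in> multi_indices N" for bs
    by (rule test_functions_bounded[OF test_functions_partials[OF f, of bs]]) (use that in auto)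
  then have "\<exists>C. \<forall>bs\<in>multi_indices N. \<forall>x. \<bar>partials bs f x\<bar> \<le> C bs" by (intro bchoice) blast
  then obtain C where C: "\<And>bs x. bs \<in> multi_indices N \<Longrightarrow> \<bar>partials bs f x\<bar> \<le> C bs" by blast
  have "\<bar>partials bs f x\<bar> \<le> max 1 (Max (C ` multi_indices N))" if "bs \<in> multi_indices N" for bs x
  proof -
    have "C bs \<le> Max (C ` multi_indices N)" by (intro Max_ge finite_imageI finite_multi_indices imageI that)
    then show ?thesis using C[OF that, of x] by simp
  qed
  then show ?thesis by (intro that[of "max 1 (Max (C ` multi_indices N))"]) auto
qed

text \<open>Separability of the test functions in \<open>C\<^sup>N\<close>: a function is encoded by its partial
  derivatives on a finite grid, rounded to multiples of \<open>1/j\<close>, and every code is represented once.\<close>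

lemma test_functions_on_separable:
  obtains F where "countable F" "F \<subseteq> test_functions_on (cball (0::'a::euclidean_space) R)"
    "\<And>f \<delta>. f \<in> test_functions_on (cball 0 R) \<Longrightarrow> \<delta> > 0 \<Longrightarrow>
       \<exists>g\<in>F. \<forall>bs\<in>multi_indices N. \<forall>x. \<bar>partials bs f x - partials bs g x\<bar> \<le> \<delta>"
proof -
  let ?D = "test_functions_on (cball (0::'a) R)" and ?B = "multi_indices N :: 'a list set"
  \<comment> \<open>The functions are sorted by a common modulus of continuity of their derivatives,
    so that values on a finite grid control them everywhere: equal codes and two moves between a
    point and the grid cost at most \<open>1/(j+1)\<close> each.\<close>
  define P where "P n j f \<longleftrightarrow> (\<forall>bs\<in>?B. \<forall>x y. dist x y < inverse (real (Suc n)) \<longrightarrow>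
     \<bar>partials bs f x - partials bs f y\<bar> < inverse (real (Suc j)))" for n j f
  have "\<exists>A. finite A \<and> cball (0::'a) R \<subseteq> (\<Union>a\<in>A. ball a (inverse (real (Suc n))))" for n
  proof -
    have "\<exists>A. finite A \<and> A \<subseteq> cball (0::'a) R \<and> cball 0 R \<subseteq> (\<Union>a\<in>A. ball a (inverse (real (Suc n))))"
      using seq_compact_imp_totally_bounded[OF compact_imp_seq_compact, OF compact_cball, of "0::'a" R] by simp
    then show ?thesis by blast
  qed
  then obtain A where A: "\<And>n. finite (A n)" "\<And>n. cball (0::'a) R \<subseteq> (\<Union>a\<in>A n. ball a (inverse (real (Suc n))))" by metis
  define code where "code n j f = restrict (\<lambda>(bs, a). \<lfloor>real (Suc j) * partials bs f a\<rfloor>) (?B \<times> A n)" for n j f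
  have exF: "\<exists>F. countable F \<and> F \<subseteq> {f\<in>?D. P n j f} \<and> code n j ` F = code n j ` {f\<in>?D. P n j f}" for n j
  proof -
    have "countable (PiE (?B \<times> A n) (\<lambda>_. UNIV :: int set))"
      by (intro countable_PiE finite_cartesian_product finite_multi_indices A(1)) simp
    moreover have "code n j ` {f\<in>?D. P n j f} \<subseteq> PiE (?B \<times> A n) (\<lambda>_. UNIV)"
      unfolding code_def by (intro image_subsetI restrict_PiE[THEN iffD2] ballI) simp
    ultimately have "countable (code n j ` {f\<in>?D. P n j f})" by (rule countable_subset[rotated])
    \<comment> \<open>One preimage is chosen for each code that occurs, so that the countable set
      consists of members of the class itself.\<close>
    from countable_subset_image[THEN iffD1, OF conjI[OF this subset_refl]]
    obtain F where "countable F" "F \<subseteq> {f\<in>?D. P n j f}" "code n j ` {f\<in>?D. P n j f} = code n j ` F" by (elim exE conjE)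
    then show ?thesis by (intro exI[of _ F] conjI) simp_all
  qed
  define F where "F n j = (SOME F. countable F \<and> F \<subseteq> {f\<in>?D. P n j f} \<and> code n j ` F = code n j ` {f\<in>?D. P n j f})" for n j
  have F: "countable (F n j)" "F n j \<subseteq> {f\<in>?D. P n j f}" "code n j ` F n j = code n j ` {f\<in>?D. P n j f}" for n j
    using someI_ex[OF exF[of n j], folded F_def] by blast+
  have "\<exists>g\<in>(\<Union>n j. F n j). \<forall>bs\<in>?B. \<forall>x. \<bar>partials bs f x - partials bs g x\<bar> \<le> \<delta>"
    if f: "f \<in> ?D" and \<delta>: "\<delta> > 0" for f \<delta>
  proof -
    note ft = test_functions_on_imp[OF f]
    obtain j where j: "inverse (real (Suc j)) < \<delta>/3" using reals_Archimedean[of "\<delta>/3"] \<delta> by auto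
    have "\<exists>L. \<forall>x y. \<bar>partials bs f x - partials bs f y\<bar> \<le> L * dist x y" if bs: "bs \<in> ?B" for bs
    proof -
      have t: "partials bs f \<in> test_functions" using test_functions_partials[OF ft, of bs] bs by auto
      then have s: "smooth (partials bs f)" by (rule test_functions_smooth)
      obtain C where C: "\<And>cs x. cs \<in> multi_indices 1 \<Longrightarrow> \<bar>partials cs (partials bs f) x\<bar> \<le> C"
        using test_function_partials_bounded[OF t, of 1] by blast
      have "\<bar>partials bs f x - partials bs f y\<bar> \<le> (real DIM('a) * C) * norm (x - y)" for x y
        by (rule lipschitz_bounded_derivative[OF smooth_grad[OF s]]) (rule norm_grad_le, rule C, simp)
      then show ?thesis by (metis dist_norm)
    qed
    then have "\<exists>L. \<forall>bs\<in>?B. \<forall>x y. \<bar>partials bs f x - partials bs f y\<bar> \<le> L bs * dist x y" by (intro bchoice) blast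
    then obtain L where L: "\<And>bs x y. bs \<in> ?B \<Longrightarrow> \<bar>partials bs f x - partials bs f y\<bar> \<le> L bs * dist x y" by blast
    define M where "M = max 1 (Max (L ` ?B))"
    have M: "M > 0" "\<And>bs. bs \<in> ?B \<Longrightarrow> L bs \<le> M" unfolding M_def
      by (simp, intro max.coboundedI2 Max_ge finite_imageI finite_multi_indices imageI)
    obtain n where n: "inverse (real (Suc n)) < inverse (real (Suc j)) / M"
      using reals_Archimedean[of "inverse (real (Suc j)) / M"] M(1) by auto
    have Pf: "P n j f" unfolding P_def
    proof (intro ballI allI impI)
      fix bs :: "'a list" and x y :: 'a assume bs: "bs \<in> ?B" and xy: "dist x y < inverse (real (Suc n))"
      have "\<bar>partials bs f x - partials bs f y\<bar> \<le> M * dist x y"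
        using L[OF bs, of x y] mult_right_mono[OF M(2)[OF bs], of "dist x y"] by simp
      also have "\<dots> < M * (inverse (real (Suc j)) / M)" using xy n M(1) by (intro mult_strict_left_mono) auto
      finally show "\<bar>partials bs f x - partials bs f y\<bar> < inverse (real (Suc j))" using M(1) by simp
    qed
    then have "code n j f \<in> code n j ` F n j" using f F(3) by blast
    then obtain g where g: "g \<in> F n j" "code n j f = code n j g" by blast
    have gD: "g \<in> ?D" "P n j g" using g(1) F(2) by auto
    have "\<bar>partials bs f x - partials bs g x\<bar> \<le> \<delta>" if bs: "bs \<in> ?B" for bs x
    proof (cases "norm x \<le> R")
      case True
      then obtain a where a: "a \<in> A n" "dist a x < inverse (real (Suc n))" using A(2)[of n] by (force simp: subset_eq)
      have "code n j f (bs, a) = code n j g (bs, a)" by (simp add: g(2))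
      then have "\<lfloor>real (Suc j) * partials bs f a\<rfloor> = \<lfloor>real (Suc j) * partials bs g a\<rfloor>"
        using bs a(1) by (simp add: code_def)
      then have "\<bar>real (Suc j) * partials bs f a - real (Suc j) * partials bs g a\<bar> < 1" by linarith
      then have "real (Suc j) * \<bar>partials bs f a - partials bs g a\<bar> < 1"
        by (simp add: right_diff_distrib[symmetric] abs_mult del: of_nat_Suc)
      then have "\<bar>partials bs f a - partials bs g a\<bar> < inverse (real (Suc j))"
        by (simp add: field_simps del: of_nat_Suc)
      moreover have "\<bar>partials bs f a - partials bs f x\<bar> < inverse (real (Suc j))"
        using Pf bs a(2) unfolding P_def by blast
      moreover have "\<bar>partials bs g a - partials bs g x\<bar> < inverse (real (Suc j))"
        using gD(2) bs a(2) unfolding P_def by blast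
      ultimately show ?thesis using j by linarith
    next
      case False
      then show ?thesis using test_functions_on_partials_zero[OF f] test_functions_on_partials_zero[OF gD(1)] \<delta> by simp
    qed
    with g(1) show ?thesis by blast
  qed
  moreover have "countable (\<Union>n j. F n j)" using F(1) by auto
  moreover have "(\<Union>n j. F n j) \<subseteq> ?D" using F(2) by blast
  ultimately show ?thesis by (intro that[of "\<Union>n j. F n j"]) auto
qed

section \<open>Regularity in time of curves of measures\<close>

lemma absolutely_continuous_on_dominated:
  assumes G: "absolutely_continuous_on c d G" and K: "K \<ge> 0"
    and le: "\<And>s t. c \<le> s \<Longrightarrow> s \<le> t \<Longrightarrow> t \<le> d \<Longrightarrow> \<bar>\<phi> s - \<phi> t\<bar> \<le> K * \<bar>G s - G t\<bar>"
  shows "absolutely_continuous_on c d \<phi>"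
  unfolding absolutely_continuous_on_def
proof (intro allI impI)
  fix \<epsilon> :: real assume "\<epsilon> > 0"
  then have "\<epsilon> / (K + 1) > 0" using K by simp
  with G obtain \<delta> where \<delta>: "\<delta> > 0" "\<And>n a b. (\<forall>i<n::nat. c \<le> a i \<and> a i \<le> b i \<and> b i \<le> d) \<Longrightarrow>
        disjoint_family_on (\<lambda>i. {a i<..<b i}) {..<n} \<Longrightarrow>
        (\<Sum>i<n. b i - a i) < \<delta> \<Longrightarrow> (\<Sum>i<n. \<bar>G (b i) - G (a i)\<bar>) < \<epsilon> / (K + 1)"
    unfolding absolutely_continuous_on_def by meson
  show "\<exists>\<delta>>0. \<forall>(n::nat) a b. (\<forall>i<n. c \<le> a i \<and> a i \<le> b i \<and> b i \<le> d) \<and>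
        disjoint_family_on (\<lambda>i. {a i<..<b i}) {..<n} \<and> (\<Sum>i<n. b i - a i) < \<delta> \<longrightarrow>
        (\<Sum>i<n. \<bar>\<phi> (b i) - \<phi> (a i)\<bar>) < \<epsilon>"
  proof (intro exI[of _ \<delta>] conjI \<delta>(1) allI impI)
    fix n :: nat and a b :: "nat \<Rightarrow> real"
    assume *: "(\<forall>i<n. c \<le> a i \<and> a i \<le> b i \<and> b i \<le> d) \<and>
        disjoint_family_on (\<lambda>i. {a i<..<b i}) {..<n} \<and> (\<Sum>i<n. b i - a i) < \<delta>"
    have "(\<Sum>i<n. \<bar>\<phi> (b i) - \<phi> (a i)\<bar>) \<le> (\<Sum>i<n. (K + 1) * \<bar>G (b i) - G (a i)\<bar>)"
    proof (rule sum_mono)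
      fix i assume "i \<in> {..<n}"
      then have "\<bar>\<phi> (a i) - \<phi> (b i)\<bar> \<le> K * \<bar>G (a i) - G (b i)\<bar>" using * by (intro le) auto
      then show "\<bar>\<phi> (b i) - \<phi> (a i)\<bar> \<le> (K + 1) * \<bar>G (b i) - G (a i)\<bar>"
        by (simp add: abs_minus_commute distrib_right)
    qed
    also have "\<dots> = (K + 1) * (\<Sum>i<n. \<bar>G (b i) - G (a i)\<bar>)" by (simp add: sum_distrib_left)
    also have "\<dots> < (K + 1) * (\<epsilon> / (K + 1))" using \<delta>(2)[of n a b] * K by (intro mult_strict_left_mono) auto
    finally show "(\<Sum>i<n. \<bar>\<phi> (b i) - \<phi> (a i)\<bar>) < \<epsilon>" using K by simp
  qed
qed

text \<open>The neighbourhood \<open>U\<close> contains the multiple of \<open>f\<close> by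
  \<open>\<epsilon>/(2 M)\<close>, so by homogeneity the estimate becomes linear in the bound
  \<open>M\<close> of the derivatives up to order \<open>N\<close>, with
  \<open>C = 2/\<epsilon>\<close>.\<close>

lemma AC_curve_nbhd:
  fixes \<rho> :: "real \<Rightarrow> 'a::euclidean_space measure"
  assumes "AC_curve T X \<rho>"
  obtains N G C where "absolutely_continuous_on 0 T G" "C \<ge> 0"
    "\<And>f M t1 t2. f \<in> test_functions_on (cball 0 R) \<Longrightarrow> M > 0 \<Longrightarrow>
      (\<And>bs x. bs \<in> multi_indices N \<Longrightarrow> \<bar>partials bs f x\<bar> \<le> M) \<Longrightarrow> 0 \<le> t1 \<Longrightarrow> t1 \<le> t2 \<Longrightarrow> t2 \<le> T \<Longrightarrow>
      \<bar>(\<integral>x. f x \<partial>\<rho> t1) - (\<integral>x. f x \<partial>\<rho> t2)\<bar> \<le> C * M * \<bar>G t1 - G t2\<bar>"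
proof -
  obtain U G where U: "zero_nbhd (cball 0 R) U" and G: "absolutely_continuous_on 0 T G"
    and le: "\<And>t1 t2 f. 0 \<le> t1 \<Longrightarrow> t1 \<le> t2 \<Longrightarrow> t2 \<le> T \<Longrightarrow> f \<in> U \<Longrightarrow>
              \<bar>(\<integral>x. f x \<partial>\<rho> t1) - (\<integral>x. f x \<partial>\<rho> t2)\<bar> \<le> \<bar>G t1 - G t2\<bar>"
    using assms compact_cball[of "0::'a" R] unfolding AC_curve_def by meson
  obtain N \<epsilon> where N: "\<epsilon> > 0" "\<And>f. f \<in> test_functions_on (cball 0 R) \<Longrightarrow>
        (\<forall>bs x. set bs \<subseteq> Basis \<and> length bs \<le> N \<longrightarrow> \<bar>partials bs f x\<bar> < \<epsilon>) \<Longrightarrow> f \<in> U"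
    using U unfolding zero_nbhd_def by meson
  show ?thesis
  proof (rule that[OF G, of "2 / \<epsilon>" N])
    fix f :: "'a \<Rightarrow> real" and M t1 t2 :: real
    assume f: "f \<in> test_functions_on (cball 0 R)" and M: "M > 0"
      and b: "\<And>bs x. bs \<in> multi_indices N \<Longrightarrow> \<bar>partials bs f x\<bar> \<le> M" and t: "0 \<le> t1" "t1 \<le> t2" "t2 \<le> T"
    define c where "c = \<epsilon> / (2 * M)"
    have c: "c > 0" using N M by (simp add: c_def)
    note ft = test_functions_on_imp[OF f]
    have cf: "(\<lambda>x. c * f x) \<in> test_functions_on (cball 0 R)"
      by (rule test_functions_onI)
         (use test_functions_smooth[OF ft] test_functions_on_partials_zero[OF f, of _ "[]"] in auto)
    have "(\<lambda>x. c * f x) \<in> U"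
    proof (rule N(2)[OF cf], intro allI impI)
      fix bs :: "'a list" and x :: 'a assume bs: "set bs \<subseteq> Basis \<and> length bs \<le> N"
      then have "\<bar>partials bs (\<lambda>x. c * f x) x\<bar> = c * \<bar>partials bs f x\<bar>"
        using c by (subst partials_cmult[OF test_functions_smooth[OF ft]]) (auto simp: abs_mult)
      also have "\<dots> \<le> c * M" using b bs c by (intro mult_left_mono) auto
      also have "\<dots> < \<epsilon>" using M N by (simp add: c_def)
      finally show "\<bar>partials bs (\<lambda>x. c * f x) x\<bar> < \<epsilon>" .
    qed
    from le[OF t this] have "c * \<bar>(\<integral>x. f x \<partial>\<rho> t1) - (\<integral>x. f x \<partial>\<rho> t2)\<bar> \<le> \<bar>G t1 - G t2\<bar>"
      using c by (simp add: right_diff_distrib[symmetric] abs_mult)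
    then show "\<bar>(\<integral>x. f x \<partial>\<rho> t1) - (\<integral>x. f x \<partial>\<rho> t2)\<bar> \<le> 2 / \<epsilon> * M * \<bar>G t1 - G t2\<bar>"
      using N(1) M by (simp add: c_def field_simps)
  qed (use N in auto)
qed

lemma AC_curve_test_function:
  assumes \<rho>: "AC_curve T X \<rho>" and f: "f \<in> test_functions"
  shows "absolutely_continuous_on 0 T (\<lambda>t. \<integral>x. f x \<partial>\<rho> t)"
proof -
  obtain R where R: "f \<in> test_functions_on (cball 0 R)" using test_functionsE[OF f] by blast
  obtain N G C where *: "absolutely_continuous_on 0 T G" "C \<ge> 0"
    "\<And>f M t1 t2. f \<in> test_functions_on (cball 0 R) \<Longrightarrow> M > 0 \<Longrightarrow>
      (\<And>bs x. bs \<in> multi_indices N \<Longrightarrow> \<bar>partials bs f x\<bar> \<le> M) \<Longrightarrow> 0 \<le> t1 \<Longrightarrow> t1 \<le> t2 \<Longrightarrow> t2 \<le> T \<Longrightarrow>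
      \<bar>(\<integral>x. f x \<partial>\<rho> t1) - (\<integral>x. f x \<partial>\<rho> t2)\<bar> \<le> C * M * \<bar>G t1 - G t2\<bar>"
    by (rule AC_curve_nbhd[OF \<rho>, of R]) blast
  obtain M where M: "M > 0" "\<And>bs x. bs \<in> multi_indices N \<Longrightarrow> \<bar>partials bs f x\<bar> \<le> M"
    by (rule test_function_partials_bounded[OF f, of N]) blast
  show ?thesis
    by (rule absolutely_continuous_on_dominated[OF *(1), of "C * M"]) (use *(2,3) M R in auto)
qed

text \<open>Near \<open>t\<close> the difference quotients of \<open>\<phi>\<close> and of an
  approximant differ by at most \<delta> times a bound for those of \<open>G\<close>. The
  derivatives of the approximants are therefore Cauchy, and their limit is the derivative of
  \<open>\<phi>\<close>.\<close>

lemma derivative_by_approximation: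
  fixes \<phi> G :: "real \<Rightarrow> real"
  assumes G: "(G has_vector_derivative G') (at t within S)"
    and ap: "\<And>\<delta>. \<delta> > 0 \<Longrightarrow> \<exists>g D. (g has_vector_derivative D) (at t within S) \<and>
      (\<forall>s\<in>S. \<bar>(\<phi> s - \<phi> t) - (g s - g t)\<bar> \<le> \<delta> * \<bar>G s - G t\<bar>)"
  shows "\<exists>D. (\<phi> has_vector_derivative D) (at t within S)"
proof (cases "at t within S = bot")
  case True
  then have "(\<phi> has_vector_derivative 0) (at t within S)"
    by (simp add: has_vector_derivative_def has_derivative_def bounded_linear_zero)
  then show ?thesis by blast
next
  case False
  let ?F = "at t within S"
  have quot: "(g has_vector_derivative D) ?F \<longleftrightarrow> ((\<lambda>s. (g s - g t) / (s - t)) \<longlongrightarrow> D) ?F" for g :: "real \<Rightarrow> real" and D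
    by (simp add: has_real_derivative_iff_has_vector_derivative[symmetric] has_field_derivative_iff)
  define K where "K = \<bar>G'\<bar> + 1"
  have K: "K > 0" by (simp add: K_def)
  have "((\<lambda>s. \<bar>(G s - G t) / (s - t)\<bar>) \<longlongrightarrow> \<bar>G'\<bar>) ?F" using G quot by (intro tendsto_rabs) blast
  then have GK: "\<forall>\<^sub>F s in ?F. \<bar>(G s - G t) / (s - t)\<bar> < K" by (rule order_tendstoD) (simp add: K_def)
  have inS: "\<forall>\<^sub>F s in ?F. s \<in> S" by (simp add: eventually_at_filter)
  have "\<exists>gD. (fst gD has_vector_derivative snd gD) ?F \<and>
      (\<forall>s\<in>S. \<bar>(\<phi> s - \<phi> t) - (fst gD s - fst gD t)\<bar> \<le> inverse (real (Suc k)) * \<bar>G s - G t\<bar>)" for k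
    using ap[of "inverse (real (Suc k))"] by auto
  then obtain gD where gD: "\<And>k. (fst (gD k) has_vector_derivative snd (gD k)) ?F"
      "\<And>k s. s \<in> S \<Longrightarrow> \<bar>(\<phi> s - \<phi> t) - (fst (gD k) s - fst (gD k) t)\<bar> \<le> inverse (real (Suc k)) * \<bar>G s - G t\<bar>"
    by metis
  define g D where "g k = fst (gD k)" and "D k = snd (gD k)" for k
  define q where "q f s = (f s - f t) / (s - t)" for f :: "real \<Rightarrow> real" and s
  have gl: "(q (g k) \<longlongrightarrow> D k) ?F" for k using gD(1)[of k] unfolding quot g_def D_def q_def .
  have ev: "\<forall>\<^sub>F s in ?F. \<bar>q \<phi> s - q (g k) s\<bar> \<le> inverse (real (Suc k)) * K" for k
    using GK inS
  proof eventually_elim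
    case (elim s)
    have "\<bar>q \<phi> s - q (g k) s\<bar> = \<bar>(\<phi> s - \<phi> t) - (g k s - g k t)\<bar> / \<bar>s - t\<bar>"
      by (simp add: q_def diff_divide_distrib[symmetric])
    also have "\<dots> \<le> inverse (real (Suc k)) * \<bar>G s - G t\<bar> / \<bar>s - t\<bar>"
      using gD(2)[OF elim(2), of k] by (intro divide_right_mono) (auto simp: g_def)
    also have "\<dots> = inverse (real (Suc k)) * \<bar>(G s - G t) / (s - t)\<bar>" by simp
    also have "\<dots> \<le> inverse (real (Suc k)) * K" using elim by (intro mult_left_mono) auto
    finally show ?case .
  qed
  have DD: "\<bar>D k - D l\<bar> \<le> inverse (real (Suc k)) * K + inverse (real (Suc l)) * K" for k l
  proof (rule tendsto_upperbound[OF _ _ False])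
    show "((\<lambda>s. \<bar>q (g k) s - q (g l) s\<bar>) \<longlongrightarrow> \<bar>D k - D l\<bar>) ?F" by (intro tendsto_intros gl)
    show "\<forall>\<^sub>F s in ?F. \<bar>q (g k) s - q (g l) s\<bar> \<le> inverse (real (Suc k)) * K + inverse (real (Suc l)) * K"
      using ev[of k] ev[of l] by eventually_elim linarith
  qed
  have small: "\<exists>M. \<forall>k\<ge>M. inverse (real (Suc k)) * K < e" if e: "e > 0" for e
  proof -
    obtain M where M: "inverse (real (Suc M)) < e / K" using reals_Archimedean[of "e/K"] e K by auto
    have "inverse (real (Suc k)) * K < e" if "k \<ge> M" for k
    proof -
      have "inverse (real (Suc k)) \<le> inverse (real (Suc M))" using that by simp
      then have "inverse (real (Suc k)) < e / K" using M by linarith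
      then show ?thesis using K by (simp add: field_simps del: of_nat_Suc)
    qed
    then show ?thesis by blast
  qed
  have "Cauchy D"
  proof (rule metric_CauchyI)
    fix e :: real assume "e > 0"
    then obtain M where M: "\<And>k. k \<ge> M \<Longrightarrow> inverse (real (Suc k)) * K < e/2" using small[of "e/2"] by auto
    have "dist (D k) (D l) < e" if "k \<ge> M" "l \<ge> M" for k l
      using DD[of k l] M[OF that(1)] M[OF that(2)] unfolding dist_real_def by linarith
    then show "\<exists>M. \<forall>m\<ge>M. \<forall>n\<ge>M. dist (D m) (D n) < e" by blast
  qed
  then obtain L where L: "D \<longlonglongrightarrow> L" using Cauchy_convergent convergentD by blast
  have DL: "\<bar>D k - L\<bar> \<le> inverse (real (Suc k)) * K" for k
  proof (rule tendsto_le[OF _ _ _ always_eventually[OF allI[OF DD[of k]]]])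
    show "(\<lambda>l. \<bar>D k - D l\<bar>) \<longlonglongrightarrow> \<bar>D k - L\<bar>" by (intro tendsto_intros L)
    have "(\<lambda>l. inverse (real (Suc k)) * K + inverse (real (Suc l)) * K) \<longlonglongrightarrow> inverse (real (Suc k)) * K + 0 * K"
      by (intro tendsto_intros LIMSEQ_inverse_real_of_nat)
    then show "(\<lambda>l. inverse (real (Suc k)) * K + inverse (real (Suc l)) * K) \<longlonglongrightarrow> inverse (real (Suc k)) * K" by simp
  qed simp
  have "(q \<phi> \<longlongrightarrow> L) ?F"
  proof (rule tendstoI)
    fix e :: real assume "e > 0"
    then obtain k where k: "inverse (real (Suc k)) * K < e/3" using small[of "e/3"] by auto
    have "\<forall>\<^sub>F s in ?F. dist (q (g k) s) (D k) < e/3" using gl[of k] \<open>e > 0\<close> by (intro tendstoD) auto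
    with ev[of k] show "\<forall>\<^sub>F s in ?F. dist (q \<phi> s) L < e"
      by eventually_elim (use k DL[of k] in \<open>unfold dist_real_def, linarith\<close>)
  qed
  then show ?thesis unfolding quot q_def by blast
qed

lemma test_function_integrable:
  assumes "prob_space M" "sets M = sets borel" "f \<in> test_functions"
  shows "integrable M f"
proof -
  interpret prob_space M by fact
  obtain C where C: "\<And>x. \<bar>f x\<bar> \<le> C" using test_functions_bounded[OF assms(3)] by blast
  have "f \<in> borel_measurable borel"
    using smooth_continuous_on[OF test_functions_smooth[OF assms(3)]] by (rule borel_measurable_continuous_onI)
  then have "f \<in> borel_measurable M" using assms(2) measurable_cong_sets by blast
  then show ?thesis by (intro integrable_const_bound[of _ C]) (use C in auto)
qed

text \<open>One null set has to serve all test functions. Off a null set the pairings with a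
  countable dense family and the dominating \<open>G\<close> are differentiable; density in C^N
  carries this to every test function supported in the ball, and countably many balls
  suffice.\<close>

lemma AC_curve_AE_differentiable:
  fixes \<rho> :: "real \<Rightarrow> 'a::euclidean_space measure"
  assumes \<rho>: "AC_curve T X \<rho>" and X: "X \<subseteq> prob_measures" and T: "0 \<le> T"
  shows "AE t in lborel. t \<in> {0..T} \<longrightarrow>
    (\<forall>f\<in>test_functions. \<exists>D. ((\<lambda>s. \<integral>x. f x \<partial>\<rho> s) has_vector_derivative D) (at t within {0..T}))"
proof -
  have ACd: "AE t in lborel. t \<in> {0..T} \<longrightarrow> (\<exists>D. (g has_vector_derivative D) (at t within {0..T}))"
    if "absolutely_continuous_on 0 T g" for g
    by (rule absolutely_continuous_on_eq_integral[OF that T], erule eventually_mono) blast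
  have "AE t in lborel. t \<in> {0..T} \<longrightarrow>
    (\<forall>f\<in>test_functions_on (cball 0 R). \<exists>D. ((\<lambda>s. \<integral>x. f x \<partial>\<rho> s) has_vector_derivative D) (at t within {0..T}))" for R
  proof -
    obtain N G C where NGC: "absolutely_continuous_on 0 T G" "C \<ge> 0"
      "\<And>f M t1 t2. f \<in> test_functions_on (cball 0 R) \<Longrightarrow> M > 0 \<Longrightarrow>
      (\<And>bs x. bs \<in> multi_indices N \<Longrightarrow> \<bar>partials bs f x\<bar> \<le> M) \<Longrightarrow> 0 \<le> t1 \<Longrightarrow> t1 \<le> t2 \<Longrightarrow> t2 \<le> T \<Longrightarrow>
      \<bar>(\<integral>x. f x \<partial>\<rho> t1) - (\<integral>x. f x \<partial>\<rho> t2)\<bar> \<le> C * M * \<bar>G t1 - G t2\<bar>"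
      by (rule AC_curve_nbhd[OF \<rho>, of R]) blast
    obtain F where F: "countable F" "F \<subseteq> test_functions_on (cball (0::'a) R)"
      "\<And>f \<delta>. f \<in> test_functions_on (cball 0 R) \<Longrightarrow> \<delta> > 0 \<Longrightarrow>
       \<exists>g\<in>F. \<forall>bs\<in>multi_indices N. \<forall>x. \<bar>partials bs f x - partials bs g x\<bar> \<le> \<delta>"
      by (rule test_functions_on_separable[of R N]) blast
    have "AE t in lborel. \<forall>f\<in>F. t \<in> {0..T} \<longrightarrow> (\<exists>D. ((\<lambda>s. \<integral>x. f x \<partial>\<rho> s) has_vector_derivative D) (at t within {0..T}))"
      unfolding AE_ball_countable[OF F(1)]
      using F(2) test_functions_on_imp by (intro ballI ACd AC_curve_test_function[OF \<rho>]) blast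
    with ACd[OF NGC(1)] show ?thesis
    proof eventually_elim
      case (elim t)
      show ?case
      proof (intro impI ballI)
        fix f :: "'a \<Rightarrow> real" assume t: "t \<in> {0..T}" and f: "f \<in> test_functions_on (cball 0 R)"
        obtain G' where G': "(G has_vector_derivative G') (at t within {0..T})" using elim(1) t by blast
        show "\<exists>D. ((\<lambda>s. \<integral>x. f x \<partial>\<rho> s) has_vector_derivative D) (at t within {0..T})"
        proof (rule derivative_by_approximation[OF G'])
          fix \<delta> :: real assume "\<delta> > 0"
          define \<eta> where "\<eta> = \<delta> / (C + 1)"
          have \<eta>: "\<eta> > 0" "C * \<eta> \<le> \<delta>" using \<open>\<delta> > 0\<close> NGC(2) by (auto simp: \<eta>_def field_simps)
          obtain g where g: "g \<in> F" "\<And>bs x. bs \<in> multi_indices N \<Longrightarrow> \<bar>partials bs f x - partials bs g x\<bar> \<le> \<eta>"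
            using F(3)[OF f \<eta>(1)] by blast
          obtain D where D: "((\<lambda>s. \<integral>x. g x \<partial>\<rho> s) has_vector_derivative D) (at t within {0..T})" using elim(2) g(1) t by blast
          have gT: "g \<in> test_functions_on (cball 0 R)" using g F by blast
          note ft = test_functions_on_imp[OF f] and gt = test_functions_on_imp[OF gT]
          have fgT: "(\<lambda>x. f x - g x) \<in> test_functions_on (cball 0 R)"
            by (rule test_functions_onI) (use test_functions_smooth[OF ft] test_functions_smooth[OF gt]
              test_functions_on_partials_zero[OF f, of _ "[]"] test_functions_on_partials_zero[OF gT, of _ "[]"] in auto)
          have b: "\<bar>partials bs (\<lambda>x. f x - g x) x\<bar> \<le> \<eta>" if "bs \<in> multi_indices N" for bs x
            using g(2)[OF that] that by (subst partials_diff[OF test_functions_smooth[OF ft] test_functions_smooth[OF gt]]) auto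
          have id: "(\<integral>x. f x - g x \<partial>\<rho> s) = (\<integral>x. f x \<partial>\<rho> s) - (\<integral>x. g x \<partial>\<rho> s)" if "s \<in> {0..T}" for s
          proof -
            have "\<rho> s \<in> prob_measures" using \<rho> X that by (auto simp: AC_curve_def)
            then show ?thesis using ft gt by (intro Bochner_Integration.integral_diff test_function_integrable) (auto simp: prob_measures_def)
          qed
          have "\<bar>((\<integral>x. f x \<partial>\<rho> s) - (\<integral>x. f x \<partial>\<rho> t)) - ((\<integral>x. g x \<partial>\<rho> s) - (\<integral>x. g x \<partial>\<rho> t))\<bar> \<le> \<delta> * \<bar>G s - G t\<bar>"
            if s: "s \<in> {0..T}" for s
          proof -
            have *: "\<bar>(\<integral>x. f x - g x \<partial>\<rho> a) - (\<integral>x. f x - g x \<partial>\<rho> b)\<bar> \<le> C * \<eta> * \<bar>G a - G b\<bar>" if "0 \<le> a" "a \<le> b" "b \<le> T" for a b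
              by (rule NGC(3)[OF fgT \<eta>(1) b that])
            have "\<bar>(\<integral>x. f x - g x \<partial>\<rho> s) - (\<integral>x. f x - g x \<partial>\<rho> t)\<bar> \<le> C * \<eta> * \<bar>G s - G t\<bar>"
            proof (cases "s \<le> t")
              case True then show ?thesis using *[of s t] s t by simp
            next
              case False then show ?thesis using *[of t s] s t by (simp add: abs_minus_commute)
            qed
            also have "\<dots> \<le> \<delta> * \<bar>G s - G t\<bar>" using \<eta>(2) by (intro mult_right_mono) auto
            finally show ?thesis unfolding id[OF s] id[OF t] by (simp add: algebra_simps)
          qed
          with D show "\<exists>g D. (g has_vector_derivative D) (at t within {0..T}) \<and>
              (\<forall>s\<in>{0..T}. \<bar>((\<integral>x. f x \<partial>\<rho> s) - (\<integral>x. f x \<partial>\<rho> t)) - (g s - g t)\<bar> \<le> \<delta> * \<bar>G s - G t\<bar>)" by blast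
        qed
      qed
    qed
  qed
  then have "AE t in lborel. \<forall>k::nat. t \<in> {0..T} \<longrightarrow>
    (\<forall>f\<in>test_functions_on (cball 0 (real k)). \<exists>D. ((\<lambda>s. \<integral>x. f x \<partial>\<rho> s) has_vector_derivative D) (at t within {0..T}))"
    unfolding AE_all_countable by blast
  then show ?thesis
  proof eventually_elim
    case (elim t)
    show ?case
    proof (intro impI ballI)
      fix f :: "'a \<Rightarrow> real" assume t: "t \<in> {0..T}" and f: "f \<in> test_functions"
      obtain R where R: "smooth f" "\<And>x. norm x > R \<Longrightarrow> f x = 0" using test_functionsE[OF f] by blast
      obtain k :: nat where k: "R \<le> real k" using real_arch_simple by blast
      have "f \<in> test_functions_on (cball 0 (real k))" by (rule test_functions_onI[OF R(1)]) (use R(2) k in auto)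
      then show "\<exists>D. ((\<lambda>s. \<integral>x. f x \<partial>\<rho> s) has_vector_derivative D) (at t within {0..T})" using elim t by blast
    qed
  qed
qed

text \<open>Positivity sets of nonnegative test functions include all balls. They are stable under
  intersections, as \<open>{f > 0} \<inter> {g > 0} = {f * g > 0}\<close>, so measurability of a
  curve of measures need only be checked on them.\<close>

lemma borel_eq_sigma_positivity_sets:
  "sets (borel :: 'a::euclidean_space measure) = sigma_sets UNIV {{x. f x > 0} |f. f \<in> test_functions \<and> (\<forall>x. f x \<ge> 0)}"
    (is "_ = sigma_sets UNIV ?G")
proof -
  have ball: "ball c r \<in> ?G" if "r > 0" for c :: 'a and r
  proof -
    let ?f = "\<lambda>x. exp_bump 0 (r\<^sup>2 - (norm (x + - c))\<^sup>2)"
    have pos: "?f x > 0 \<longleftrightarrow> x \<in> ball c r" for x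
    proof -
      have "?f x > 0 \<longleftrightarrow> (norm (x - c))\<^sup>2 < r\<^sup>2" by (simp add: exp_bump_pos_iff)
      also have "\<dots> \<longleftrightarrow> norm (x - c) < r" using that by (auto intro: power2_less_imp_less power_strict_mono)
      finally show ?thesis by (simp add: dist_norm norm_minus_commute)
    qed
    have "smooth (\<lambda>x. (norm (x + - c))\<^sup>2)"
      by (rule smooth_compose_affine[OF smooth_norm_sq bounded_linear_ident])
    then have "smooth ?f" by (intro smooth_compose[OF smooth_exp_bump] smooth_diff smooth_const)
    moreover have "?f x = 0" if "norm x > norm c + r" for x
    proof -
      have "x \<notin> ball c r" using that norm_triangle_ineq2[of x c] by (auto simp: dist_norm norm_minus_commute)
      then show ?thesis using pos[of x] exp_bump_pos_iff(2)[of 0 "r\<^sup>2 - (norm (x + - c))\<^sup>2"] by linarith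
    qed
    ultimately have "?f \<in> test_functions" by (rule test_functionsI)
    moreover have "{x. ?f x > 0} = ball c r" using pos by blast
    ultimately show ?thesis by (intro CollectI exI[of _ ?f] conjI allI exp_bump_pos_iff(2)) simp_all
  qed
  show ?thesis
  proof
    have "?G \<subseteq> sets borel"
    proof safe
      fix f :: "'a \<Rightarrow> real" assume "f \<in> test_functions"
      then have "f \<in> borel_measurable borel"
        by (intro borel_measurable_continuous_onI smooth_continuous_on test_functions_smooth)
      then show "{x. f x > 0} \<in> sets borel" by measurable
    qed
    then show "sigma_sets UNIV ?G \<subseteq> sets borel" using sets.sigma_sets_subset[of ?G borel] by simp
    have "S \<in> sigma_sets UNIV ?G" if "open S" for S
    proof -
      let ?F = "{ball x r |x r. r > 0 \<and> ball x r \<subseteq> S}"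
      obtain F' where F': "F' \<subseteq> ?F" "countable F'" "\<Union>F' = \<Union>?F" by (rule Lindelof[of ?F]) auto
      have "\<Union>?F = S" using that by (auto simp: open_contains_ball) (metis centre_in_ball)
      moreover have "\<Union>F' \<in> sigma_sets UNIV ?G"
      proof (rule sigma_sets_UNION[OF F'(2)])
        fix B assume "B \<in> F'"
        then have "B \<in> ?F" using F'(1) by (rule subsetD[rotated])
        then obtain x r where B: "B = ball x r" and r: "r > 0" by (elim CollectE exE conjE)
        show "B \<in> sigma_sets UNIV ?G" unfolding B by (rule sigma_sets.Basic[OF ball[OF r]])
      qed
      ultimately show ?thesis using F'(3) by simp
    qed
    then have "{S. open S} \<subseteq> sigma_sets UNIV ?G" by blast
    then show "sets borel \<subseteq> sigma_sets UNIV ?G"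
      unfolding borel_def by (simp add: sigma_sets_mono)
  qed
qed

text \<open>Needed for measurability in time of integrals whose integrand depends on time as well,
  such as those with the self-consistent force. The measure of \<open>{f > 0}\<close> is the limit
  of the integrals of the test functions \<open>\<sigma> (k f)\<close>, each of which is continuous
  in time.\<close>

lemma AC_curve_kernel:
  fixes \<rho> :: "real \<Rightarrow> 'a::euclidean_space measure"
  assumes \<rho>: "AC_curve T X \<rho>" and X: "X \<subseteq> prob_measures" and T: "0 \<le> T"
  shows "(\<lambda>t. \<rho> (max 0 (min T t))) \<in> borel \<rightarrow>\<^sub>M prob_algebra borel"
proof (rule measurable_prob_algebra_generated[OF borel_eq_sigma_positivity_sets])
  define \<mu> where "\<mu> t = \<rho> (max 0 (min T t))" for t
  have "max 0 (min T t) \<in> {0..T}" for t using T by auto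
  then have \<mu>: "prob_space (\<mu> t)" "sets (\<mu> t) = sets borel" for t
    using \<rho> X unfolding \<mu>_def AC_curve_def prob_measures_def by blast+
  then show "prob_space (\<rho> (max 0 (min T t)))" "sets (\<rho> (max 0 (min T t))) = sets borel" for t
    by (auto simp: \<mu>_def)
  show "Int_stable {{x. 0 < f x} |f::'a\<Rightarrow>real. f \<in> test_functions \<and> (\<forall>x. 0 \<le> f x)}"
    unfolding Int_stable_def
  proof safe
    fix f g :: "'a \<Rightarrow> real" assume *: "f \<in> test_functions" "\<forall>x. 0 \<le> f x" "g \<in> test_functions" "\<forall>x. 0 \<le> g x"
    have "{x. 0 < f x} \<inter> {x. 0 < g x} = {x. 0 < f x * g x}"
      using *(2,4) by (auto simp: zero_less_mult_iff) (metis less_le_not_le)+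
    moreover have "(\<lambda>x. f x * g x) \<in> test_functions" using * by (intro test_functions_smooth_mult test_functions_smooth)
    ultimately show "\<exists>h. {x. 0 < f x} \<inter> {x. 0 < g x} = {x. 0 < h x} \<and> h \<in> test_functions \<and> (\<forall>x. 0 \<le> h x)"
      using *(2,4) by (intro exI[of _ "\<lambda>x. f x * g x"]) auto
  qed
  have cont: "(\<lambda>t. \<integral>x. f x \<partial>\<mu> t) \<in> borel_measurable borel" if f: "f \<in> test_functions" for f
  proof (rule borel_measurable_continuous_onI)
    have "globally_AC (\<lambda>t. \<integral>x. f x \<partial>\<mu> t)"
      unfolding \<mu>_def by (rule globally_AC_clamp[OF AC_curve_test_function[OF \<rho> f] T])
    then show "continuous_on UNIV (\<lambda>t. \<integral>x. f x \<partial>\<mu> t)"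
      by (intro continuous_at_imp_continuous_on ballI globally_AC_isCont)
  qed
  fix A :: "'a set" assume "A \<in> {{x. 0 < f x} |f. f \<in> test_functions \<and> (\<forall>x. 0 \<le> f x)}"
  then obtain f :: "'a \<Rightarrow> real" where f: "A = {x. 0 < f x}" "f \<in> test_functions" "\<And>x. 0 \<le> f x" by blast
  obtain \<sigma> :: "real \<Rightarrow> real" where \<sigma>: "smooth \<sigma>" "\<And>x. x \<le> 0 \<Longrightarrow> \<sigma> x = 0" "\<And>x. x \<ge> 1 \<Longrightarrow> \<sigma> x = 1" "\<And>x. \<sigma> x \<le> 1" "\<And>x. \<sigma> x \<ge> 0"
    by (rule smooth_step_exists) blast
  obtain R where R: "smooth f" "\<And>x. norm x > R \<Longrightarrow> f x = 0" using test_functionsE[OF f(2)] by blast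
  have t: "(\<lambda>x. \<sigma> (real k * f x)) \<in> test_functions" for k
    by (rule test_functionsI[of _ R]) (use R \<sigma>(2) in \<open>auto intro!: smooth_compose[OF \<sigma>(1)]\<close>)
  have fm: "f \<in> borel_measurable borel" using smooth_continuous_on[OF R(1)] by (rule borel_measurable_continuous_onI)
  then have Ab: "A \<in> sets borel" unfolding f(1) by measurable
  have lim: "(\<lambda>k. \<integral>x. \<sigma> (real k * f x) \<partial>\<mu> t) \<longlonglongrightarrow> measure (\<mu> t) A" for t
  proof -
    interpret prob_space "\<mu> t" by (rule \<mu>)
    have At: "A \<in> sets (\<mu> t)" unfolding \<mu>(2) by (rule Ab)
    have "(\<lambda>k. \<integral>x. \<sigma> (real k * f x) \<partial>\<mu> t) \<longlonglongrightarrow> (\<integral>x. indicator A x \<partial>\<mu> t)"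
    proof (rule integral_dominated_convergence[where w="\<lambda>_. 1"])
      show "indicat_real A \<in> borel_measurable (\<mu> t)" using At by (rule borel_measurable_indicator)
      show "(\<lambda>x. \<sigma> (real k * f x)) \<in> borel_measurable (\<mu> t)" for k
        using test_function_integrable[OF \<mu> t[of k]] by auto
      show "AE x in \<mu> t. (\<lambda>k. \<sigma> (real k * f x)) \<longlonglongrightarrow> indicat_real A x"
      proof (rule AE_I2)
        fix x
        show "(\<lambda>k. \<sigma> (real k * f x)) \<longlonglongrightarrow> indicat_real A x"
        proof (cases "f x > 0")
          case True
          obtain N :: nat where "1 / f x \<le> real N" using real_arch_simple by blast
          then have "1 \<le> real k * f x" if "k \<ge> N" for k
            using True that by (simp add: field_simps) (meson mult_right_mono of_nat_le_iff order_trans less_imp_le mult.commute)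
          then have "\<forall>\<^sub>F k in sequentially. \<sigma> (real k * f x) = indicat_real A x"
            unfolding eventually_sequentially using \<sigma>(3) True by (auto simp: f(1) intro!: exI[of _ N])
          then show ?thesis by (rule tendsto_eventually)
        next
          case False
          then show ?thesis using f(3)[of x] \<sigma>(2) by (auto simp: f(1))
        qed
      qed
    qed (use \<sigma>(4,5) in auto)
    then show ?thesis using At by simp
  qed
  have "(\<lambda>t. measure (\<mu> t) A) \<in> borel_measurable borel"
    by (rule borel_measurable_LIMSEQ_metric[OF cont[OF t] lim])
  moreover have "emeasure (\<mu> t) A = ennreal (measure (\<mu> t) A)" for t
    using \<mu>(1)[of t] by (simp add: prob_space_def finite_measure.emeasure_eq_measure)
  ultimately show "(\<lambda>t. emeasure (\<rho> (max 0 (min T t))) A) \<in> borel_measurable borel"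
    by (simp add: \<mu>_def)
qed auto

section \<open>Phase space calculus\<close>

lemma Basis_prod_snd: "b \<in> Basis \<Longrightarrow> (0, b) \<in> Basis" and Basis_prod_fst: "b \<in> Basis \<Longrightarrow> (b, 0) \<in> Basis"
  by (auto simp: Basis_prod_def)

lemma grad_p_eq_snd_grad:
  assumes "f differentiable (at (q, p))" shows "grad_p f (q, p) = snd (grad f (q, p))"
proof -
  have "((\<lambda>p'. f (q, p')) has_derivative (\<lambda>h. grad f (q, p) \<bullet> (0, h))) (at p)"
    by (rule has_derivative_compose[of "\<lambda>p'. (q, p')" "\<lambda>h. (0, h)" p UNIV f, simplified])
       (auto intro!: derivative_eq_intros differentiable_grad[OF assms])
  then have "((\<lambda>p'. f (q, p')) has_derivative (\<lambda>h. snd (grad f (q, p)) \<bullet> h)) (at p)" by (simp add: inner_prod_def)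
  then show ?thesis unfolding grad_p_def by (simp add: grad_eqI)
qed

lemma grad_q_eq_fst_grad:
  assumes "f differentiable (at (q, p))" shows "grad_q f (q, p) = fst (grad f (q, p))"
proof -
  have "((\<lambda>q'. f (q', p)) has_derivative (\<lambda>h. grad f (q, p) \<bullet> (h, 0))) (at q)"
    by (rule has_derivative_compose[of "\<lambda>q'. (q', p)" "\<lambda>h. (h, 0)" q UNIV f, simplified])
       (auto intro!: derivative_eq_intros differentiable_grad[OF assms])
  then have "((\<lambda>q'. f (q', p)) has_derivative (\<lambda>h. fst (grad f (q, p)) \<bullet> h)) (at q)" by (simp add: inner_prod_def)
  then show ?thesis unfolding grad_q_def by (simp add: grad_eqI)
qed

lemma partial_slice:
  fixes f :: "'d::finite phase \<Rightarrow> real"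
  assumes "f differentiable (at (q, p))" "b \<in> Basis"
  shows "partials [b] (\<lambda>p'. f (q, p')) p = partials [(0, b)] f (q, p)"
proof -
  have "partials [b] (\<lambda>p'. f (q, p')) p = grad_p f (q, p) \<bullet> b"
    unfolding grad_p_def using grad_inner_Basis[OF assms(2)] by simp
  also have "\<dots> = grad f (q, p) \<bullet> (0, b)" by (simp add: grad_p_eq_snd_grad[OF assms(1)] inner_prod_def)
  also have "\<dots> = partials [(0, b)] f (q, p)" by (rule grad_inner_Basis[OF Basis_prod_snd[OF assms(2)]])
  finally show ?thesis .
qed

lemma laplacian_p_eq:
  assumes f: "smooth f"
  shows "laplacian_p f (q, p) = (\<Sum>b\<in>Basis. partials [(0, b), (0, b)] f (q, p))"
proof -
  have "partials [b, b] (\<lambda>p'. f (q, p')) p = partials [(0, b), (0, b)] f (q, p)" if b: "b \<in> Basis" for b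
  proof -
    have "partials [b] (\<lambda>p'. f (q, p')) = (\<lambda>p'. partials [(0, b)] f (q, p'))"
      by (intro ext partial_slice smooth_differentiable f b)
    then have "partials [b, b] (\<lambda>p'. f (q, p')) p = partials [b] (\<lambda>p'. partials [(0, b)] f (q, p')) p" by simp
    also have "\<dots> = partials [(0, b)] (partials [(0, b)] f) (q, p)"
      using b by (intro partial_slice smooth_differentiable smooth_partials f) (auto intro: Basis_prod_snd)
    finally show ?thesis by simp
  qed
  then show ?thesis by (simp add: laplacian_p_def laplacian_def del: partials.simps)
qed

lemma partials_lincomb:
  assumes "smooth f" "smooth g" "set bs \<subseteq> Basis"
  shows "partials bs (\<lambda>x. a * f x - c * g x) = (\<lambda>x. a * partials bs f x - c * partials bs g x)"
  using assms by (simp add: partials_diff partials_cmult smooth_cmult)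

lemma test_functions_lincomb:
  "f \<in> test_functions \<Longrightarrow> g \<in> test_functions \<Longrightarrow> (\<lambda>x. a * f x - c * g x) \<in> test_functions"
  by (intro test_functions_diff test_functions_cmult)

text \<open>The form \<open>a f - c g\<close> covers scaling with \<open>c = 0\<close>, differences
  with \<open>a = c = 1\<close>, and the corrections \<open>f - r \<xi>\<close> used for the norm
  comparison.\<close>

lemma phase_derivatives_lincomb:
  fixes f g :: "'d::finite phase \<Rightarrow> real"
  assumes f: "smooth f" and g: "smooth g"
  shows "grad_p (\<lambda>x. a * f x - c * g x) x = a *\<^sub>R grad_p f x - c *\<^sub>R grad_p g x"
    "grad_q (\<lambda>x. a * f x - c * g x) x = a *\<^sub>R grad_q f x - c *\<^sub>R grad_q g x"
    "laplacian_p (\<lambda>x. a * f x - c * g x) x = a * laplacian_p f x - c * laplacian_p g x"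
proof -
  obtain q p where x: "x = (q, p)" by (cases x)
  have fg: "smooth (\<lambda>x. a * f x - c * g x)" using f g by auto
  have gr: "grad (\<lambda>x. a * f x - c * g x) x = a *\<^sub>R grad f x - c *\<^sub>R grad g x"
    unfolding grad_def by (simp add: partials_lincomb[OF f g] scaleR_sum_right sum_subtractf scaleR_diff_left del: partials.simps)
  show "grad_p (\<lambda>x. a * f x - c * g x) x = a *\<^sub>R grad_p f x - c *\<^sub>R grad_p g x"
    "grad_q (\<lambda>x. a * f x - c * g x) x = a *\<^sub>R grad_q f x - c *\<^sub>R grad_q g x"
    using gr f g fg by (simp_all add: x grad_p_eq_snd_grad grad_q_eq_fst_grad smooth_differentiable)
  show "laplacian_p (\<lambda>x. a * f x - c * g x) x = a * laplacian_p f x - c * laplacian_p g x"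
    unfolding x laplacian_p_eq[OF f] laplacian_p_eq[OF g] laplacian_p_eq[OF fg]
    by (simp add: partials_lincomb[OF f g] Basis_prod_snd sum_subtractf sum_distrib_left del: partials.simps)
qed

lemma phase_derivatives_test:
  fixes f :: "'d::finite phase \<Rightarrow> real"
  assumes f: "f \<in> test_functions"
  shows "continuous_on UNIV (grad_p f)" "continuous_on UNIV (grad_q f)" "continuous_on UNIV (laplacian_p f)"
    "\<exists>R. \<forall>x. norm x > R \<longrightarrow> grad_p f x = 0 \<and> grad_q f x = 0 \<and> laplacian_p f x = 0"
proof -
  obtain R where R: "smooth f" "\<And>x. norm x > R \<Longrightarrow> f x = 0" using test_functionsE[OF f] by blast
  note diff = smooth_differentiable[OF R(1)]
  have eq: "grad_p f = (\<lambda>x. snd (grad f x))" "grad_q f = (\<lambda>x. fst (grad f x))"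
    "laplacian_p f = (\<lambda>x. \<Sum>b\<in>Basis. partials [(0, b), (0, b)] f x)"
    by (auto simp: fun_eq_iff grad_p_eq_snd_grad grad_q_eq_fst_grad laplacian_p_eq[OF R(1)] diff simp del: partials.simps)
  have cp: "continuous_on UNIV (partials bs f)" if "set bs \<subseteq> Basis" for bs
    by (rule smooth_continuous_on[OF smooth_partials[OF R(1) that]])
  have cg: "continuous_on UNIV (grad f)" by (rule continuous_on_grad, rule cp) simp
  show "continuous_on UNIV (grad_p f)" "continuous_on UNIV (grad_q f)"
    unfolding eq by (intro continuous_intros cg)+
  show "continuous_on UNIV (laplacian_p f)"
    unfolding eq by (intro continuous_on_sum cp) (simp add: Basis_prod_snd)
  have "grad f x = 0" "partials bs f x = 0" if "norm x > R" for x bs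
    using partials_zero_outside[of R f x, OF R(2) that] by (simp_all add: grad_def del: partials.simps)
  then have "\<forall>x. norm x > R \<longrightarrow> grad_p f x = 0 \<and> grad_q f x = 0 \<and> laplacian_p f x = 0"
    unfolding eq by (simp del: partials.simps)
  then show "\<exists>R. \<forall>x. norm x > R \<longrightarrow> grad_p f x = 0 \<and> grad_q f x = 0 \<and> laplacian_p f x = 0" by blast
qed

section \<open>Integrability for measures with finite second momentum moment\<close>

lemma P2_D:
  assumes "\<nu> \<in> P2"
  shows "prob_space \<nu>" "sets \<nu> = sets borel" "integrable \<nu> (\<lambda>x. (norm (snd x))\<^sup>2)"
proof -
  show 1: "prob_space \<nu>" and 2: "sets \<nu> = sets borel" using assms by (auto simp: P2_def prob_measures_def)
  have [measurable]: "(\<lambda>x::'a phase. (norm (snd x))\<^sup>2) \<in> borel_measurable \<nu>"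
    using 2 by (subst measurable_cong_sets[OF 2 refl]) (intro borel_measurable_continuous_onI continuous_intros)
  show "integrable \<nu> (\<lambda>x. (norm (snd x))\<^sup>2)"
    by (rule integrableI_nonneg) (use assms in \<open>auto simp: P2_def case_prod_unfold\<close>)
qed

lemma P2_measurable: "\<nu> \<in> P2 \<Longrightarrow> f \<in> borel_measurable borel \<Longrightarrow> f \<in> borel_measurable \<nu>"
  using measurable_cong_sets[OF P2_D(2) refl] by blast

lemma P2_integrable:
  fixes f :: "'d::finite phase \<Rightarrow> 'b::{banach, second_countable_topology}"
  assumes \<nu>: "\<nu> \<in> P2" and f: "f \<in> borel_measurable borel" and b: "\<And>x. norm (f x) \<le> C * (1 + (norm (snd x))\<^sup>2)"
  shows "integrable \<nu> f"
proof (rule Bochner_Integration.integrable_bound)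
  interpret prob_space \<nu> by (rule P2_D[OF \<nu>])
  show "integrable \<nu> (\<lambda>x. C * (1 + (norm (snd x))\<^sup>2))" using P2_D(3)[OF \<nu>] by auto
  show "f \<in> borel_measurable \<nu>" by (rule P2_measurable[OF \<nu> f])
  have "norm (f x) \<le> norm (C * (1 + (norm (snd x))\<^sup>2))" for x using b[of x] abs_ge_self[of "C * (1 + (norm (snd x))\<^sup>2)"] by simp
  then show "AE x in \<nu>. norm (f x) \<le> norm (C * (1 + (norm (snd x))\<^sup>2))" by simp
qed

lemma P2_integrable_bounded:
  fixes f :: "'d::finite phase \<Rightarrow> 'b::{banach, second_countable_topology}"
  assumes \<nu>: "\<nu> \<in> P2" and f: "f \<in> borel_measurable borel" and b: "\<And>x. norm (f x) \<le> C"
  shows "integrable \<nu> f"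
proof (rule P2_integrable[OF \<nu> f, of C])
  fix x :: "'d phase"
  have "0 \<le> C" using b[of x] norm_ge_zero order_trans by blast
  then have "C * 1 \<le> C * (1 + (norm (snd x))\<^sup>2)" by (intro mult_left_mono) auto
  then show "norm (f x) \<le> C * (1 + (norm (snd x))\<^sup>2)" using b[of x] by simp
qed

lemma P2_integrable_test:
  fixes f :: "'d::finite phase \<Rightarrow> 'b::{banach, second_countable_topology}"
  assumes \<nu>: "\<nu> \<in> P2" and f: "continuous_on UNIV f" "\<And>x. norm x > R \<Longrightarrow> f x = 0"
  shows "integrable \<nu> f"
proof -
  obtain C where "\<And>x. norm (f x) \<le> C" using continuous_compact_support_bounded[OF f] by blast
  then show ?thesis by (intro P2_integrable_bounded[OF \<nu>] borel_measurable_continuous_onI[OF f(1)])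
qed

section \<open>The Vlasov-Fokker-Planck generator\<close>

locale vfp =
  fixes m \<gamma> \<theta> :: real and V \<psi> :: "real ^ 'd::finite \<Rightarrow> real" and LV L\<psi> C\<psi> :: real
  assumes m: "m > 0" and \<gamma>: "\<gamma> > 0" and \<theta>: "\<theta> > 0"
    and V: "lipschitz_grad LV V (grad V)" "\<And>q. V q \<ge> 0"
    and \<psi>: "lipschitz_grad L\<psi> \<psi> (grad \<psi>)" "\<And>q. norm (grad \<psi> q) \<le> C\<psi>" "\<And>q. \<psi> q \<ge> 0" "\<And>q. \<psi> (- q) = \<psi> q"
begin

abbreviation gen :: "'d phase measure \<Rightarrow> ('d phase \<Rightarrow> real) \<Rightarrow> 'd phase \<Rightarrow> real" where
  "gen \<equiv> generator m \<gamma> \<theta> V \<psi>"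

lemma C\<psi>_nonneg: "C\<psi> \<ge> 0" using \<psi>(2)[of 0] norm_ge_zero order_trans by blast

lemma integrable_grad_\<psi>: "\<nu> \<in> P2 \<Longrightarrow> integrable \<nu> (\<lambda>x. grad \<psi> (q - fst x))"
  by (rule P2_integrable_bounded[where C=C\<psi>])
     (auto intro!: borel_measurable_continuous_onI continuous_intros continuous_on_compose2[OF lipschitz_grad_continuous(2)[OF \<psi>(1)]] \<psi>(2))

lemma grad_conv_eq: "grad_conv \<psi> \<nu> q = (\<integral>x. grad \<psi> (q - fst x) \<partial>\<nu>)"
  by (simp add: grad_conv_def case_prod_unfold)

lemma grad_conv_bounded: assumes \<nu>: "\<nu> \<in> P2" shows "norm (grad_conv \<psi> \<nu> q) \<le> C\<psi>"
proof -
  interpret prob_space \<nu> by (rule P2_D[OF \<nu>])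
  have "norm (grad_conv \<psi> \<nu> q) \<le> (\<integral>x. C\<psi> \<partial>\<nu>)"
    unfolding grad_conv_eq by (rule Bochner_Integration.integral_norm_bound_integral) (auto intro: integrable_grad_\<psi> \<nu> \<psi>(2))
  then show ?thesis by (simp add: prob_space)
qed

lemma grad_conv_lipschitz:
  assumes \<nu>: "\<nu> \<in> P2" shows "norm (grad_conv \<psi> \<nu> q - grad_conv \<psi> \<nu> q') \<le> L\<psi> * norm (q - q')"
proof -
  interpret prob_space \<nu> by (rule P2_D[OF \<nu>])
  have "grad_conv \<psi> \<nu> q - grad_conv \<psi> \<nu> q' = (\<integral>x. grad \<psi> (q - fst x) - grad \<psi> (q' - fst x) \<partial>\<nu>)"
    unfolding grad_conv_eq by (intro Bochner_Integration.integral_diff[symmetric] integrable_grad_\<psi> \<nu>)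
  also have "norm \<dots> \<le> (\<integral>x. L\<psi> * norm (q - q') \<partial>\<nu>)"
  proof (rule Bochner_Integration.integral_norm_bound_integral)
    show "norm (grad \<psi> (q - fst x) - grad \<psi> (q' - fst x)) \<le> L\<psi> * norm (q - q')" for x
      using lipschitz_grad_neg_inner_le(3)[OF \<psi>(1), of "q - fst x" "q' - fst x"] by simp
  qed (auto intro!: integrable_grad_\<psi> \<nu> Bochner_Integration.integrable_diff)
  finally show ?thesis by (simp add: prob_space)
qed

lemma continuous_grad_conv: assumes \<nu>: "\<nu> \<in> P2" shows "continuous_on S (grad_conv \<psi> \<nu>)"
proof -
  have "L\<psi>-lipschitz_on UNIV (grad_conv \<psi> \<nu>)"
    using grad_conv_lipschitz[OF \<nu>] lipschitz_grad_neg_inner_le(1)[OF \<psi>(1)] by (intro lipschitz_onI) (auto simp: dist_norm)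
  then show ?thesis by (meson continuous_on_subset lipschitz_on_continuous_on subset_UNIV)
qed

lemma gen_eq:
  "gen \<nu> f x = (snd x /\<^sub>R m) \<bullet> grad_q f x - (grad V (fst x) + grad_conv \<psi> \<nu> (fst x) + \<gamma> *\<^sub>R (snd x /\<^sub>R m)) \<bullet> grad_p f x
     + \<gamma> * \<theta> * laplacian_p f x"
  by (simp add: generator_def case_prod_unfold)

lemma gen_lincomb:
  assumes "smooth f" "smooth g"
  shows "gen \<nu> (\<lambda>x. a * f x - c * g x) x = a * gen \<nu> f x - c * gen \<nu> g x"
  unfolding gen_eq phase_derivatives_lincomb[OF assms] by (simp add: inner_diff_right algebra_simps)

lemma integrable_gen:
  assumes \<nu>: "\<nu> \<in> P2" and \<nu>': "\<nu>' \<in> P2" and f: "f \<in> test_functions"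
  shows "integrable \<nu> (gen \<nu>' f)"
proof -
  obtain R where R: "\<And>x. norm x > R \<Longrightarrow> grad_p f x = 0 \<and> grad_q f x = 0 \<and> laplacian_p f x = 0"
    using phase_derivatives_test(4)[OF f] by blast
  have "gen \<nu>' f = (\<lambda>x. gen \<nu>' f x)" by simp
  then show ?thesis unfolding gen_eq
    using R by (intro P2_integrable_test[OF \<nu>, of _ R])
      (auto intro!: continuous_intros phase_derivatives_test[OF f] continuous_on_compose2[OF continuous_grad_conv[OF \<nu>', of UNIV]]
        continuous_on_compose2[OF lipschitz_grad_continuous(2)[OF V(1), of UNIV]])
qed

lemma generator_adjoint_lincomb:
  assumes \<nu>: "\<nu> \<in> P2" and f: "f \<in> test_functions" and g: "g \<in> test_functions"
  shows "generator_adjoint m \<gamma> \<theta> V \<psi> \<nu> (\<lambda>x. a * f x - c * g x) =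
    a * generator_adjoint m \<gamma> \<theta> V \<psi> \<nu> f - c * generator_adjoint m \<gamma> \<theta> V \<psi> \<nu> g"
  unfolding generator_adjoint_def gen_lincomb[OF test_functions_smooth[OF f] test_functions_smooth[OF g]]
  using integrable_gen[OF \<nu> \<nu> f] integrable_gen[OF \<nu> \<nu> g] by simp

lemma integrable_grad_p_sq:
  fixes f :: "'d phase \<Rightarrow> real"
  assumes \<nu>: "\<nu> \<in> P2" and f: "f \<in> test_functions"
  shows "integrable \<nu> (\<lambda>x. (norm (grad_p f x - r *\<^sub>R (snd x /\<^sub>R m)))\<^sup>2)"
proof -
  obtain R where R: "\<And>x. norm x > R \<Longrightarrow> grad_p f x = 0" using phase_derivatives_test(4)[OF f] by blast
  obtain C where C: "C > 0" "\<And>x. norm (grad_p f x) \<le> C"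
    using continuous_compact_support_bounded[OF phase_derivatives_test(1)[OF f] R] by blast
  show ?thesis
  proof (rule P2_integrable[OF \<nu>, of _ "2 * C\<^sup>2 + 2 * (r/m)\<^sup>2"])
    fix x :: "'d phase"
    have "(norm (grad_p f x - r *\<^sub>R (snd x /\<^sub>R m)))\<^sup>2 \<le> (norm (grad_p f x) + norm (r *\<^sub>R (snd x /\<^sub>R m)))\<^sup>2"
      by (intro power_mono norm_triangle_ineq4) auto
    also have "\<dots> \<le> 2 * (norm (grad_p f x))\<^sup>2 + 2 * (norm (r *\<^sub>R (snd x /\<^sub>R m)))\<^sup>2"
      using sum_squares_bound[of "norm (grad_p f x)" "norm (r *\<^sub>R (snd x /\<^sub>R m))"] by (simp add: power2_sum)
    also have "\<dots> \<le> 2 * C\<^sup>2 + 2 * (r/m)\<^sup>2 * (norm (snd x))\<^sup>2"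
      using power_mono[OF C(2)[of x], of 2] by (simp add: power_mult_distrib power_divide divide_inverse power_inverse)
    also have "\<dots> \<le> (2 * C\<^sup>2 + 2 * (r/m)\<^sup>2) * (1 + (norm (snd x))\<^sup>2)" by (simp add: algebra_simps)
    finally show "norm ((norm (grad_p f x - r *\<^sub>R (snd x /\<^sub>R m)))\<^sup>2) \<le> (2 * C\<^sup>2 + 2 * (r/m)\<^sup>2) * (1 + (norm (snd x))\<^sup>2)" by simp
  qed (intro borel_measurable_continuous_onI continuous_intros phase_derivatives_test[OF f])
qed

text \<open>The reversible and the dissipative field add up to the dual generator, so the first
  component in J is the same distribution as in I. Compact support of the derivatives gives the
  integrability that permits splitting the integral.\<close>

lemma GENERIC_drift:
  assumes \<nu>: "\<nu> \<in> P2" and f: "f \<in> test_functions"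
  shows "fst (L_grad_E m V \<psi> \<nu>) f + fst (M_grad_S m \<gamma> \<theta> \<nu>) f = generator_adjoint m \<gamma> \<theta> V \<psi> \<nu> f"
proof -
  obtain R where R: "\<And>x. norm x > R \<Longrightarrow> grad_p f x = 0 \<and> grad_q f x = 0 \<and> laplacian_p f x = 0"
    using phase_derivatives_test(4)[OF f] by blast
  note cont = continuous_intros phase_derivatives_test[OF f] continuous_on_compose2[OF continuous_grad_conv[OF \<nu>, of UNIV]]
        continuous_on_compose2[OF lipschitz_grad_continuous(2)[OF V(1), of UNIV]]
  have 1: "integrable \<nu> (\<lambda>x. (snd x /\<^sub>R m) \<bullet> grad_q f x)"
    by (rule P2_integrable_test[OF \<nu>, of _ R]) (auto intro!: cont simp: R)
  have 2: "integrable \<nu> (\<lambda>x. (grad V (fst x) + grad_conv \<psi> \<nu> (fst x)) \<bullet> grad_p f x)"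
    by (rule P2_integrable_test[OF \<nu>, of _ R]) (auto intro!: cont simp: R)
  have 3: "integrable \<nu> (\<lambda>x. (snd x /\<^sub>R m) \<bullet> grad_p f x)"
    by (rule P2_integrable_test[OF \<nu>, of _ R]) (auto intro!: cont simp: R)
  have 4: "integrable \<nu> (\<lambda>x. laplacian_p f x)"
    by (rule P2_integrable_test[OF \<nu>, of _ R]) (auto intro!: cont simp: R)
  have "generator_adjoint m \<gamma> \<theta> V \<psi> \<nu> f = (\<integral>x. (snd x /\<^sub>R m) \<bullet> grad_q f x - (grad V (fst x) + grad_conv \<psi> \<nu> (fst x)) \<bullet> grad_p f x
     - \<gamma> * ((snd x /\<^sub>R m) \<bullet> grad_p f x) + \<gamma> * \<theta> * laplacian_p f x \<partial>\<nu>)"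
    unfolding generator_adjoint_def gen_eq by (simp add: inner_add_left algebra_simps)
  also have "\<dots> = (\<integral>x. (snd x /\<^sub>R m) \<bullet> grad_q f x \<partial>\<nu>) - (\<integral>x. (grad V (fst x) + grad_conv \<psi> \<nu> (fst x)) \<bullet> grad_p f x \<partial>\<nu>)
     - \<gamma> * (\<integral>x. (snd x /\<^sub>R m) \<bullet> grad_p f x \<partial>\<nu>) + \<gamma> * \<theta> * (\<integral>x. laplacian_p f x \<partial>\<nu>)"
    using 1 2 3 4 by simp
  finally show ?thesis
    by (simp add: L_grad_E_def M_grad_S_def div_q_def div_p_def lap_p_def case_prod_unfold)
qed

end

section \<open>Truncated energies\<close>

text \<open>\<open>N\<close> is the energy level of the truncation and \<open>R\<close> its radius
  in position. The spatial cutoff depends on \<open>q\<close> alone, which keeps the momentum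
  gradient parallel to \<open>p/m\<close>.\<close>

definition truncated :: "real \<Rightarrow> (real \<Rightarrow> real) \<Rightarrow> (real \<Rightarrow> real) \<Rightarrow> real \<Rightarrow> real \<Rightarrow> (real ^ 'd \<Rightarrow> real) \<Rightarrow> 'd::finite phase \<Rightarrow> real" where
  "truncated m \<zeta> \<Theta> N R W x = \<zeta> ((norm (fst x))\<^sup>2 / R\<^sup>2) * (N * \<Theta> (((norm (snd x))\<^sup>2 / (2 * m) + W (fst x)) / N))"

lemma smooth_truncated:
  fixes W :: "real ^ 'd::finite \<Rightarrow> real"
  assumes "smooth \<zeta>" "smooth \<Theta>" "smooth W"
  shows "smooth (truncated m \<zeta> \<Theta> N R W)"
proof -
  have 1: "smooth (\<lambda>x::'d phase. \<zeta> (1 / R\<^sup>2 * (norm (fst x))\<^sup>2))"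
    by (rule smooth_compose[OF assms(1)]) (intro smooth_cmult smooth_fst[OF smooth_norm_sq])
  have 2: "smooth (\<lambda>x::'d phase. \<Theta> (1 / N * (1 / (2 * m) * (norm (snd x))\<^sup>2 + W (fst x))))"
    by (rule smooth_compose[OF assms(2)]) (intro smooth_cmult smooth_add smooth_snd[OF smooth_norm_sq] smooth_fst[OF assms(3)])
  show ?thesis unfolding truncated_def[abs_def] using smooth_mult[OF 1 smooth_cmult[OF 2]] by simp
qed

lemma truncated_derivatives:
  fixes W :: "real ^ 'd::finite \<Rightarrow> real" and R m N :: real
  assumes \<zeta>: "smooth \<zeta>" and \<Theta>: "smooth \<Theta>" and W: "smooth W" and N: "N > 0" and m: "m > 0"
  defines "h \<equiv> \<lambda>q p. ((norm p)\<^sup>2 / (2 * m) + W q) / N" and "z \<equiv> \<lambda>q. (norm q)\<^sup>2 / R\<^sup>2"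
  shows "grad_p (truncated m \<zeta> \<Theta> N R W) (q, p) = (\<zeta> (z q) * deriv \<Theta> (h q p)) *\<^sub>R (p /\<^sub>R m)"
    "grad_q (truncated m \<zeta> \<Theta> N R W) (q, p) =
       (N * \<Theta> (h q p) * (deriv \<zeta> (z q) * (2 / R\<^sup>2))) *\<^sub>R q + (\<zeta> (z q) * deriv \<Theta> (h q p)) *\<^sub>R grad W q"
    "laplacian_p (truncated m \<zeta> \<Theta> N R W) (q, p) =
       \<zeta> (z q) * (deriv (deriv \<Theta>) (h q p) * (norm p)\<^sup>2 / (N * m\<^sup>2) + deriv \<Theta> (h q p) * real CARD('d) / m)"
proof -
  have D\<Theta>: "(\<Theta> has_real_derivative deriv \<Theta> y) (at y)" "(deriv \<Theta> has_real_derivative deriv (deriv \<Theta>) y) (at y)" for y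
    using smooth_real_derivative \<Theta> by blast+
  have D\<zeta>: "(\<zeta> has_real_derivative deriv \<zeta> y) (at y)" for y using smooth_real_derivative \<zeta> by blast
  have Dsq: "((\<lambda>x. (norm x)\<^sup>2) has_derivative (\<lambda>k. 2 * (x \<bullet> k))) (at x)" for x :: "real ^ 'd"
    unfolding power2_norm_eq_inner by (auto intro!: derivative_eq_intros simp: inner_commute)
  have Dh: "((\<lambda>p. h q p) has_derivative (\<lambda>k. (p \<bullet> k) / (m * N))) (at p)" for p q
  proof -
    have "((\<lambda>p. ((norm p)\<^sup>2 * (1 / (2 * m)) + W q) * (1 / N)) has_derivative (\<lambda>k. (2 * (p \<bullet> k) * (1 / (2 * m)) + 0) * (1 / N))) (at p)"
      by (intro has_derivative_mult_left has_derivative_add has_derivative_const Dsq)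
    then show ?thesis using N m by (simp add: h_def)
  qed
  have Dhq: "((\<lambda>q. h q p) has_derivative (\<lambda>k. (grad W q \<bullet> k) / N)) (at q)" for p q
  proof -
    have "((\<lambda>q. ((norm p)\<^sup>2 / (2 * m) + W q) * (1 / N)) has_derivative (\<lambda>k. (0 + grad W q \<bullet> k) * (1 / N))) (at q)"
      by (intro has_derivative_mult_left has_derivative_add has_derivative_const smooth_grad[OF W])
    then show ?thesis by (simp add: h_def)
  qed
  have Dz: "((\<lambda>q. z q) has_derivative (\<lambda>k. (2 * (q \<bullet> k)) / R\<^sup>2)) (at q)" for q
  proof -
    have "((\<lambda>q. (norm q)\<^sup>2 * (1 / R\<^sup>2)) has_derivative (\<lambda>k. 2 * (q \<bullet> k) * (1 / R\<^sup>2))) (at q)"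
      by (intro has_derivative_mult_left Dsq)
    then show ?thesis by (simp add: z_def)
  qed
  have tr: "truncated m \<zeta> \<Theta> N R W (q, p) = \<zeta> (z q) * (N * \<Theta> (h q p))" for q p
    by (simp add: truncated_def h_def z_def)
  have gp: "grad (\<lambda>p'. truncated m \<zeta> \<Theta> N R W (q, p')) p = (\<zeta> (z q) * deriv \<Theta> (h q p)) *\<^sub>R (p /\<^sub>R m)" for p
  proof (rule grad_eqI)
    have "((\<lambda>p'. \<zeta> (z q) * (N * \<Theta> (h q p'))) has_derivative (\<lambda>k. \<zeta> (z q) * (N * ((p \<bullet> k) / (m * N) * deriv \<Theta> (h q p))))) (at p)"
      by (intro has_derivative_mult_right DERIV_compose_FDERIV[OF D\<Theta>(1)] Dh)
    then show "((\<lambda>p'. truncated m \<zeta> \<Theta> N R W (q, p')) has_derivative (\<lambda>k. ((\<zeta> (z q) * deriv \<Theta> (h q p)) *\<^sub>R (p /\<^sub>R m)) \<bullet> k)) (at p)"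
      unfolding tr using N by (simp add: field_simps)
  qed
  then show "grad_p (truncated m \<zeta> \<Theta> N R W) (q, p) = (\<zeta> (z q) * deriv \<Theta> (h q p)) *\<^sub>R (p /\<^sub>R m)"
    by (simp add: grad_p_def)
  have "grad (\<lambda>q'. truncated m \<zeta> \<Theta> N R W (q', p)) q =
     (N * \<Theta> (h q p) * (deriv \<zeta> (z q) * (2 / R\<^sup>2))) *\<^sub>R q + (\<zeta> (z q) * deriv \<Theta> (h q p)) *\<^sub>R grad W q"
  proof (rule grad_eqI)
    have "((\<lambda>q'. \<zeta> (z q') * (N * \<Theta> (h q' p))) has_derivative
       (\<lambda>k. \<zeta> (z q) * (N * ((grad W q \<bullet> k) / N * deriv \<Theta> (h q p))) + (2 * (q \<bullet> k)) / R\<^sup>2 * deriv \<zeta> (z q) * (N * \<Theta> (h q p)))) (at q)"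
      by (intro has_derivative_mult has_derivative_mult_right DERIV_compose_FDERIV[OF D\<Theta>(1)] DERIV_compose_FDERIV[OF D\<zeta>] Dhq Dz)
    then show "((\<lambda>q'. truncated m \<zeta> \<Theta> N R W (q', p)) has_derivative
       (\<lambda>k. ((N * \<Theta> (h q p) * (deriv \<zeta> (z q) * (2 / R\<^sup>2))) *\<^sub>R q + (\<zeta> (z q) * deriv \<Theta> (h q p)) *\<^sub>R grad W q) \<bullet> k)) (at q)"
      unfolding tr using N by (simp add: inner_add_left mult_ac add.commute)
  qed
  then show "grad_q (truncated m \<zeta> \<Theta> N R W) (q, p) =
       (N * \<Theta> (h q p) * (deriv \<zeta> (z q) * (2 / R\<^sup>2))) *\<^sub>R q + (\<zeta> (z q) * deriv \<Theta> (h q p)) *\<^sub>R grad W q"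
    by (simp add: grad_q_def)
  have lap: "partials [b, b] (\<lambda>p'. truncated m \<zeta> \<Theta> N R W (q, p')) p =
     \<zeta> (z q) * (deriv (deriv \<Theta>) (h q p) * (p \<bullet> b)\<^sup>2 / (N * m\<^sup>2) + deriv \<Theta> (h q p) / m)" if b: "b \<in> Basis" for b
  proof -
    have "partials [b] (\<lambda>p'. truncated m \<zeta> \<Theta> N R W (q, p')) = (\<lambda>p. \<zeta> (z q) / m * (deriv \<Theta> (h q p) * (p \<bullet> b)))"
      unfolding grad_inner_Basis[OF b, symmetric] gp by (simp add: fun_eq_iff divide_inverse)
    moreover have "((\<lambda>p. \<zeta> (z q) / m * (deriv \<Theta> (h q p) * (p \<bullet> b))) has_derivative
       (\<lambda>k. \<zeta> (z q) / m * (deriv \<Theta> (h q p) * (k \<bullet> b) + (p \<bullet> k) / (m * N) * deriv (deriv \<Theta>) (h q p) * (p \<bullet> b)))) (at p)"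
      by (intro has_derivative_mult_right has_derivative_mult DERIV_compose_FDERIV[OF D\<Theta>(2)] Dh
        bounded_linear_imp_has_derivative bounded_linear_inner_left)
    ultimately have "partials [b, b] (\<lambda>p'. truncated m \<zeta> \<Theta> N R W (q, p')) p =
      \<zeta> (z q) / m * (deriv \<Theta> (h q p) * (b \<bullet> b) + (p \<bullet> b) / (m * N) * deriv (deriv \<Theta>) (h q p) * (p \<bullet> b))"
      by (simp add: frechet_derivative_at[symmetric])
    also have "\<dots> = \<zeta> (z q) * (deriv (deriv \<Theta>) (h q p) * (p \<bullet> b)\<^sup>2 / (N * m\<^sup>2) + deriv \<Theta> (h q p) / m)"
      using b N m by (simp add: inner_Basis field_simps power2_eq_square)
    finally show ?thesis .
  qed
  have "(\<Sum>b\<in>Basis. (p \<bullet> b)\<^sup>2) = p \<bullet> p" unfolding euclidean_inner[of p p] power2_eq_square ..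
  then have "(\<Sum>b\<in>Basis. (p \<bullet> b)\<^sup>2) = (norm p)\<^sup>2" by (simp add: power2_norm_eq_inner)
  then show "laplacian_p (truncated m \<zeta> \<Theta> N R W) (q, p) =
       \<zeta> (z q) * (deriv (deriv \<Theta>) (h q p) * (norm p)\<^sup>2 / (N * m\<^sup>2) + deriv \<Theta> (h q p) * real CARD('d) / m)"
    unfolding laplacian_p_def laplacian_def using lap
    by (simp add: sum_distrib_left[symmetric] sum.distrib sum_divide_distrib[symmetric] mult.commute[of _ "real CARD('d)"] del: partials.simps)
qed

lemma tail_small:
  assumes \<nu>: "\<nu> \<in> P2" and "\<epsilon> > 0"
  shows "\<exists>k0::nat. \<forall>k\<ge>k0. measure \<nu> {x. norm (fst x) > real k} < \<epsilon>"
proof -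
  interpret prob_space \<nu> by (rule P2_D[OF \<nu>])
  let ?A = "\<lambda>k::nat. {x::'a phase. norm (fst x) > real k}"
  have "(\<lambda>k. measure \<nu> (?A k)) \<longlonglongrightarrow> measure \<nu> (\<Inter>k. ?A k)"
  proof (rule finite_Lim_measure_decseq)
    have "continuous_on UNIV (\<lambda>x::'a phase. norm (fst x))" by (intro continuous_intros)
    then have "?A k \<in> sets borel" for k by (intro borel_open open_Collect_less continuous_on_const)
    then show "range ?A \<subseteq> sets \<nu>" using P2_D(2)[OF \<nu>] by auto
    show "decseq ?A" by (auto simp: decseq_def intro: order.strict_trans1)
  qed
  moreover have "(\<Inter>k. ?A k) = {}" 
  proof -
    have "\<exists>k. \<not> norm (fst x) > real k" for x :: "'a phase"
      using real_arch_simple[of "norm (fst x)"] by (auto simp: not_less)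
    then show ?thesis by blast
  qed
  ultimately have "(\<lambda>k. measure \<nu> (?A k)) \<longlonglongrightarrow> 0" by simp
  then have "\<forall>\<^sub>F k in sequentially. measure \<nu> (?A k) < \<epsilon>" using \<open>\<epsilon> > 0\<close> by (rule order_tendstoD)
  then show ?thesis by (simp add: eventually_sequentially)
qed

context vfp begin

text \<open>The terms bound, in this order, the second derivative of the energy cutoff, on whose
  support \<open>|p|^2 \<le> 4 m N\<close>, its first derivative times the dimension, and the
  transport of the spatial cutoff.\<close>

definition remainder_bound :: "real \<Rightarrow> real" where
  "remainder_bound K = \<gamma> * \<theta> * (K * 4 / m + K * real CARD('d) / m) + 8 * K * (1 + 4 * m) / m"

text \<open>\<open>c\<close> is the weight in \<open>grad_p f = c p/m\<close>, \<open>u\<close> the mollification error of the gradient of \<open>W\<close>,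
  \<open>\<phi>\<close> the truncated energy; \<open>\<nu>1\<close> and \<open>\<nu>2\<close> determine the radius of the spatial cutoff.\<close>

lemma truncation_sequence:
  assumes cut: "spatial_cutoff K \<zeta>" "energy_cutoff K \<Theta>"
    and W: "lipschitz_grad L W G" "\<And>q. W q \<ge> 0" and \<nu>1: "\<nu>1 \<in> P2" and \<nu>2: "\<nu>2 \<in> P2"
  obtains f :: "nat \<Rightarrow> 'd phase \<Rightarrow> real" and c \<phi> rem u r where "K \<ge> 1" "remainder_bound K \<ge> 0"
    "\<And>n. f n \<in> test_functions"
    "\<And>n x. grad_p (f n) x = c n x *\<^sub>R (snd x /\<^sub>R m)" "\<And>n x. 0 \<le> c n x" "\<And>n x. c n x \<le> K"
    "\<And>n. continuous_on UNIV (c n)" "\<And>x. (\<lambda>n. c n x) \<longlonglongrightarrow> 1"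
    "\<And>n \<nu> x. gen \<nu> (f n) x = c n x * ((snd x /\<^sub>R m) \<bullet> (G (fst x) - grad V (fst x) - grad_conv \<psi> \<nu> (fst x) + u n (fst x))
       - \<gamma> * (norm (snd x))\<^sup>2 / m\<^sup>2) + rem n x"
    "\<And>n q. norm (u n q) \<le> 1" "\<And>q. (\<lambda>n. u n q) \<longlonglongrightarrow> 0"
    "\<And>n x. \<bar>rem n x\<bar> \<le> remainder_bound K" "\<And>x. (\<lambda>n. rem n x) \<longlonglongrightarrow> \<gamma> * \<theta> * real CARD('d) / m"
    "\<And>n x. f n x + 2 * real (Suc n) = \<phi> n x + r n x"
    "\<And>n. continuous_on UNIV (\<phi> n)" "\<And>n x. 0 \<le> \<phi> n x" "\<And>n x. \<phi> n x \<le> K * ((norm (snd x))\<^sup>2 / (2 * m) + W (fst x) + 2)"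
    "\<And>x. (\<lambda>n. \<phi> n x) \<longlonglongrightarrow> (norm (snd x))\<^sup>2 / (2 * m) + W (fst x)"
    "\<And>n. continuous_on UNIV (r n)" "\<And>n x. 0 \<le> r n x" "\<And>n x. r n x \<le> 2 * real (Suc n)"
    "\<And>n. (\<integral>x. r n x \<partial>\<nu>1) \<le> 1 / real (Suc n)" "\<And>n. (\<integral>x. r n x \<partial>\<nu>2) \<le> 1 / real (Suc n)"
proof -
  have \<zeta>: "smooth \<zeta>" "\<And>s. s \<le> 1 \<Longrightarrow> \<zeta> s = 1" "\<And>s. s \<ge> 2 \<Longrightarrow> \<zeta> s = 0" "\<And>s. 0 \<le> \<zeta> s" "\<And>s. \<zeta> s \<le> 1"
    "\<And>s. \<bar>deriv \<zeta> s\<bar> \<le> K" "\<And>s. s \<ge> 2 \<Longrightarrow> deriv \<zeta> s = 0"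
    using cut(1) by (simp_all add: spatial_cutoff_def)
  have \<Theta>: "smooth \<Theta>" "1 \<le> K" "\<And>h. h \<le> 1 \<Longrightarrow> \<Theta> h = h - 2" "\<And>h. h \<ge> 2 \<Longrightarrow> \<Theta> h = 0" "mono \<Theta>"
    "\<And>h. 0 \<le> deriv \<Theta> h" "\<And>h. deriv \<Theta> h \<le> K" "\<And>h. \<bar>deriv (deriv \<Theta>) h\<bar> \<le> K"
    "\<And>h. h \<ge> 2 \<Longrightarrow> deriv \<Theta> h = 0" "\<And>h. h \<ge> 2 \<Longrightarrow> deriv (deriv \<Theta>) h = 0"
    "\<And>h. h < 1 \<Longrightarrow> deriv \<Theta> h = 1" "\<And>h. h < 1 \<Longrightarrow> deriv (deriv \<Theta>) h = 0"
    using cut(2) by (simp_all add: energy_cutoff_def)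
  have L0: "L \<ge> 0" by (rule lipschitz_grad_neg_inner_le(1)[OF W(1)])
  define N where "N n = real (Suc n)" for n
  have N: "N n > 0" "N n \<ge> 1" for n by (auto simp: N_def)
  \<comment> \<open>Adding the bound on the mollification error puts \<open>W'\<close> above
    \<open>W\<close>, so that the smoothed energy stays nonnegative; the choice of \<epsilon> makes
    the errors of value and gradient of order \<open>1/N\<close>.\<close>
  have exW: "\<exists>W'. smooth W' \<and> (\<forall>q. W q \<le> W' q \<and> W' q \<le> W q + 2 / N n \<and> norm (grad W' q - G q) \<le> 1 / N n)" for n
  proof -
    define \<epsilon> where "\<epsilon> = 1 / ((L + 1) * N n)"
    have LN: "1 \<le> (L + 1) * N n" using mult_mono[of 1 "L + 1" 1 "N n"] L0 N(2)[of n] by simp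
    have \<epsilon>: "\<epsilon> > 0" "\<epsilon> \<le> 1" using LN by (auto simp: \<epsilon>_def)
    have "L * \<epsilon> = L / (L + 1) * (1 / N n)" by (simp add: \<epsilon>_def)
    also have "\<dots> \<le> 1 * (1 / N n)" using L0 N(1)[of n] by (intro mult_right_mono) auto
    finally have L\<epsilon>: "L * \<epsilon> \<le> 1 / N n" by simp
    note \<epsilon> = \<epsilon>(1) L\<epsilon> \<epsilon>(2)
    have \<epsilon>2: "L * \<epsilon>\<^sup>2 \<le> 1 / N n"
      using mult_mono[OF \<epsilon>(2) \<epsilon>(3)] \<epsilon>(1) L0 N[of n] by (simp add: power2_eq_square mult.assoc)
    obtain W0 where W0: "smooth W0" "\<And>q. \<bar>W0 q - W q\<bar> \<le> L * \<epsilon>\<^sup>2" "\<And>q. norm (grad W0 q - G q) \<le> L * \<epsilon>"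
      using smooth_approximation[OF W(1) \<epsilon>(1)] by blast
    show ?thesis
    proof (intro exI[of _ "\<lambda>q. W0 q + L * \<epsilon>\<^sup>2"] conjI allI)
      show "smooth (\<lambda>q. W0 q + L * \<epsilon>\<^sup>2)" using W0(1) by auto
      fix q
      show "W q \<le> W0 q + L * \<epsilon>\<^sup>2" "W0 q + L * \<epsilon>\<^sup>2 \<le> W q + 2 / N n" using W0(2)[of q] \<epsilon>2 by (auto simp: abs_le_iff)
      have "((\<lambda>q. W0 q + L * \<epsilon>\<^sup>2) has_derivative (\<lambda>h. grad W0 q \<bullet> h)) (at q)"
        using smooth_grad[OF W0(1)] by (auto intro!: derivative_eq_intros)
      then have "grad (\<lambda>q. W0 q + L * \<epsilon>\<^sup>2) q = grad W0 q" by (rule grad_eqI)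
      then show "norm (grad (\<lambda>q. W0 q + L * \<epsilon>\<^sup>2) q - G q) \<le> 1 / N n" using W0(3)[of q] \<epsilon>(2) by simp
    qed
  qed
  define W' where "W' n = (SOME W'. smooth W' \<and> (\<forall>q. W q \<le> W' q \<and> W' q \<le> W q + 2 / N n \<and> norm (grad W' q - G q) \<le> 1 / N n))" for n
  have W': "smooth (W' n)" "W q \<le> W' n q" "W' n q \<le> W q + 2 / N n" "norm (grad (W' n) q - G q) \<le> 1 / N n" for n q
    using someI_ex[OF exW[of n], folded W'_def] by auto
  \<comment> \<open>The tail bound makes the loss \<open>r\<close>, of size at most
    \<open>2 N\<close>, cost no more than \<open>1/N\<close>. A radius of at least
    \<open>N^3\<close> beats the transport of the spatial cutoff, which is of order
    \<open>N^2/R\<close>.\<close>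
  have "\<exists>k::nat. (N n)^3 \<le> real k \<and> measure \<nu>1 {x. norm (fst x) > real k} \<le> 1 / (2 * (N n)\<^sup>2) \<and>
      measure \<nu>2 {x. norm (fst x) > real k} \<le> 1 / (2 * (N n)\<^sup>2)" for n
  proof -
    have e: "1 / (2 * (N n)\<^sup>2) > 0" using N(1)[of n] by simp
    obtain k1 where k1: "\<And>k. k \<ge> k1 \<Longrightarrow> measure \<nu>1 {x. norm (fst x) > real k} < 1 / (2 * (N n)\<^sup>2)" using tail_small[OF \<nu>1 e] by blast
    obtain k2 where k2: "\<And>k. k \<ge> k2 \<Longrightarrow> measure \<nu>2 {x. norm (fst x) > real k} < 1 / (2 * (N n)\<^sup>2)" using tail_small[OF \<nu>2 e] by blast
    obtain k3 where k3: "(N n)^3 \<le> real k3" using real_arch_simple by blast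
    show ?thesis
      by (intro exI[of _ "max k1 (max k2 k3)"] conjI less_imp_le[OF k1] less_imp_le[OF k2] order_trans[OF k3]) simp_all
  qed
  then obtain k where k: "\<And>n. (N n)^3 \<le> real (k n)" "\<And>n. measure \<nu>1 {x. norm (fst x) > real (k n)} \<le> 1 / (2 * (N n)\<^sup>2)"
      "\<And>n. measure \<nu>2 {x. norm (fst x) > real (k n)} \<le> 1 / (2 * (N n)\<^sup>2)" by metis
  define R where "R n = real (k n)" for n
  have RN: "R n \<ge> (N n)^3" for n using k by (simp add: R_def)
  have N13: "1 \<le> (N n)^3" "N n \<le> (N n)^3" for n
    using N(2)[of n] power_increasing[of 1 3 "N n"] one_le_power[of "N n" 3] by auto
  have R1: "R n \<ge> 1" "R n \<ge> N n" for n using RN[of n] N13[of n] by linarith+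
  define f where "f n = (truncated m \<zeta> \<Theta> (N n) (R n) (W' n) :: 'd phase \<Rightarrow> real)" for n
  define z where "z n x = \<zeta> ((norm (fst x))\<^sup>2 / (R n)\<^sup>2)" for n and x :: "'d phase"
  define h where "h n x = (norm (snd x))\<^sup>2 / (2 * m) + W' n (fst x)" for n and x :: "'d phase"
  define H where "H x = (norm (snd x))\<^sup>2 / (2 * m) + W (fst x)" for x :: "'d phase"
  have W'0: "0 \<le> W' n q" for n q using W(2)[of q] W'(2)[of q n] by linarith
  have p2: "0 \<le> (norm (snd x))\<^sup>2 / (2 * m)" for x :: "'d phase" using m by simp
  have h0: "0 \<le> h n x" for n x using p2[of x] W'0[of n "fst x"] unfolding h_def by linarith
  have hH: "H x \<le> h n x" "h n x \<le> H x + 2 / N n" for n x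
    using W'(2,3) by (auto simp: h_def H_def add.assoc)
  have N2: "2 / N n \<le> 2" for n using N[of n] by (simp add: field_simps)
  define c where "c n x = z n x * deriv \<Theta> (h n x / N n)" for n x
  define rem where "rem n x = \<gamma> * \<theta> * (z n x * (deriv (deriv \<Theta>) (h n x / N n) * (norm (snd x))\<^sup>2 / (N n * m\<^sup>2) +
      deriv \<Theta> (h n x / N n) * real CARD('d) / m)) +
      N n * \<Theta> (h n x / N n) * (deriv \<zeta> ((norm (fst x))\<^sup>2 / (R n)\<^sup>2) * (2 / (R n)\<^sup>2)) * ((snd x /\<^sub>R m) \<bullet> fst x)" for n x
  define \<phi> where "\<phi> n x = z n x * (N n * (\<Theta> (h n x / N n) + 2))" for n x
  \<comment> \<open>Outside the spatial cutoff \<open>f\<close> is 0 where the energy truncation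
    would start from \<open>-2 N\<close>; \<open>r\<close> collects this discrepancy, and
    \<open>\<phi>\<close> is the nonnegative part that converges to the energy.\<close>
  define r where "r n x = 2 * N n * (1 - z n x)" for n x
  have z01: "0 \<le> z n x" "z n x \<le> 1" for n x using \<zeta>(4,5) by (simp_all add: z_def)
  have z1: "z n x = 1" if "norm (fst x) \<le> R n" for n x
  proof -
    have "(norm (fst x))\<^sup>2 \<le> (R n)\<^sup>2" using that by (intro power_mono) auto
    then have "(norm (fst x))\<^sup>2 / (R n)\<^sup>2 \<le> 1" using R1[of n] by (simp add: divide_le_eq_1)
    then show ?thesis using \<zeta>(2) by (simp add: z_def)
  qed
  have q2R: "norm (fst x) \<le> 2 * R n" if "(norm (fst x))\<^sup>2 / (R n)\<^sup>2 < 2" for n and x :: "'d phase"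
  proof -
    have "(norm (fst x))\<^sup>2 < 2 * (R n)\<^sup>2" using that R1(1)[of n] by (simp add: divide_less_eq)
    moreover have "(2 * R n)\<^sup>2 = 4 * (R n)\<^sup>2" by (simp add: power_mult_distrib)
    ultimately have "(norm (fst x))\<^sup>2 \<le> (2 * R n)\<^sup>2" using zero_le_power2[of "R n"] by linarith
    then show ?thesis by (rule power2_le_imp_le) (use R1(1)[of n] in simp)
  qed
  have fx: "f n x = z n x * (N n * \<Theta> (h n x / N n))" for n x by (simp add: f_def truncated_def z_def h_def)
  have gp: "grad_p (f n) x = c n x *\<^sub>R (snd x /\<^sub>R m)" for n x
    using truncated_derivatives(1)[OF \<zeta>(1) \<Theta>(1) W'(1)[of n] N(1)[of n] m, where R="R n" and q="fst x" and p="snd x"] by (simp add: f_def c_def z_def h_def)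
  have gq: "grad_q (f n) x = (N n * \<Theta> (h n x / N n) * (deriv \<zeta> ((norm (fst x))\<^sup>2 / (R n)\<^sup>2) * (2 / (R n)\<^sup>2))) *\<^sub>R fst x + c n x *\<^sub>R grad (W' n) (fst x)" for n x
    using truncated_derivatives(2)[OF \<zeta>(1) \<Theta>(1) W'(1)[of n] N(1)[of n] m, where R="R n" and q="fst x" and p="snd x"] by (simp add: f_def c_def z_def h_def)
  have lp: "laplacian_p (f n) x = z n x * (deriv (deriv \<Theta>) (h n x / N n) * (norm (snd x))\<^sup>2 / (N n * m\<^sup>2) + deriv \<Theta> (h n x / N n) * real CARD('d) / m)" for n x
    using truncated_derivatives(3)[OF \<zeta>(1) \<Theta>(1) W'(1)[of n] N(1)[of n] m, where R="R n" and q="fst x" and p="snd x"] by (simp add: f_def z_def h_def)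
  have sf: "smooth (f n)" for n unfolding f_def by (rule smooth_truncated[OF \<zeta>(1) \<Theta>(1) W'(1)])
  have pN: "(norm (snd x))\<^sup>2 \<le> 4 * m * N n" if "h n x < 2 * N n" for n x
  proof -
    have "(norm (snd x))\<^sup>2 / (2 * m) \<le> 2 * N n" using that W'0[of n "fst x"] by (simp add: h_def)
    then show ?thesis using m by (simp add: field_simps)
  qed
  have tf: "f n \<in> test_functions" for n
  proof (rule test_functionsI[OF sf])
    fix x :: "'d phase" assume x: "norm x > 2 * R n + (1 + 4 * m * N n)"
    show "f n x = 0"
    proof (rule ccontr)
      assume "f n x \<noteq> 0"
      then have nz: "z n x \<noteq> 0" "\<Theta> (h n x / N n) \<noteq> 0" by (auto simp: fx)
      then have "(norm (fst x))\<^sup>2 / (R n)\<^sup>2 < 2" "h n x / N n < 2" using \<zeta>(3) \<Theta>(4) by (auto simp: z_def not_le[symmetric])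
      then have "norm (fst x) \<le> 2 * R n" "(norm (snd x))\<^sup>2 \<le> 4 * m * N n" using q2R pN N(1)[of n] by (auto simp: field_simps)
      moreover have "norm (snd x) \<le> 1 + (norm (snd x))\<^sup>2" using sum_squares_bound[of 1 "norm (snd x)"] by (simp, use norm_ge_zero[of "snd x"] in linarith)
      moreover have "norm x \<le> norm (fst x) + norm (snd x)" using norm_Pair_le[of "fst x" "snd x"] by simp
      ultimately show False using x by linarith
    qed
  qed
  have c0: "0 \<le> c n x" "c n x \<le> K" for n x
  proof -
    show "0 \<le> c n x" unfolding c_def using z01 \<Theta>(6) by (intro mult_nonneg_nonneg)
    have "c n x \<le> 1 * K" unfolding c_def using z01 \<Theta>(6,7,2) by (intro mult_mono) auto
    then show "c n x \<le> K" by simp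
  qed
  have cz: "continuous_on UNIV (z n)" for n unfolding z_def
    by (intro continuous_on_compose2[OF smooth_continuous_on[OF \<zeta>(1), of UNIV]] continuous_intros) (use R1(1)[of n] in auto)
  have ch: "continuous_on UNIV (\<lambda>x. h n x / N n)" for n unfolding h_def
    by (intro continuous_intros continuous_on_compose2[OF smooth_continuous_on[OF W'(1), of UNIV]]) (use N(1)[of n] m in auto)
  have cc: "continuous_on UNIV (c n)" for n unfolding c_def
    by (intro continuous_on_mult cz continuous_on_compose2[OF smooth_continuous_on[OF smooth_real_derivative(2)[OF \<Theta>(1)], of UNIV] ch]) auto
  have c\<phi>: "continuous_on UNIV (\<phi> n)" for n unfolding \<phi>_def
    by (intro continuous_on_mult continuous_on_add continuous_on_const cz continuous_on_compose2[OF smooth_continuous_on[OF \<Theta>(1), of UNIV] ch]) auto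
  have gen: "gen \<nu> (f n) x = c n x * ((snd x /\<^sub>R m) \<bullet> (G (fst x) - grad V (fst x) - grad_conv \<psi> \<nu> (fst x) + (grad (W' n) (fst x) - G (fst x)))
       - \<gamma> * (norm (snd x))\<^sup>2 / m\<^sup>2) + rem n x" for n \<nu> x
  proof -
    have sq: "(snd x /\<^sub>R m) \<bullet> (snd x /\<^sub>R m) = (norm (snd x))\<^sup>2 / m\<^sup>2"
      unfolding power2_norm_eq_inner by (simp add: power2_eq_square divide_inverse)
    show ?thesis unfolding gen_eq gp gq lp rem_def
      by (simp only: inner_add_left inner_add_right inner_diff_right inner_scaleR_left[of "\<gamma>"] inner_scaleR_right[of _ "c n x"]
        inner_scaleR_right[of _ "N n * \<Theta> (h n x / N n) * (deriv \<zeta> ((norm (fst x))\<^sup>2 / (R n)\<^sup>2) * (2 / (R n)\<^sup>2))"] sq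
        inner_commute[of _ "snd x /\<^sub>R m"]) (simp add: algebra_simps sq power2_norm_eq_inner[of "snd x"] divide_inverse power2_eq_square[of m])
  qed
  define C2 where "C2 = 8 * K * (1 + 4 * m) / m"
  have C2: "C2 \<ge> 0" using \<Theta>(2) m by (simp add: C2_def)
  define t2 where "t2 n x = N n * \<Theta> (h n x / N n) * (deriv \<zeta> ((norm (fst x))\<^sup>2 / (R n)\<^sup>2) * (2 / (R n)\<^sup>2)) * ((snd x /\<^sub>R m) \<bullet> fst x)" for n x
  have \<Theta>b: "- 2 \<le> \<Theta> s" "\<Theta> s \<le> 0" if "s \<ge> 0" for s
    using monoD[OF \<Theta>(5) that] \<Theta>(3)[of 0] monoD[OF \<Theta>(5), of s "max 2 s"] \<Theta>(4)[of "max 2 s"] by auto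
  have hN0: "0 \<le> h n x / N n" for n x using h0[of n x] N(1)[of n] by simp
  \<comment> \<open>The term vanishes unless the point lies in the support of both cutoffs; there
    \<open>|q| \<le> 2 R\<close> and \<open>|p| \<le> (1 + 4 m) N\<close>, and the spatial cutoff
    contributes \<open>2/R^2\<close>.\<close>
  have t2b: "\<bar>t2 n x\<bar> \<le> C2 / N n" for n x
  proof (cases "h n x < 2 * N n \<and> (norm (fst x))\<^sup>2 / (R n)\<^sup>2 < 2")
    case False
    then have "2 \<le> h n x / N n \<or> 2 \<le> (norm (fst x))\<^sup>2 / (R n)\<^sup>2" using N(1)[of n] by (auto simp: field_simps not_less)
    then have "t2 n x = 0" using \<Theta>(4) \<zeta>(7) unfolding t2_def by (elim disjE) simp_all
    then show ?thesis using C2 N(1)[of n] by simp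
  next
    case True
    have "norm (snd x) \<le> 1 + (norm (snd x))\<^sup>2" using sum_squares_bound[of 1 "norm (snd x)"] by (simp, use norm_ge_zero[of "snd x"] in linarith)
    also have "\<dots> \<le> N n + 4 * m * N n" using pN[of n x] True N(2)[of n] by linarith
    finally have p: "norm (snd x) \<le> (1 + 4 * m) * N n" by (simp add: algebra_simps)
    have ip: "\<bar>(snd x /\<^sub>R m) \<bullet> fst x\<bar> \<le> ((1 + 4 * m) * N n) / m * (2 * R n)"
    proof -
      have "\<bar>(snd x /\<^sub>R m) \<bullet> fst x\<bar> \<le> norm (snd x /\<^sub>R m) * norm (fst x)" by (rule Cauchy_Schwarz_ineq2)
      also have "\<dots> \<le> ((1 + 4 * m) * N n) / m * (2 * R n)"
        using p q2R True m N(1)[of n] by (intro mult_mono) (auto simp: field_simps)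
      finally show ?thesis .
    qed
    have th: "\<bar>\<Theta> (h n x / N n)\<bar> \<le> 2" using \<Theta>b[OF hN0[of n x]] by (simp add: abs_le_iff)
    have "\<bar>t2 n x\<bar> = N n * \<bar>\<Theta> (h n x / N n)\<bar> * (\<bar>deriv \<zeta> ((norm (fst x))\<^sup>2 / (R n)\<^sup>2)\<bar> * (2 / (R n)\<^sup>2)) * \<bar>(snd x /\<^sub>R m) \<bullet> fst x\<bar>"
      using N(1)[of n] by (simp add: t2_def abs_mult)
    also have "\<dots> \<le> N n * 2 * (K * (2 / (R n)\<^sup>2)) * (((1 + 4 * m) * N n) / m * (2 * R n))"
      using N(1)[of n] R1(1)[of n] \<Theta>(2) th ip \<zeta>(6) by (intro mult_mono) (auto intro!: mult_nonneg_nonneg)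
    also have "\<dots> = C2 * ((N n)\<^sup>2 / R n)" using R1(1)[of n] m by (simp add: C2_def field_simps power2_eq_square)
    also have "\<dots> \<le> C2 * (1 / N n)"
    proof (rule mult_left_mono[OF _ C2])
      show "(N n)\<^sup>2 / R n \<le> 1 / N n" using RN[of n] N(1)[of n] R1(1)[of n] by (simp add: field_simps power2_eq_square power3_eq_cube)
    qed
    finally show ?thesis by simp
  qed
  define C where "C = remainder_bound K"
  note C_def0 = C_def
  note C_def = C_def[unfolded remainder_bound_def C2_def[symmetric]]
  have C0: "C \<ge> 0" unfolding C_def using \<gamma> \<theta> m \<Theta>(2) C2 by (intro add_nonneg_nonneg mult_nonneg_nonneg) auto
  have remb: "\<bar>rem n x\<bar> \<le> C" for n x
  proof -
    have "C2 / N n \<le> C2" using C2 N[of n] by (simp add: divide_le_eq mult_le_cancel_left1)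
    then have t2C: "\<bar>t2 n x\<bar> \<le> C2" using t2b[of n x] by linarith
    have A: "\<bar>deriv (deriv \<Theta>) (h n x / N n) * (norm (snd x))\<^sup>2 / (N n * m\<^sup>2)\<bar> \<le> K * 4 / m"
    proof (cases "h n x < 2 * N n")
      case True
      have "\<bar>deriv (deriv \<Theta>) (h n x / N n) * (norm (snd x))\<^sup>2 / (N n * m\<^sup>2)\<bar> = \<bar>deriv (deriv \<Theta>) (h n x / N n)\<bar> * ((norm (snd x))\<^sup>2 / (N n * m\<^sup>2))"
        using N(1)[of n] by (simp add: abs_mult)
      also have "\<dots> \<le> K * ((4 * m * N n) / (N n * m\<^sup>2))"
        using pN[OF True] \<Theta>(8) N(1)[of n] \<Theta>(2) by (intro mult_mono divide_right_mono) auto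
      also have "\<dots> = K * 4 / m" using N(1)[of n] m by (simp add: field_simps power2_eq_square)
      finally show ?thesis .
    next
      case False
      then have "2 \<le> h n x / N n" using N(1)[of n] by (simp add: field_simps)
      then show ?thesis using \<Theta>(10,2) m by simp
    qed
    have B: "\<bar>deriv \<Theta> (h n x / N n) * real CARD('d) / m\<bar> \<le> K * real CARD('d) / m"
      using \<Theta>(6,7) m by (simp add: abs_mult divide_right_mono mult_right_mono)
    have "\<bar>z n x * (deriv (deriv \<Theta>) (h n x / N n) * (norm (snd x))\<^sup>2 / (N n * m\<^sup>2) + deriv \<Theta> (h n x / N n) * real CARD('d) / m)\<bar>
      \<le> 1 * (K * 4 / m + K * real CARD('d) / m)"
      unfolding abs_mult using z01[of n x] by (intro mult_mono order_trans[OF abs_triangle_ineq add_mono[OF A B]]) auto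
    from mult_left_mono[OF this, of "\<gamma> * \<theta>"] have "\<bar>\<gamma> * \<theta> * (z n x * (deriv (deriv \<Theta>) (h n x / N n) * (norm (snd x))\<^sup>2 / (N n * m\<^sup>2) + deriv \<Theta> (h n x / N n) * real CARD('d) / m))\<bar>
      \<le> \<gamma> * \<theta> * (K * 4 / m + K * real CARD('d) / m)"
      using \<gamma> \<theta> unfolding abs_mult by simp
    then show ?thesis using t2C unfolding rem_def t2_def[symmetric] C_def by linarith
  qed
  have lim1: "(\<lambda>n. B / N n) \<longlonglongrightarrow> 0" for B :: real
    using tendsto_mult_right_zero[OF LIMSEQ_inverse_real_of_nat, of B] by (simp add: N_def divide_inverse)
  \<comment> \<open>At a fixed point both cutoffs are inactive for large \<open>n\<close>, so the
    limits are those of the untruncated expressions.\<close>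
  have ev: "\<forall>\<^sub>F n in sequentially. z n x = 1 \<and> h n x / N n < 1" for x
  proof -
    obtain n0 :: nat where n0: "H x + 2 + norm (fst x) < real n0" using reals_Archimedean2 by blast
    have Hx: "0 \<le> H x" unfolding H_def using p2[of x] W(2)[of "fst x"] by linarith
    have "z n x = 1 \<and> h n x / N n < 1" if "n \<ge> n0" for n
    proof -
      have "H x + 2 + norm (fst x) < N n" using n0 that by (simp add: N_def)
      then have "norm (fst x) \<le> R n" "h n x < N n" using R1(2)[of n] hH(2)[of n x] N2[of n] Hx norm_ge_zero[of "fst x"] by linarith+
      then show ?thesis using z1 N(1)[of n] by simp
    qed
    then show ?thesis unfolding eventually_sequentially by blast
  qed
  have rb: "0 \<le> r n x" "r n x \<le> 2 * N n" for n x
    using z01[of n x] N(1)[of n] mult_left_mono[of "1 - z n x" 1 "2 * N n"] by (auto simp: r_def)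
  have \<nu>r: "(\<integral>x. r n x \<partial>\<nu>) \<le> 1 / real (Suc n)" if \<nu>: "\<nu> \<in> P2" and me: "measure \<nu> {x. norm (fst x) > real (k n)} \<le> 1 / (2 * (N n)\<^sup>2)" for n \<nu>
  proof -
    interpret prob_space \<nu> by (rule P2_D[OF \<nu>])
    let ?A = "{x::'d phase. norm (fst x) > real (k n)}"
    have A: "?A \<in> sets \<nu>" unfolding P2_D(2)[OF \<nu>]
      by (intro borel_open open_Collect_less continuous_intros)
    have "(\<integral>x. r n x \<partial>\<nu>) \<le> (\<integral>x. 2 * N n * indicator ?A x \<partial>\<nu>)"
    proof (rule integral_mono)
      show "integrable \<nu> (r n)"
      proof (rule P2_integrable_bounded[OF \<nu>, of _ "2 * N n"])
        show "r n \<in> borel_measurable borel" unfolding r_def by (intro borel_measurable_continuous_onI continuous_intros cz)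
        show "norm (r n x) \<le> 2 * N n" for x using rb[of n x] by simp
      qed
      show "integrable \<nu> (\<lambda>x. 2 * N n * indicator ?A x)" using A by (auto simp: less_top[symmetric])
      show "r n x \<le> 2 * N n * indicator ?A x" for x
        using z1[of x n] z01[of n x] N(1)[of n] by (cases "norm (fst x) \<le> R n") (auto simp: r_def R_def not_le mult_left_le)
    qed
    also have "\<dots> = 2 * N n * measure \<nu> ?A" using A by simp
    also have "\<dots> \<le> 2 * N n * (1 / (2 * (N n)\<^sup>2))" using me N(1)[of n] by (intro mult_left_mono) auto
    also have "\<dots> = 1 / real (Suc n)" unfolding N_def[symmetric] using N(1)[of n] by (simp add: field_simps power2_eq_square)
    finally show ?thesis .
  qed
  show ?thesis
  proof (rule that[of f c "\<lambda>n q. grad (W' n) q - G q" rem \<phi> r])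
    show "(\<lambda>n. c n x) \<longlonglongrightarrow> 1" for x
      by (rule tendsto_eventually) (use ev[of x] in \<open>eventually_elim, simp add: c_def \<Theta>(11)\<close>)
    show "norm (grad (W' n) q - G q) \<le> 1" for n q
    proof -
      have "1 / N n \<le> 1" using N[of n] by simp
      then show ?thesis using W'(4)[of n q] by linarith
    qed
    show "(\<lambda>n. grad (W' n) q - G q) \<longlonglongrightarrow> 0" for q
      by (rule Lim_null_comparison[OF _ lim1[of 1]]) (use W'(4) in simp)
    show "(\<lambda>n. rem n x) \<longlonglongrightarrow> \<gamma> * \<theta> * real CARD('d) / m" for x
    proof -
      have "(\<lambda>n. t2 n x) \<longlonglongrightarrow> 0" by (rule Lim_null_comparison[OF _ lim1[of C2]]) (use t2b in simp)
      then have "(\<lambda>n. \<gamma> * \<theta> * real CARD('d) / m + t2 n x) \<longlonglongrightarrow> \<gamma> * \<theta> * real CARD('d) / m + 0" by (intro tendsto_intros)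
      moreover have "\<forall>\<^sub>F n in sequentially. \<gamma> * \<theta> * real CARD('d) / m + t2 n x = rem n x"
        using ev[of x] by eventually_elim (simp add: rem_def t2_def \<Theta>(11,12))
      ultimately show ?thesis using Lim_transform_eventually by fastforce
    qed
    show "f n x + 2 * real (Suc n) = \<phi> n x + r n x" for n x
      by (simp add: fx \<phi>_def r_def N_def algebra_simps)
    show "0 \<le> \<phi> n x" for n x unfolding \<phi>_def using z01 N(1)[of n] \<Theta>b(1)[OF hN0[of n x]]
      by (intro mult_nonneg_nonneg) auto
    show "\<phi> n x \<le> K * ((norm (snd x))\<^sup>2 / (2 * m) + W (fst x) + 2)" for n x
    proof -
      \<comment> \<open>The left side is 0 at \<open>s = 0\<close> and has slope at most
        \<open>K\<close>.\<close>
      have "\<Theta> s + 2 \<le> K * s" if "s \<ge> 0" for s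
      proof -
        have "(K * 0 - \<Theta> 0) \<le> (K * s - \<Theta> s)"
        proof (rule DERIV_nonneg_imp_nondecreasing[OF that])
          fix y show "\<exists>d. ((\<lambda>s. K * s - \<Theta> s) has_real_derivative d) (at y) \<and> 0 \<le> d"
            by (rule exI[of _ "K - deriv \<Theta> y"]) (use \<Theta>(7) smooth_real_derivative(1)[OF \<Theta>(1)] in \<open>auto intro!: derivative_eq_intros\<close>)
        qed
        then show ?thesis using \<Theta>(3)[of 0] by simp
      qed
      from this[OF hN0[of n x]] have "N n * (\<Theta> (h n x / N n) + 2) \<le> N n * (K * (h n x / N n))" using N(1)[of n] by (intro mult_left_mono) auto
      also have "\<dots> = K * h n x" using N(1)[of n] by simp
      also have "\<dots> \<le> K * (H x + 2)" using hH(2)[of n x] N2[of n] \<Theta>(2) by (intro mult_left_mono) auto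
      finally have *: "N n * (\<Theta> (h n x / N n) + 2) \<le> K * (H x + 2)" .
      have "\<phi> n x \<le> 1 * (N n * (\<Theta> (h n x / N n) + 2))" unfolding \<phi>_def
        using z01[of n x] N(1)[of n] \<Theta>b(1)[OF hN0[of n x]] by (intro mult_right_mono) auto
      with * show ?thesis by (simp add: H_def)
    qed
    show "(\<lambda>n. \<phi> n x) \<longlonglongrightarrow> (norm (snd x))\<^sup>2 / (2 * m) + W (fst x)" for x
    proof -
      have "(\<lambda>n. h n x - H x) \<longlonglongrightarrow> 0"
        by (rule Lim_null_comparison[OF _ lim1[of 2]]) (use hH in \<open>auto simp: abs_le_iff algebra_simps\<close>)
      then have "(\<lambda>n. h n x) \<longlonglongrightarrow> H x" by (simp add: LIM_zero_cancel)
      moreover have "\<forall>\<^sub>F n in sequentially. h n x = \<phi> n x"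
        using ev[of x] by eventually_elim (use N(1) in \<open>simp add: \<phi>_def \<Theta>(3)\<close>, metis N(1) less_irrefl)
      ultimately show ?thesis unfolding H_def using Lim_transform_eventually by fastforce
    qed
    show "continuous_on UNIV (r n)" for n unfolding r_def by (intro continuous_intros cz)
    show "0 \<le> r n x" "r n x \<le> 2 * real (Suc n)" for n x using rb[of n x] by (simp_all only: N_def)
  qed (use \<Theta>(2) C0[unfolded C_def0] tf gp c0 cc gen remb[unfolded C_def0] c\<phi> \<nu>r[OF \<nu>1 k(2)] \<nu>r[OF \<nu>2 k(3)] in auto)
qed

end

section \<open>The defect of a curve\<close>

lemma kernel_integral_measurable:
  fixes F :: "'a \<Rightarrow> 'b \<Rightarrow> real"
  assumes F: "(\<lambda>(s, x). F s x) \<in> borel_measurable (M \<Otimes>\<^sub>M N)" and L: "L \<in> M \<rightarrow>\<^sub>M subprob_algebra N"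
    and int: "\<And>s. s \<in> space M \<Longrightarrow> integrable (L s) (F s)"
  shows "(\<lambda>s. \<integral>x. F s x \<partial>L s) \<in> borel_measurable M"
proof -
  have "(\<lambda>s. enn2real (\<integral>\<^sup>+x. ennreal (F s x) \<partial>L s) - enn2real (\<integral>\<^sup>+x. ennreal (- F s x) \<partial>L s)) \<in> borel_measurable M"
  proof (intro borel_measurable_diff borel_measurable_enn2real nn_integral_measurable_subprob_algebra2[where N=N] L)
    show "(\<lambda>(s, x). ennreal (F s x)) \<in> borel_measurable (M \<Otimes>\<^sub>M N)"
      "(\<lambda>(s, x). ennreal (- F s x)) \<in> borel_measurable (M \<Otimes>\<^sub>M N)"
      using F by (simp_all add: case_prod_unfold)
  qed
  then show ?thesis
    by (rule measurable_cong[THEN iffD1, rotated]) (simp add: int real_lebesgue_integral_def)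
qed

text \<open>A discriminant inequality. The hypothesis is asked for rational \<open>c\<close> because
  it comes from almost everywhere statements, of which countably many hold at once; it extends to
  real \<open>c\<close> by continuity.\<close>

lemma quadratic_bound_from_rationals:
  fixes a N D :: real
  assumes le: "\<And>c::rat. 2 * of_rat c * a - (of_rat c)\<^sup>2 * N \<le> D" and N: "N \<ge> 0"
  shows "a\<^sup>2 \<le> D * N"
proof -
  have all: "2 * c * a - c\<^sup>2 * N \<le> D" for c :: real
  proof (rule ccontr)
    assume "\<not> 2 * c * a - c\<^sup>2 * N \<le> D"
    moreover have "open {c::real. D < 2 * c * a - c\<^sup>2 * N}" by (intro open_Collect_less continuous_intros)
    ultimately obtain e where e: "e > 0" "ball c e \<subseteq> {c. D < 2 * c * a - c\<^sup>2 * N}"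
      unfolding open_contains_ball not_le by blast
    obtain r :: rat where "c < of_rat r" "of_rat r < c + e" using of_rat_dense[of c "c + e"] e(1) by auto
    then have "of_rat r \<in> ball c e" by (simp add: dist_real_def)
    from subsetD[OF e(2) this] show False using le[of r] by simp
  qed
  show ?thesis
  proof (cases "N = 0")
    case True
    have "a = 0"
    proof (rule ccontr)
      assume "a \<noteq> 0"
      then show False using all[of "(D + 1) / (2 * a)"] True by simp
    qed
    then show ?thesis using True by simp
  next
    case False
    then have "2 * (a / N) * a - (a / N)\<^sup>2 * N = a\<^sup>2 / N" by (simp add: power2_eq_square field_simps)
    then show ?thesis using all[of "a / N"] N False by (simp add: divide_le_eq)
  qed
qed

text \<open>Fatou's lemma. Integrability of the energy at positive times is obtained here rather
  than assumed.\<close>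

lemma integrable_of_bounded_limit:
  fixes \<phi> :: "nat \<Rightarrow> 'a \<Rightarrow> real"
  assumes int: "\<And>n. integrable M (\<phi> n)" and nn: "\<And>n x. 0 \<le> \<phi> n x" and lim: "\<And>x. (\<lambda>n. \<phi> n x) \<longlonglongrightarrow> H x"
    and B: "\<And>n. (\<integral>x. \<phi> n x \<partial>M) \<le> B"
  shows "integrable M H" "(\<integral>x. H x \<partial>M) \<le> B"
proof -
  have Hm: "H \<in> borel_measurable M" by (rule borel_measurable_LIMSEQ_real[OF lim]) (use int in auto)
  have H0: "0 \<le> H x" for x by (rule LIMSEQ_le_const[OF lim]) (use nn in auto)
  have "0 \<le> (\<integral>x. \<phi> 0 x \<partial>M)" by (rule Bochner_Integration.integral_nonneg) (rule nn)
  then have B0: "0 \<le> B" using B[of 0] by linarith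
  have "ennreal (H x) = liminf (\<lambda>n. ennreal (\<phi> n x))" for x
    by (rule lim_imp_Liminf[symmetric]) (auto intro: lim)
  then have "(\<integral>\<^sup>+x. ennreal (H x) \<partial>M) \<le> liminf (\<lambda>n. \<integral>\<^sup>+x. ennreal (\<phi> n x) \<partial>M)"
    using nn_integral_liminf[of "\<lambda>n x. ennreal (\<phi> n x)" M] int by auto
  also have "\<dots> \<le> ennreal B"
    by (rule Liminf_le) (use B nn int in \<open>auto simp: nn_integral_eq_integral intro!: always_eventually ennreal_leI\<close>)
  finally have le: "(\<integral>\<^sup>+x. ennreal (H x) \<partial>M) \<le> ennreal B" .
  then show i: "integrable M H" using Hm H0 by (intro integrableI_nonneg) (auto simp: less_top[symmetric] top_unique)
  show "(\<integral>x. H x \<partial>M) \<le> B" using le H0 B0 by (simp add: nn_integral_eq_integral[OF i] ennreal_le_iff)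
qed

locale vfp_curve = vfp m \<gamma> \<theta> V \<psi> LV L\<psi> C\<psi>
  for m \<gamma> \<theta> :: real and V \<psi> :: "real ^ 'd::finite \<Rightarrow> real" and LV L\<psi> C\<psi> :: real +
  fixes T :: real and \<rho> :: "real \<Rightarrow> 'd phase measure"
  assumes T: "T > 0" and \<rho>_P2: "\<And>t. t \<in> {0..T} \<Longrightarrow> \<rho> t \<in> P2" and \<rho>_AC: "AC_curve T prob_measures \<rho>"
begin

text \<open>The curve is continued by constants to all times, so that measurability can be stated on
  the whole line.\<close>

definition \<mu> :: "real \<Rightarrow> 'd phase measure" where
  "\<mu> t = \<rho> (max 0 (min T t))"

definition defect :: "real \<Rightarrow> 'd distrib" where
  "defect t f = time_deriv T \<rho> t f - generator_adjoint m \<gamma> \<theta> V \<psi> (\<rho> t) f"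

lemma \<mu>_eq: "t \<in> {0..T} \<Longrightarrow> \<mu> t = \<rho> t" by (simp add: \<mu>_def)

lemma \<mu>_P2: "\<mu> t \<in> P2" unfolding \<mu>_def by (rule \<rho>_P2) (use T in auto)

lemma \<mu>_kernel: "\<mu> \<in> borel \<rightarrow>\<^sub>M subprob_algebra borel"
  using AC_curve_kernel[OF \<rho>_AC] T unfolding \<mu>_def[abs_def] by (intro measurable_prob_algebraD) auto

lemma \<mu>_integral_measurable:
  fixes F :: "real \<Rightarrow> 'd phase \<Rightarrow> real"
  assumes "(\<lambda>(s, x). F s x) \<in> borel_measurable (borel \<Otimes>\<^sub>M borel)" "\<And>s. integrable (\<mu> s) (F s)"
  shows "(\<lambda>s. \<integral>x. F s x \<partial>\<mu> s) \<in> borel_measurable borel"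
  by (rule kernel_integral_measurable[OF assms(1) \<mu>_kernel assms(2)])

lemma grad_conv_\<mu>_measurable:
  "(\<lambda>(t, x). grad_conv \<psi> (\<mu> t) (fst x)) \<in> borel_measurable (borel \<Otimes>\<^sub>M (borel :: 'd phase measure))"
proof (rule borel_measurable_euclidean_space[THEN iffD2], intro ballI)
  fix b :: "real ^ 'd"
  have [measurable]: "grad \<psi> \<in> borel_measurable borel"
    by (intro borel_measurable_continuous_onI lipschitz_grad_continuous(2)[OF \<psi>(1)])
  have "(\<lambda>s. \<integral>y. grad \<psi> (fst (snd s) - fst y) \<bullet> b \<partial>\<mu> (fst s)) \<in> borel_measurable (borel \<Otimes>\<^sub>M (borel :: 'd phase measure))"
  proof (rule kernel_integral_measurable[where N=borel])
    have f[measurable]: "(fst :: 'd phase \<Rightarrow> _) \<in> borel_measurable borel" by (intro borel_measurable_continuous_onI continuous_intros)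
    show "(\<lambda>(s, y). grad \<psi> (fst (snd s) - fst y) \<bullet> b) \<in> borel_measurable ((borel \<Otimes>\<^sub>M (borel :: 'd phase measure)) \<Otimes>\<^sub>M (borel :: 'd phase measure))"
      by measurable
    show "(\<lambda>s. \<mu> (fst s)) \<in> borel \<Otimes>\<^sub>M (borel :: 'd phase measure) \<rightarrow>\<^sub>M subprob_algebra borel"
      using \<mu>_kernel by measurable
    show "integrable (\<mu> (fst s)) (\<lambda>y. grad \<psi> (fst (snd s) - fst y) \<bullet> b)" for s :: "real \<times> 'd phase"
      by (intro integrable_inner_left integrable_grad_\<psi> \<mu>_P2)
  qed
  moreover have "grad_conv \<psi> (\<mu> t) q \<bullet> b = (\<integral>y. grad \<psi> (q - fst y) \<bullet> b \<partial>\<mu> t)" for t q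
    unfolding grad_conv_eq by (rule integral_inner_left[symmetric]) (rule integrable_grad_\<psi>[OF \<mu>_P2])
  ultimately show "(\<lambda>s. (case s of (t, x) \<Rightarrow> grad_conv \<psi> (\<mu> t) (fst x)) \<bullet> b) \<in> borel_measurable (borel \<Otimes>\<^sub>M (borel :: 'd phase measure))"
    by (simp add: case_prod_unfold)
qed

lemma gen_\<mu>_measurable:
  assumes f: "f \<in> test_functions"
  shows "(\<lambda>t. \<integral>x. gen (\<mu> t) f x \<partial>\<mu> t) \<in> borel_measurable borel"
proof (rule \<mu>_integral_measurable)
  define A where "A x = (snd x /\<^sub>R m) \<bullet> grad_q f x - (grad V (fst x) + \<gamma> *\<^sub>R (snd x /\<^sub>R m)) \<bullet> grad_p f x + \<gamma> * \<theta> * laplacian_p f x" for x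
  have [measurable]: "A \<in> borel_measurable borel" unfolding A_def
    by (intro borel_measurable_continuous_onI continuous_intros phase_derivatives_test[OF f] continuous_on_compose2[OF lipschitz_grad_continuous(2)[OF V(1), of UNIV]]) auto
  have [measurable]: "grad_p f \<in> borel_measurable borel" by (intro borel_measurable_continuous_onI phase_derivatives_test[OF f])
  note [measurable] = grad_conv_\<mu>_measurable
  have "(\<lambda>s. A (snd s) - (case s of (t, x) \<Rightarrow> grad_conv \<psi> (\<mu> t) (fst x)) \<bullet> grad_p f (snd s)) \<in> borel_measurable (borel \<Otimes>\<^sub>M borel)"
    by measurable
  then show "(\<lambda>(s, x). gen (\<mu> s) f x) \<in> borel_measurable (borel \<Otimes>\<^sub>M borel)"
    by (simp add: case_prod_unfold gen_eq A_def inner_add_left algebra_simps)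
  show "integrable (\<mu> s) (gen (\<mu> s) f)" for s by (intro integrable_gen \<mu>_P2 f)
qed

text \<open>\<open>h\<close> is a measurable representative of the time derivative of the pairing.
  Comparison with a maximal measurable minorant works only for measurable functions, so it stands in
  for the defect.\<close>

lemma pairing_density:
  assumes f: "f \<in> test_functions"
  obtains h where "h \<in> borel_measurable borel" "set_integrable lborel {0..T} h"
    "\<And>t. t \<in> {0..T} \<Longrightarrow> (\<integral>x. f x \<partial>\<rho> t) = (\<integral>x. f x \<partial>\<rho> 0) + (LINT s:{0..t}|lborel. h s)"
    "AE s in lborel. s \<in> {0..T} \<longrightarrow> h s = (\<integral>x. gen (\<mu> s) f x \<partial>\<mu> s) + defect s f"
proof -
  obtain h where h: "h \<in> borel_measurable borel" "set_integrable lborel {0..T} h"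
    "\<And>t. t \<in> {0..T} \<Longrightarrow> (\<integral>x. f x \<partial>\<rho> t) = (\<integral>x. f x \<partial>\<rho> 0) + (LINT s:{0..t}|lborel. h s)"
    "AE t in lborel. t \<in> {0..T} \<longrightarrow> ((\<lambda>t. \<integral>x. f x \<partial>\<rho> t) has_vector_derivative h t) (at t within {0..T})"
    by (rule absolutely_continuous_on_eq_integral[OF AC_curve_test_function[OF \<rho>_AC f] less_imp_le[OF T]]) (rule that; assumption)
  have "AE s in lborel. s \<in> {0..T} \<longrightarrow> h s = (\<integral>x. gen (\<mu> s) f x \<partial>\<mu> s) + defect s f"
    using h(4)
  proof eventually_elim
    case (elim s)
    show ?case
    proof
      assume s: "s \<in> {0..T}"
      then have "time_deriv T \<rho> s f = h s"
        unfolding time_deriv_def using elim T by (intro vector_derivative_within_closed_interval) auto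
      then show "h s = (\<integral>x. gen (\<mu> s) f x \<partial>\<mu> s) + defect s f"
        by (simp add: defect_def generator_adjoint_def \<mu>_eq[OF s])
    qed
  qed
  with h show ?thesis by (intro that)
qed

text \<open>\<open>time_deriv\<close> is known to be linear where the derivatives exist, hence
  almost everywhere in time, with an exceptional set that does not depend on the functions.\<close>

lemma defect_lincomb:
  "AE t in lborel. t \<in> {0..T} \<longrightarrow> (\<forall>f\<in>test_functions. \<forall>g\<in>test_functions. \<forall>a c.
     defect t (\<lambda>x. a * f x - c * g x) = a * defect t f - c * defect t g)"
  using AC_curve_AE_differentiable[OF \<rho>_AC subset_refl less_imp_le[OF T]]
proof eventually_elim
  case (elim t)
  show ?case
  proof (intro impI ballI allI)
    fix f g :: "'d phase \<Rightarrow> real" and a c :: real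
    assume t: "t \<in> {0..T}" and f: "f \<in> test_functions" and g: "g \<in> test_functions"
    obtain A where A: "((\<lambda>s. \<integral>x. f x \<partial>\<rho> s) has_vector_derivative A) (at t within {0..T})" using elim t f by blast
    obtain B where B: "((\<lambda>s. \<integral>x. g x \<partial>\<rho> s) has_vector_derivative B) (at t within {0..T})" using elim t g by blast
    have "((\<lambda>s. a * (\<integral>x. f x \<partial>\<rho> s) - c * (\<integral>x. g x \<partial>\<rho> s)) has_vector_derivative a * A - c * B) (at t within {0..T})"
      using A B by (auto intro!: derivative_eq_intros)
    then have C: "((\<lambda>s. \<integral>x. a * f x - c * g x \<partial>\<rho> s) has_vector_derivative a * A - c * B) (at t within {0..T})"
    proof (rule has_vector_derivative_transform[OF t, rotated])
      fix s assume "s \<in> {0..T}"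
      then have s: "\<rho> s \<in> P2" by (rule \<rho>_P2)
      have "integrable (\<rho> s) f" "integrable (\<rho> s) g" by (intro test_function_integrable P2_D[OF s] f g)+
      then show "(\<integral>x. a * f x - c * g x \<partial>\<rho> s) = a * (\<integral>x. f x \<partial>\<rho> s) - c * (\<integral>x. g x \<partial>\<rho> s)" by simp
    qed
    have "time_deriv T \<rho> t (\<lambda>x. a * f x - c * g x) = a * A - c * B" "time_deriv T \<rho> t f = A" "time_deriv T \<rho> t g = B"
      unfolding time_deriv_def using T t A B C by (intro vector_derivative_within_closed_interval; simp)+
    then show "defect t (\<lambda>x. a * f x - c * g x) = a * defect t f - c * defect t g"
      unfolding defect_def by (simp add: generator_adjoint_lincomb[OF \<rho>_P2[OF t] f g] algebra_simps)
  qed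
qed

lemma grad_p_sq_\<mu>_measurable:
  assumes f: "f \<in> test_functions"
  shows "(\<lambda>t. \<integral>x. (norm (grad_p f x - r *\<^sub>R (snd x /\<^sub>R m)))\<^sup>2 \<partial>\<mu> t) \<in> borel_measurable borel"
proof (rule \<mu>_integral_measurable)
  have [measurable]: "(\<lambda>x. (norm (grad_p f x - r *\<^sub>R (snd x /\<^sub>R m)))\<^sup>2) \<in> borel_measurable borel"
    by (intro borel_measurable_continuous_onI continuous_intros phase_derivatives_test[OF f])
  have "(\<lambda>s. (\<lambda>x. (norm (grad_p f x - r *\<^sub>R (snd x /\<^sub>R m)))\<^sup>2) (snd s)) \<in> borel_measurable (borel \<Otimes>\<^sub>M borel)"
    by measurable
  then show "(\<lambda>(s, x). (norm (grad_p f x - r *\<^sub>R (snd x /\<^sub>R m)))\<^sup>2) \<in> borel_measurable (borel \<Otimes>\<^sub>M borel)"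
    by (simp add: case_prod_unfold)
qed (intro integrable_grad_p_sq \<mu>_P2 f)

text \<open>For each rational \<open>c\<close> the measurable function \<open>2 c a - c^2 N\<close>
  lies below the dual norm almost everywhere, hence below its maximal measurable minorant
  \<open>D\<close>. Optimising over \<open>c\<close> gives a Cauchy-Schwarz inequality with a
  measurable and integrable factor.\<close>

lemma defect_bound_exists:
  assumes fin: "(\<integral>\<^sup>+t\<in>{0..T}. dual_norm_sq (\<rho> t) (defect t) \<partial>lborel) < \<infinity>"
  obtains D :: "real \<Rightarrow> real" where "D \<in> borel_measurable borel" "\<And>s. 0 \<le> D s" "integrable lborel D"
    "\<And>f. f \<in> test_functions \<Longrightarrow> AE s in lborel. s \<in> {0..T} \<longrightarrow> (defect s f)\<^sup>2 \<le> D s * (\<integral>x. (norm (grad_p f x))\<^sup>2 \<partial>\<rho> s)"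
proof -
  obtain D :: "real \<Rightarrow> real" where D: "D \<in> borel_measurable lborel" "\<And>s. 0 \<le> D s" "integrable lborel D"
    "\<And>h. h \<in> borel_measurable lborel \<Longrightarrow> (AE s in lborel. ennreal (h s) \<le> dual_norm_sq (\<rho> s) (defect s) * indicator {0..T} s) \<Longrightarrow>
       AE s in lborel. h s \<le> D s"
    by (rule maximal_measurable_minorant[OF fin]) (rule that; assumption)
  have "AE s in lborel. s \<in> {0..T} \<longrightarrow> (defect s f)\<^sup>2 \<le> D s * (\<integral>x. (norm (grad_p f x))\<^sup>2 \<partial>\<rho> s)"
    if f: "f \<in> test_functions" for f
  proof -
    obtain h where h: "h \<in> borel_measurable borel"
      "AE s in lborel. s \<in> {0..T} \<longrightarrow> h s = (\<integral>x. gen (\<mu> s) f x \<partial>\<mu> s) + defect s f"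
      by (rule pairing_density[OF f]) (rule that; assumption)
    define a where "a s = h s - (\<integral>x. gen (\<mu> s) f x \<partial>\<mu> s)" for s
    define N where "N s = (\<integral>x. (norm (grad_p f x))\<^sup>2 \<partial>\<mu> s)" for s
    have [measurable]: "a \<in> borel_measurable borel" unfolding a_def using h(1) gen_\<mu>_measurable[OF f] by measurable
    have [measurable]: "N \<in> borel_measurable borel" unfolding N_def using grad_p_sq_\<mu>_measurable[OF f, of 0] by simp
    have N0: "0 \<le> N s" for s by (simp add: N_def)
    have "AE s in lborel. indicator {0..T} s * (2 * of_rat c * a s - (of_rat c)\<^sup>2 * N s) \<le> D s" for c :: rat
    proof (rule D(4))
      show "(\<lambda>s. indicator {0..T} s * (2 * of_rat c * a s - (of_rat c)\<^sup>2 * N s)) \<in> borel_measurable lborel" by measurable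
      show "AE s in lborel. ennreal (indicator {0..T} s * (2 * of_rat c * a s - (of_rat c)\<^sup>2 * N s)) \<le> dual_norm_sq (\<rho> s) (defect s) * indicator {0..T} s"
        using h(2) defect_lincomb
      proof eventually_elim
        case (elim s)
        show ?case
        proof (cases "s \<in> {0..T}")
          case True
          let ?g = "\<lambda>x. of_rat c * f x - 0 * f x"
          have g: "?g \<in> test_functions" by (rule test_functions_lincomb[OF f f])
          have "defect s ?g = of_rat c * defect s f - 0 * defect s f" using elim(2) True f by blast
          then have "defect s ?g = of_rat c * a s" using elim(1) True by (simp add: a_def)
          moreover have "(\<integral>x. (norm (grad_p ?g x))\<^sup>2 \<partial>\<rho> s) = (of_rat c)\<^sup>2 * N s"
          proof -
            have sc: "(norm (r *\<^sub>R v - 0 *\<^sub>R v))\<^sup>2 = r\<^sup>2 * (norm v)\<^sup>2" for r :: real and v :: "real ^ 'd"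
              by (simp add: power_mult_distrib)
            show ?thesis
              unfolding phase_derivatives_lincomb(1)[OF test_functions_smooth[OF f] test_functions_smooth[OF f]] sc
                N_def \<mu>_eq[OF True] by (rule integral_mult_right_zero)
          qed
          moreover have "ennreal (2 * defect s ?g - (\<integral>x. (norm (grad_p ?g x))\<^sup>2 \<partial>\<rho> s)) \<le> dual_norm_sq (\<rho> s) (defect s)"
            unfolding dual_norm_sq_def by (rule SUP_upper[OF g])
          ultimately show ?thesis using True by (simp add: mult.assoc)
        qed simp
      qed
    qed
    then have "AE s in lborel. \<forall>c::rat. indicator {0..T} s * (2 * of_rat c * a s - (of_rat c)\<^sup>2 * N s) \<le> D s"
      unfolding AE_all_countable by blast
    with h(2) show ?thesis
    proof eventually_elim
      case (elim s)
      show ?case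
      proof
        assume s: "s \<in> {0..T}"
        have "(a s)\<^sup>2 \<le> D s * N s"
        proof (rule quadratic_bound_from_rationals[OF _ N0])
          fix c :: rat show "2 * of_rat c * a s - (of_rat c)\<^sup>2 * N s \<le> D s"
            using elim(2)[rule_format, of c] s by simp
        qed
        then show "(defect s f)\<^sup>2 \<le> D s * (\<integral>x. (norm (grad_p f x))\<^sup>2 \<partial>\<rho> s)"
          using elim(1) s by (simp add: a_def N_def \<mu>_eq[OF s])
      qed
    qed
  qed
  with D show ?thesis by (intro that[of D]) auto
qed

end

section \<open>The defect of the kinetic energy\<close>

context vfp begin

lemma weighted_momentum_L2_limit:
  assumes \<nu>: "\<nu> \<in> P2" and gp: "\<And>n x. grad_p (f n) x = c n x *\<^sub>R (snd x /\<^sub>R m)"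
    and c: "\<And>n x. 0 \<le> c n x" "\<And>n x. c n x \<le> K" "\<And>n. continuous_on UNIV (c n)" "\<And>x. (\<lambda>n. c n x) \<longlonglongrightarrow> 1"
  shows "(\<lambda>n. \<integral>x. (norm (grad_p (f n) x - snd x /\<^sub>R m))\<^sup>2 \<partial>\<nu>) \<longlonglongrightarrow> 0"
proof -
  have eq: "(norm (grad_p (f n) x - snd x /\<^sub>R m))\<^sup>2 = (c n x - 1)\<^sup>2 * ((norm (snd x))\<^sup>2 / m\<^sup>2)" for n x
  proof -
    have "grad_p (f n) x - snd x /\<^sub>R m = (c n x - 1) *\<^sub>R (snd x /\<^sub>R m)" by (simp only: gp scaleR_diff_left scaleR_one)
    then show ?thesis by (simp add: power_mult_distrib power_divide divide_inverse power_inverse)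
  qed
  have K: "0 \<le> K" using c(1)[of 0 0] c(2)[of 0 0] by linarith
  have "(\<lambda>n. \<integral>x. (c n x - 1)\<^sup>2 * ((norm (snd x))\<^sup>2 / m\<^sup>2) \<partial>\<nu>) \<longlonglongrightarrow> (\<integral>x. 0 \<partial>\<nu>)"
  proof (rule integral_dominated_convergence[where w="\<lambda>x. (K + 1)\<^sup>2 * ((norm (snd x))\<^sup>2 / m\<^sup>2)"])
    show "(\<lambda>x. (c n x - 1)\<^sup>2 * ((norm (snd x))\<^sup>2 / m\<^sup>2)) \<in> borel_measurable \<nu>" for n
      by (rule P2_measurable[OF \<nu>]) (intro borel_measurable_continuous_onI continuous_intros c, use m in simp)
    show "integrable \<nu> (\<lambda>x. (K + 1)\<^sup>2 * ((norm (snd x))\<^sup>2 / m\<^sup>2))" using P2_D(3)[OF \<nu>] by simp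
    show "AE x in \<nu>. (\<lambda>n. (c n x - 1)\<^sup>2 * ((norm (snd x))\<^sup>2 / m\<^sup>2)) \<longlonglongrightarrow> 0"
    proof (rule AE_I2)
      fix x
      have "(\<lambda>n. (c n x - 1)\<^sup>2 * ((norm (snd x))\<^sup>2 / m\<^sup>2)) \<longlonglongrightarrow> (1 - 1)\<^sup>2 * ((norm (snd x))\<^sup>2 / m\<^sup>2)"
        by (intro tendsto_intros c)
      then show "(\<lambda>n. (c n x - 1)\<^sup>2 * ((norm (snd x))\<^sup>2 / m\<^sup>2)) \<longlonglongrightarrow> 0" by simp
    qed
    show "AE x in \<nu>. norm ((c n x - 1)\<^sup>2 * ((norm (snd x))\<^sup>2 / m\<^sup>2)) \<le> (K + 1)\<^sup>2 * ((norm (snd x))\<^sup>2 / m\<^sup>2)" for n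
    proof (rule AE_I2)
      fix x
      have "\<bar>c n x - 1\<bar> \<le> \<bar>K + 1\<bar>" using c(1)[of n x] c(2)[of n x] K by linarith
      then have "(c n x - 1)\<^sup>2 \<le> (K + 1)\<^sup>2" by (simp only: abs_le_square_iff)
      then have "(c n x - 1)\<^sup>2 * ((norm (snd x))\<^sup>2 / m\<^sup>2) \<le> (K + 1)\<^sup>2 * ((norm (snd x))\<^sup>2 / m\<^sup>2)" by (intro mult_right_mono) auto
      then show "norm ((c n x - 1)\<^sup>2 * ((norm (snd x))\<^sup>2 / m\<^sup>2)) \<le> (K + 1)\<^sup>2 * ((norm (snd x))\<^sup>2 / m\<^sup>2)" by simp
    qed
  qed simp
  then show ?thesis unfolding eq by simp
qed

text \<open>These are truncations of the pure kinetic energy, \<open>W = 0\<close>. One sequence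
  serves all measures in \<open>P2\<close>, because the weights are bounded and tend to 1
  pointwise.\<close>

lemma momentum_approximation_exists:
  fixes \<nu>0 :: "'d phase measure"
  assumes "\<nu>0 \<in> P2"
  obtains \<xi> :: "nat \<Rightarrow> 'd phase \<Rightarrow> real" where "\<And>n. \<xi> n \<in> test_functions"
    "\<And>\<nu>. \<nu> \<in> P2 \<Longrightarrow> (\<lambda>n. \<integral>x. (norm (grad_p (\<xi> n) x - snd x /\<^sub>R m))\<^sup>2 \<partial>\<nu>) \<longlonglongrightarrow> 0"
proof -
  have W: "lipschitz_grad 0 (\<lambda>q::real^'d. 0) (\<lambda>q. 0)" by (simp add: lipschitz_grad_def)
  have W0: "\<And>q::real^'d. 0 \<le> (0::real)" by simp
  obtain K \<zeta> \<Theta> where cut: "spatial_cutoff K \<zeta>" "energy_cutoff K \<Theta>" by (rule cutoffs_exist)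
  show ?thesis
  proof (rule truncation_sequence[OF cut W W0 assms assms])
    fix f :: "nat \<Rightarrow> 'd phase \<Rightarrow> real" and c
    assume *: "\<And>n. f n \<in> test_functions" "\<And>n x. grad_p (f n) x = c n x *\<^sub>R (snd x /\<^sub>R m)" "\<And>n x. 0 \<le> c n x" "\<And>n x. c n x \<le> K"
      "\<And>n. continuous_on UNIV (c n)" "\<And>x. (\<lambda>n. c n x) \<longlonglongrightarrow> 1"
    show thesis by (rule that[of f, OF *(1)]) (rule weighted_momentum_L2_limit[OF _ *(2-6)])
  qed
qed

end

locale vfp_finite = vfp_curve m \<gamma> \<theta> V \<psi> LV L\<psi> C\<psi> T \<rho>
  for m \<gamma> \<theta> :: real and V \<psi> :: "real ^ 'd::finite \<Rightarrow> real" and LV L\<psi> C\<psi> T :: real and \<rho> :: "real \<Rightarrow> 'd phase measure" +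
  fixes D :: "real \<Rightarrow> real"
  assumes D: "D \<in> borel_measurable borel" "\<And>s. 0 \<le> D s" "integrable lborel D"
    and defect_bound: "\<And>f. f \<in> test_functions \<Longrightarrow>
      AE s in lborel. s \<in> {0..T} \<longrightarrow> (defect s f)\<^sup>2 \<le> D s * (\<integral>x. (norm (grad_p f x))\<^sup>2 \<partial>\<rho> s)"
begin

text \<open>Squared L2 distance between the momentum gradients of \<open>f\<close> and of the
  kinetic energy \<open>p^2/(2 m)\<close>; it controls the defect of differences.\<close>

definition momentum_error :: "('d phase \<Rightarrow> real) \<Rightarrow> 'd phase measure \<Rightarrow> real" where
  "momentum_error f \<nu> = (\<integral>x. (norm (grad_p f x - snd x /\<^sub>R m))\<^sup>2 \<partial>\<nu>)"

lemma momentum_error_nonneg: "0 \<le> momentum_error f \<nu>"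
  by (simp add: momentum_error_def)

lemma grad_p_difference_le:
  assumes \<nu>: "\<nu> \<in> P2" and f: "f \<in> test_functions" and g: "g \<in> test_functions"
  shows "(\<integral>x. (norm (grad_p (\<lambda>x. 1 * f x - 1 * g x) x))\<^sup>2 \<partial>\<nu>) \<le> 2 * (momentum_error f \<nu> + momentum_error g \<nu>)"
proof -
  have i: "integrable \<nu> (\<lambda>x. (norm (grad_p k x - snd x /\<^sub>R m))\<^sup>2)" if "k \<in> test_functions" for k
    using integrable_grad_p_sq[OF \<nu> that, of 1] by simp
  have "(\<integral>x. (norm (grad_p (\<lambda>x. 1 * f x - 1 * g x) x))\<^sup>2 \<partial>\<nu>) \<le>
    (\<integral>x. 2 * (norm (grad_p f x - snd x /\<^sub>R m))\<^sup>2 + 2 * (norm (grad_p g x - snd x /\<^sub>R m))\<^sup>2 \<partial>\<nu>)"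
  proof (rule integral_mono)
    show "integrable \<nu> (\<lambda>x. (norm (grad_p (\<lambda>x. 1 * f x - 1 * g x) x))\<^sup>2)"
      using integrable_grad_p_sq[OF \<nu> test_functions_lincomb[OF f g, of 1 1], of 0] by simp
    show "integrable \<nu> (\<lambda>x. 2 * (norm (grad_p f x - snd x /\<^sub>R m))\<^sup>2 + 2 * (norm (grad_p g x - snd x /\<^sub>R m))\<^sup>2)"
      using i[OF f] i[OF g] by simp
    fix x
    let ?a = "grad_p f x - snd x /\<^sub>R m" and ?b = "grad_p g x - snd x /\<^sub>R m"
    have "grad_p (\<lambda>x. 1 * f x - 1 * g x) x = 1 *\<^sub>R grad_p f x - 1 *\<^sub>R grad_p g x"
      by (rule phase_derivatives_lincomb(1)[OF test_functions_smooth[OF f] test_functions_smooth[OF g]])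
    also have "\<dots> = ?a - ?b" by simp
    finally have eq: "grad_p (\<lambda>x. 1 * f x - 1 * g x) x = ?a - ?b" .
    have "(norm (grad_p (\<lambda>x. 1 * f x - 1 * g x) x))\<^sup>2 \<le> (norm ?a + norm ?b)\<^sup>2"
      unfolding eq by (rule power_mono[OF norm_triangle_ineq4 norm_ge_zero])
    also have "\<dots> \<le> 2 * (norm ?a)\<^sup>2 + 2 * (norm ?b)\<^sup>2"
      using sum_squares_bound[of "norm ?a" "norm ?b"] by (simp add: power2_sum)
    finally show "(norm (grad_p (\<lambda>x. 1 * f x - 1 * g x) x))\<^sup>2 \<le> 2 * (norm ?a)\<^sup>2 + 2 * (norm ?b)\<^sup>2" .
  qed
  also have "\<dots> = 2 * (momentum_error f \<nu> + momentum_error g \<nu>)"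
    unfolding momentum_error_def using i[OF f] i[OF g] by simp
  finally show ?thesis .
qed

lemma defect_difference_AE:
  assumes f: "f \<in> test_functions" and g: "g \<in> test_functions"
  shows "AE s in lborel. s \<in> {0..T} \<longrightarrow> (defect s f - defect s g)\<^sup>2 \<le> D s * (2 * (momentum_error f (\<rho> s) + momentum_error g (\<rho> s)))"
  using defect_lincomb defect_bound[OF test_functions_lincomb[OF f g, of 1 1]]
proof eventually_elim
  case (elim s)
  show ?case
  proof
    assume s: "s \<in> {0..T}"
    have "defect s (\<lambda>x. 1 * f x - 1 * g x) = 1 * defect s f - 1 * defect s g" using elim(1) s f g by blast
    then have "(defect s f - defect s g)\<^sup>2 \<le> D s * (\<integral>x. (norm (grad_p (\<lambda>x. 1 * f x - 1 * g x) x))\<^sup>2 \<partial>\<rho> s)"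
      using elim(2) s by simp
    also have "\<dots> \<le> D s * (2 * (momentum_error f (\<rho> s) + momentum_error g (\<rho> s)))"
      by (intro mult_left_mono grad_p_difference_le \<rho>_P2 s f g D(2))
    finally show "(defect s f - defect s g)\<^sup>2 \<le> D s * (2 * (momentum_error f (\<rho> s) + momentum_error g (\<rho> s)))" .
  qed
qed

text \<open>\<open>\<tau> s\<close> is the value of the defect on the kinetic energy, which is not a test function.\<close>

definition kinetic_defect :: "(real \<Rightarrow> real) \<Rightarrow> bool" where
  "kinetic_defect \<tau> \<longleftrightarrow> \<tau> \<in> borel_measurable borel \<and>
    (\<forall>f. (\<forall>n. f n \<in> test_functions) \<longrightarrow> (\<forall>s\<in>{0..T}. (\<lambda>n. momentum_error (f n) (\<rho> s)) \<longlonglongrightarrow> 0) \<longrightarrow>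
      (AE s in lborel. s \<in> {0..T} \<longrightarrow> (\<lambda>n. defect s (f n)) \<longlonglongrightarrow> \<tau> s))"

lemma kinetic_defect_D:
  assumes "kinetic_defect \<tau>"
  shows "\<tau> \<in> borel_measurable borel"
    "(\<And>n. f n \<in> test_functions) \<Longrightarrow> (\<And>s. s \<in> {0..T} \<Longrightarrow> (\<lambda>n. momentum_error (f n) (\<rho> s)) \<longlonglongrightarrow> 0) \<Longrightarrow>
      AE s in lborel. s \<in> {0..T} \<longrightarrow> (\<lambda>n. defect s (f n)) \<longlonglongrightarrow> \<tau> s"
proof -
  show "\<tau> \<in> borel_measurable borel" using assms unfolding kinetic_defect_def by (rule conjunct1)
  assume f: "\<And>n. f n \<in> test_functions" "\<And>s. s \<in> {0..T} \<Longrightarrow> (\<lambda>n. momentum_error (f n) (\<rho> s)) \<longlonglongrightarrow> 0"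
  show "AE s in lborel. s \<in> {0..T} \<longrightarrow> (\<lambda>n. defect s (f n)) \<longlonglongrightarrow> \<tau> s"
    by (rule assms[unfolded kinetic_defect_def, THEN conjunct2, rule_format]) (rule f; assumption?)+
qed

text \<open>Along functions with vanishing momentum error the defects form a Cauchy sequence,
  because the defect of a difference is controlled by \<open>D s\<close> and the two errors. Any
  other such sequence has the same limit for the same reason.\<close>

lemma defect_of_kinetic_energy:
  obtains \<tau> where "kinetic_defect \<tau>"
proof -
  have P0: "\<rho> 0 \<in> P2" by (rule \<rho>_P2) (use T in auto)
  obtain \<xi> :: "nat \<Rightarrow> 'd phase \<Rightarrow> real" where \<xi>: "\<And>n. \<xi> n \<in> test_functions"
    "\<And>\<nu>. \<nu> \<in> P2 \<Longrightarrow> (\<lambda>n. \<integral>x. (norm (grad_p (\<xi> n) x - snd x /\<^sub>R m))\<^sup>2 \<partial>\<nu>) \<longlonglongrightarrow> 0"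
    by (rule momentum_approximation_exists[OF P0]) (rule that; assumption)
  note \<xi> = \<xi>(1) \<xi>(2)[folded momentum_error_def]
  define Q where "Q n h \<longleftrightarrow> h \<in> borel_measurable borel \<and>
    (AE s in lborel. s \<in> {0..T} \<longrightarrow> h s = (\<integral>x. gen (\<mu> s) (\<xi> n) x \<partial>\<mu> s) + defect s (\<xi> n))" for n h
  have "\<exists>h. Q n h" for n
    by (rule pairing_density[OF \<xi>(1)[of n]]) (unfold Q_def, blast)
  then have Q: "Q n (SOME h. Q n h)" for n by (rule someI_ex)
  \<comment> \<open>\<open>a n\<close> is a measurable version of the defect of
    \<open>\<xi> n\<close>, which makes the limit measurable.\<close>
  define a where "a n s = (SOME h. Q n h) s - (\<integral>x. gen (\<mu> s) (\<xi> n) x \<partial>\<mu> s)" for n s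
  have am: "a n \<in> borel_measurable borel" for n
    unfolding a_def using Q[of n] gen_\<mu>_measurable[OF \<xi>(1)[of n]] unfolding Q_def by (intro borel_measurable_diff) auto
  have "AE s in lborel. s \<in> {0..T} \<longrightarrow> a n s = defect s (\<xi> n)" for n
    using Q[of n] unfolding Q_def a_def by (elim conjE eventually_mono) auto
  then have ad: "AE s in lborel. \<forall>n. s \<in> {0..T} \<longrightarrow> a n s = defect s (\<xi> n)" unfolding AE_all_countable by blast
  have dd: "AE s in lborel. \<forall>n k. s \<in> {0..T} \<longrightarrow>
      (defect s (\<xi> n) - defect s (\<xi> k))\<^sup>2 \<le> D s * (2 * (momentum_error (\<xi> n) (\<rho> s) + momentum_error (\<xi> k) (\<rho> s)))"
    unfolding AE_all_countable using defect_difference_AE \<xi>(1) by blast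
  define \<tau> where "\<tau> s = lim (\<lambda>n. a n s)" for s
  have \<tau>m: "\<tau> \<in> borel_measurable borel" unfolding \<tau>_def by (rule borel_measurable_lim_metric[OF am])
  have conv: "AE s in lborel. s \<in> {0..T} \<longrightarrow> (\<lambda>n. defect s (\<xi> n)) \<longlonglongrightarrow> \<tau> s"
    using ad dd
  proof eventually_elim
    case (elim s)
    show ?case
    proof
      assume s: "s \<in> {0..T}"
      let ?A = "\<lambda>n. momentum_error (\<xi> n) (\<rho> s)"
      have "Cauchy (\<lambda>n. defect s (\<xi> n))"
      proof (rule metric_CauchyI)
        fix e :: real assume e: "e > 0"
        \<comment> \<open>The factor is raised by 1 since \<open>D s\<close> may vanish and is
          divided by below.\<close>
        have D1: "D s + 1 > 0" using D(2)[of s] by linarith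
        have half: "k * (2 * (e\<^sup>2 / (4 * k) + e\<^sup>2 / (4 * k))) = e\<^sup>2" if "k > 0" for k :: real
          using that by (simp add: field_simps)
        have "\<forall>\<^sub>F n in sequentially. ?A n < e\<^sup>2 / (4 * (D s + 1))"
          using e D1 by (intro order_tendstoD(2)[OF \<xi>(2)[OF \<rho>_P2[OF s]]]) auto
        then obtain M where M: "\<And>n. n \<ge> M \<Longrightarrow> ?A n < e\<^sup>2 / (4 * (D s + 1))" by (auto simp: eventually_sequentially)
        have "dist (defect s (\<xi> n)) (defect s (\<xi> k)) < e" if "n \<ge> M" "k \<ge> M" for n k
        proof -
          have "(defect s (\<xi> n) - defect s (\<xi> k))\<^sup>2 \<le> D s * (2 * (?A n + ?A k))" using elim(2) s by blast
          also have "\<dots> \<le> (D s + 1) * (2 * (?A n + ?A k))"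
            by (intro mult_right_mono) (auto intro!: add_nonneg_nonneg momentum_error_nonneg)
          also have "\<dots> < (D s + 1) * (2 * (e\<^sup>2 / (4 * (D s + 1)) + e\<^sup>2 / (4 * (D s + 1))))"
            using M[OF that(1)] M[OF that(2)] D1 by (intro mult_strict_left_mono) auto
          also have "\<dots> = e\<^sup>2" by (rule half[OF D1])
          finally have lt: "(defect s (\<xi> n) - defect s (\<xi> k))\<^sup>2 < e\<^sup>2" .
          have "\<bar>defect s (\<xi> n) - defect s (\<xi> k)\<bar> < e"
          proof (rule power2_less_imp_less)
            show "\<bar>defect s (\<xi> n) - defect s (\<xi> k)\<bar>\<^sup>2 < e\<^sup>2" using lt by (simp only: power2_abs)
          qed (use e in simp)
          then show ?thesis using e by (simp add: dist_real_def)
        qed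
        then show "\<exists>M. \<forall>m\<ge>M. \<forall>n\<ge>M. dist (defect s (\<xi> m)) (defect s (\<xi> n)) < e" by blast
      qed
      then have "convergent (\<lambda>n. defect s (\<xi> n))" by (rule Cauchy_convergent)
      moreover have "(\<lambda>n. a n s) = (\<lambda>n. defect s (\<xi> n))" using elim(1) s by auto
      ultimately show "(\<lambda>n. defect s (\<xi> n)) \<longlonglongrightarrow> \<tau> s" unfolding \<tau>_def by (simp add: convergent_LIMSEQ_iff)
    qed
  qed
  have "AE s in lborel. s \<in> {0..T} \<longrightarrow> (\<lambda>n. defect s (f n)) \<longlonglongrightarrow> \<tau> s"
    if f: "\<And>n. f n \<in> test_functions" "\<And>s. s \<in> {0..T} \<Longrightarrow> (\<lambda>n. momentum_error (f n) (\<rho> s)) \<longlonglongrightarrow> 0" for f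
  proof -
    have "AE s in lborel. \<forall>n. s \<in> {0..T} \<longrightarrow>
      (defect s (f n) - defect s (\<xi> n))\<^sup>2 \<le> D s * (2 * (momentum_error (f n) (\<rho> s) + momentum_error (\<xi> n) (\<rho> s)))"
      unfolding AE_all_countable using defect_difference_AE \<xi>(1) f(1) by blast
    with conv show ?thesis
    proof eventually_elim
      case (elim s)
      show ?case
      proof
        assume s: "s \<in> {0..T}"
        have "(\<lambda>n. D s * (2 * (momentum_error (f n) (\<rho> s) + momentum_error (\<xi> n) (\<rho> s)))) \<longlonglongrightarrow> D s * (2 * (0 + 0))"
          by (intro tendsto_intros f(2)[OF s] \<xi>(2)[OF \<rho>_P2[OF s]])
        then have "(\<lambda>n. D s * (2 * (momentum_error (f n) (\<rho> s) + momentum_error (\<xi> n) (\<rho> s)))) \<longlonglongrightarrow> 0" by simp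
        then have "(\<lambda>n. (defect s (f n) - defect s (\<xi> n))\<^sup>2) \<longlonglongrightarrow> 0"
          by (rule Lim_null_comparison[rotated]) (use elim(2) s in auto)
        then have "(\<lambda>n. sqrt ((defect s (f n) - defect s (\<xi> n))\<^sup>2)) \<longlonglongrightarrow> sqrt 0" by (rule tendsto_real_sqrt)
        then have "(\<lambda>n. defect s (f n) - defect s (\<xi> n)) \<longlonglongrightarrow> 0" by (simp add: tendsto_rabs_zero_iff)
        moreover have "(\<lambda>n. defect s (\<xi> n)) \<longlonglongrightarrow> \<tau> s" using elim(1) s by blast
        ultimately have "(\<lambda>n. (defect s (f n) - defect s (\<xi> n)) + defect s (\<xi> n)) \<longlonglongrightarrow> 0 + \<tau> s" by (rule tendsto_add)
        then show "(\<lambda>n. defect s (f n)) \<longlonglongrightarrow> \<tau> s" by simp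
      qed
    qed
  qed
  with \<tau>m have "kinetic_defect \<tau>" unfolding kinetic_defect_def by blast
  then show ?thesis by (rule that)
qed

text \<open>By Young's inequality half of the friction absorbs a force bounded by \<open>Cv\<close>
  at the price \<open>Cv^2/(2 \<gamma>)\<close>; the weight contributes the factor
  \<open>K\<close>.\<close>

definition A0 :: "real \<Rightarrow> real \<Rightarrow> real" where
  "A0 K Cv = K * (Cv\<^sup>2 / (2 * \<gamma>)) + remainder_bound K"

text \<open>Dissipation absorbs both the force and the defect: with \<open>P = \<integral> c |p|\<^sup>2/m\<^sup>2 d\<mu>\<^sub>s\<close>
  the integral of the generator is at most \<open>- \<gamma>/2 P + A0\<close>, and the defect is at most \<open>\<gamma>/2 P + K D/(2\<gamma>)\<close>.\<close>

lemma truncated_rate_bound: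
  assumes f: "f \<in> test_functions" and gp: "\<And>x. grad_p f x = c x *\<^sub>R (snd x /\<^sub>R m)"
    and c: "\<And>x. 0 \<le> c x" "\<And>x. c x \<le> K" "continuous_on UNIV c"
    and gen: "\<And>s x. gen (\<mu> s) f x = c x * ((snd x /\<^sub>R m) \<bullet> v s x - \<gamma> * (norm (snd x))\<^sup>2 / m\<^sup>2) + rem x"
    and v: "\<And>s x. norm (v s x) \<le> Cv" and rem: "\<And>x. \<bar>rem x\<bar> \<le> remainder_bound K"
  shows "\<bar>gen (\<mu> s) f x\<bar> \<le> 3 / 2 * \<gamma> * (K * ((norm (snd x))\<^sup>2 / m\<^sup>2)) + A0 K Cv"
    and "AE s in lborel. s \<in> {0..T} \<longrightarrow>
     (\<integral>x. gen (\<mu> s) f x \<partial>\<mu> s) + defect s f \<le> A0 K Cv + K / (2 * \<gamma>) * D s \<and>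
     \<bar>(\<integral>x. gen (\<mu> s) f x \<partial>\<mu> s) + defect s f\<bar> \<le> 2 * \<gamma> * (K / m\<^sup>2 * (\<integral>x. (norm (snd x))\<^sup>2 \<partial>\<mu> s)) + A0 K Cv + K / (2 * \<gamma>) * D s"
proof -
  let ?w = "\<lambda>x. (norm (snd x))\<^sup>2 / m\<^sup>2 :: real"
  have dl: "a * (b * w + k) = b * (a * w) + a * k" for a b w k :: real by (simp add: algebra_simps)
  have K: "0 \<le> K" using c(1)[of 0] c(2)[of 0] by linarith
  have Cv: "0 \<le> Cv" using v[of 0 0] norm_ge_zero order_trans by blast
  have vp: "\<bar>(snd x /\<^sub>R m) \<bullet> v s x\<bar> \<le> \<gamma> / 2 * ?w x + Cv\<^sup>2 / (2 * \<gamma>)" for s x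
  proof -
    have "\<bar>(snd x /\<^sub>R m) \<bullet> v s x\<bar> \<le> norm (snd x /\<^sub>R m) * norm (v s x)" by (rule Cauchy_Schwarz_ineq2)
    also have "\<dots> \<le> norm (snd x) / m * Cv" using v[of s x] m by (intro mult_mono) (auto simp: divide_inverse)
    also have "\<dots> \<le> \<gamma> / 2 * ?w x + Cv\<^sup>2 / (2 * \<gamma>)"
    proof -
      have "2 * \<gamma> * (a * Cv) \<le> \<gamma>\<^sup>2 * a\<^sup>2 + Cv\<^sup>2" for a
      proof -
        have "0 \<le> (\<gamma> * a - Cv)\<^sup>2" by simp
        then show ?thesis by (simp add: power2_diff power_mult_distrib mult_ac)
      qed
      from this[of "norm (snd x) / m"] have "2 * \<gamma> * (norm (snd x) / m * Cv) \<le> \<gamma>\<^sup>2 * (norm (snd x) / m)\<^sup>2 + Cv\<^sup>2" .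
      then show ?thesis using \<gamma> by (simp add: field_simps power2_eq_square)
    qed
    finally show ?thesis .
  qed
  have up: "gen (\<mu> s) f x \<le> - (\<gamma> / 2) * (c x * ?w x) + A0 K Cv" for s x
  proof -
    have "(snd x /\<^sub>R m) \<bullet> v s x - \<gamma> * (norm (snd x))\<^sup>2 / m\<^sup>2 \<le> - (\<gamma> / 2) * ?w x + Cv\<^sup>2 / (2 * \<gamma>)"
      using vp[of x s] by (simp add: abs_le_iff)
    from mult_left_mono[OF this c(1)[of x]]
    have "gen (\<mu> s) f x \<le> c x * (- (\<gamma> / 2) * ?w x + Cv\<^sup>2 / (2 * \<gamma>)) + remainder_bound K"
      unfolding gen using rem[of x] by linarith
    also have "c x * (Cv\<^sup>2 / (2 * \<gamma>)) \<le> K * (Cv\<^sup>2 / (2 * \<gamma>))" using c(2)[of x] \<gamma> by (intro mult_right_mono) auto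
    then have "c x * (- (\<gamma> / 2) * ?w x + Cv\<^sup>2 / (2 * \<gamma>)) + remainder_bound K \<le> - (\<gamma> / 2) * (c x * ?w x) + A0 K Cv"
      by (simp only: dl A0_def add.assoc add_le_cancel_left add_le_cancel_right)
    finally show ?thesis .
  qed
  have ab: "\<bar>gen (\<mu> s) f x\<bar> \<le> 3 / 2 * \<gamma> * (c x * ?w x) + A0 K Cv" for s x
  proof -
    have w0: "0 \<le> \<gamma> * ?w x" using \<gamma> by simp
    have "\<bar>(snd x /\<^sub>R m) \<bullet> v s x - \<gamma> * (norm (snd x))\<^sup>2 / m\<^sup>2\<bar> \<le> 3 / 2 * \<gamma> * ?w x + Cv\<^sup>2 / (2 * \<gamma>)"
      using vp[of x s] w0 by (simp add: abs_le_iff)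
    from mult_left_mono[OF this c(1)[of x]]
    have "\<bar>gen (\<mu> s) f x\<bar> \<le> c x * (3 / 2 * \<gamma> * ?w x + Cv\<^sup>2 / (2 * \<gamma>)) + remainder_bound K"
      unfolding gen using rem[of x] c(1)[of x] by (intro order_trans[OF abs_triangle_ineq add_mono]) (auto simp: abs_mult)
    also have "c x * (Cv\<^sup>2 / (2 * \<gamma>)) \<le> K * (Cv\<^sup>2 / (2 * \<gamma>))" using c(2)[of x] \<gamma> by (intro mult_right_mono) auto
    then have "c x * (3 / 2 * \<gamma> * ?w x + Cv\<^sup>2 / (2 * \<gamma>)) + remainder_bound K \<le> 3 / 2 * \<gamma> * (c x * ?w x) + A0 K Cv"
      by (simp only: dl A0_def add.assoc add_le_cancel_left add_le_cancel_right)
    finally show ?thesis .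
  qed
  have cw: "c x * ?w x \<le> K * ?w x" for x using c(2) by (intro mult_right_mono) auto
  show "\<bar>gen (\<mu> s) f x\<bar> \<le> 3 / 2 * \<gamma> * (K * ((norm (snd x))\<^sup>2 / m\<^sup>2)) + A0 K Cv"
  proof -
    have "3 / 2 * \<gamma> * (c x * ?w x) \<le> 3 / 2 * \<gamma> * (K * ?w x)" using cw[of x] \<gamma> by (intro mult_left_mono) auto
    then show ?thesis using ab[of s x] by linarith
  qed
  define P where "P s = (\<integral>x. c x * ?w x \<partial>\<mu> s)" for s
  have iw: "integrable (\<mu> s) ?w" for s using P2_D(3)[OF \<mu>_P2] by simp
  have ip: "integrable (\<mu> s) (\<lambda>x. c x * ?w x)" for s
  proof (rule Bochner_Integration.integrable_bound)
    show "integrable (\<mu> s) (\<lambda>x. K * ?w x)" by (intro integrable_mult_right iw)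
    show "(\<lambda>x. c x * ?w x) \<in> borel_measurable (\<mu> s)"
      by (rule P2_measurable[OF \<mu>_P2]) (intro borel_measurable_continuous_onI continuous_intros c, use m in simp)
    show "AE x in \<mu> s. norm (c x * ?w x) \<le> norm (K * ?w x)" using cw c(1) K by (auto simp: abs_mult)
  qed
  have P0: "0 \<le> P s" for s unfolding P_def using c(1) by (intro Bochner_Integration.integral_nonneg) auto
  have PK: "P s \<le> K / m\<^sup>2 * (\<integral>x. (norm (snd x))\<^sup>2 \<partial>\<mu> s)" for s
  proof -
    have "P s \<le> (\<integral>x. K * ?w x \<partial>\<mu> s)" unfolding P_def by (rule integral_mono[OF ip integrable_mult_right[OF iw] cw])
    then show ?thesis by simp
  qed
  have ig: "integrable (\<mu> s) (gen (\<mu> s) f)" for s by (intro integrable_gen \<mu>_P2 f)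
  have prob: "measure (\<mu> s) (space (\<mu> s)) = 1" for s using P2_D(1)[OF \<mu>_P2] by (rule prob_space.prob_space)
  have fin: "integrable (\<mu> s) (\<lambda>x. c0)" for s and c0 :: real
    using P2_integrable_bounded[OF \<mu>_P2, of "\<lambda>x. c0" "\<bar>c0\<bar>"] by simp
  have la: "integrable (\<mu> s) (\<lambda>x. a * (c x * ?w x) + b)" for s a b
    by (intro Bochner_Integration.integrable_add integrable_mult_right ip fin)
  have lb: "(\<integral>x. a * (c x * ?w x) + b \<partial>\<mu> s) = a * P s + b" for s a b
    unfolding P_def Bochner_Integration.integral_add[OF integrable_mult_right[OF ip] fin] integral_mult_right_zero
    by (simp add: prob)
  have Iup: "(\<integral>x. gen (\<mu> s) f x \<partial>\<mu> s) \<le> - (\<gamma> / 2) * P s + A0 K Cv" for s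
  proof -
    have "(\<integral>x. gen (\<mu> s) f x \<partial>\<mu> s) \<le> (\<integral>x. - (\<gamma> / 2) * (c x * ?w x) + A0 K Cv \<partial>\<mu> s)"
      by (rule integral_mono[OF ig la up])
    also have "\<dots> = - (\<gamma> / 2) * P s + A0 K Cv"
      by (rule lb)
    finally show ?thesis .
  qed
  have Iab: "\<bar>\<integral>x. gen (\<mu> s) f x \<partial>\<mu> s\<bar> \<le> 3 / 2 * \<gamma> * P s + A0 K Cv" for s
  proof -
    have "\<bar>\<integral>x. gen (\<mu> s) f x \<partial>\<mu> s\<bar> \<le> (\<integral>x. 3 / 2 * \<gamma> * (c x * ?w x) + A0 K Cv \<partial>\<mu> s)"
      by (rule Bochner_Integration.integral_abs_bound_integral[OF ig la ab])
    also have "\<dots> = 3 / 2 * \<gamma> * P s + A0 K Cv"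
      by (rule lb)
    finally show ?thesis .
  qed
  \<comment> \<open>Only one of the two factors \<open>c\<close> is estimated by \<open>K\<close>;
    the other stays in the weighted integral \<open>P\<close>, which is the one that friction
    controls.\<close>
  have gsq: "(\<integral>x. (norm (grad_p f x))\<^sup>2 \<partial>\<mu> s) \<le> K * P s" for s
  proof -
    have eq: "(norm (grad_p f x))\<^sup>2 = c x * (c x * ?w x)" for x
      unfolding gp by (simp add: power_mult_distrib power2_eq_square divide_inverse)
    have "(\<integral>x. (norm (grad_p f x))\<^sup>2 \<partial>\<mu> s) \<le> (\<integral>x. K * (c x * ?w x) \<partial>\<mu> s)"
    proof (rule integral_mono)
      show "integrable (\<mu> s) (\<lambda>x. (norm (grad_p f x))\<^sup>2)" using integrable_grad_p_sq[OF \<mu>_P2 f, of s 0] by simp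
      show "(norm (grad_p f x))\<^sup>2 \<le> K * (c x * ?w x)" for x unfolding eq using c by (intro mult_right_mono) auto
    qed (intro integrable_mult_right ip)
    then show ?thesis by (simp only: P_def integral_mult_right_zero)
  qed
  show "AE s in lborel. s \<in> {0..T} \<longrightarrow>
     (\<integral>x. gen (\<mu> s) f x \<partial>\<mu> s) + defect s f \<le> A0 K Cv + K / (2 * \<gamma>) * D s \<and>
     \<bar>(\<integral>x. gen (\<mu> s) f x \<partial>\<mu> s) + defect s f\<bar> \<le> 2 * \<gamma> * (K / m\<^sup>2 * (\<integral>x. (norm (snd x))\<^sup>2 \<partial>\<mu> s)) + A0 K Cv + K / (2 * \<gamma>) * D s"
    using defect_bound[OF f]
  proof eventually_elim
    case (elim s)
    show ?case
    proof
      assume s: "s \<in> {0..T}"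
      have "(defect s f)\<^sup>2 \<le> D s * (K * P s)"
        using elim s gsq[of s] mult_left_mono[OF gsq[of s] D(2)[of s]] by (simp add: \<mu>_eq[OF s])
      \<comment> \<open>The product is split for the inequality \<open>4 a b \<le> (a + b)^2\<close>
        so that the defect uses up exactly the \<open>\<gamma>/2 * P\<close> left over after
        absorbing the force.\<close>
      also have "\<dots> = 4 * ((\<gamma> / 2 * P s) * (K / (2 * \<gamma>) * D s))" using \<gamma> by (simp add: field_simps)
      also have "\<dots> \<le> (\<gamma> / 2 * P s + K / (2 * \<gamma>) * D s)\<^sup>2"
      proof -
        have "0 \<le> (\<gamma> / 2 * P s - K / (2 * \<gamma>) * D s)\<^sup>2" by simp
        then show ?thesis by (simp only: power2_diff power2_sum)
      qed
      finally have "\<bar>defect s f\<bar> \<le> \<bar>\<gamma> / 2 * P s + K / (2 * \<gamma>) * D s\<bar>" by (simp only: abs_le_square_iff)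
      moreover have "0 \<le> \<gamma> / 2 * P s + K / (2 * \<gamma>) * D s"
        using P0[of s] D(2)[of s] K \<gamma> by (intro add_nonneg_nonneg mult_nonneg_nonneg) auto
      ultimately have d: "\<bar>defect s f\<bar> \<le> \<gamma> / 2 * P s + K / (2 * \<gamma>) * D s" by linarith
      have g: "\<gamma> * P s \<le> \<gamma> * (K / m\<^sup>2 * (\<integral>x. (norm (snd x))\<^sup>2 \<partial>\<mu> s))" using PK[of s] \<gamma> by (intro mult_left_mono) auto
      have "(\<integral>x. gen (\<mu> s) f x \<partial>\<mu> s) + defect s f \<le> A0 K Cv + K / (2 * \<gamma>) * D s"
        using Iup[of s] d by linarith
      moreover have "\<bar>(\<integral>x. gen (\<mu> s) f x \<partial>\<mu> s) + defect s f\<bar> \<le> 2 * (\<gamma> * P s) + A0 K Cv + K / (2 * \<gamma>) * D s"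
        using Iab[of s] d by linarith
      ultimately show "(\<integral>x. gen (\<mu> s) f x \<partial>\<mu> s) + defect s f \<le> A0 K Cv + K / (2 * \<gamma>) * D s \<and>
     \<bar>(\<integral>x. gen (\<mu> s) f x \<partial>\<mu> s) + defect s f\<bar> \<le> 2 * \<gamma> * (K / m\<^sup>2 * (\<integral>x. (norm (snd x))\<^sup>2 \<partial>\<mu> s)) + A0 K Cv + K / (2 * \<gamma>) * D s"
        using g by (simp add: mult.assoc)
    qed
  qed
qed

end

section \<open>Balance of kinetic and external energy\<close>

context vfp_finite begin

definition momentum_integral :: "('d phase \<Rightarrow> real ^ 'd) \<Rightarrow> real \<Rightarrow> real" where
  "momentum_integral g s = (\<integral>x. (snd x /\<^sub>R m) \<bullet> g x \<partial>\<mu> s)"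

text \<open>When \<open>G\<close> is the gradient of \<open>W\<close>, this is the generator applied
  to \<open>p^2/(2 m) + W\<close> without its diffusion constant
  \<open>\<gamma> * \<theta> * d / m\<close>.\<close>

definition power_drift :: "(real ^ 'd \<Rightarrow> real ^ 'd) \<Rightarrow> real \<Rightarrow> 'd phase \<Rightarrow> real" where
  "power_drift G s x = (snd x /\<^sub>R m) \<bullet> (G (fst x) - grad V (fst x) - grad_conv \<psi> (\<mu> s) (fst x)) - \<gamma> * (norm (snd x))\<^sup>2 / m\<^sup>2"

lemma integrable_momentum_inner:
  fixes \<nu> :: "'d phase measure" and g :: "'d phase \<Rightarrow> real ^ 'd"
  assumes \<nu>: "\<nu> \<in> P2" and g: "continuous_on UNIV g" "\<And>x. norm (g x) \<le> C"
  shows "integrable \<nu> (\<lambda>x. (snd x /\<^sub>R m) \<bullet> g x)"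
proof (rule P2_integrable[OF \<nu>, of _ "C / m"])
  fix x :: "'d phase"
  have "norm ((snd x /\<^sub>R m) \<bullet> g x) \<le> norm (snd x /\<^sub>R m) * norm (g x)"
    by (simp only: real_norm_def) (rule Cauchy_Schwarz_ineq2)
  also have "\<dots> \<le> norm (snd x) / m * C" using g(2)[of x] m by (intro mult_mono) (auto simp: divide_inverse)
  also have "\<dots> = C / m * norm (snd x)" by simp
  also have "\<dots> \<le> C / m * (1 + (norm (snd x))\<^sup>2)"
  proof (rule mult_left_mono)
    show "norm (snd x) \<le> 1 + (norm (snd x))\<^sup>2" using sum_squares_bound[of 1 "norm (snd x)"] by (simp, use norm_ge_zero[of "snd x"] in linarith)
    have "0 \<le> C" using g(2)[of x] norm_ge_zero order_trans by blast
    then show "0 \<le> C / m" using m by simp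
  qed
  finally show "norm ((snd x /\<^sub>R m) \<bullet> g x) \<le> C / m * (1 + (norm (snd x))\<^sup>2)" .
qed (intro borel_measurable_continuous_onI continuous_intros g)

lemma prob_integral_const: "\<nu> \<in> P2 \<Longrightarrow> (\<integral>x. c \<partial>\<nu>) = (c :: real)" "\<nu> \<in> P2 \<Longrightarrow> integrable \<nu> (\<lambda>x. c :: real)"
  using prob_space.prob_space[OF P2_D(1)] P2_integrable_bounded[of \<nu> "\<lambda>x. c" "\<bar>c\<bar>"] by auto

text \<open>\<open>G\<close> and \<open>grad V\<close> may be unbounded, but their difference is
  bounded, which is what friction can absorb. The one-sided bound on the rate gives the energy bound
  at every time by Fatou; the momentum bound that follows makes the two-sided bound integrable, and
  dominated convergence in time yields the identity.\<close>

lemma energy_balance: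
  assumes W: "lipschitz_grad L W G" "\<And>q. W q \<ge> 0" and Cg: "\<And>q. norm (G q - grad V q) \<le> Cg"
    and int0: "integrable (\<rho> 0) (\<lambda>x. W (fst x))"
    and \<tau>: "kinetic_defect \<tau>"
  defines "H \<equiv> \<lambda>x. (norm (snd x))\<^sup>2 / (2 * m) + W (fst x)"
    and "b \<equiv> \<lambda>s. (\<integral>x. power_drift G s x \<partial>\<mu> s) + \<gamma> * \<theta> * real CARD('d) / m + \<tau> s"
  shows "\<exists>B. \<forall>t\<in>{0..T}. integrable (\<rho> t) H \<and> (\<integral>x. H x \<partial>\<rho> t) \<le> B" (is ?A)
    and "b \<in> borel_measurable borel" "set_integrable lborel {0..T} b"
    and "\<And>t. t \<in> {0..T} \<Longrightarrow> (\<integral>x. H x \<partial>\<rho> t) = (\<integral>x. H x \<partial>\<rho> 0) + (LINT s:{0..t}|lborel. b s)"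
proof -
  obtain K \<zeta> \<Theta> where cut: "spatial_cutoff K \<zeta>" "energy_cutoff K \<Theta>" by (rule cutoffs_exist)
  have P0: "\<rho> 0 \<in> P2" by (rule \<rho>_P2) (use T in auto)
  define Cv where "Cv = Cg + C\<psi> + 1"
  have cH: "continuous_on UNIV H" unfolding H_def
    by (intro continuous_intros continuous_on_compose2[OF lipschitz_grad_continuous(1)[OF W(1), of UNIV]]) (use m in auto)
  have iH0: "integrable (\<rho> 0) H" unfolding H_def using P2_D(3)[OF P0] int0 by simp
  have H0: "0 \<le> H x" for x unfolding H_def using m W(2) by simp
  have cG: "continuous_on UNIV (\<lambda>x::'d phase. G (fst x) - grad V (fst x) - grad_conv \<psi> (\<mu> s) (fst x))" for s
    by (intro continuous_intros continuous_on_compose2[OF lipschitz_grad_continuous(2)[OF W(1), of UNIV]]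
        continuous_on_compose2[OF lipschitz_grad_continuous(2)[OF V(1), of UNIV]] continuous_on_compose2[OF continuous_grad_conv[OF \<mu>_P2, of UNIV]]) auto
  have nG: "norm (G q - grad V q - grad_conv \<psi> (\<mu> s) q) \<le> Cg + C\<psi>" for s q
    using norm_triangle_ineq4[of "G q - grad V q" "grad_conv \<psi> (\<mu> s) q"] Cg[of q] grad_conv_bounded[OF \<mu>_P2, of s q] by linarith
  have ipd: "integrable (\<mu> s) (power_drift G s)" for s
  proof -
    have "integrable (\<mu> s) (\<lambda>x. (snd x /\<^sub>R m) \<bullet> (G (fst x) - grad V (fst x) - grad_conv \<psi> (\<mu> s) (fst x)) - \<gamma> * (norm (snd x))\<^sup>2 / m\<^sup>2)"
      by (rule Bochner_Integration.integrable_diff[OF integrable_momentum_inner[OF \<mu>_P2 cG nG]]) (use P2_D(3)[OF \<mu>_P2, of s] in simp)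
    then show ?thesis by (simp add: power_drift_def[abs_def])
  qed
  \<comment> \<open>The sequence depends on \<open>t\<close>, since its radii are adapted to the
    tails of \<open>\<rho> 0\<close> and \<open>\<rho> t\<close>. Its properties are bundled because
    the a priori bound and the identity both use them.\<close>
  define good where "good t f c \<phi> rem u r h \<longleftrightarrow>
    (\<forall>n. f n \<in> test_functions) \<and> (\<forall>n x. grad_p (f n) x = c n x *\<^sub>R (snd x /\<^sub>R m)) \<and> (\<forall>n x. 0 \<le> c n x) \<and> (\<forall>n x. c n x \<le> K) \<and>
    (\<forall>n. continuous_on UNIV (c n)) \<and> (\<forall>x. (\<lambda>n. c n x) \<longlonglongrightarrow> 1) \<and>
    (\<forall>n s x. gen (\<mu> s) (f n) x = c n x * ((snd x /\<^sub>R m) \<bullet> (G (fst x) - grad V (fst x) - grad_conv \<psi> (\<mu> s) (fst x) + u n (fst x))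
       - \<gamma> * (norm (snd x))\<^sup>2 / m\<^sup>2) + rem n x) \<and>
    (\<forall>n q. norm (u n q) \<le> 1) \<and> (\<forall>q. (\<lambda>n. u n q) \<longlonglongrightarrow> 0) \<and>
    (\<forall>n x. \<bar>rem n x\<bar> \<le> remainder_bound K) \<and> (\<forall>x. (\<lambda>n. rem n x) \<longlonglongrightarrow> \<gamma> * \<theta> * real CARD('d) / m) \<and>
    (\<forall>n x. 0 \<le> \<phi> n x) \<and> (\<forall>n x. \<phi> n x \<le> K * (H x + 2)) \<and> (\<forall>x. (\<lambda>n. \<phi> n x) \<longlonglongrightarrow> H x) \<and> (\<forall>n. continuous_on UNIV (\<phi> n)) \<and>
    (\<forall>n. \<forall>\<nu>\<in>P2. integrable \<nu> (\<phi> n) \<and> (\<integral>x. f n x \<partial>\<nu>) + 2 * real (Suc n) = (\<integral>x. \<phi> n x \<partial>\<nu>) + (\<integral>x. r n x \<partial>\<nu>)) \<and>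
    (\<forall>n. \<forall>\<nu>\<in>P2. 0 \<le> (\<integral>x. r n x \<partial>\<nu>)) \<and>
    (\<forall>n. (\<integral>x. r n x \<partial>\<rho> 0) \<le> 1 / real (Suc n)) \<and> (\<forall>n. (\<integral>x. r n x \<partial>\<rho> t) \<le> 1 / real (Suc n)) \<and>
    (\<forall>n. h n \<in> borel_measurable borel \<and> set_integrable lborel {0..T} (h n) \<and>
      (\<integral>x. f n x \<partial>\<rho> t) = (\<integral>x. f n x \<partial>\<rho> 0) + (LINT s:{0..t}|lborel. h n s) \<and>
      (AE s in lborel. s \<in> {0..T} \<longrightarrow> h n s = (\<integral>x. gen (\<mu> s) (f n) x \<partial>\<mu> s) + defect s (f n)))" for t f c \<phi> rem u r h
  have gD: "f n \<in> test_functions"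
    "grad_p (f n) x = c n x *\<^sub>R (snd x /\<^sub>R m)"
    "0 \<le> c n x"
    "c n x \<le> K"
    "continuous_on UNIV (c n)"
    "(\<lambda>n. c n x) \<longlonglongrightarrow> 1"
    "gen (\<mu> s) (f n) x = c n x * ((snd x /\<^sub>R m) \<bullet> (G (fst x) - grad V (fst x) - grad_conv \<psi> (\<mu> s) (fst x) + u n (fst x)) - \<gamma> * (norm (snd x))\<^sup>2 / m\<^sup>2) + rem n x"
    "norm (u n q) \<le> 1"
    "(\<lambda>n. u n q) \<longlonglongrightarrow> 0"
    "\<bar>rem n x\<bar> \<le> remainder_bound K"
    "(\<lambda>n. rem n x) \<longlonglongrightarrow> \<gamma> * \<theta> * real CARD('d) / m"
    "0 \<le> \<phi> n x"
    "\<phi> n x \<le> K * (H x + 2)"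
    "(\<lambda>n. \<phi> n x) \<longlonglongrightarrow> H x"
    "continuous_on UNIV (\<phi> n)"
    "\<nu> \<in> P2 \<Longrightarrow> integrable \<nu> (\<phi> n)"
    "\<nu> \<in> P2 \<Longrightarrow> (\<integral>x. f n x \<partial>\<nu>) + 2 * real (Suc n) = (\<integral>x. \<phi> n x \<partial>\<nu>) + (\<integral>x. r n x \<partial>\<nu>)"
    "\<nu> \<in> P2 \<Longrightarrow> 0 \<le> (\<integral>x. r n x \<partial>\<nu>)"
    "(\<integral>x. r n x \<partial>\<rho> 0) \<le> 1 / real (Suc n)"
    "(\<integral>x. r n x \<partial>\<rho> t) \<le> 1 / real (Suc n)"
    "h n \<in> borel_measurable borel"
    "set_integrable lborel {0..T} (h n)"
    "(\<integral>x. f n x \<partial>\<rho> t) = (\<integral>x. f n x \<partial>\<rho> 0) + (LINT s:{0..t}|lborel. h n s)"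
    "AE s in lborel. s \<in> {0..T} \<longrightarrow> h n s = (\<integral>x. gen (\<mu> s) (f n) x \<partial>\<mu> s) + defect s (f n)"
    if good: "good t f c \<phi> rem u r h" for t f c \<phi> rem u r h n x s q \<nu>
  proof -
    note d1 = good[unfolded good_def]
    note d2 = d1[THEN conjunct2]
    note d3 = d2[THEN conjunct2]
    note d4 = d3[THEN conjunct2]
    note d5 = d4[THEN conjunct2]
    note d6 = d5[THEN conjunct2]
    note d7 = d6[THEN conjunct2]
    note d8 = d7[THEN conjunct2]
    note d9 = d8[THEN conjunct2]
    note d10 = d9[THEN conjunct2]
    note d11 = d10[THEN conjunct2]
    note d12 = d11[THEN conjunct2]
    note d13 = d12[THEN conjunct2]
    note d14 = d13[THEN conjunct2]
    note d15 = d14[THEN conjunct2]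
    note d16 = d15[THEN conjunct2]
    note d17 = d16[THEN conjunct2]
    note d18 = d17[THEN conjunct2]
    note d19 = d18[THEN conjunct2]
    note d20 = d19[THEN conjunct2]
    show "f n \<in> test_functions" by (rule d1[THEN conjunct1, rule_format])
    show "grad_p (f n) x = c n x *\<^sub>R (snd x /\<^sub>R m)" by (rule d2[THEN conjunct1, rule_format])
    show "0 \<le> c n x" by (rule d3[THEN conjunct1, rule_format])
    show "c n x \<le> K" by (rule d4[THEN conjunct1, rule_format])
    show "continuous_on UNIV (c n)" by (rule d5[THEN conjunct1, rule_format])
    show "(\<lambda>n. c n x) \<longlonglongrightarrow> 1" by (rule d6[THEN conjunct1, rule_format])
    show "gen (\<mu> s) (f n) x = c n x * ((snd x /\<^sub>R m) \<bullet> (G (fst x) - grad V (fst x) - grad_conv \<psi> (\<mu> s) (fst x) + u n (fst x)) - \<gamma> * (norm (snd x))\<^sup>2 / m\<^sup>2) + rem n x" by (rule d7[THEN conjunct1, rule_format])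
    show "norm (u n q) \<le> 1" by (rule d8[THEN conjunct1, rule_format])
    show "(\<lambda>n. u n q) \<longlonglongrightarrow> 0" by (rule d9[THEN conjunct1, rule_format])
    show "\<bar>rem n x\<bar> \<le> remainder_bound K" by (rule d10[THEN conjunct1, rule_format])
    show "(\<lambda>n. rem n x) \<longlonglongrightarrow> \<gamma> * \<theta> * real CARD('d) / m" by (rule d11[THEN conjunct1, rule_format])
    show "0 \<le> \<phi> n x" by (rule d12[THEN conjunct1, rule_format])
    show "\<phi> n x \<le> K * (H x + 2)" by (rule d13[THEN conjunct1, rule_format])
    show "(\<lambda>n. \<phi> n x) \<longlonglongrightarrow> H x" by (rule d14[THEN conjunct1, rule_format])
    show "continuous_on UNIV (\<phi> n)" by (rule d15[THEN conjunct1, rule_format])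
    show "\<nu> \<in> P2 \<Longrightarrow> integrable \<nu> (\<phi> n)" by (rule d16[THEN conjunct1, rule_format, THEN conjunct1])
    show "\<nu> \<in> P2 \<Longrightarrow> (\<integral>x. f n x \<partial>\<nu>) + 2 * real (Suc n) = (\<integral>x. \<phi> n x \<partial>\<nu>) + (\<integral>x. r n x \<partial>\<nu>)" by (rule d16[THEN conjunct1, rule_format, THEN conjunct2])
    show "\<nu> \<in> P2 \<Longrightarrow> 0 \<le> (\<integral>x. r n x \<partial>\<nu>)" by (rule d17[THEN conjunct1, rule_format])
    show "(\<integral>x. r n x \<partial>\<rho> 0) \<le> 1 / real (Suc n)" by (rule d18[THEN conjunct1, rule_format])
    show "(\<integral>x. r n x \<partial>\<rho> t) \<le> 1 / real (Suc n)" by (rule d19[THEN conjunct1, rule_format])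
    show "h n \<in> borel_measurable borel" by (rule d20[rule_format, THEN conjunct1])
    show "set_integrable lborel {0..T} (h n)" by (rule d20[rule_format, THEN conjunct2, THEN conjunct1])
    show "(\<integral>x. f n x \<partial>\<rho> t) = (\<integral>x. f n x \<partial>\<rho> 0) + (LINT s:{0..t}|lborel. h n s)" by (rule d20[rule_format, THEN conjunct2, THEN conjunct2, THEN conjunct1])
    show "AE s in lborel. s \<in> {0..T} \<longrightarrow> h n s = (\<integral>x. gen (\<mu> s) (f n) x \<partial>\<mu> s) + defect s (f n)" by (rule d20[rule_format, THEN conjunct2, THEN conjunct2, THEN conjunct2])
  qed
  have seq: "\<exists>f c \<phi> rem u r h. good t f c \<phi> rem u r h" if t: "t \<in> {0..T}" for t
  proof (rule truncation_sequence[OF cut W P0 \<rho>_P2[OF t]])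
    fix f :: "nat \<Rightarrow> 'd phase \<Rightarrow> real" and c \<phi> rem u r
    assume f: "\<And>n. f n \<in> test_functions" and 1: "\<And>n x. grad_p (f n) x = c n x *\<^sub>R (snd x /\<^sub>R m)" "\<And>n x. 0 \<le> c n x" "\<And>n x. c n x \<le> K"
      "\<And>n. continuous_on UNIV (c n)" "\<And>x. (\<lambda>n. c n x) \<longlonglongrightarrow> 1"
      "\<And>n \<nu> x. gen \<nu> (f n) x = c n x * ((snd x /\<^sub>R m) \<bullet> (G (fst x) - grad V (fst x) - grad_conv \<psi> \<nu> (fst x) + u n (fst x))
       - \<gamma> * (norm (snd x))\<^sup>2 / m\<^sup>2) + rem n x"
      "\<And>n q. norm (u n q) \<le> 1" "\<And>q. (\<lambda>n. u n q) \<longlonglongrightarrow> 0"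
      "\<And>n x. \<bar>rem n x\<bar> \<le> remainder_bound K" "\<And>x. (\<lambda>n. rem n x) \<longlonglongrightarrow> \<gamma> * \<theta> * real CARD('d) / m"
      and fr: "\<And>n x. f n x + 2 * real (Suc n) = \<phi> n x + r n x"
      and 2: "\<And>n. continuous_on UNIV (\<phi> n)" "\<And>n x. 0 \<le> \<phi> n x" "\<And>n x. \<phi> n x \<le> K * ((norm (snd x))\<^sup>2 / (2 * m) + W (fst x) + 2)"
        "\<And>x. (\<lambda>n. \<phi> n x) \<longlonglongrightarrow> (norm (snd x))\<^sup>2 / (2 * m) + W (fst x)"
      and r: "\<And>n. continuous_on UNIV (r n)" "\<And>n x. 0 \<le> r n x" "\<And>n x. r n x \<le> 2 * real (Suc n)"
      and 3: "\<And>n. (\<integral>x. r n x \<partial>\<rho> 0) \<le> 1 / real (Suc n)" "\<And>n. (\<integral>x. r n x \<partial>\<rho> t) \<le> 1 / real (Suc n)"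
    have 4: "integrable \<nu> (\<phi> n)" "(\<integral>x. f n x \<partial>\<nu>) + 2 * real (Suc n) = (\<integral>x. \<phi> n x \<partial>\<nu>) + (\<integral>x. r n x \<partial>\<nu>)" if \<nu>: "\<nu> \<in> P2" for n \<nu>
    proof -
      have ir: "integrable \<nu> (r n)"
        by (rule P2_integrable_bounded[OF \<nu>, of _ "2 * real (Suc n)"]) (use r(2,3) in \<open>auto intro: borel_measurable_continuous_onI[OF r(1)]\<close>)
      have ifn: "integrable \<nu> (f n)" by (intro test_function_integrable P2_D[OF \<nu>] f)
      have i2: "integrable \<nu> (\<lambda>x. f n x + 2 * real (Suc n))" by (intro Bochner_Integration.integrable_add ifn prob_integral_const(2)[OF \<nu>])
      have "\<phi> n = (\<lambda>x. f n x + 2 * real (Suc n) - r n x)" using fr[of n] by (auto simp: fun_eq_iff)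
      then show i\<phi>: "integrable \<nu> (\<phi> n)" using i2 ir by simp
      have "(\<integral>x. f n x + 2 * real (Suc n) \<partial>\<nu>) = (\<integral>x. \<phi> n x + r n x \<partial>\<nu>)" unfolding fr ..
      then show "(\<integral>x. f n x \<partial>\<nu>) + 2 * real (Suc n) = (\<integral>x. \<phi> n x \<partial>\<nu>) + (\<integral>x. r n x \<partial>\<nu>)"
        unfolding Bochner_Integration.integral_add[OF i\<phi> ir] Bochner_Integration.integral_add[OF ifn prob_integral_const(2)[OF \<nu>]] prob_integral_const(1)[OF \<nu>] .
    qed
    have "\<exists>h. h \<in> borel_measurable borel \<and> set_integrable lborel {0..T} h \<and>
      (\<integral>x. f n x \<partial>\<rho> t) = (\<integral>x. f n x \<partial>\<rho> 0) + (LINT s:{0..t}|lborel. h s) \<and>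
      (AE s in lborel. s \<in> {0..T} \<longrightarrow> h s = (\<integral>x. gen (\<mu> s) (f n) x \<partial>\<mu> s) + defect s (f n))" for n
      by (rule pairing_density[OF f[of n]]) (use t in blast)
    then have "\<exists>h. \<forall>n. h n \<in> borel_measurable borel \<and> set_integrable lborel {0..T} (h n) \<and>
      (\<integral>x. f n x \<partial>\<rho> t) = (\<integral>x. f n x \<partial>\<rho> 0) + (LINT s:{0..t}|lborel. h n s) \<and>
      (AE s in lborel. s \<in> {0..T} \<longrightarrow> h n s = (\<integral>x. gen (\<mu> s) (f n) x \<partial>\<mu> s) + defect s (f n))"
      by (intro choice allI)
    then obtain h where h: "\<forall>n. h n \<in> borel_measurable borel \<and> set_integrable lborel {0..T} (h n) \<and>
      (\<integral>x. f n x \<partial>\<rho> t) = (\<integral>x. f n x \<partial>\<rho> 0) + (LINT s:{0..t}|lborel. h n s) \<and>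
      (AE s in lborel. s \<in> {0..T} \<longrightarrow> h n s = (\<integral>x. gen (\<mu> s) (f n) x \<partial>\<mu> s) + defect s (f n))" ..
    have h': "h n \<in> borel_measurable borel" "set_integrable lborel {0..T} (h n)"
      "(\<integral>x. f n x \<partial>\<rho> t) = (\<integral>x. f n x \<partial>\<rho> 0) + (LINT s:{0..t}|lborel. h n s)"
      "AE s in lborel. s \<in> {0..T} \<longrightarrow> h n s = (\<integral>x. gen (\<mu> s) (f n) x \<partial>\<mu> s) + defect s (f n)" for n
      using h by simp_all
    have "good t f c \<phi> rem u r h"
      unfolding good_def H_def
      by (intro conjI allI ballI f 1 2 3 4 h' Bochner_Integration.integral_nonneg r; assumption)
    then show ?thesis by blast
  qed
  have bound: "AE s in lborel. s \<in> {0..T} \<longrightarrow> h n s \<le> A0 K Cv + K / (2 * \<gamma>) * D s \<and>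
      \<bar>h n s\<bar> \<le> 2 * \<gamma> * (K / m\<^sup>2 * (\<integral>x. (norm (snd x))\<^sup>2 \<partial>\<mu> s)) + A0 K Cv + K / (2 * \<gamma>) * D s"
    and gbound: "\<bar>gen (\<mu> s) (f n) x\<bar> \<le> 3 / 2 * \<gamma> * (K * ((norm (snd x))\<^sup>2 / m\<^sup>2)) + A0 K Cv"
    if g: "good t f c \<phi> rem u r h" for t f c \<phi> rem u r h n s x
  proof -
    have v: "norm (G (fst x) - grad V (fst x) - grad_conv \<psi> (\<mu> s) (fst x) + u n (fst x)) \<le> Cv" for s and x :: "'d phase"
    proof -
      have "norm (u n (fst x)) \<le> 1" by (rule gD[OF g])
      then show ?thesis unfolding Cv_def
        using norm_triangle_ineq[of "G (fst x) - grad V (fst x) - grad_conv \<psi> (\<mu> s) (fst x)" "u n (fst x)"] nG[of "fst x" s] by linarith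
    qed
    have *: "f n \<in> test_functions" "\<And>x. grad_p (f n) x = c n x *\<^sub>R (snd x /\<^sub>R m)" "\<And>x. 0 \<le> c n x" "\<And>x. c n x \<le> K" "continuous_on UNIV (c n)"
      "\<And>s x. gen (\<mu> s) (f n) x = c n x * ((snd x /\<^sub>R m) \<bullet> (G (fst x) - grad V (fst x) - grad_conv \<psi> (\<mu> s) (fst x) + u n (fst x))
       - \<gamma> * (norm (snd x))\<^sup>2 / m\<^sup>2) + rem n x" "\<And>x. \<bar>rem n x\<bar> \<le> remainder_bound K"
      by (rule gD[OF g])+
    note R = truncated_rate_bound[OF *(1-5) *(6) v *(7)]
    show "\<bar>gen (\<mu> s) (f n) x\<bar> \<le> 3 / 2 * \<gamma> * (K * ((norm (snd x))\<^sup>2 / m\<^sup>2)) + A0 K Cv" by (rule R(1))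
    have "AE s in lborel. s \<in> {0..T} \<longrightarrow> h n s = (\<integral>x. gen (\<mu> s) (f n) x \<partial>\<mu> s) + defect s (f n)" by (rule gD[OF g])
    with R(2) show "AE s in lborel. s \<in> {0..T} \<longrightarrow> h n s \<le> A0 K Cv + K / (2 * \<gamma>) * D s \<and>
      \<bar>h n s\<bar> \<le> 2 * \<gamma> * (K / m\<^sup>2 * (\<integral>x. (norm (snd x))\<^sup>2 \<partial>\<mu> s)) + A0 K Cv + K / (2 * \<gamma>) * D s"
      by eventually_elim simp
  qed
  have K1: "1 \<le> K" using cut(2) by (simp add: energy_cutoff_def)
  have A0n: "0 \<le> A0 K Cv"
  proof -
    have "0 \<le> remainder_bound K" unfolding remainder_bound_def using \<gamma> \<theta> m K1 by (intro add_nonneg_nonneg mult_nonneg_nonneg divide_nonneg_pos) auto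
    then show ?thesis unfolding A0_def using K1 \<gamma> by (intro add_nonneg_nonneg mult_nonneg_nonneg) auto
  qed
  \<comment> \<open>The summands bound the truncated energy at time 0, the spatial loss
    \<open>r\<close> at time 0 and the time integral of the rate.\<close>
  define B where "B = K * ((\<integral>x. H x \<partial>\<rho> 0) + 2) + 1 + (A0 K Cv * T + K / (2 * \<gamma>) * (\<integral>s. D s \<partial>lborel))"
  have apriori: "integrable (\<rho> t) H" "(\<integral>x. H x \<partial>\<rho> t) \<le> B" if t: "t \<in> {0..T}" for t
  proof -
    obtain f c \<phi> rem u r h where g: "good t f c \<phi> rem u r h" using seq[OF t] by blast
    have h: "h n \<in> borel_measurable borel" "set_integrable lborel {0..T} (h n)" "(\<integral>x. f n x \<partial>\<rho> t) = (\<integral>x. f n x \<partial>\<rho> 0) + (LINT s:{0..t}|lborel. h n s)" for n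
      by (rule gD[OF g])+
    have i\<phi>: "integrable \<nu> (\<phi> n)" and f\<phi>: "(\<integral>x. f n x \<partial>\<nu>) + 2 * real (Suc n) = (\<integral>x. \<phi> n x \<partial>\<nu>) + (\<integral>x. r n x \<partial>\<nu>)" if "\<nu> \<in> P2" for n \<nu>
      by (rule gD(16,17)[OF g that])+
    have le: "(\<integral>x. \<phi> n x \<partial>\<rho> t) \<le> B" for n
    proof -
      \<comment> \<open>Only the upper bound of the rate enters: it does not contain the momentum
        integral, for which no bound uniform in time is available yet.\<close>
      have "(LINT s:{0..t}|lborel. h n s) \<le> (\<integral>s. indicator {0..T} s * A0 K Cv + K / (2 * \<gamma>) * D s \<partial>lborel)"
        unfolding set_lebesgue_integral_def real_scaleR_def
      proof (rule integral_mono_AE)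
        show "integrable lborel (\<lambda>s. indicator {0..t} s * h n s)"
          using set_integrable_subset[OF h(2), of "{0..t}" n] t by (simp add: set_integrable_def)
        show "integrable lborel (\<lambda>s. indicator {0..T} s * A0 K Cv + K / (2 * \<gamma>) * D s)"
          by (intro Bochner_Integration.integrable_add integrable_mult_right integrable_mult_left integrable_real_indicator D(3)) (auto simp: emeasure_lborel_Icc_eq)
        show "AE s in lborel. indicator {0..t} s * h n s \<le> indicator {0..T} s * A0 K Cv + K / (2 * \<gamma>) * D s"
          using bound[OF g, of n]
        proof eventually_elim
          case (elim s)
          have "0 \<le> K / (2 * \<gamma>) * D s" using D(2)[of s] K1 \<gamma> by simp
          then show ?case using elim t A0n by (auto simp: indicator_def)
        qed
      qed
      also have "\<dots> = A0 K Cv * T + K / (2 * \<gamma>) * (\<integral>s. D s \<partial>lborel)" using D(3) T by simp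
      finally have hh: "(LINT s:{0..t}|lborel. h n s) \<le> A0 K Cv * T + K / (2 * \<gamma>) * (\<integral>s. D s \<partial>lborel)" .
      have "(\<integral>x. \<phi> n x \<partial>\<rho> 0) \<le> (\<integral>x. K * (H x + 2) \<partial>\<rho> 0)"
        by (rule integral_mono[OF i\<phi>[OF P0] _ gD(13)[OF g]]) (use iH0 prob_integral_const(2)[OF P0] in simp)
      also have "\<dots> = K * ((\<integral>x. H x \<partial>\<rho> 0) + 2)" using iH0 prob_integral_const[OF P0] by simp
      finally have p0: "(\<integral>x. \<phi> n x \<partial>\<rho> 0) \<le> K * ((\<integral>x. H x \<partial>\<rho> 0) + 2)" .
      have r0: "(\<integral>x. r n x \<partial>\<rho> 0) \<le> 1" by (rule order_trans[OF gD(19)[OF g]]) simp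
      have rt: "0 \<le> (\<integral>x. r n x \<partial>\<rho> t)" by (rule gD(18)[OF g \<rho>_P2[OF t]])
      show ?thesis using f\<phi>[OF P0, of n] f\<phi>[OF \<rho>_P2[OF t], of n] h(3)[of n] hh p0 r0 rt unfolding B_def by linarith
    qed
    note lim = integrable_of_bounded_limit[OF i\<phi>[OF \<rho>_P2[OF t]] gD(12)[OF g] gD(14)[OF g] le]
    show "integrable (\<rho> t) H" "(\<integral>x. H x \<partial>\<rho> t) \<le> B" by (rule lim)+
  qed
  then show ?A by blast
  have p2B: "(\<integral>x. (norm (snd x))\<^sup>2 \<partial>\<mu> s) \<le> 2 * m * B" for s
  proof -
    define t where "t = max 0 (min T s)"
    have t: "t \<in> {0..T}" using T by (auto simp: t_def)
    have "(\<integral>x. (norm (snd x))\<^sup>2 \<partial>\<mu> s) = (\<integral>x. (norm (snd x))\<^sup>2 \<partial>\<rho> t)" by (simp add: \<mu>_def t_def)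
    also have "\<dots> \<le> (\<integral>x. 2 * m * H x \<partial>\<rho> t)"
      by (rule integral_mono[OF P2_D(3)[OF \<rho>_P2[OF t]] integrable_mult_right[OF apriori(1)[OF t]]]) (use m W(2) in \<open>auto simp: H_def distrib_left\<close>)
    also have "\<dots> \<le> 2 * m * B" using apriori[OF t] m by simp
    finally show ?thesis .
  qed
  \<comment> \<open>With the momentum integral bounded uniformly in time, the two-sided bound on the
    rate becomes an integrable majorant.\<close>
  define A1 where "A1 = 2 * \<gamma> * (K / m\<^sup>2 * (2 * m * B)) + A0 K Cv"
  have lims: "(\<lambda>n. \<integral>x. gen (\<mu> s) (f n) x \<partial>\<mu> s) \<longlonglongrightarrow> (\<integral>x. power_drift G s x \<partial>\<mu> s) + \<gamma> * \<theta> * real CARD('d) / m"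
    if g: "good t f c \<phi> rem u r h" for t f c \<phi> rem u r h s
  proof -
    have ft: "f n \<in> test_functions" for n by (rule gD[OF g])
    have "(\<lambda>n. \<integral>x. gen (\<mu> s) (f n) x \<partial>\<mu> s) \<longlonglongrightarrow> (\<integral>x. power_drift G s x + \<gamma> * \<theta> * real CARD('d) / m \<partial>\<mu> s)"
    proof (rule integral_dominated_convergence[where w="\<lambda>x. 3 / 2 * \<gamma> * (K * ((norm (snd x))\<^sup>2 / m\<^sup>2)) + A0 K Cv"])
      show "(\<lambda>x. power_drift G s x + \<gamma> * \<theta> * real CARD('d) / m) \<in> borel_measurable (\<mu> s)" using ipd[of s] by auto
      show "gen (\<mu> s) (f n) \<in> borel_measurable (\<mu> s)" for n using integrable_gen[OF \<mu>_P2 \<mu>_P2 ft] by auto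
      show "integrable (\<mu> s) (\<lambda>x. 3 / 2 * \<gamma> * (K * ((norm (snd x))\<^sup>2 / m\<^sup>2)) + A0 K Cv)"
        using P2_D(3)[OF \<mu>_P2, of s] prob_integral_const(2)[OF \<mu>_P2] by auto
      show "AE x in \<mu> s. norm (gen (\<mu> s) (f n) x) \<le> 3 / 2 * \<gamma> * (K * ((norm (snd x))\<^sup>2 / m\<^sup>2)) + A0 K Cv" for n
        by (rule AE_I2) (unfold real_norm_def, rule gbound[OF g])
      show "AE x in \<mu> s. (\<lambda>n. gen (\<mu> s) (f n) x) \<longlonglongrightarrow> power_drift G s x + \<gamma> * \<theta> * real CARD('d) / m"
      proof (rule AE_I2)
        fix x
        have c: "(\<lambda>n. c n x) \<longlonglongrightarrow> 1" and u: "(\<lambda>n. u n (fst x)) \<longlonglongrightarrow> 0" and re: "(\<lambda>n. rem n x) \<longlonglongrightarrow> \<gamma> * \<theta> * real CARD('d) / m"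
          by (rule gD[OF g])+
        have "(\<lambda>n. c n x * ((snd x /\<^sub>R m) \<bullet> (G (fst x) - grad V (fst x) - grad_conv \<psi> (\<mu> s) (fst x) + u n (fst x))
           - \<gamma> * (norm (snd x))\<^sup>2 / m\<^sup>2) + rem n x) \<longlonglongrightarrow> 1 * ((snd x /\<^sub>R m) \<bullet> (G (fst x) - grad V (fst x) - grad_conv \<psi> (\<mu> s) (fst x) + 0)
           - \<gamma> * (norm (snd x))\<^sup>2 / m\<^sup>2) + \<gamma> * \<theta> * real CARD('d) / m"
          by (intro tendsto_intros c u re)
        moreover have "gen (\<mu> s) (f n) x = c n x * ((snd x /\<^sub>R m) \<bullet> (G (fst x) - grad V (fst x) - grad_conv \<psi> (\<mu> s) (fst x) + u n (fst x))
           - \<gamma> * (norm (snd x))\<^sup>2 / m\<^sup>2) + rem n x" for n by (rule gD[OF g])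
        ultimately show "(\<lambda>n. gen (\<mu> s) (f n) x) \<longlonglongrightarrow> power_drift G s x + \<gamma> * \<theta> * real CARD('d) / m"
          by (simp add: power_drift_def)
      qed
    qed
    then show ?thesis unfolding Bochner_Integration.integral_add[OF ipd prob_integral_const(2)[OF \<mu>_P2]] prob_integral_const(1)[OF \<mu>_P2] .
  qed
  show bm: "b \<in> borel_measurable borel"
  proof -
    obtain f c \<phi> rem u r h where g: "good 0 f c \<phi> rem u r h" using seq[of 0] T by auto
    have "f n \<in> test_functions" for n by (rule gD[OF g])
    then have "(\<lambda>s. (\<integral>x. power_drift G s x \<partial>\<mu> s) + \<gamma> * \<theta> * real CARD('d) / m) \<in> borel_measurable borel"
      by (intro borel_measurable_LIMSEQ_real[OF lims[OF g]] gen_\<mu>_measurable)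
    then show ?thesis unfolding b_def using kinetic_defect_D(1)[OF \<tau>] by measurable
  qed
  have step: "(\<integral>x. H x \<partial>\<rho> t) = (\<integral>x. H x \<partial>\<rho> 0) + (LINT s:{0..t}|lborel. b s)" "set_integrable lborel {0..t} b" if t: "t \<in> {0..T}" for t
  proof -
    obtain f c \<phi> rem u r h where g: "good t f c \<phi> rem u r h" using seq[OF t] by blast
    have h: "h n \<in> borel_measurable borel" "(\<integral>x. f n x \<partial>\<rho> t) = (\<integral>x. f n x \<partial>\<rho> 0) + (LINT s:{0..t}|lborel. h n s)" for n
      by (rule gD[OF g])+
    have ft: "f n \<in> test_functions" for n by (rule gD[OF g])
    have me: "(\<lambda>n. momentum_error (f n) (\<rho> s)) \<longlonglongrightarrow> 0" if "s \<in> {0..T}" for s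
      unfolding momentum_error_def by (rule weighted_momentum_L2_limit[OF \<rho>_P2[OF that] gD(2)[OF g] gD(3)[OF g] gD(4)[OF g] gD(5)[OF g] gD(6)[OF g]])
    have hl: "AE s in lborel. s \<in> {0..T} \<longrightarrow> (\<lambda>n. h n s) \<longlonglongrightarrow> b s"
    proof -
      have "AE s in lborel. \<forall>n. s \<in> {0..T} \<longrightarrow> h n s = (\<integral>x. gen (\<mu> s) (f n) x \<partial>\<mu> s) + defect s (f n)"
        unfolding AE_all_countable by (intro allI gD[OF g])
      moreover have "AE s in lborel. s \<in> {0..T} \<longrightarrow> (\<lambda>n. defect s (f n)) \<longlonglongrightarrow> \<tau> s"
        by (rule kinetic_defect_D(2)[OF \<tau> ft me])
      ultimately show ?thesis
      proof eventually_elim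
        case (elim s)
        show ?case
        proof
          assume s: "s \<in> {0..T}"
          have "(\<lambda>n. (\<integral>x. gen (\<mu> s) (f n) x \<partial>\<mu> s) + defect s (f n)) \<longlonglongrightarrow> b s"
            unfolding b_def using elim(2) s by (intro tendsto_add lims[OF g] tendsto_const) blast
          moreover have "(\<lambda>n. h n s) = (\<lambda>n. (\<integral>x. gen (\<mu> s) (f n) x \<partial>\<mu> s) + defect s (f n))" using elim(1) s by auto
          ultimately show "(\<lambda>n. h n s) \<longlonglongrightarrow> b s" by simp
        qed
      qed
    qed
    let ?I = "\<lambda>s. indicator {0..t} s :: real"
    have dc: "(\<lambda>s. ?I s * b s) \<in> borel_measurable lborel" "\<And>n. (\<lambda>s. ?I s * h n s) \<in> borel_measurable lborel"
      using bm h(1) by auto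
    have w: "integrable lborel (\<lambda>s. indicator {0..T} s * A1 + K / (2 * \<gamma>) * D s)"
      by (intro Bochner_Integration.integrable_add integrable_mult_right integrable_mult_left integrable_real_indicator D(3)) (auto simp: emeasure_lborel_Icc_eq)
    have l: "AE s in lborel. (\<lambda>n. ?I s * h n s) \<longlonglongrightarrow> ?I s * b s"
      using hl by eventually_elim (use t in \<open>auto simp: indicator_def\<close>)
    have bd: "AE s in lborel. norm (?I s * h n s) \<le> indicator {0..T} s * A1 + K / (2 * \<gamma>) * D s" for n
      using bound[OF g, of n]
    proof eventually_elim
      case (elim s)
      have D0: "0 \<le> K / (2 * \<gamma>) * D s" using D(2)[of s] K1 \<gamma> by simp
      have "2 * \<gamma> * (K / m\<^sup>2 * (\<integral>x. (norm (snd x))\<^sup>2 \<partial>\<mu> s)) \<le> 2 * \<gamma> * (K / m\<^sup>2 * (2 * m * B))"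
        using p2B[of s] K1 \<gamma> by (intro mult_left_mono) auto
      moreover have "0 \<le> 2 * \<gamma> * (K / m\<^sup>2 * (\<integral>x. (norm (snd x))\<^sup>2 \<partial>\<mu> s))" using K1 \<gamma> by (intro mult_nonneg_nonneg) auto
      ultimately have "0 \<le> A1" "s \<in> {0..T} \<Longrightarrow> \<bar>h n s\<bar> \<le> A1 + K / (2 * \<gamma>) * D s" using elim A0n unfolding A1_def by linarith+
      then show ?case using t D0 by (auto simp: indicator_def)
    qed
    show "set_integrable lborel {0..t} b" unfolding set_integrable_def real_scaleR_def
      by (rule integrable_dominated_convergence[OF dc w l bd])
    have "(\<lambda>n. LINT s:{0..t}|lborel. h n s) \<longlonglongrightarrow> (LINT s:{0..t}|lborel. b s)"
      unfolding set_lebesgue_integral_def real_scaleR_def by (rule integral_dominated_convergence[OF dc w l bd])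
    moreover have "(\<lambda>n. LINT s:{0..t}|lborel. h n s) \<longlonglongrightarrow> (\<integral>x. H x \<partial>\<rho> t) - (\<integral>x. H x \<partial>\<rho> 0)"
    proof -
      have lim: "(\<lambda>n. (\<integral>x. f n x \<partial>\<rho> s) + 2 * real (Suc n)) \<longlonglongrightarrow> (\<integral>x. H x \<partial>\<rho> s)"
        if s: "s \<in> {0..T}" and rs: "\<And>n. (\<integral>x. r n x \<partial>\<rho> s) \<le> 1 / real (Suc n)" for s
      proof -
        have i: "integrable (\<rho> s) H" by (rule apriori(1)[OF s])
        have "(\<lambda>n. \<integral>x. \<phi> n x \<partial>\<rho> s) \<longlonglongrightarrow> (\<integral>x. H x \<partial>\<rho> s)"
        proof (rule integral_dominated_convergence[where w="\<lambda>x. K * (H x + 2)"])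
          show "H \<in> borel_measurable (\<rho> s)" using i by auto
          show "\<phi> n \<in> borel_measurable (\<rho> s)" for n
            by (rule P2_measurable[OF \<rho>_P2[OF s]]) (rule borel_measurable_continuous_onI[OF gD(15)[OF g]])
          show "integrable (\<rho> s) (\<lambda>x. K * (H x + 2))" using i prob_integral_const(2)[OF \<rho>_P2[OF s]] by auto
          show "AE x in \<rho> s. (\<lambda>n. \<phi> n x) \<longlonglongrightarrow> H x" by (rule AE_I2) (rule gD[OF g])
          show "AE x in \<rho> s. norm (\<phi> n x) \<le> K * (H x + 2)" for n
            by (rule AE_I2) (use gD(12,13)[OF g] in \<open>simp only: real_norm_def abs_of_nonneg\<close>)
        qed
        moreover have "(\<lambda>n. \<integral>x. r n x \<partial>\<rho> s) \<longlonglongrightarrow> 0"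
        proof (rule Lim_null_comparison)
          have "norm (\<integral>x. r n x \<partial>\<rho> s) \<le> inverse (real (Suc n))" for n
            using rs[of n] gD(18)[OF g \<rho>_P2[OF s]] by (simp only: real_norm_def abs_of_nonneg inverse_eq_divide)
          then show "\<forall>\<^sub>F n in sequentially. norm (\<integral>x. r n x \<partial>\<rho> s) \<le> inverse (real (Suc n))" by simp
        qed (rule LIMSEQ_inverse_real_of_nat)
        ultimately have "(\<lambda>n. (\<integral>x. \<phi> n x \<partial>\<rho> s) + (\<integral>x. r n x \<partial>\<rho> s)) \<longlonglongrightarrow> (\<integral>x. H x \<partial>\<rho> s) + 0" by (rule tendsto_add)
        moreover have "(\<integral>x. f n x \<partial>\<rho> s) + 2 * real (Suc n) = (\<integral>x. \<phi> n x \<partial>\<rho> s) + (\<integral>x. r n x \<partial>\<rho> s)" for n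
          by (rule gD(17)[OF g \<rho>_P2[OF s]])
        ultimately show ?thesis by simp
      qed
      \<comment> \<open>The constants \<open>2 * real (Suc n)\<close> diverge but cancel between the
        two times.\<close>
      have "(\<lambda>n. ((\<integral>x. f n x \<partial>\<rho> t) + 2 * real (Suc n)) - ((\<integral>x. f n x \<partial>\<rho> 0) + 2 * real (Suc n))) \<longlonglongrightarrow> (\<integral>x. H x \<partial>\<rho> t) - (\<integral>x. H x \<partial>\<rho> 0)"
        by (intro tendsto_diff lim t gD(19,20)[OF g]) (use T in simp)
      then show ?thesis by (simp add: h(2))
    qed
    ultimately have "(LINT s:{0..t}|lborel. b s) = (\<integral>x. H x \<partial>\<rho> t) - (\<integral>x. H x \<partial>\<rho> 0)" by (rule LIMSEQ_unique)
    then show "(\<integral>x. H x \<partial>\<rho> t) = (\<integral>x. H x \<partial>\<rho> 0) + (LINT s:{0..t}|lborel. b s)" by simp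
  qed
  show "set_integrable lborel {0..T} b" using step(2)[of T] T by simp
  show "(\<integral>x. H x \<partial>\<rho> t) = (\<integral>x. H x \<partial>\<rho> 0) + (LINT s:{0..t}|lborel. b s)" if "t \<in> {0..T}" for t by (rule step(1)[OF that])
qed

end

section \<open>Balance of the Hamiltonian\<close>

text \<open>Differentiation along \<open>G\<close> itself gives the slope \<open>norm G ^ 2\<close>,
  while the Lipschitz bound allows at most \<open>c * norm G\<close>.\<close>

lemma lipschitz_imp_gradient_bound:
  fixes w :: "'a::euclidean_space \<Rightarrow> real"
  assumes D: "(w has_derivative (\<lambda>h. G \<bullet> h)) (at q)" and lip: "\<And>x y. \<bar>w x - w y\<bar> \<le> c * norm (x - y)"
  shows "norm G \<le> c"
proof (cases "G = 0")
  case True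
  have "norm (0::'a) = 0" by simp
  obtain b :: 'a where "b \<in> Basis" using nonempty_Basis by blast
  then show ?thesis using True lip[of b 0] abs_ge_zero[of "w b - w 0"] by simp
next
  case False
  have "((\<lambda>t. w (q + t *\<^sub>R G)) has_derivative (\<lambda>t. G \<bullet> (t *\<^sub>R G))) (at 0)"
    by (rule has_derivative_compose[of "\<lambda>t. q + t *\<^sub>R G" "\<lambda>t. t *\<^sub>R G" 0 UNIV w, simplified]) (auto intro!: derivative_eq_intros D)
  then have "((\<lambda>t. w (q + t *\<^sub>R G)) has_real_derivative (G \<bullet> G)) (at 0)"
    unfolding has_field_derivative_def by (simp add: mult_commute_abs)
  then have lim: "(\<lambda>h. (w (q + h *\<^sub>R G) - w q) / h) \<midarrow>0\<rightarrow> G \<bullet> G" by (simp add: DERIV_def)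
  have "G \<bullet> G \<le> c * norm G"
  proof (rule tendsto_upperbound[OF lim])
    show "\<forall>\<^sub>F h in at 0. (w (q + h *\<^sub>R G) - w q) / h \<le> c * norm G"
      unfolding eventually_at_filter
    proof (intro always_eventually allI impI)
      fix h :: real assume h: "h \<noteq> 0"
      have "(w (q + h *\<^sub>R G) - w q) / h \<le> \<bar>w (q + h *\<^sub>R G) - w q\<bar> / \<bar>h\<bar>" by (metis abs_divide abs_ge_self)
      also have "\<dots> \<le> (c * norm (h *\<^sub>R G)) / \<bar>h\<bar>" using lip[of "q + h *\<^sub>R G" q] by (intro divide_right_mono) auto
      also have "\<dots> = c * norm G" using h by simp
      finally show "(w (q + h *\<^sub>R G) - w q) / h \<le> c * norm G" .
    qed
  qed simp
  then have "norm G * norm G \<le> c * norm G" by (simp add: power2_norm_eq_inner[symmetric] power2_eq_square)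
  then show ?thesis using False by simp
qed

text \<open>With \<open>n + 1\<close> equal steps the increments add up to at most
  \<open>C * t^2 / (n + 1)\<close>.\<close>

lemma constant_of_quadratic_increments:
  fixes F :: "real \<Rightarrow> real"
  assumes F: "\<And>r t. 0 \<le> r \<Longrightarrow> r \<le> t \<Longrightarrow> t \<le> T \<Longrightarrow> \<bar>F t - F r\<bar> \<le> C * (t - r)\<^sup>2" and t: "0 \<le> t" "t \<le> T"
  shows "F t = F 0"
proof -
  have est: "\<bar>F t - F 0\<bar> \<le> C * t\<^sup>2 * inverse (real (Suc n))" for n
  proof -
    define h where "h = t / real (Suc n)"
    have h: "0 \<le> h" "real (Suc n) * h = t" using t by (auto simp: h_def)
    have "\<bar>F (real k * h) - F 0\<bar> \<le> real k * (C * h\<^sup>2)" if "k \<le> Suc n" for k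
      using that
    proof (induction k)
      case (Suc k)
      have "real (Suc k) * h \<le> real (Suc n) * h" using Suc.prems h(1) by (intro mult_right_mono) auto
      then have "\<bar>F (real (Suc k) * h) - F (real k * h)\<bar> \<le> C * (real (Suc k) * h - real k * h)\<^sup>2"
        using h t by (intro F) (auto simp: algebra_simps)
      also have "real (Suc k) * h - real k * h = h" by (simp add: algebra_simps)
      finally show ?case using Suc by (simp add: distrib_right)
    qed simp
    from this[of "Suc n"] have "\<bar>F t - F 0\<bar> \<le> real (Suc n) * (C * h\<^sup>2)" by (simp only: h(2) order_refl simp_thms)
    also have "real (Suc n) * (C * h\<^sup>2) = C * t * h" using h(2) by (simp add: power2_eq_square mult_ac)
    also have "\<dots> = C * t\<^sup>2 * inverse (real (Suc n))" by (simp add: h_def power2_eq_square divide_inverse)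
    finally show ?thesis .
  qed
  have "(\<lambda>n. C * t\<^sup>2 * inverse (real (Suc n))) \<longlonglongrightarrow> C * t\<^sup>2 * 0" by (intro tendsto_intros LIMSEQ_inverse_real_of_nat)
  then have "\<bar>F t - F 0\<bar> \<le> C * t\<^sup>2 * 0" by (rule LIMSEQ_le_const) (use est in auto)
  then show ?thesis by simp
qed

lemma set_integral_interval_diff:
  fixes f :: "real \<Rightarrow> real"
  assumes "set_integrable lborel {0..T} f" "0 \<le> r" "r \<le> t" "t \<le> T"
  shows "(LINT s:{0..t}|lborel. f s) - (LINT s:{0..r}|lborel. f s) = (LINT s:{r<..t}|lborel. f s)"
    "set_integrable lborel {r<..t} f"
proof -
  have i: "set_integrable lborel {0..r} f" "set_integrable lborel {r<..t} f"
    using assms by (auto intro!: set_integrable_subset[OF assms(1)])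
  then show "set_integrable lborel {r<..t} f" by simp
  have u: "{0..t} = {0..r} \<union> {r<..t}" and d: "{0..r} \<inter> {r<..t} = {}" using assms by auto
  then show "(LINT s:{0..t}|lborel. f s) - (LINT s:{0..r}|lborel. f s) = (LINT s:{r<..t}|lborel. f s)"
    unfolding u set_integral_Un[OF d i] by simp
qed

section \<open>Interaction energy\<close>

context vfp begin

definition potential :: "'d phase measure \<Rightarrow> real ^ 'd \<Rightarrow> real" where
  "potential \<nu> q = (\<integral>x. \<psi> (q - fst x) \<partial>\<nu>)"

text \<open>Extended nonnegative values let pairs be compared before finiteness is known, whereas
  \<open>potential\<close>, a Bochner integral, takes the value 0 when the integrand is not
  integrable.\<close>

definition interaction :: "'d phase measure \<Rightarrow> 'd phase measure \<Rightarrow> ennreal" where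
  "interaction \<nu> \<nu>' = (\<integral>\<^sup>+x. \<integral>\<^sup>+y. ennreal (\<psi> (fst x - fst y)) \<partial>\<nu> \<partial>\<nu>')"

lemma continuous_\<psi>: "continuous_on S \<psi>" by (rule lipschitz_grad_continuous(1)[OF \<psi>(1)])

text \<open>Tonelli's theorem together with the evenness of \<psi>.\<close>

lemma interaction_commute:
  assumes \<nu>: "\<nu> \<in> P2" and \<nu>': "\<nu>' \<in> P2"
  shows "interaction \<nu> \<nu>' = interaction \<nu>' \<nu>"
proof -
  have sw: "\<psi> (a - b) = \<psi> (b - a)" for a b using \<psi>(4)[of "a - b"] by simp
  interpret A: prob_space \<nu> by (rule P2_D[OF \<nu>])
  interpret B: prob_space \<nu>' by (rule P2_D[OF \<nu>'])
  interpret pair_sigma_finite \<nu> \<nu>' ..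
  have "(\<lambda>z::'d phase \<times> 'd phase. ennreal (\<psi> (fst (snd z) - fst (fst z)))) \<in> borel_measurable borel"
    by (intro borel_measurable_continuous_onI measurable_compose[OF _ measurable_ennreal] continuous_intros continuous_on_compose2[OF continuous_\<psi>[of UNIV]]) auto
  moreover have "sets (\<nu> \<Otimes>\<^sub>M \<nu>') = sets (borel :: ('d phase \<times> 'd phase) measure)"
    by (simp add: borel_prod[symmetric] P2_D(2)[OF \<nu>] P2_D(2)[OF \<nu>'] cong: sets_pair_measure_cong)
  ultimately have "(\<lambda>z. ennreal (\<psi> (fst (snd z) - fst (fst z)))) \<in> borel_measurable (\<nu> \<Otimes>\<^sub>M \<nu>')"
    using measurable_cong_sets by blast
  from Fubini[OF this] have "interaction \<nu> \<nu>' = (\<integral>\<^sup>+y. \<integral>\<^sup>+x. ennreal (\<psi> (fst x - fst y)) \<partial>\<nu>' \<partial>\<nu>)"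
    unfolding interaction_def by simp
  also have "\<dots> = interaction \<nu>' \<nu>"
    unfolding interaction_def by (intro nn_integral_cong arg_cong[where f=ennreal] sw)
  finally show ?thesis .
qed

lemma measurable_\<psi>_shift: "(\<lambda>x::'d phase. \<psi> (q - fst x)) \<in> borel_measurable borel"
  by (intro borel_measurable_continuous_onI continuous_on_compose2[OF continuous_\<psi>[of UNIV]] continuous_intros) auto

text \<open>The gradient of \<psi> is bounded, so shifting \<open>q\<close> changes the integrand by
  a bounded amount.\<close>

lemma integrable_\<psi>_shift:
  assumes \<nu>: "\<nu> \<in> P2" and "integrable \<nu> (\<lambda>x. \<psi> (q0 - fst x))"
  shows "integrable \<nu> (\<lambda>x. \<psi> (q - fst x))"
proof (rule Bochner_Integration.integrable_bound)
  have "integrable \<nu> (\<lambda>x. C\<psi> * norm (q - q0))" by (rule P2_integrable_bounded[OF \<nu>]) auto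
  then show "integrable \<nu> (\<lambda>x. \<psi> (q0 - fst x) + C\<psi> * norm (q - q0))" using assms(2) by simp
  show "(\<lambda>x. \<psi> (q - fst x)) \<in> borel_measurable \<nu>" by (rule P2_measurable[OF \<nu> measurable_\<psi>_shift])
  have "norm (\<psi> (q - fst x)) \<le> norm (\<psi> (q0 - fst x) + C\<psi> * norm (q - q0))" for x :: "'d phase"
    using lipschitz_bounded_derivative[OF lipschitz_grad_neg_inner_le(2)[OF \<psi>(1)] \<psi>(2), of "q - fst x" "q0 - fst x"] \<psi>(3)[of "q - fst x"] \<psi>(3)[of "q0 - fst x"] by simp
  then show "AE x in \<nu>. norm (\<psi> (q - fst x)) \<le> norm (\<psi> (q0 - fst x) + C\<psi> * norm (q - q0))" by simp
qed

lemma potential_lipschitz_grad: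
  assumes \<nu>: "\<nu> \<in> P2" and i: "\<And>q. integrable \<nu> (\<lambda>x. \<psi> (q - fst x))"
  shows "lipschitz_grad L\<psi> (potential \<nu>) (grad_conv \<psi> \<nu>)"
  unfolding lipschitz_grad_def
proof (intro conjI allI)
  show "0 \<le> L\<psi>" by (rule lipschitz_grad_neg_inner_le(1)[OF \<psi>(1)])
  show "norm (grad_conv \<psi> \<nu> x - grad_conv \<psi> \<nu> y) \<le> L\<psi> * norm (x - y)" for x y by (rule grad_conv_lipschitz[OF \<nu>])
  show "(potential \<nu> has_derivative (\<lambda>h. grad_conv \<psi> \<nu> q \<bullet> h)) (at q)" for q
  proof (rule has_derivative_quadratic[where \<delta>=1 and C=L\<psi>])
    fix h :: "real ^ 'd"
    interpret prob_space \<nu> by (rule P2_D[OF \<nu>])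
    have ig: "integrable \<nu> (\<lambda>x. grad \<psi> (q - fst x) \<bullet> h)" by (intro integrable_inner_left integrable_grad_\<psi> \<nu>)
    have "potential \<nu> (q + h) - potential \<nu> q - grad_conv \<psi> \<nu> q \<bullet> h =
      (\<integral>x. \<psi> (q + h - fst x) - \<psi> (q - fst x) - grad \<psi> (q - fst x) \<bullet> h \<partial>\<nu>)"
      unfolding potential_def grad_conv_eq
      by (subst integral_inner_left[symmetric], rule integrable_grad_\<psi>[OF \<nu>]) (use i ig in simp)
    also have "norm \<dots> \<le> (\<integral>x. L\<psi> * (norm h)\<^sup>2 \<partial>\<nu>)"
    proof (rule Bochner_Integration.integral_norm_bound_integral)
      show "norm (\<psi> (q + h - fst x) - \<psi> (q - fst x) - grad \<psi> (q - fst x) \<bullet> h) \<le> L\<psi> * (norm h)\<^sup>2" for x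
        using lipschitz_grad_taylor[OF \<psi>(1), of "q - fst x" h] by (simp add: diff_add_eq)
    qed (use i ig in auto)
    finally show "norm (potential \<nu> (q + h) - potential \<nu> q - grad_conv \<psi> \<nu> q \<bullet> h) \<le> L\<psi> * (norm h)\<^sup>2" by (simp add: prob_space)
  qed (auto intro: bounded_linear_inner_right)
qed

lemma potential_nonneg: "0 \<le> potential \<nu> q" unfolding potential_def using \<psi>(3) by (intro Bochner_Integration.integral_nonneg) auto

lemma ennreal_potential:
  "integrable \<nu> (\<lambda>x. \<psi> (q - fst x)) \<Longrightarrow> ennreal (potential \<nu> q) = (\<integral>\<^sup>+x. ennreal (\<psi> (q - fst x)) \<partial>\<nu>)"
  unfolding potential_def using \<psi>(3) by (intro nn_integral_eq_integral[symmetric]) auto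

text \<open>A finite double integral makes the inner one finite at some \<open>q0\<close>, and
  shifting extends this to every \<open>q\<close>.\<close>

lemma interaction_finite_integrable:
  assumes \<nu>: "\<nu> \<in> P2" and \<nu>': "\<nu>' \<in> P2" and fin: "interaction \<nu> \<nu>' < \<infinity>"
  shows "integrable \<nu> (\<lambda>x. \<psi> (q - fst x))"
proof -
  interpret A: prob_space \<nu> by (rule P2_D[OF \<nu>])
  interpret B: prob_space \<nu>' by (rule P2_D[OF \<nu>'])
  have "\<exists>q0. (\<integral>\<^sup>+y. ennreal (\<psi> (q0 - fst y)) \<partial>\<nu>) < \<infinity>"
  proof (rule ccontr)
    assume "\<not> ?thesis"
    then have "interaction \<nu> \<nu>' = (\<integral>\<^sup>+x. \<infinity> \<partial>\<nu>')" unfolding interaction_def by (simp add: not_less top_unique)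
    then show False using fin by (simp add: B.emeasure_space_1)
  qed
  then obtain q0 where "(\<integral>\<^sup>+y. ennreal (\<psi> (q0 - fst y)) \<partial>\<nu>) < \<infinity>" ..
  then have "integrable \<nu> (\<lambda>x. \<psi> (q0 - fst x))"
    using \<psi>(3) P2_measurable[OF \<nu> measurable_\<psi>_shift] by (intro integrableI_nonneg) auto
  then show ?thesis by (rule integrable_\<psi>_shift[OF \<nu>])
qed

lemma interaction_eq_integral:
  assumes \<nu>: "\<nu> \<in> P2" and \<nu>': "\<nu>' \<in> P2" and i: "\<And>q. integrable \<nu> (\<lambda>x. \<psi> (q - fst x))"
  shows "interaction \<nu> \<nu>' = (\<integral>\<^sup>+x. ennreal (potential \<nu> (fst x)) \<partial>\<nu>')"
    "interaction \<nu> \<nu>' < \<infinity> \<longleftrightarrow> integrable \<nu>' (\<lambda>x. potential \<nu> (fst x))"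
proof -
  show eq: "interaction \<nu> \<nu>' = (\<integral>\<^sup>+x. ennreal (potential \<nu> (fst x)) \<partial>\<nu>')"
    unfolding interaction_def by (simp add: ennreal_potential[OF i])
  have "(\<lambda>x::'d phase. potential \<nu> (fst x)) \<in> borel_measurable borel"
    by (intro borel_measurable_continuous_onI continuous_on_compose2[OF lipschitz_grad_continuous(1)[OF potential_lipschitz_grad[OF \<nu> i], of UNIV]] continuous_intros) auto
  then have "(\<lambda>x. potential \<nu> (fst x)) \<in> borel_measurable \<nu>'" by (rule P2_measurable[OF \<nu>'])
  then show "interaction \<nu> \<nu>' < \<infinity> \<longleftrightarrow> integrable \<nu>' (\<lambda>x. potential \<nu> (fst x))"
    unfolding eq integrable_iff_bounded by (simp add: potential_nonneg)
qed

end

context vfp_finite begin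

text \<open>A function of the position is the difference of the energies for
  \<open>V + \<phi>\<close> and for \<open>V\<close>. Subtracting the two balances cancels the
  friction, the diffusion constant and the defect \<tau> and leaves the transport term;
  integrability is propagated by the two a priori bounds.\<close>

lemma position_balance:
  assumes \<tau>: "kinetic_defect \<tau>"
    and V0: "integrable (\<rho> 0) (\<lambda>x. V (fst x))"
    and \<phi>: "lipschitz_grad L \<phi> g" "\<And>q. 0 \<le> \<phi> q" "\<And>q. norm (g q) \<le> Cg" and \<phi>0: "integrable (\<rho> 0) (\<lambda>x. \<phi> (fst x))"
  shows "t \<in> {0..T} \<Longrightarrow> integrable (\<rho> t) (\<lambda>x. \<phi> (fst x))"
    "set_integrable lborel {0..T} (momentum_integral (\<lambda>x. g (fst x)))"
    "t \<in> {0..T} \<Longrightarrow> (\<integral>x. \<phi> (fst x) \<partial>\<rho> t) = (\<integral>x. \<phi> (fst x) \<partial>\<rho> 0) + (LINT s:{0..t}|lborel. momentum_integral (\<lambda>x. g (fst x)) s)"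
proof -
  let ?W = "\<lambda>q. V q + \<phi> q" and ?G = "\<lambda>q. grad V q + g q"
  let ?H = "\<lambda>W (x::'d phase). (norm (snd x))\<^sup>2 / (2 * m) + W (fst x)"
  let ?b = "\<lambda>G s. (\<integral>x. power_drift G s x \<partial>\<mu> s) + \<gamma> * \<theta> * real CARD('d) / m + \<tau> s"
  have W: "lipschitz_grad (LV + L) ?W ?G" "\<And>q. 0 \<le> ?W q" "\<And>q. norm (?G q - grad V q) \<le> Cg" "integrable (\<rho> 0) (\<lambda>x. ?W (fst x))"
    using lipschitz_grad_add[OF V(1) \<phi>(1)] V(2) \<phi>(2,3) V0 \<phi>0 by auto
  have V': "\<And>q. norm (grad V q - grad V q) \<le> 0" by simp
  note bV = energy_balance[OF V V' V0 \<tau>] and bW = energy_balance[OF W \<tau>]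
  have iV: "integrable (\<rho> t) (?H V)" and iW: "integrable (\<rho> t) (?H ?W)" if "t \<in> {0..T}" for t
    using bV(1) bW(1) that by auto
  show i\<phi>: "integrable (\<rho> t) (\<lambda>x. \<phi> (fst x))" if "t \<in> {0..T}" for t
    using Bochner_Integration.integrable_diff[OF iW[OF that] iV[OF that]] by simp
  have cg: "continuous_on UNIV (\<lambda>x::'d phase. g (fst x))"
    by (intro continuous_on_compose2[OF lipschitz_grad_continuous(2)[OF \<phi>(1), of UNIV]] continuous_intros) auto
  have ig: "integrable (\<mu> s) (\<lambda>x. (snd x /\<^sub>R m) \<bullet> g (fst x))" for s by (rule integrable_momentum_inner[OF \<mu>_P2 cg \<phi>(3)])
  have ic: "integrable (\<mu> s) (\<lambda>x. (snd x /\<^sub>R m) \<bullet> - grad_conv \<psi> (\<mu> s) (fst x))" for s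
    by (rule integrable_momentum_inner[OF \<mu>_P2, of _ C\<psi>])
       (auto intro!: continuous_intros continuous_on_compose2[OF continuous_grad_conv[OF \<mu>_P2, of UNIV]] simp: grad_conv_bounded[OF \<mu>_P2])
  have ipV: "integrable (\<mu> s) (power_drift (grad V) s)" for s
    using Bochner_Integration.integrable_diff[OF ic[of s], of "\<lambda>x. \<gamma> * (norm (snd x))\<^sup>2 / m\<^sup>2"] P2_D(3)[OF \<mu>_P2, of s]
    by (simp add: power_drift_def[abs_def])
  have diff: "?b ?G s - ?b (grad V) s = momentum_integral (\<lambda>x. g (fst x)) s" for s
  proof -
    have "power_drift ?G s x = power_drift (grad V) s x + (snd x /\<^sub>R m) \<bullet> g (fst x)" for x
      by (simp add: power_drift_def inner_diff_right inner_add_right)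
    then have "(\<integral>x. power_drift ?G s x \<partial>\<mu> s) = (\<integral>x. power_drift (grad V) s x \<partial>\<mu> s) + momentum_integral (\<lambda>x. g (fst x)) s"
      unfolding momentum_integral_def using Bochner_Integration.integral_add[OF ipV ig] by simp
    then show ?thesis by simp
  qed
  have sd: "set_integrable lborel {0..t} (?b ?G)" "set_integrable lborel {0..t} (?b (grad V))" if "t \<in> {0..T}" for t
    using that by (auto intro!: set_integrable_subset[OF bV(3)] set_integrable_subset[OF bW(3)])
  show "set_integrable lborel {0..T} (momentum_integral (\<lambda>x. g (fst x)))"
    using set_integral_diff(1)[OF bW(3) bV(3)] by (simp only: diff)
  show "(\<integral>x. \<phi> (fst x) \<partial>\<rho> t) = (\<integral>x. \<phi> (fst x) \<partial>\<rho> 0) + (LINT s:{0..t}|lborel. momentum_integral (\<lambda>x. g (fst x)) s)" if t: "t \<in> {0..T}" for t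
  proof -
    have e: "(\<integral>x. \<phi> (fst x) \<partial>\<rho> s) = (\<integral>x. ?H ?W x \<partial>\<rho> s) - (\<integral>x. ?H V x \<partial>\<rho> s)" if "s \<in> {0..T}" for s
      using Bochner_Integration.integral_diff[OF iW[OF that] iV[OF that]] by simp
    have "(LINT s:{0..t}|lborel. momentum_integral (\<lambda>x. g (fst x)) s) = (LINT s:{0..t}|lborel. ?b ?G s) - (LINT s:{0..t}|lborel. ?b (grad V) s)"
      using set_integral_diff(2)[OF sd[OF t]] by (simp only: diff)
    moreover have "0 \<in> {0..T}" using T by simp
    ultimately show ?thesis using e[OF t] e[of 0] bV(4)[OF t] bW(4)[OF t] by simp
  qed
qed

text \<open>The balance of kinetic and external energy contains the power of the interaction force.
  The interaction energy is quadratic in the curve, and \<open>position_balance\<close> covers only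
  its pairing with a frozen potential; symmetry of \<open>\<Psi>\<close> and Lipschitz dependence of
  the force on time identify its rate as the opposite of that power.\<close>

theorem hamiltonian_balance:
  assumes \<tau>: "kinetic_defect \<tau>"
    and fin: "hamiltonian m V \<psi> (\<rho> 0) < \<infinity>"
  defines "\<eta> \<equiv> \<lambda>s. \<gamma> * \<theta> * real CARD('d) / m - \<gamma> * (\<integral>x. (norm (snd x))\<^sup>2 / m\<^sup>2 \<partial>\<mu> s) + \<tau> s"
  obtains E where "\<And>t. t \<in> {0..T} \<Longrightarrow> hamiltonian m V \<psi> (\<rho> t) = ennreal (E t)" "\<And>t. 0 \<le> E t"
    "set_integrable lborel {0..T} \<eta>" "\<And>t. t \<in> {0..T} \<Longrightarrow> E t = E 0 + (LINT s:{0..t}|lborel. \<eta> s)"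
proof -
  have z: "0 \<in> {0..T}" using T by simp
  note P0 = \<rho>_P2[OF z]
  let ?H = "\<lambda>x::'d phase. (norm (snd x))\<^sup>2 / (2 * m) + V (fst x)"
  have H0: "0 \<le> ?H x" for x using m V(2)[of "fst x"] by simp
  have mV: "(\<lambda>x::'d phase. V (fst x)) \<in> borel_measurable borel"
    by (intro borel_measurable_continuous_onI continuous_on_compose2[OF lipschitz_grad_continuous(1)[OF V(1), of UNIV]] continuous_intros) auto
  have mH: "?H \<in> borel_measurable \<nu>" if "\<nu> \<in> P2" for \<nu>
    by (rule P2_measurable[OF that]) (intro borel_measurable_continuous_onI continuous_intros continuous_on_compose2[OF lipschitz_grad_continuous(1)[OF V(1), of UNIV]], use m in auto)
  have mI: "(\<lambda>x. \<integral>\<^sup>+y. ennreal (\<psi> (fst x - fst y)) \<partial>\<nu>) \<in> borel_measurable \<nu>" if \<nu>: "\<nu> \<in> P2" for \<nu>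
  proof -
    interpret prob_space \<nu> by (rule P2_D[OF \<nu>])
    have "(\<lambda>z::'d phase \<times> 'd phase. ennreal (\<psi> (fst (fst z) - fst (snd z)))) \<in> borel_measurable borel"
      by (intro measurable_compose[OF _ measurable_ennreal] borel_measurable_continuous_onI continuous_intros continuous_on_compose2[OF continuous_\<psi>[of UNIV]]) auto
    moreover have "sets (\<nu> \<Otimes>\<^sub>M \<nu>) = sets (borel :: ('d phase \<times> 'd phase) measure)"
      by (simp add: borel_prod[symmetric] P2_D(2)[OF \<nu>] cong: sets_pair_measure_cong)
    ultimately have "(\<lambda>(x, y). ennreal (\<psi> (fst x - fst y))) \<in> borel_measurable (\<nu> \<Otimes>\<^sub>M \<nu>)"
      unfolding case_prod_unfold using measurable_cong_sets by blast
    then show ?thesis by (rule borel_measurable_nn_integral)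
  qed
  have ham: "hamiltonian m V \<psi> \<nu> = (\<integral>\<^sup>+x. ennreal (?H x) \<partial>\<nu>) + interaction \<nu> \<nu> / 2" if \<nu>: "\<nu> \<in> P2" for \<nu>
  proof -
    have "hamiltonian m V \<psi> \<nu> = (\<integral>\<^sup>+x. ennreal (?H x) + (\<integral>\<^sup>+y. ennreal (\<psi> (fst x - fst y)) \<partial>\<nu>) / 2 \<partial>\<nu>)"
      unfolding hamiltonian_def case_prod_unfold using m V(2) by (simp add: ennreal_plus)
    also have "\<dots> = (\<integral>\<^sup>+x. ennreal (?H x) \<partial>\<nu>) + (\<integral>\<^sup>+x. (\<integral>\<^sup>+y. ennreal (\<psi> (fst x - fst y)) \<partial>\<nu>) / 2 \<partial>\<nu>)"
      by (rule nn_integral_add) (use mH[OF \<nu>] mI[OF \<nu>] in auto)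
    also have "(\<integral>\<^sup>+x. (\<integral>\<^sup>+y. ennreal (\<psi> (fst x - fst y)) \<partial>\<nu>) / 2 \<partial>\<nu>) = interaction \<nu> \<nu> / 2"
      unfolding interaction_def by (rule nn_integral_divide[OF mI[OF \<nu>]])
    finally show ?thesis .
  qed
  have finH: "(\<integral>\<^sup>+x. ennreal (?H x) \<partial>\<rho> 0) < \<infinity>" and finI: "interaction (\<rho> 0) (\<rho> 0) < \<infinity>"
    using fin unfolding ham[OF P0] by (auto simp: less_top[symmetric] ennreal_divide_eq_top_iff)
  have iH0: "integrable (\<rho> 0) ?H" using finH H0 mH[OF P0] by (intro integrableI_nonneg) auto
  have V0: "integrable (\<rho> 0) (\<lambda>x. V (fst x))"
    using Bochner_Integration.integrable_diff[OF iH0, of "\<lambda>x. (norm (snd x))\<^sup>2 / (2 * m)"] P2_D(3)[OF P0] by simp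
  note pb = position_balance[OF \<tau> V0]
  have V': "\<And>q. norm (grad V q - grad V q) \<le> 0" by simp
  note bV = energy_balance[OF V V' V0 \<tau>]
  obtain B where B: "\<And>t. t \<in> {0..T} \<Longrightarrow> integrable (\<rho> t) ?H" "\<And>t. t \<in> {0..T} \<Longrightarrow> (\<integral>x. ?H x \<partial>\<rho> t) \<le> B" using bV(1) by blast
  \<comment> \<open>A bound for the mean speed, from \<open>|p| \<le> 1 + |p|^2\<close> and the
    energy bound \<open>B\<close>.\<close>
  define M where "M = (1 + 2 * m * B) / m"
  have M: "(\<integral>x. norm (snd x) / m \<partial>\<mu> s) \<le> M" "integrable (\<mu> s) (\<lambda>x. norm (snd x) / m)" for s
  proof -
    define t where "t = max 0 (min T s)"
    have t: "t \<in> {0..T}" using T by (auto simp: t_def)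
    have \<mu>t: "\<mu> s = \<rho> t" by (simp add: \<mu>_def t_def)
    have n1: "norm (snd x) \<le> 1 + (norm (snd x))\<^sup>2" for x :: "'d phase"
      using sum_squares_bound[of 1 "norm (snd x)"] by (simp, use norm_ge_zero[of "snd x"] in linarith)
    show i: "integrable (\<mu> s) (\<lambda>x. norm (snd x) / m)"
      by (rule P2_integrable[OF \<mu>_P2, of _ "1 / m"]) (use n1 m in \<open>auto intro!: borel_measurable_continuous_onI continuous_intros simp: divide_right_mono\<close>)
    have n2: "norm (snd x) / m \<le> (1 + 2 * m * ?H x) / m" for x :: "'d phase"
      using n1[of x] m V(2)[of "fst x"] by (intro divide_right_mono) (auto simp: distrib_left intro: order_trans)
    have "(\<integral>x. norm (snd x) / m \<partial>\<mu> s) \<le> (\<integral>x. (1 + 2 * m * ?H x) / m \<partial>\<rho> t)"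
      unfolding \<mu>t
    proof (rule integral_mono)
      show "integrable (\<rho> t) (\<lambda>x. norm (snd x) / m)" using i by (simp only: \<mu>t)
      show "integrable (\<rho> t) (\<lambda>x. (1 + 2 * m * ?H x) / m)"
        by (intro integrable_divide Bochner_Integration.integrable_add prob_integral_const(2)[OF \<rho>_P2[OF t]] integrable_mult_right B(1)[OF t])
    qed (rule n2)
    also have "\<dots> = (1 + 2 * m * (\<integral>x. ?H x \<partial>\<rho> t)) / m"
      using Bochner_Integration.integral_add[OF prob_integral_const(2)[OF \<rho>_P2[OF t], of 1] integrable_mult_right[OF B(1)[OF t], of "2 * m"]]
        prob_integral_const(1)[OF \<rho>_P2[OF t], of 1] by (simp only: integral_divide_zero integral_mult_right_zero)
    also have "\<dots> \<le> M" unfolding M_def using B(2)[OF t] m by (intro divide_right_mono) auto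
    finally show "(\<integral>x. norm (snd x) / m \<partial>\<mu> s) \<le> M" .
  qed
  have M0: "0 \<le> M" using M(1)[of 0] m by (intro order_trans[OF _ M(1)[of 0]] Bochner_Integration.integral_nonneg) auto
  have mom: "\<bar>momentum_integral g s\<bar> \<le> C * M" if g: "continuous_on UNIV g" "\<And>x. norm (g x) \<le> C" for g C s
  proof -
    have C0: "0 \<le> C" using g(2)[of 0] norm_ge_zero order_trans by blast
    have "\<bar>momentum_integral g s\<bar> \<le> (\<integral>x. C * (norm (snd x) / m) \<partial>\<mu> s)"
      unfolding momentum_integral_def
    proof (rule Bochner_Integration.integral_abs_bound_integral)
      show "integrable (\<mu> s) (\<lambda>x. (snd x /\<^sub>R m) \<bullet> g x)" by (rule integrable_momentum_inner[OF \<mu>_P2 g])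
      show "integrable (\<mu> s) (\<lambda>x. C * (norm (snd x) / m))" using M(2)[of s] by (rule integrable_mult_right)
      fix x :: "'d phase"
      have "\<bar>(snd x /\<^sub>R m) \<bullet> g x\<bar> \<le> norm (snd x /\<^sub>R m) * norm (g x)" by (rule Cauchy_Schwarz_ineq2)
      also have "\<dots> \<le> norm (snd x) / m * C" using g(2)[of x] m by (intro mult_mono) (auto simp: divide_inverse)
      finally show "\<bar>(snd x /\<^sub>R m) \<bullet> g x\<bar> \<le> C * (norm (snd x) / m)" by (simp add: mult.commute)
    qed
    also have "\<dots> = C * (\<integral>x. norm (snd x) / m \<partial>\<mu> s)" by (rule integral_mult_right_zero)
    also have "\<dots> \<le> C * M" by (intro mult_left_mono M C0)
    finally show ?thesis .
  qed
  have i0: "integrable (\<rho> 0) (\<lambda>x. \<psi> (q - fst x))" for q by (rule interaction_finite_integrable[OF P0 P0 finI])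
  have p00: "integrable (\<rho> 0) (\<lambda>x. potential (\<rho> 0) (fst x))"
    using finI unfolding interaction_eq_integral(2)[OF P0 P0 i0] .
  \<comment> \<open>Finiteness spreads from the pair (0, 0) to (0, t) by propagating the potential
    of \<open>\<rho> 0\<close>, and by symmetry to (t, 0); then potentials of
    \<open>\<rho> t\<close> can be propagated from time 0 as well.\<close>
  have fin0: "interaction (\<rho> 0) (\<rho> t) < \<infinity>" if t: "t \<in> {0..T}" for t
    unfolding interaction_eq_integral(2)[OF P0 \<rho>_P2[OF t] i0]
    by (rule pb(1)[OF potential_lipschitz_grad[OF P0 i0] potential_nonneg grad_conv_bounded[OF P0] p00 t])
  have it: "integrable (\<rho> t) (\<lambda>x. \<psi> (q - fst x))" if t: "t \<in> {0..T}" for q t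
    using fin0[OF t] by (intro interaction_finite_integrable[OF \<rho>_P2[OF t] P0]) (simp add: interaction_commute[OF P0 \<rho>_P2[OF t]])
  have U0: "integrable (\<rho> 0) (\<lambda>x. potential (\<rho> t) (fst x))" if t: "t \<in> {0..T}" for t
    using fin0[OF t] interaction_eq_integral(2)[OF \<rho>_P2[OF t] P0 it[OF t]] by (simp add: interaction_commute[OF P0 \<rho>_P2[OF t]])
  note U = potential_lipschitz_grad[OF \<rho>_P2 it]
  \<comment> \<open>\<open>B' r s\<close> is the power at time \<open>s\<close> against the gradient
    of the potential generated by the measure at time \<open>r\<close>.\<close>
  define B' where "B' r = momentum_integral (\<lambda>x. grad_conv \<psi> (\<mu> r) (fst x))" for r
  define \<Psi> where "\<Psi> r t = (\<integral>x. potential (\<rho> r) (fst x) \<partial>\<rho> t)" for r t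
  have Ui: "integrable (\<rho> t) (\<lambda>x. potential (\<rho> r) (fst x))" if "r \<in> {0..T}" "t \<in> {0..T}" for r t
    by (rule pb(1)[OF U[OF that(1) that(1)] potential_nonneg grad_conv_bounded[OF \<rho>_P2[OF that(1)]] U0[OF that(1)] that(2)])
  have Bi: "set_integrable lborel {0..T} (B' r)" if "r \<in> {0..T}" for r
    unfolding B'_def \<mu>_eq[OF that] by (rule pb(2)[OF U[OF that that] potential_nonneg grad_conv_bounded[OF \<rho>_P2[OF that]] U0[OF that]])
  have \<Psi>B: "\<Psi> r t = \<Psi> r 0 + (LINT s:{0..t}|lborel. B' r s)" if "r \<in> {0..T}" "t \<in> {0..T}" for r t
    unfolding B'_def \<Psi>_def \<mu>_eq[OF that(1)]
    by (rule pb(3)[OF U[OF that(1) that(1)] potential_nonneg grad_conv_bounded[OF \<rho>_P2[OF that(1)]] U0[OF that(1)] that(2)])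
  have \<Psi>I: "ennreal (\<Psi> r t) = interaction (\<rho> r) (\<rho> t)" if "r \<in> {0..T}" "t \<in> {0..T}" for r t
    unfolding interaction_eq_integral(1)[OF \<rho>_P2[OF that(1)] \<rho>_P2[OF that(2)] it[OF that(1)]] \<Psi>_def
    by (rule nn_integral_eq_integral[symmetric]) (use Ui[OF that] potential_nonneg in auto)
  have \<Psi>0: "0 \<le> \<Psi> r t" for r t unfolding \<Psi>_def using potential_nonneg by (intro Bochner_Integration.integral_nonneg) auto
  have \<Psi>sym: "\<Psi> r t = \<Psi> t r" if "r \<in> {0..T}" "t \<in> {0..T}" for r t
  proof -
    have "ennreal (\<Psi> r t) = ennreal (\<Psi> t r)"
      unfolding \<Psi>I[OF that] \<Psi>I[OF that(2,1)] by (rule interaction_commute[OF \<rho>_P2[OF that(1)] \<rho>_P2[OF that(2)]])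
    then show ?thesis using \<Psi>0 by simp
  qed
  have cshift: "continuous_on UNIV (\<lambda>x::'d phase. grad \<psi> (fst x - q))" for q
    by (intro continuous_on_compose2[OF lipschitz_grad_continuous(2)[OF \<psi>(1), of UNIV]] continuous_intros) auto
  have shift: "lipschitz_grad L\<psi> (\<lambda>y. \<psi> (y - q)) (\<lambda>y. grad \<psi> (y - q))" for q
    unfolding lipschitz_grad_def
  proof (intro conjI allI)
    show "((\<lambda>y. \<psi> (y - q)) has_derivative (\<lambda>h. grad \<psi> (x - q) \<bullet> h)) (at x)" for x
      by (rule has_derivative_compose[of "\<lambda>y. y - q" "\<lambda>h. h" x UNIV \<psi>, simplified])
         (auto intro!: derivative_eq_intros lipschitz_grad_neg_inner_le(2)[OF \<psi>(1)])
    show "norm (grad \<psi> (x - q) - grad \<psi> (y - q)) \<le> L\<psi> * norm (x - y)" for x y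
      using lipschitz_grad_neg_inner_le(3)[OF \<psi>(1), of "x - q" "y - q"] by simp
  qed (rule lipschitz_grad_neg_inner_le(1)[OF \<psi>(1)])
  have L0: "0 \<le> L\<psi>" by (rule lipschitz_grad_neg_inner_le(1)[OF \<psi>(1)])
  have sw: "\<psi> (a - b) = \<psi> (b - a)" for a b using \<psi>(4)[of "a - b"] by simp
  \<comment> \<open>The difference of the potentials is a time integral of momentum pairings with
    shifted gradients of \<psi>. Its Lipschitz constant in \<open>q\<close> comes from that of
    \<open>grad \<psi>\<close> and the mean speed, and it bounds the difference of the
    gradients.\<close>
  have time_lip: "norm (grad_conv \<psi> (\<rho> t) q - grad_conv \<psi> (\<rho> r) q) \<le> L\<psi> * M * (t - r)" if rt: "0 \<le> r" "r \<le> t" "t \<le> T" for r t q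
  proof (rule lipschitz_imp_gradient_bound)
    have tt: "t \<in> {0..T}" "r \<in> {0..T}" using rt by auto
    show "((\<lambda>q. potential (\<rho> t) q - potential (\<rho> r) q) has_derivative (\<lambda>h. (grad_conv \<psi> (\<rho> t) q - grad_conv \<psi> (\<rho> r) q) \<bullet> h)) (at q)"
      unfolding inner_diff_left by (intro has_derivative_diff lipschitz_grad_neg_inner_le(2)[OF U] tt)
    fix q1 q2
    let ?mi = "\<lambda>q. momentum_integral (\<lambda>x. grad \<psi> (fst x - q))"
    have p: "(\<integral>x. \<psi> (fst x - q) \<partial>\<rho> s) = (\<integral>x. \<psi> (fst x - q) \<partial>\<rho> 0) + (LINT s:{0..s}|lborel. ?mi q s)" and si: "set_integrable lborel {0..T} (?mi q)"
      if "s \<in> {0..T}" for q s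
      using pb(3)[OF shift[of q] \<psi>(3) \<psi>(2) _ that] pb(2)[OF shift[of q] \<psi>(3) \<psi>(2)] i0[of q] by (simp_all add: sw[of _ q])
    have pot: "potential (\<rho> s) q = (\<integral>x. \<psi> (fst x - q) \<partial>\<rho> s)" for s q unfolding potential_def by (simp add: sw[of q])
    have dif: "potential (\<rho> t) q - potential (\<rho> r) q = (LINT s:{r<..t}|lborel. ?mi q s)" for q
      using p[OF tt(1), of q] p[OF tt(2), of q] set_integral_interval_diff(1)[OF si[OF tt(1), of q] rt] unfolding pot by simp
    have sri: "set_integrable lborel {r<..t} (?mi q)" for q by (rule set_integral_interval_diff(2)[OF si[OF tt(1)] rt])
    have mm: "\<bar>?mi q1 s - ?mi q2 s\<bar> \<le> L\<psi> * norm (q1 - q2) * M" for s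
    proof -
      have "?mi q1 s - ?mi q2 s = momentum_integral (\<lambda>x. grad \<psi> (fst x - q1) - grad \<psi> (fst x - q2)) s"
        unfolding momentum_integral_def inner_diff_right
        by (rule Bochner_Integration.integral_diff[symmetric]; rule integrable_momentum_inner[OF \<mu>_P2 cshift \<psi>(2)])
      also have "\<bar>\<dots>\<bar> \<le> L\<psi> * norm (q1 - q2) * M"
      proof (rule mom)
        show "norm (grad \<psi> (fst x - q1) - grad \<psi> (fst x - q2)) \<le> L\<psi> * norm (q1 - q2)" for x :: "'d phase"
          using lipschitz_grad_neg_inner_le(3)[OF \<psi>(1), of "fst x - q1" "fst x - q2"] by (simp add: norm_minus_commute)
      qed (intro continuous_intros cshift)
      finally show ?thesis .
    qed
    have "(potential (\<rho> t) q1 - potential (\<rho> r) q1) - (potential (\<rho> t) q2 - potential (\<rho> r) q2) = (LINT s:{r<..t}|lborel. ?mi q1 s - ?mi q2 s)"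
      unfolding dif using set_integral_diff(2)[OF sri sri] by simp
    also have "\<bar>\<dots>\<bar> \<le> (LINT s:{r<..t}|lborel. L\<psi> * norm (q1 - q2) * M)"
      unfolding set_lebesgue_integral_def real_scaleR_def
    proof (rule Bochner_Integration.integral_abs_bound_integral)
      show "integrable lborel (\<lambda>s. indicator {r<..t} s * (?mi q1 s - ?mi q2 s))"
        using set_integral_diff(1)[OF sri sri, of q1 q2] by (simp add: set_integrable_def)
      show "\<bar>indicator {r<..t} s * (?mi q1 s - ?mi q2 s)\<bar> \<le> indicator {r<..t} s * (L\<psi> * norm (q1 - q2) * M)" for s
        using mm[of s] by (simp add: indicator_def)
    qed (intro integrable_mult_left integrable_real_indicator; use rt in simp)
    also have "\<dots> = L\<psi> * M * (t - r) * norm (q1 - q2)" using rt by (simp add: set_lebesgue_integral_def mult_ac)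
    finally show "\<bar>(potential (\<rho> t) q1 - potential (\<rho> r) q1) - (potential (\<rho> t) q2 - potential (\<rho> r) q2)\<bar> \<le> L\<psi> * M * (t - r) * norm (q1 - q2)" .
  qed
  have cgc: "continuous_on UNIV (\<lambda>x::'d phase. grad_conv \<psi> (\<mu> r) (fst x))" for r
    by (intro continuous_on_compose2[OF continuous_grad_conv[OF \<mu>_P2, of UNIV]] continuous_intros) auto
  have Bdiff: "\<bar>B' t s - B' r s\<bar> \<le> L\<psi> * M * (t - r) * M" if "0 \<le> r" "r \<le> t" "t \<le> T" for r t s
  proof -
    have tt: "t \<in> {0..T}" "r \<in> {0..T}" using that by auto
    have "B' t s - B' r s = momentum_integral (\<lambda>x. grad_conv \<psi> (\<mu> t) (fst x) - grad_conv \<psi> (\<mu> r) (fst x)) s"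
      unfolding B'_def momentum_integral_def inner_diff_right
      by (rule Bochner_Integration.integral_diff[symmetric]; rule integrable_momentum_inner[OF \<mu>_P2 cgc grad_conv_bounded[OF \<mu>_P2]])
    also have "\<bar>\<dots>\<bar> \<le> L\<psi> * M * (t - r) * M"
      by (rule mom) (intro continuous_intros cgc, use time_lip[OF that] in \<open>simp add: \<mu>_eq[OF tt(1)] \<mu>_eq[OF tt(2)]\<close>)
    finally show ?thesis .
  qed
  have Bm: "(\<lambda>s. B' s s) \<in> borel_measurable borel"
    unfolding B'_def momentum_integral_def
  proof (rule \<mu>_integral_measurable)
    have [measurable]: "(\<lambda>x::'d phase. snd x /\<^sub>R m) \<in> borel_measurable borel" by (intro borel_measurable_continuous_onI continuous_intros)
    note [measurable] = grad_conv_\<mu>_measurable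
    have "(\<lambda>z. (\<lambda>x::'d phase. snd x /\<^sub>R m) (snd z) \<bullet> (case z of (t, x) \<Rightarrow> grad_conv \<psi> (\<mu> t) (fst x))) \<in> borel_measurable (borel \<Otimes>\<^sub>M borel)"
      by measurable
    then show "(\<lambda>(s, x). (snd x /\<^sub>R m) \<bullet> grad_conv \<psi> (\<mu> s) (fst x)) \<in> borel_measurable (borel \<Otimes>\<^sub>M borel)"
      by (simp add: case_prod_unfold)
  qed (rule integrable_momentum_inner[OF \<mu>_P2 cgc grad_conv_bounded[OF \<mu>_P2]])
  have Bb: "\<bar>B' r s\<bar> \<le> C\<psi> * M" for r s unfolding B'_def by (rule mom[OF cgc grad_conv_bounded[OF \<mu>_P2]])
  have BBi: "set_integrable lborel {0..T} (\<lambda>s. B' s s)"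
    unfolding set_integrable_def real_scaleR_def
  proof (rule Bochner_Integration.integrable_bound)
    show "integrable lborel (\<lambda>s. indicator {0..T} s * (C\<psi> * M))"
      by (intro integrable_mult_left integrable_real_indicator) (auto simp: emeasure_lborel_Icc_eq)
    show "(\<lambda>s. indicator {0..T} s * B' s s) \<in> borel_measurable lborel" using Bm by simp
    have "0 \<le> C\<psi> * M" using C\<psi>_nonneg M0 by simp
    then show "AE s in lborel. norm (indicator {0..T} s * B' s s) \<le> norm (indicator {0..T} s * (C\<psi> * M))"
      using Bb by (auto simp: indicator_def)
  qed
  have \<Psi>\<Psi>: "\<Psi> t t = \<Psi> 0 0 + 2 * (LINT s:{0..t}|lborel. B' s s)" if t: "t \<in> {0..T}" for t
  proof -
    define F where "F t = \<Psi> t t - 2 * (LINT s:{0..t}|lborel. B' s s)" for t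
    have "F t = F 0"
    proof (rule constant_of_quadratic_increments[where C="2 * (L\<psi> * M * M)" and T=T])
      fix r t assume rt: "0 \<le> r" "r \<le> t" "t \<le> T"
      then have tt: "t \<in> {0..T}" "r \<in> {0..T}" by auto
      have "\<Psi> t t - \<Psi> r r = (\<Psi> t t - \<Psi> t r) + (\<Psi> r t - \<Psi> r r)" using \<Psi>sym[OF tt] by simp
      also have "\<Psi> t t - \<Psi> t r = (LINT s:{r<..t}|lborel. B' t s)"
        using \<Psi>B[OF tt(1) tt(1)] \<Psi>B[OF tt(1) tt(2)] set_integral_interval_diff(1)[OF Bi[OF tt(1)] rt] by simp
      also have "\<Psi> r t - \<Psi> r r = (LINT s:{r<..t}|lborel. B' r s)"
        using \<Psi>B[OF tt(2) tt(1)] \<Psi>B[OF tt(2) tt(2)] set_integral_interval_diff(1)[OF Bi[OF tt(2)] rt] by simp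
      finally have 1: "\<Psi> t t - \<Psi> r r = (LINT s:{r<..t}|lborel. B' t s) + (LINT s:{r<..t}|lborel. B' r s)" .
      note ii = set_integral_interval_diff(2)[OF Bi[OF tt(1)] rt] set_integral_interval_diff(2)[OF Bi[OF tt(2)] rt] set_integral_interval_diff(2)[OF BBi rt]
      have "F t - F r = (\<Psi> t t - \<Psi> r r) - 2 * ((LINT s:{0..t}|lborel. B' s s) - (LINT s:{0..r}|lborel. B' s s))" by (simp add: F_def)
      also have "\<dots> = (LINT s:{r<..t}|lborel. (B' t s - B' s s) + (B' r s - B' s s))"
        unfolding 1 set_integral_interval_diff(1)[OF BBi rt]
          set_integral_add(2)[OF set_integral_diff(1)[OF ii(1,3)] set_integral_diff(1)[OF ii(2,3)]] set_integral_diff(2)[OF ii(1,3)] set_integral_diff(2)[OF ii(2,3)]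
        by simp
      also have "\<bar>\<dots>\<bar> \<le> (LINT s:{r<..t}|lborel. 2 * (L\<psi> * M * M) * (t - r))"
        unfolding set_lebesgue_integral_def real_scaleR_def
      proof (rule Bochner_Integration.integral_abs_bound_integral)
        show "integrable lborel (\<lambda>s. indicator {r<..t} s * ((B' t s - B' s s) + (B' r s - B' s s)))"
          using set_integral_add(1)[OF set_integral_diff(1)[OF ii(1,3)] set_integral_diff(1)[OF ii(2,3)]] by (simp add: set_integrable_def)
        show "\<bar>indicator {r<..t} s * ((B' t s - B' s s) + (B' r s - B' s s))\<bar> \<le> indicator {r<..t} s * (2 * (L\<psi> * M * M) * (t - r))" for s
        proof (cases "s \<in> {r<..t}")
          case True
          have c0: "0 \<le> L\<psi> * M * M" using L0 M0 by simp
          have "\<bar>B' t s - B' s s\<bar> \<le> L\<psi> * M * M * (t - s)" "\<bar>B' s s - B' r s\<bar> \<le> L\<psi> * M * M * (s - r)"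
            using Bdiff[of s t s] Bdiff[of r s s] True rt by (auto simp: mult_ac)
          moreover have "L\<psi> * M * M * (t - s) \<le> L\<psi> * M * M * (t - r)" "L\<psi> * M * M * (s - r) \<le> L\<psi> * M * M * (t - r)"
            using True c0 by (intro mult_left_mono; simp)+
          ultimately have "\<bar>(B' t s - B' s s) + (B' r s - B' s s)\<bar> \<le> 2 * (L\<psi> * M * M * (t - r))" by linarith
          then show ?thesis using True by (simp add: mult_ac)
        qed simp
      qed (intro integrable_mult_left integrable_real_indicator; use rt in simp)
      also have "\<dots> = 2 * (L\<psi> * M * M) * (t - r)\<^sup>2" using rt by (simp add: set_lebesgue_integral_def power2_eq_square)
      finally show "\<bar>F t - F r\<bar> \<le> 2 * (L\<psi> * M * M) * (t - r)\<^sup>2" .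
    qed (use t in auto)
    moreover have "(LINT s:{0..0}|lborel. B' s s) = 0"
    proof -
      have "AE s in lborel. s \<noteq> (0::real)" by (rule AE_lborel_singleton)
      then have "(\<integral>s. indicator {0..0} s *\<^sub>R B' s s \<partial>lborel) = 0"
        by (intro integral_eq_zero_AE) (auto elim!: eventually_mono)
      then show ?thesis by (simp add: set_lebesgue_integral_def)
    qed
    ultimately show ?thesis by (simp add: F_def)
  qed
  define E where "E t = (\<integral>x. ?H x \<partial>\<rho> t) + \<Psi> t t / 2" for t
  have En: "0 \<le> E t" for t unfolding E_def
    by (rule add_nonneg_nonneg[OF Bochner_Integration.integral_nonneg[OF H0]]) (use \<Psi>0[of t t] in simp)
  have hE: "hamiltonian m V \<psi> (\<rho> t) = ennreal (E t)" if t: "t \<in> {0..T}" for t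
  proof -
    have "(\<integral>\<^sup>+x. ennreal (?H x) \<partial>\<rho> t) = ennreal (\<integral>x. ?H x \<partial>\<rho> t)" by (rule nn_integral_eq_integral[OF B(1)[OF t]]) (use H0 in auto)
    moreover have "interaction (\<rho> t) (\<rho> t) / 2 = ennreal (\<Psi> t t / 2)"
      unfolding \<Psi>I[OF t t, symmetric] using \<Psi>0[of t t] by (simp add: ennreal_divide_numeral)
    ultimately show ?thesis unfolding ham[OF \<rho>_P2[OF t]] E_def
      using \<Psi>0[of t t] H0 by (simp add: ennreal_plus Bochner_Integration.integral_nonneg)
  qed
  let ?b = "\<lambda>s. (\<integral>x. power_drift (grad V) s x \<partial>\<mu> s) + \<gamma> * \<theta> * real CARD('d) / m + \<tau> s"
  \<comment> \<open>The work of the interaction force cancels between the two parts of the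
    Hamiltonian; the factor 1/2 of the interaction energy meets the factor 2 in
    \<open>\<Psi>\<Psi>\<close>.\<close>
  have \<eta>b: "\<eta> s = ?b s + B' s s" for s
  proof -
    have "(\<integral>x. power_drift (grad V) s x \<partial>\<mu> s) = (\<integral>x. - ((snd x /\<^sub>R m) \<bullet> grad_conv \<psi> (\<mu> s) (fst x)) - \<gamma> * ((norm (snd x))\<^sup>2 / m\<^sup>2) \<partial>\<mu> s)"
      by (simp add: power_drift_def)
    also have "\<dots> = - B' s s - \<gamma> * (\<integral>x. (norm (snd x))\<^sup>2 / m\<^sup>2 \<partial>\<mu> s)"
      unfolding B'_def momentum_integral_def
      using integrable_momentum_inner[OF \<mu>_P2 cgc grad_conv_bounded[OF \<mu>_P2], of s s] P2_D(3)[OF \<mu>_P2, of s]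
      by (subst Bochner_Integration.integral_diff) auto
    finally show ?thesis by (simp add: \<eta>_def)
  qed
  have bi: "set_integrable lborel {0..t} ?b" "set_integrable lborel {0..t} (\<lambda>s. B' s s)" if "t \<in> {0..T}" for t
    using that by (auto intro!: set_integrable_subset[OF bV(3)] set_integrable_subset[OF BBi])
  show ?thesis
  proof (rule that[OF hE En])
    show "set_integrable lborel {0..T} \<eta>" using set_integral_add(1)[OF bV(3) BBi] by (simp add: \<eta>b[abs_def])
    fix t assume t: "t \<in> {0..T}"
    have "(LINT s:{0..t}|lborel. \<eta> s) = (LINT s:{0..t}|lborel. ?b s) + (LINT s:{0..t}|lborel. B' s s)"
      unfolding \<eta>b by (rule set_integral_add(2)[OF bi[OF t]])
    then show "E t = E 0 + (LINT s:{0..t}|lborel. \<eta> s)"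
      unfolding E_def using bV(4)[OF t] \<Psi>\<Psi>[OF t] by simp
  qed
qed

end

section \<open>Comparison of the two rate functions\<close>

context vfp begin

lemma M_norm_sq_eq: "M_norm_sq m \<gamma> \<nu> (f, r) = \<gamma> * (\<integral>x. (norm (grad_p f x - r *\<^sub>R (snd x /\<^sub>R m)))\<^sup>2 \<partial>\<nu>)"
  by (simp add: M_norm_sq_def case_prod_unfold)

lemma M_dual_norm_sq_upper:
  assumes "f \<in> test_functions"
  shows "ennreal (2 * \<T> f + 2 * s * r - \<gamma> * (\<integral>x. (norm (grad_p f x - r *\<^sub>R (snd x /\<^sub>R m)))\<^sup>2 \<partial>\<nu>))
    \<le> M_dual_norm_sq m \<gamma> \<nu> (\<T>, s)"
  unfolding M_dual_norm_sq_def prod.case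
  by (rule SUP_upper2[of "(f, r)"]) (use assms in \<open>simp_all add: M_norm_sq_eq\<close>)

text \<open>Directions with \<open>r = 0\<close> suffice, whatever \<open>s\<close> is; replacing
  \<open>f\<close> by \<open>f/\<gamma>\<close> converts the weight \<gamma> of the seminorm into
  the factor \<open>1/\<gamma>\<close>.\<close>

lemma dual_norm_sq_le_M_dual_norm_sq:
  fixes \<T> :: "'d distrib"
  assumes lin: "\<And>f g a c. f \<in> test_functions \<Longrightarrow> g \<in> test_functions \<Longrightarrow> \<T> (\<lambda>x. a * f x - c * g x) = a * \<T> f - c * \<T> g"
  shows "ennreal (1 / \<gamma>) * dual_norm_sq \<nu> \<T> \<le> M_dual_norm_sq m \<gamma> \<nu> (\<T>, s)"
proof -
  have "ennreal (1 / \<gamma>) * ennreal (2 * \<T> f - (\<integral>x. (norm (grad_p f x))\<^sup>2 \<partial>\<nu>)) \<le> M_dual_norm_sq m \<gamma> \<nu> (\<T>, s)"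
    if f: "f \<in> test_functions" for f
  proof -
    let ?g = "\<lambda>x. (1 / \<gamma>) * f x - 0 * f x"
    have sc: "(norm ((1 / \<gamma>) *\<^sub>R v - 0 *\<^sub>R v - 0 *\<^sub>R w))\<^sup>2 = (1 / \<gamma>)\<^sup>2 * (norm v)\<^sup>2" for v w :: "real ^ 'd"
      by (simp add: power_mult_distrib power_divide)
    have N: "(\<integral>x. (norm (grad_p ?g x - 0 *\<^sub>R (snd x /\<^sub>R m)))\<^sup>2 \<partial>\<nu>) = (1 / \<gamma>)\<^sup>2 * (\<integral>x. (norm (grad_p f x))\<^sup>2 \<partial>\<nu>)"
      unfolding phase_derivatives_lincomb(1)[OF test_functions_smooth[OF f] test_functions_smooth[OF f]] sc
      by (rule integral_mult_right_zero)
    have Tg: "\<T> ?g = (1 / \<gamma>) * \<T> f - 0 * \<T> f" by (rule lin[OF f f])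
    have e: "1 / \<gamma> * (2 * a - b) = 2 * ((1 / \<gamma>) * a - 0 * a) + 2 * s * 0 - \<gamma> * ((1 / \<gamma>)\<^sup>2 * b)" for a b
      using \<gamma> by (simp add: power2_eq_square field_simps)
    have "ennreal (1 / \<gamma>) * ennreal (2 * \<T> f - (\<integral>x. (norm (grad_p f x))\<^sup>2 \<partial>\<nu>))
      = ennreal (1 / \<gamma> * (2 * \<T> f - (\<integral>x. (norm (grad_p f x))\<^sup>2 \<partial>\<nu>)))"
      by (rule ennreal_mult'[symmetric]) (use \<gamma> in simp)
    also have "\<dots> = ennreal (2 * \<T> ?g + 2 * s * 0 - \<gamma> * (\<integral>x. (norm (grad_p ?g x - 0 *\<^sub>R (snd x /\<^sub>R m)))\<^sup>2 \<partial>\<nu>))"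
      unfolding N Tg e ..
    also have "\<dots> \<le> M_dual_norm_sq m \<gamma> \<nu> (\<T>, s)"
      by (rule M_dual_norm_sq_upper) (rule test_functions_lincomb[OF f f])
    finally show ?thesis .
  qed
  then show ?thesis unfolding dual_norm_sq_def SUP_mult_left_ennreal by (rule SUP_least)
qed

lemma young_diff:
  fixes v w :: "'a::real_normed_vector"
  assumes "0 < \<delta>" shows "(norm (v - w))\<^sup>2 \<le> (1 + \<delta>) * (norm v)\<^sup>2 + (1 + 1 / \<delta>) * (norm w)\<^sup>2"
proof -
  have "(norm (v - w))\<^sup>2 \<le> (norm v + norm w)\<^sup>2" by (intro power_mono norm_triangle_ineq4) auto
  moreover have "0 \<le> (\<delta> * norm v - norm w)\<^sup>2 / \<delta>" using assms by simp
  moreover have "(\<delta> * norm v - norm w)\<^sup>2 / \<delta> = \<delta> * (norm v)\<^sup>2 + (norm w)\<^sup>2 / \<delta> - 2 * norm v * norm w"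
    using assms by (simp add: power2_eq_square field_simps)
  ultimately show ?thesis by (simp add: power2_sum distrib_right)
qed

text \<open>When \<open>s\<close> is minus the limit of the functional along approximations of the
  kinetic energy, a pair \<open>(f, r)\<close> acts like the single function
  \<open>f - r \<xi> n\<close>. The momentum gradient of that function only approximates that of the
  pair, which costs a factor \<open>1 + \<delta>\<close> by Young's inequality; \<open>n\<close>
  tends to infinity before \<delta> tends to 0.\<close>

lemma M_dual_norm_sq_le_dual_norm_sq:
  fixes \<T> :: "'d distrib"
  assumes lin: "\<And>f g a c. f \<in> test_functions \<Longrightarrow> g \<in> test_functions \<Longrightarrow> \<T> (\<lambda>x. a * f x - c * g x) = a * \<T> f - c * \<T> g"
    and \<nu>: "\<nu> \<in> P2" and \<xi>: "\<And>n. \<xi> n \<in> test_functions"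
    and \<xi>0: "(\<lambda>n. \<integral>x. (norm (grad_p (\<xi> n) x - snd x /\<^sub>R m))\<^sup>2 \<partial>\<nu>) \<longlonglongrightarrow> 0" and \<T>s: "(\<lambda>n. \<T> (\<xi> n)) \<longlonglongrightarrow> - s"
  shows "M_dual_norm_sq m \<gamma> \<nu> (\<T>, s) \<le> ennreal (1 / \<gamma>) * dual_norm_sq \<nu> \<T>"
proof -
  let ?D = "ennreal (1 / \<gamma>) * dual_norm_sq \<nu> \<T>"
  let ?err = "\<lambda>n. \<integral>x. (norm (grad_p (\<xi> n) x - snd x /\<^sub>R m))\<^sup>2 \<partial>\<nu>"
  have "ennreal (2 * \<T> f + 2 * s * r - \<gamma> * (\<integral>x. (norm (grad_p f x - r *\<^sub>R (snd x /\<^sub>R m)))\<^sup>2 \<partial>\<nu>)) \<le> ?D"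
    if f: "f \<in> test_functions" for f r
  proof -
    define A where "A = (\<integral>x. (norm (grad_p f x - r *\<^sub>R (snd x /\<^sub>R m)))\<^sup>2 \<partial>\<nu>)"
    have al: "k * (a * b + c * (u * v)) = (k * a) * b + (k * c * u) * v" for k a b c u v :: real
      by (simp add: algebra_simps)
    have step: "ennreal (2 * (\<T> f - r * \<T> (\<xi> n)) - \<gamma> * ((1 + \<delta>) * A + (1 + 1 / \<delta>) * r\<^sup>2 * ?err n)) \<le> ?D"
      if \<delta>: "0 < \<delta>" for \<delta> n
    proof -
      \<comment> \<open>The factor \<gamma> adjusts for the different weights of the two
        seminorms.\<close>
      let ?g = "\<lambda>x. \<gamma> * f x - (\<gamma> * r) * \<xi> n x"
      have g: "?g \<in> test_functions" by (rule test_functions_lincomb[OF f \<xi>])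
      have iA: "integrable \<nu> (\<lambda>x. (norm (grad_p f x - r *\<^sub>R (snd x /\<^sub>R m)))\<^sup>2)" by (rule integrable_grad_p_sq[OF \<nu> f])
      have ie: "integrable \<nu> (\<lambda>x. (norm (grad_p (\<xi> n) x - snd x /\<^sub>R m))\<^sup>2)" using integrable_grad_p_sq[OF \<nu> \<xi>, of n 1] by simp
      have "(\<integral>x. (norm (grad_p ?g x))\<^sup>2 \<partial>\<nu>) \<le>
        (\<integral>x. (\<gamma>\<^sup>2 * (1 + \<delta>)) * (norm (grad_p f x - r *\<^sub>R (snd x /\<^sub>R m)))\<^sup>2 + (\<gamma>\<^sup>2 * (1 + 1 / \<delta>) * r\<^sup>2) * (norm (grad_p (\<xi> n) x - snd x /\<^sub>R m))\<^sup>2 \<partial>\<nu>)"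
      proof (rule integral_mono)
        show "integrable \<nu> (\<lambda>x. (norm (grad_p ?g x))\<^sup>2)" using integrable_grad_p_sq[OF \<nu> g, of 0] by simp
        show "integrable \<nu> (\<lambda>x. (\<gamma>\<^sup>2 * (1 + \<delta>)) * (norm (grad_p f x - r *\<^sub>R (snd x /\<^sub>R m)))\<^sup>2 + (\<gamma>\<^sup>2 * (1 + 1 / \<delta>) * r\<^sup>2) * (norm (grad_p (\<xi> n) x - snd x /\<^sub>R m))\<^sup>2)"
          by (intro Bochner_Integration.integrable_add integrable_mult_right iA ie)
        fix x
        let ?v = "grad_p f x - r *\<^sub>R (snd x /\<^sub>R m)" and ?w = "r *\<^sub>R (grad_p (\<xi> n) x - snd x /\<^sub>R m)"
        have "grad_p ?g x = \<gamma> *\<^sub>R grad_p f x - (\<gamma> * r) *\<^sub>R grad_p (\<xi> n) x"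
          by (rule phase_derivatives_lincomb(1)[OF test_functions_smooth[OF f] test_functions_smooth[OF \<xi>]])
        also have "\<dots> = \<gamma> *\<^sub>R (?v - ?w)" by (simp add: scaleR_diff_right)
        finally have "(norm (grad_p ?g x))\<^sup>2 = \<gamma>\<^sup>2 * (norm (?v - ?w))\<^sup>2" by (simp only: norm_scaleR power_mult_distrib power2_abs)
        also have "\<dots> \<le> \<gamma>\<^sup>2 * ((1 + \<delta>) * (norm ?v)\<^sup>2 + (1 + 1 / \<delta>) * (norm ?w)\<^sup>2)"
          by (intro mult_left_mono young_diff \<delta>) simp
        also have "(norm ?w)\<^sup>2 = r\<^sup>2 * (norm (grad_p (\<xi> n) x - snd x /\<^sub>R m))\<^sup>2" by (simp only: norm_scaleR power_mult_distrib power2_abs)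
        finally show "(norm (grad_p ?g x))\<^sup>2 \<le> (\<gamma>\<^sup>2 * (1 + \<delta>)) * (norm ?v)\<^sup>2 + (\<gamma>\<^sup>2 * (1 + 1 / \<delta>) * r\<^sup>2) * (norm (grad_p (\<xi> n) x - snd x /\<^sub>R m))\<^sup>2"
          by (simp only: al)
      qed
      also have "\<dots> = \<gamma>\<^sup>2 * (1 + \<delta>) * A + (\<gamma>\<^sup>2 * (1 + 1 / \<delta>) * r\<^sup>2) * ?err n"
        using iA ie by (simp add: A_def)
      finally have le: "(\<integral>x. (norm (grad_p ?g x))\<^sup>2 \<partial>\<nu>) \<le> \<gamma>\<^sup>2 * (1 + \<delta>) * A + (\<gamma>\<^sup>2 * (1 + 1 / \<delta>) * r\<^sup>2) * ?err n" .
      have Tg: "\<T> ?g = \<gamma> * \<T> f - (\<gamma> * r) * \<T> (\<xi> n)" by (rule lin[OF f \<xi>])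
      have "2 * (\<T> f - r * \<T> (\<xi> n)) - \<gamma> * ((1 + \<delta>) * A + (1 + 1 / \<delta>) * r\<^sup>2 * ?err n) =
          1 / \<gamma> * (2 * \<T> ?g - (\<gamma>\<^sup>2 * (1 + \<delta>) * A + (\<gamma>\<^sup>2 * (1 + 1 / \<delta>) * r\<^sup>2) * ?err n))"
        unfolding Tg using \<gamma> \<delta> by (simp add: power2_eq_square field_simps)
      also have "\<dots> \<le> 1 / \<gamma> * (2 * \<T> ?g - (\<integral>x. (norm (grad_p ?g x))\<^sup>2 \<partial>\<nu>))"
        using le \<gamma> by (intro mult_left_mono) auto
      finally have "ennreal (2 * (\<T> f - r * \<T> (\<xi> n)) - \<gamma> * ((1 + \<delta>) * A + (1 + 1 / \<delta>) * r\<^sup>2 * ?err n))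
         \<le> ennreal (1 / \<gamma> * (2 * \<T> ?g - (\<integral>x. (norm (grad_p ?g x))\<^sup>2 \<partial>\<nu>)))" by (rule ennreal_leI)
      also have "\<dots> = ennreal (1 / \<gamma>) * ennreal (2 * \<T> ?g - (\<integral>x. (norm (grad_p ?g x))\<^sup>2 \<partial>\<nu>))"
        by (rule ennreal_mult') (use \<gamma> in simp)
      also have "\<dots> \<le> ?D" unfolding dual_norm_sq_def by (intro mult_left_mono SUP_upper g) simp
      finally show ?thesis .
    qed
    have \<delta>_bound: "ennreal (2 * (\<T> f - r * (- s)) - \<gamma> * ((1 + \<delta>) * A + (1 + 1 / \<delta>) * r\<^sup>2 * 0)) \<le> ?D" if \<delta>: "0 < \<delta>" for \<delta>
    proof (rule LIMSEQ_le_const2)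
      show "(\<lambda>n. ennreal (2 * (\<T> f - r * \<T> (\<xi> n)) - \<gamma> * ((1 + \<delta>) * A + (1 + 1 / \<delta>) * r\<^sup>2 * ?err n)))
        \<longlonglongrightarrow> ennreal (2 * (\<T> f - r * (- s)) - \<gamma> * ((1 + \<delta>) * A + (1 + 1 / \<delta>) * r\<^sup>2 * 0))"
        by (intro tendsto_ennrealI tendsto_diff tendsto_mult tendsto_add tendsto_const \<T>s \<xi>0)
    qed (use step[OF \<delta>] in blast)
    have lim: "ennreal (2 * (\<T> f - r * (- s)) - \<gamma> * ((1 + 0) * A)) \<le> ?D"
    proof (rule LIMSEQ_le_const2)
      show "(\<lambda>n. ennreal (2 * (\<T> f - r * (- s)) - \<gamma> * ((1 + inverse (real (Suc n))) * A)))
        \<longlonglongrightarrow> ennreal (2 * (\<T> f - r * (- s)) - \<gamma> * ((1 + 0) * A))"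
        by (intro tendsto_ennrealI tendsto_diff tendsto_mult tendsto_add tendsto_const LIMSEQ_inverse_real_of_nat)
      have "ennreal (2 * (\<T> f - r * (- s)) - \<gamma> * ((1 + inverse (real (Suc n))) * A)) \<le> ?D" for n
        using \<delta>_bound[of "inverse (real (Suc n))"] by simp
      then show "\<exists>N. \<forall>n\<ge>N. ennreal (2 * (\<T> f - r * (- s)) - \<gamma> * ((1 + inverse (real (Suc n))) * A)) \<le> ?D" by blast
    qed
    have "2 * (\<T> f - r * (- s)) - \<gamma> * ((1 + 0) * A) = 2 * \<T> f + 2 * s * r - \<gamma> * A" by (simp add: algebra_simps)
    with lim show ?thesis unfolding A_def by (simp only:)
  qed
  then show ?thesis unfolding M_dual_norm_sq_def prod.case
    by (intro SUP_least) (auto simp: M_norm_sq_eq)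
qed

end

context vfp_curve begin

text \<open>The second component of the difference in J: \<open>L grad E\<close> contributes 0 to
  it, and the remaining terms are those of \<open>M grad S\<close>.\<close>

definition heat_defect :: "(real \<Rightarrow> real) \<Rightarrow> real \<Rightarrow> real" where
  "heat_defect e s = vector_derivative e (at s within {0..T}) - \<gamma> * (\<integral>x. (norm (snd x))\<^sup>2 / m\<^sup>2 \<partial>\<mu> s) + \<gamma> * \<theta> * real CARD('d) / m"

lemma rate_J_eq:
  assumes e: "absolutely_continuous_on 0 T e"
  shows "rate_J m \<gamma> \<theta> V \<psi> T (\<rho> 0) (\<rho>, e) =
    (\<integral>\<^sup>+s\<in>{0..T}. ennreal (1 / (4 * \<theta>)) * M_dual_norm_sq m \<gamma> (\<rho> s) (defect s, heat_defect e s) \<partial>lborel)"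
proof -
  have AC: "AC_curve T P2 \<rho>" using \<rho>_AC \<rho>_P2 by (simp add: AC_curve_def)
  have eq: "M_dual_norm_sq m \<gamma> (\<rho> s)
      (\<lambda>f. time_deriv T \<rho> s f - fst (L_grad_E m V \<psi> (\<rho> s)) f - fst (M_grad_S m \<gamma> \<theta> (\<rho> s)) f,
       vector_derivative e (at s within {0..T}) - snd (L_grad_E m V \<psi> (\<rho> s)) - snd (M_grad_S m \<gamma> \<theta> (\<rho> s)))
    = M_dual_norm_sq m \<gamma> (\<rho> s) (defect s, heat_defect e s)" if s: "s \<in> {0..T}" for s
  proof -
    have 1: "time_deriv T \<rho> s f - fst (L_grad_E m V \<psi> (\<rho> s)) f - fst (M_grad_S m \<gamma> \<theta> (\<rho> s)) f = defect s f"
      if "f \<in> test_functions" for f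
      using GENERIC_drift[OF \<rho>_P2[OF s] that] by (simp add: defect_def)
    have 2: "vector_derivative e (at s within {0..T}) - snd (L_grad_E m V \<psi> (\<rho> s)) - snd (M_grad_S m \<gamma> \<theta> (\<rho> s)) = heat_defect e s"
      by (simp add: heat_defect_def L_grad_E_def M_grad_S_def case_prod_unfold \<mu>_eq[OF s])
    show ?thesis unfolding M_dual_norm_sq_def prod.case 2 by (rule SUP_cong[OF refl], elim SigmaE) (simp only: prod.case 1)
  qed
  show ?thesis unfolding rate_J_def prod.case using AC e
    by (auto intro!: nn_integral_cong simp: eq split: split_indicator)
qed

lemma rate_I_eq:
  "rate_I m \<gamma> \<theta> V \<psi> T (\<rho> 0) \<rho> = ennreal (1 / (4 * \<gamma> * \<theta>)) * (\<integral>\<^sup>+s\<in>{0..T}. dual_norm_sq (\<rho> s) (defect s) \<partial>lborel)"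
proof -
  have "(\<lambda>f. time_deriv T \<rho> s f - generator_adjoint m \<gamma> \<theta> V \<psi> (\<rho> s) f) = defect s" for s
    by (rule ext) (simp add: defect_def)
  then show ?thesis unfolding rate_I_def using \<rho>_AC by simp
qed

lemma rate_constants: "ennreal (1 / (4 * \<theta>)) * (ennreal (1 / \<gamma>) * y) = ennreal (1 / (4 * \<gamma> * \<theta>)) * y"
proof -
  have "ennreal (1 / (4 * \<theta>)) * ennreal (1 / \<gamma>) = ennreal (1 / (4 * \<theta>) * (1 / \<gamma>))"
    by (rule ennreal_mult[symmetric]) (use \<gamma> \<theta> in auto)
  also have "1 / (4 * \<theta>) * (1 / \<gamma>) = 1 / (4 * \<gamma> * \<theta>)" by simp
  finally show ?thesis by (simp only: mult.assoc[symmetric])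
qed

text \<open>The constants move under a lower integral, which scales without measurability of the
  integrand, so that I and J can be compared pointwise in time.\<close>

lemma rate_I_lower_integral:
  "rate_I m \<gamma> \<theta> V \<psi> T (\<rho> 0) \<rho> = (\<integral>\<^sup>+s\<in>{0..T}. ennreal (1 / (4 * \<theta>)) * (ennreal (1 / \<gamma>) * dual_norm_sq (\<rho> s) (defect s)) \<partial>lborel)"
proof -
  have "0 < 1 / (4 * \<gamma> * \<theta>)" using \<gamma> \<theta> by simp
  from nn_integral_cmult_lower[OF this, of lborel "\<lambda>s. dual_norm_sq (\<rho> s) (defect s) * indicator {0..T} s"]
  show ?thesis unfolding rate_I_eq rate_constants by (simp add: mult.assoc)
qed

text \<open>The argument rests on linearity of the defect and not on integrability of its norm; thus
  an infinite I forces an infinite J.\<close>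

lemma rate_I_le_rate_J:
  assumes e: "absolutely_continuous_on 0 T e"
  shows "rate_I m \<gamma> \<theta> V \<psi> T (\<rho> 0) \<rho> \<le> rate_J m \<gamma> \<theta> V \<psi> T (\<rho> 0) (\<rho>, e)"
  unfolding rate_I_lower_integral rate_J_eq[OF e]
proof (rule nn_integral_mono_AE)
  show "AE s in lborel. ennreal (1 / (4 * \<theta>)) * (ennreal (1 / \<gamma>) * dual_norm_sq (\<rho> s) (defect s)) * indicator {0..T} s
    \<le> ennreal (1 / (4 * \<theta>)) * M_dual_norm_sq m \<gamma> (\<rho> s) (defect s, heat_defect e s) * indicator {0..T} s"
    using defect_lincomb
  proof eventually_elim
    case (elim s)
    show ?case
    proof (cases "s \<in> {0..T}")
      case True
      have lin: "defect s (\<lambda>x. a * f x - c * g x) = a * defect s f - c * defect s g"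
        if "f \<in> test_functions" "g \<in> test_functions" for f g a c
        using elim True that by blast
      show ?thesis
        by (intro mult_right_mono mult_left_mono dual_norm_sq_le_M_dual_norm_sq lin) auto
    qed simp
  qed
qed

end

section \<open>Equality of the rates and conservation of energy\<close>

context vfp_finite begin

context
  fixes \<tau> :: "real \<Rightarrow> real"
  assumes \<tau>: "kinetic_defect \<tau>"
begin

text \<open>Under the condition on the second component both norm comparisons apply, and the
  integrands agree almost everywhere.\<close>

lemma rate_J_eq_rate_I:
  assumes e: "absolutely_continuous_on 0 T e" and s: "AE s in lborel. s \<in> {0..T} \<longrightarrow> heat_defect e s = - \<tau> s"
  shows "rate_J m \<gamma> \<theta> V \<psi> T (\<rho> 0) (\<rho>, e) = rate_I m \<gamma> \<theta> V \<psi> T (\<rho> 0) \<rho>"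
  unfolding rate_I_lower_integral rate_J_eq[OF e]
proof (rule nn_integral_cong_AE)
  have P0: "\<rho> 0 \<in> P2" by (rule \<rho>_P2) (use T in auto)
  obtain \<xi> :: "nat \<Rightarrow> 'd phase \<Rightarrow> real" where \<xi>: "\<And>n. \<xi> n \<in> test_functions"
    "\<And>\<nu>. \<nu> \<in> P2 \<Longrightarrow> (\<lambda>n. \<integral>x. (norm (grad_p (\<xi> n) x - snd x /\<^sub>R m))\<^sup>2 \<partial>\<nu>) \<longlonglongrightarrow> 0"
    by (rule momentum_approximation_exists[OF P0]) (rule that; assumption)
  have lim: "AE s in lborel. s \<in> {0..T} \<longrightarrow> (\<lambda>n. defect s (\<xi> n)) \<longlonglongrightarrow> \<tau> s"
    by (rule kinetic_defect_D(2)[OF \<tau> \<xi>(1)]) (unfold momentum_error_def, rule \<xi>(2)[OF \<rho>_P2])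
  show "AE s in lborel. ennreal (1 / (4 * \<theta>)) * M_dual_norm_sq m \<gamma> (\<rho> s) (defect s, heat_defect e s) * indicator {0..T} s =
      ennreal (1 / (4 * \<theta>)) * (ennreal (1 / \<gamma>) * dual_norm_sq (\<rho> s) (defect s)) * indicator {0..T} s"
    using defect_lincomb lim s
  proof eventually_elim
    case (elim s)
    show ?case
    proof (cases "s \<in> {0..T}")
      case True
      have lin: "defect s (\<lambda>x. a * f x - c * g x) = a * defect s f - c * defect s g"
        if "f \<in> test_functions" "g \<in> test_functions" for f g a c
        using elim(1) True that by blast
      have "(\<lambda>n. defect s (\<xi> n)) \<longlonglongrightarrow> - heat_defect e s" using elim(2,3) True by simp
      then have "M_dual_norm_sq m \<gamma> (\<rho> s) (defect s, heat_defect e s) \<le> ennreal (1 / \<gamma>) * dual_norm_sq (\<rho> s) (defect s)"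
        by (intro M_dual_norm_sq_le_dual_norm_sq[OF lin \<rho>_P2[OF True] \<xi>(1) \<xi>(2)[OF \<rho>_P2[OF True]]])
      moreover have "ennreal (1 / \<gamma>) * dual_norm_sq (\<rho> s) (defect s) \<le> M_dual_norm_sq m \<gamma> (\<rho> s) (defect s, heat_defect e s)"
        by (rule dual_norm_sq_le_M_dual_norm_sq[OF lin])
      ultimately show ?thesis by simp
    qed simp
  qed
qed

text \<open>The directions \<open>(c \<xi> n, c)\<close> approach the degenerate one: their seminorm
  tends to 0, so the quadratic bound in \<open>c\<close> forces
  \<open>defect s (\<xi> n) + heat_defect e s\<close> to 0. As J is a lower integral, the pointwise
  bound is taken from a maximal measurable minorant \<open>g\<close>.\<close>

lemma heat_defect_eq_if_rate_J_finite:
  assumes e: "absolutely_continuous_on 0 T e" and fin: "rate_J m \<gamma> \<theta> V \<psi> T (\<rho> 0) (\<rho>, e) < \<infinity>"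
  shows "AE s in lborel. s \<in> {0..T} \<longrightarrow> heat_defect e s = - \<tau> s"
proof -
  let ?M = "\<lambda>s. M_dual_norm_sq m \<gamma> (\<rho> s) (defect s, heat_defect e s) * indicator {0..T} s"
  have c: "0 < 1 / (4 * \<theta>)" using \<theta> by simp
  have "ennreal (1 / (4 * \<theta>)) * (\<integral>\<^sup>+s. ?M s \<partial>lborel) < \<infinity>"
    using fin unfolding rate_J_eq[OF e] nn_integral_cmult_lower[OF c, symmetric] by (simp add: mult.assoc)
  then have "(\<integral>\<^sup>+s. ?M s \<partial>lborel) < \<infinity>" using c by (auto simp: ennreal_mult_less_top ennreal_eq_0_iff)
  then obtain g :: "real \<Rightarrow> real" where g: "\<And>s. 0 \<le> g s"
    "\<And>h. h \<in> borel_measurable lborel \<Longrightarrow> (AE s in lborel. ennreal (h s) \<le> ?M s) \<Longrightarrow> AE s in lborel. h s \<le> g s"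
    by (rule maximal_measurable_minorant) (rule that; assumption)
  obtain e' where e': "e' \<in> borel_measurable borel"
    "AE t in lborel. t \<in> {0..T} \<longrightarrow> (e has_vector_derivative e' t) (at t within {0..T})"
    by (rule absolutely_continuous_on_eq_integral[OF e less_imp_le[OF T]]) (rule that; assumption)
  \<comment> \<open>A measurable version of \<open>heat_defect e\<close>, with the derivative of
    \<open>e\<close> replaced by its density.\<close>
  define w where "w s = e' s - \<gamma> * (\<integral>x. (norm (snd x))\<^sup>2 / m\<^sup>2 \<partial>\<mu> s) + \<gamma> * \<theta> * real CARD('d) / m" for s
  have "(\<lambda>s. \<integral>x. (norm (snd x))\<^sup>2 / m\<^sup>2 \<partial>\<mu> s) \<in> borel_measurable borel"
  proof (rule \<mu>_integral_measurable)
    have [measurable]: "(\<lambda>x::'d phase. (norm (snd x))\<^sup>2 / m\<^sup>2) \<in> borel_measurable borel"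
      by (intro borel_measurable_continuous_onI continuous_intros) (use m in auto)
    have "(\<lambda>z. (\<lambda>x::'d phase. (norm (snd x))\<^sup>2 / m\<^sup>2) (snd z)) \<in> borel_measurable (borel \<Otimes>\<^sub>M borel)" by measurable
    then show "(\<lambda>(s, x::'d phase). (norm (snd x))\<^sup>2 / m\<^sup>2) \<in> borel_measurable (borel \<Otimes>\<^sub>M borel)" by (simp add: case_prod_unfold)
    show "integrable (\<mu> s) (\<lambda>x. (norm (snd x))\<^sup>2 / m\<^sup>2)" for s using P2_D(3)[OF \<mu>_P2, of s] by simp
  qed
  then have wm: "w \<in> borel_measurable borel" unfolding w_def
    by (intro borel_measurable_add borel_measurable_diff borel_measurable_times borel_measurable_const e'(1))
  have wh: "AE s in lborel. s \<in> {0..T} \<longrightarrow> heat_defect e s = w s"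
    using e'(2)
  proof eventually_elim
    case (elim s)
    show ?case
    proof
      assume s: "s \<in> {0..T}"
      then have "vector_derivative e (at s within {0..T}) = e' s"
        using elim T by (intro vector_derivative_within_closed_interval) auto
      then show "heat_defect e s = w s" by (simp add: heat_defect_def w_def)
    qed
  qed
  have P0: "\<rho> 0 \<in> P2" by (rule \<rho>_P2) (use T in auto)
  obtain \<xi> :: "nat \<Rightarrow> 'd phase \<Rightarrow> real" where \<xi>: "\<And>n. \<xi> n \<in> test_functions"
    "\<And>\<nu>. \<nu> \<in> P2 \<Longrightarrow> (\<lambda>n. \<integral>x. (norm (grad_p (\<xi> n) x - snd x /\<^sub>R m))\<^sup>2 \<partial>\<nu>) \<longlonglongrightarrow> 0"
    by (rule momentum_approximation_exists[OF P0]) (rule that; assumption)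
  note \<xi> = \<xi>(1) \<xi>(2)[folded momentum_error_def]
  have bound: "AE s in lborel. s \<in> {0..T} \<longrightarrow> (defect s (\<xi> n) + heat_defect e s)\<^sup>2 \<le> g s * (\<gamma> * momentum_error (\<xi> n) (\<rho> s))" for n
  proof -
    obtain h where h: "h \<in> borel_measurable borel"
      "AE s in lborel. s \<in> {0..T} \<longrightarrow> h s = (\<integral>x. gen (\<mu> s) (\<xi> n) x \<partial>\<mu> s) + defect s (\<xi> n)"
      by (rule pairing_density[OF \<xi>(1)[of n]]) (rule that; assumption)
    define a where "a s = h s - (\<integral>x. gen (\<mu> s) (\<xi> n) x \<partial>\<mu> s) + w s" for s
    define N where "N s = \<gamma> * (\<integral>x. (norm (grad_p (\<xi> n) x - snd x /\<^sub>R m))\<^sup>2 \<partial>\<mu> s)" for s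
    have [measurable]: "a \<in> borel_measurable borel" unfolding a_def using h(1) wm gen_\<mu>_measurable[OF \<xi>(1)[of n]] by measurable
    have [measurable]: "N \<in> borel_measurable borel" unfolding N_def
      using grad_p_sq_\<mu>_measurable[OF \<xi>(1)[of n], of 1] by simp
    have N0: "0 \<le> N s" for s using \<gamma> by (simp add: N_def)
    have "AE s in lborel. indicator {0..T} s * (2 * of_rat c * a s - (of_rat c)\<^sup>2 * N s) \<le> g s" for c :: rat
    proof (rule g(2))
      show "(\<lambda>s. indicator {0..T} s * (2 * of_rat c * a s - (of_rat c)\<^sup>2 * N s)) \<in> borel_measurable lborel" by measurable
      show "AE s in lborel. ennreal (indicator {0..T} s * (2 * of_rat c * a s - (of_rat c)\<^sup>2 * N s)) \<le> ?M s"
        using h(2) wh defect_lincomb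
      proof eventually_elim
        case (elim s)
        show ?case
        proof (cases "s \<in> {0..T}")
          case True
          let ?g = "\<lambda>x. of_rat c * \<xi> n x - 0 * \<xi> n x"
          have g: "?g \<in> test_functions" by (rule test_functions_lincomb[OF \<xi>(1) \<xi>(1)])
          have d: "defect s ?g = of_rat c * defect s (\<xi> n) - 0 * defect s (\<xi> n)" using elim(3) True \<xi>(1) by blast
          have sc: "(norm (r *\<^sub>R v - 0 *\<^sub>R v - r *\<^sub>R y))\<^sup>2 = r\<^sup>2 * (norm (v - y))\<^sup>2" for r :: real and v y :: "real ^ 'd"
          proof -
            have "r *\<^sub>R v - 0 *\<^sub>R v - r *\<^sub>R y = r *\<^sub>R (v - y)" by (simp add: scaleR_diff_right)
            then show ?thesis by (simp only: norm_scaleR power_mult_distrib power2_abs)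
          qed
          have N: "\<gamma> * (\<integral>x. (norm (grad_p ?g x - of_rat c *\<^sub>R (snd x /\<^sub>R m)))\<^sup>2 \<partial>\<rho> s) = (of_rat c)\<^sup>2 * N s"
            unfolding phase_derivatives_lincomb(1)[OF test_functions_smooth[OF \<xi>(1)] test_functions_smooth[OF \<xi>(1)]] sc N_def \<mu>_eq[OF True]
              integral_mult_right_zero by (rule mult.left_commute)
          have eq: "2 * of_rat c * a s - (of_rat c)\<^sup>2 * N s = 2 * defect s ?g + 2 * heat_defect e s * of_rat c
              - \<gamma> * (\<integral>x. (norm (grad_p ?g x - of_rat c *\<^sub>R (snd x /\<^sub>R m)))\<^sup>2 \<partial>\<rho> s)"
            unfolding N d using elim(1,2) True by (simp add: a_def algebra_simps)
          have "ennreal (2 * of_rat c * a s - (of_rat c)\<^sup>2 * N s) \<le> M_dual_norm_sq m \<gamma> (\<rho> s) (defect s, heat_defect e s)"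
            unfolding eq by (rule M_dual_norm_sq_upper[OF g])
          then show ?thesis using True by (simp only: indicator_simps(1) mult_1_left mult_1_right)
        qed simp
      qed
    qed
    then have "AE s in lborel. \<forall>c::rat. indicator {0..T} s * (2 * of_rat c * a s - (of_rat c)\<^sup>2 * N s) \<le> g s"
      unfolding AE_all_countable by blast
    with h(2) wh show ?thesis
    proof eventually_elim
      case (elim s)
      show ?case
      proof
        assume s: "s \<in> {0..T}"
        have "(a s)\<^sup>2 \<le> g s * N s"
        proof (rule quadratic_bound_from_rationals[OF _ N0])
          fix c :: rat show "2 * of_rat c * a s - (of_rat c)\<^sup>2 * N s \<le> g s"
            using elim(3)[rule_format, of c] s by simp
        qed
        then show "(defect s (\<xi> n) + heat_defect e s)\<^sup>2 \<le> g s * (\<gamma> * momentum_error (\<xi> n) (\<rho> s))"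
          using elim(1,2) s by (simp add: a_def N_def momentum_error_def \<mu>_eq[OF s])
      qed
    qed
  qed
  have "AE s in lborel. \<forall>n. s \<in> {0..T} \<longrightarrow> (defect s (\<xi> n) + heat_defect e s)\<^sup>2 \<le> g s * (\<gamma> * momentum_error (\<xi> n) (\<rho> s))"
    unfolding AE_all_countable using bound by blast
  moreover have "AE s in lborel. s \<in> {0..T} \<longrightarrow> (\<lambda>n. defect s (\<xi> n)) \<longlonglongrightarrow> \<tau> s"
    by (rule kinetic_defect_D(2)[OF \<tau> \<xi>(1)]) (rule \<xi>(2)[OF \<rho>_P2])
  ultimately show ?thesis
  proof eventually_elim
    case (elim s)
    show ?case
    proof
      assume s: "s \<in> {0..T}"
      have lim: "(\<lambda>n. defect s (\<xi> n)) \<longlonglongrightarrow> \<tau> s" using elim(2) s by blast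
      have "(\<tau> s + heat_defect e s)\<^sup>2 \<le> g s * (\<gamma> * 0)"
      proof (rule LIMSEQ_le)
        show "(\<lambda>n. (defect s (\<xi> n) + heat_defect e s)\<^sup>2) \<longlonglongrightarrow> (\<tau> s + heat_defect e s)\<^sup>2"
          by (intro tendsto_intros lim)
        show "(\<lambda>n. g s * (\<gamma> * momentum_error (\<xi> n) (\<rho> s))) \<longlonglongrightarrow> g s * (\<gamma> * 0)"
          by (intro tendsto_mult tendsto_const \<xi>(2)[OF \<rho>_P2[OF s]])
      qed (use elim(1) s in blast)
      then show "heat_defect e s = - \<tau> s" by simp
    qed
  qed
qed

lemma heat_defect_eq_iff:
  assumes "s \<in> {0..T}" "(e has_vector_derivative e') (at s within {0..T})"
  shows "heat_defect e s = - \<tau> s \<longleftrightarrow>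
    e' = - (\<gamma> * \<theta> * real CARD('d) / m - \<gamma> * (\<integral>x. (norm (snd x))\<^sup>2 / m\<^sup>2 \<partial>\<mu> s) + \<tau> s)"
proof -
  have "vector_derivative e (at s within {0..T}) = e'"
    using assms T by (intro vector_derivative_within_closed_interval) auto
  then show ?thesis unfolding heat_defect_def by linarith
qed

end

text \<open>If the total energy is constant, \<open>e\<close> is a constant minus an indefinite
  integral, which gives both its absolute continuity and its derivative. Conversely a finite J fixes
  the derivative of \<open>e\<close> almost everywhere, and absolute continuity turns this into
  constancy of the total energy.\<close>

lemma rate_J_formula_finite:
  assumes fin: "hamiltonian m V \<psi> (\<rho> 0) < \<infinity>"
  shows "rate_J m \<gamma> \<theta> V \<psi> T (\<rho> 0) (\<rho>, e) =
    (if (\<lambda>t. enn2ereal (hamiltonian m V \<psi> (\<rho> t)) + ereal (e t)) constant_on {0..T}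
     then rate_I m \<gamma> \<theta> V \<psi> T (\<rho> 0) \<rho> else \<infinity>)"
proof -
  obtain \<tau> where \<tau>: "kinetic_defect \<tau>"
    by (rule defect_of_kinetic_energy) (rule that; assumption)
  define \<eta> where "\<eta> s = \<gamma> * \<theta> * real CARD('d) / m - \<gamma> * (\<integral>x. (norm (snd x))\<^sup>2 / m\<^sup>2 \<partial>\<mu> s) + \<tau> s" for s
  obtain E where E: "\<And>t. t \<in> {0..T} \<Longrightarrow> hamiltonian m V \<psi> (\<rho> t) = ennreal (E t)" "\<And>t. 0 \<le> E t"
    "set_integrable lborel {0..T} \<eta>" "\<And>t. t \<in> {0..T} \<Longrightarrow> E t = E 0 + (LINT s:{0..t}|lborel. \<eta> s)"
    by (rule hamiltonian_balance[OF \<tau> fin, folded \<eta>_def]) (rule that; assumption)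
  have z: "0 \<in> {0..T}" using T by simp
  \<comment> \<open>Along the curve the Hamiltonian is finite, so the extended sum is a real number
    and constancy can be read in the reals.\<close>
  have total: "enn2ereal (hamiltonian m V \<psi> (\<rho> t)) + ereal (e t) = ereal (E t + e t)" if "t \<in> {0..T}" for t
    using E(1)[OF that] E(2)[of t] by (simp add: enn2ereal_ennreal)
  show ?thesis
  proof (cases "(\<lambda>t. enn2ereal (hamiltonian m V \<psi> (\<rho> t)) + ereal (e t)) constant_on {0..T}")
    case True
    then obtain y where y: "\<And>t. t \<in> {0..T} \<Longrightarrow> ereal (E t + e t) = y"
      unfolding constant_on_def using total by metis
    have "E t + e t = E 0 + e 0" if "t \<in> {0..T}" for t using y[OF that] y[OF z] by (metis ereal.inject)
    then have et: "e t = e 0 + (LINT s:{0..t}|lborel. - \<eta> s)" if "t \<in> {0..T}" for t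
      using E(4)[OF that] that by (fastforce simp: set_lebesgue_integral_def)
    have i: "set_integrable lborel {0..T} (\<lambda>s. - \<eta> s)" using E(3) by (simp add: set_integrable_def)
    have e: "absolutely_continuous_on 0 T e" by (rule absolutely_continuous_on_integral[OF i et])
    have "AE s in lborel. s \<in> {0..T} \<longrightarrow> (e has_vector_derivative - \<eta> s) (at s within {0..T})"
      by (rule AE_derivative_integral[OF i et])
    then have "AE s in lborel. s \<in> {0..T} \<longrightarrow> heat_defect e s = - \<tau> s"
    proof eventually_elim
      case (elim s)
      show ?case
      proof
        assume s: "s \<in> {0..T}"
        then have d: "(e has_vector_derivative - \<eta> s) (at s within {0..T})" using elim by blast
        show "heat_defect e s = - \<tau> s" using heat_defect_eq_iff[OF \<tau> s d] by (simp add: \<eta>_def)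
      qed
    qed
    then show ?thesis using True rate_J_eq_rate_I[OF \<tau> e] by simp
  next
    case False
    have "rate_J m \<gamma> \<theta> V \<psi> T (\<rho> 0) (\<rho>, e) = \<infinity>"
    proof (cases "absolutely_continuous_on 0 T e")
      case e: True
      show ?thesis
      proof (rule ccontr)
        assume "rate_J m \<gamma> \<theta> V \<psi> T (\<rho> 0) (\<rho>, e) \<noteq> \<infinity>"
        then have "rate_J m \<gamma> \<theta> V \<psi> T (\<rho> 0) (\<rho>, e) < \<infinity>" by (simp add: less_top)
        from heat_defect_eq_if_rate_J_finite[OF \<tau> e this]
        have hd: "AE s in lborel. s \<in> {0..T} \<longrightarrow> heat_defect e s = - \<tau> s" .
        obtain h where h: "set_integrable lborel {0..T} h" "\<And>t. t \<in> {0..T} \<Longrightarrow> e t = e 0 + (LINT s:{0..t}|lborel. h s)"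
          "AE t in lborel. t \<in> {0..T} \<longrightarrow> (e has_vector_derivative h t) (at t within {0..T})"
          by (rule absolutely_continuous_on_eq_integral[OF e less_imp_le[OF T]]) (rule that; assumption)
        have hz: "AE s in lborel. s \<in> {0..T} \<longrightarrow> h s + \<eta> s = 0"
          using hd h(3)
        proof eventually_elim
          case (elim s)
          show ?case
          proof
            assume s: "s \<in> {0..T}"
            then have d: "(e has_vector_derivative h s) (at s within {0..T})" using elim(2) by blast
            show "h s + \<eta> s = 0" using heat_defect_eq_iff[OF \<tau> s d] elim(1) s by (simp add: \<eta>_def)
          qed
        qed
        have cst: "E t + e t = E 0 + e 0" if t: "t \<in> {0..T}" for t
        proof -
          have "set_integrable lborel {0..t} h" "set_integrable lborel {0..t} \<eta>"
            by (rule set_integrable_subset[OF h(1)], use t in auto) (rule set_integrable_subset[OF E(3)], use t in auto)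
          then have "(LINT s:{0..t}|lborel. h s) + (LINT s:{0..t}|lborel. \<eta> s) = (LINT s:{0..t}|lborel. h s + \<eta> s)"
            by (rule set_integral_add(2)[symmetric])
          also have "\<dots> = 0"
            unfolding set_lebesgue_integral_def
            by (rule integral_eq_zero_AE, rule eventually_mono[OF hz]) (use t in \<open>auto simp: indicator_def\<close>)
          finally show ?thesis using h(2)[OF t] E(4)[OF t] by linarith
        qed
        have "enn2ereal (hamiltonian m V \<psi> (\<rho> t)) + ereal (e t) = ereal (E 0 + e 0)" if t: "t \<in> {0..T}" for t
          by (rule trans[OF total[OF t] arg_cong[where f=ereal, OF cst[OF t]]])
        then have "(\<lambda>t. enn2ereal (hamiltonian m V \<psi> (\<rho> t)) + ereal (e t)) constant_on {0..T}"
          unfolding constant_on_def by blast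
        with False show False by blast
      qed
    next
      case False
      then show ?thesis by (simp add: rate_J_def)
    qed
    with False show ?thesis by simp
  qed
qed

end

context vfp_curve begin

text \<open>If the norm of the defect is not integrable in time, I is infinite and J with it, so
  both branches of the formula have the same value. Otherwise a bound \<open>D\<close> for the
  defect exists and the finite case applies.\<close>

lemma rate_J_formula:
  assumes fin: "hamiltonian m V \<psi> (\<rho> 0) < \<infinity>"
  shows "rate_J m \<gamma> \<theta> V \<psi> T (\<rho> 0) (\<rho>, e) =
    (if (\<lambda>t. enn2ereal (hamiltonian m V \<psi> (\<rho> t)) + ereal (e t)) constant_on {0..T}
     then rate_I m \<gamma> \<theta> V \<psi> T (\<rho> 0) \<rho> else \<infinity>)"
proof (cases "(\<integral>\<^sup>+t\<in>{0..T}. dual_norm_sq (\<rho> t) (defect t) \<partial>lborel) < \<infinity>")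
  case True
  then obtain D :: "real \<Rightarrow> real" where D: "D \<in> borel_measurable borel" "\<And>s. 0 \<le> D s" "integrable lborel D"
    "\<And>f. f \<in> test_functions \<Longrightarrow> AE s in lborel. s \<in> {0..T} \<longrightarrow> (defect s f)\<^sup>2 \<le> D s * (\<integral>x. (norm (grad_p f x))\<^sup>2 \<partial>\<rho> s)"
    by (rule defect_bound_exists) (rule that; assumption)
  interpret vfp_finite m \<gamma> \<theta> V \<psi> LV L\<psi> C\<psi> T \<rho> D
    by unfold_locales (rule D; assumption?)+
  show ?thesis by (rule rate_J_formula_finite[OF fin])
next
  case False
  then have "(\<integral>\<^sup>+t\<in>{0..T}. dual_norm_sq (\<rho> t) (defect t) \<partial>lborel) = \<infinity>" by (simp add: not_less top_unique)
  then have I: "rate_I m \<gamma> \<theta> V \<psi> T (\<rho> 0) \<rho> = \<infinity>"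
    using \<gamma> \<theta> by (simp add: rate_I_eq ennreal_mult_top)
  have "rate_J m \<gamma> \<theta> V \<psi> T (\<rho> 0) (\<rho>, e) = \<infinity>"
  proof (cases "absolutely_continuous_on 0 T e")
    case True
    from rate_I_le_rate_J[OF this] I show ?thesis by (simp add: top_unique)
  next
    case False
    then show ?thesis by (simp add: rate_J_def)
  qed
  with I show ?thesis by simp
qed

end

theorem lemma3p4:
  fixes m \<gamma> \<theta> T :: real
    and V \<psi> :: "real ^ 'd::finite \<Rightarrow> real"
    and \<rho>0 :: "'d phase measure"
    and \<rho> :: "real \<Rightarrow> 'd phase measure"
    and e :: "real \<Rightarrow> real"
  assumes "m > 0" and "\<gamma> > 0" and "\<theta> > 0" and "T > 0"
    and "C_k 2 V" and "bounded_partials 2 V" and "\<And>q. V q \<ge> 0"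
    and "C_k 2 \<psi>" and "bounded_partials 1 \<psi>" and "bounded_partials 2 \<psi>" and "\<And>q. \<psi> q \<ge> 0"
    and psi_even: "\<And>q. \<psi> (- q) = \<psi> q"
    and "\<rho>0 \<in> prob_measures" and "hamiltonian m V \<psi> \<rho>0 < \<infinity>"
    and "\<And>t. t \<in> {0..T} \<Longrightarrow> \<rho> t \<in> P2"
  shows "rate_J m \<gamma> \<theta> V \<psi> T \<rho>0 (\<rho>, e) =
    (if (\<lambda>t. enn2ereal (hamiltonian m V \<psi> (\<rho> t)) + ereal (e t)) constant_on {0..T}
     then rate_I m \<gamma> \<theta> V \<psi> T \<rho>0 \<rho>
     else \<infinity>)"
proof (cases "AC_curve T prob_measures \<rho> \<and> \<rho> 0 = \<rho>0")
  case True
  obtain LV where LV: "lipschitz_grad LV V (grad V)" by (rule C2_lipschitz_grad[OF assms(5,6)])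
  obtain L\<psi> where L\<psi>: "lipschitz_grad L\<psi> \<psi> (grad \<psi>)" by (rule C2_lipschitz_grad[OF assms(8,10)])
  obtain C where C: "\<And>bs x. set bs \<subseteq> Basis \<Longrightarrow> length bs = 1 \<Longrightarrow> \<bar>partials bs \<psi> x\<bar> \<le> C"
    using assms(9) unfolding bounded_partials_def by blast
  have G: "norm (grad \<psi> q) \<le> real DIM(real ^ 'd) * C" for q by (rule norm_grad_le) (rule C, auto)
  interpret vfp_curve m \<gamma> \<theta> V \<psi> LV L\<psi> "real DIM(real ^ 'd) * C" T \<rho>
    by unfold_locales (use assms(1-4,7,11,12,15) LV L\<psi> G True in auto)
  show ?thesis using rate_J_formula[of e] True assms(14) by simp
next
  case False
  \<comment> \<open>An absolutely continuous curve in \<open>P2\<close> is one in the probability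
    measures, so J is infinite by definition whenever I is infinite by definition.\<close>
  moreover have "AC_curve T prob_measures \<rho>" if "AC_curve T P2 \<rho>"
    using that by (auto simp: AC_curve_def P2_def)
  ultimately show ?thesis unfolding rate_J_def rate_I_def by auto
qed

end
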